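(* Let $P$ be a finite point set in general position in the plane, $P^*$ its dual pseudoline arrangement and $P^{*1}$ the support of $P^*$ minus its first level. Then: (i) For every pointed pseudotriangulation $T$ of $P$, the dual arrangement $T^*:=\{\Delta^*\mid \Delta\text{ pseudotriangle of }T\}$ is a pseudoline arrangement (with contact points) supported by $P^{*1}$. (ii) For every pseudoline arrangement $\Lambda$ (with contact points) supported by $P^{*1}$, the primal set of edges $E:=\{[p,q]\mid p,q\in P,\ p^*\wedge q^*\text{ is a contact point of }\Lambda\}$ is a pointed pseudotriangulation of $P$.
   Context: General position: no three points of $P$ collinear. The space of lines of the plane is the Möbius strip $\mathcal M=\mathbb R^2/(\theta,d)\sim(\theta+\pi,-d)$, an oriented line being parametrized by its angle $\theta$ with the horizontal axis and its signed distance $d$ to the origin. For a point $p$, $p^*\subset\mathcal M$ is the set of lines through $p$; it is a pseudoline (a non-separating simple closed curve, image of the graph of a continuous $\pi$-antiperiodic function). $P^*=\{p^*\mid p\in P\}$ is a simple pseudoline arrangement: any two $p^*,q^*$ cross exactly once, at the line $(pq)$, denoted $p^*\wedge q^*$. A pseudoline arrangement with contact points is a finite set of pseudolines any two of which have exactly one crossing point and possibly some contact points (points where they touch without crossing). Its support is the union of its pseudolines; "supported by $\mathcal S$" means having support $\mathcal S$. The first level of $P^*$ is the boundary of the external (unbounded) face of the complement of its support in $\mathcal M$; $P^{*1}$ is the support with (the edges of) this first level removed. A pseudotriangle is a polygon with exactly three convex vertices (corners) joined by three concave polygonal chains. A line is tangent to a pseudotriangle $\Delta$ if it passes through a corner and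 separates the two edges incident to it, or passes through a concave vertex and does not separate the two edges incident to it; $\Delta^*\subset\mathcal M$ is the set of tangents to $\Delta$. A pseudotriangulation of $P$ is a set of edges between points of $P$ that decomposes the convex hull of $P$ into pseudotriangles; it is pointed if for each $p\in P$ some line through $p$ bounds a half-plane containing all edges incident to $p$.
   Formalization: In (ii) the vertices of the first level also count as contact points of Λ, so E includes the convex hull edges; read literally E omits them and the claim fails, e.g. for three points, where Λ is a single pseudoline without contact points and E would be empty. *)

theory Defs
  imports "HOL-Analysis.Analysis"
begin

text \<open>The Euclidean plane is the type \<^typ>\<open>complex\<close>, for which the library proves the Jordan curve
  theorem.\<close>

definition general_position :: "complex set \<Rightarrow> bool" where
  "general_position P \<longleftrightarrow>
     (\<forall>p\<in>P. \<forall>q\<in>P. \<forall>r\<in>P. p \<noteq> q \<and> q \<noteq> r \<and> p \<noteq> r \<longrightarrow> \<not> collinear {p, q, r})"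


section \<open>The Moebius strip as the space of lines\<close>

definition flip_step :: "real \<times> real \<Rightarrow> real \<times> real \<Rightarrow> bool" where
  "flip_step = (\<lambda>(\<theta>, d) (\<theta>', d'). \<theta>' = \<theta> + pi \<and> d' = - d)"

quotient_type moebius = "real \<times> real" / "equivclp flip_step"
  by (rule equivp_evquivclp)

definition mline :: "real \<Rightarrow> real \<Rightarrow> moebius" where
  "mline \<theta> d = abs_moebius (\<theta>, d)"

instantiation moebius :: topological_space
begin

definition open_moebius :: "moebius set \<Rightarrow> bool" where
  "open_moebius U \<longleftrightarrow> open {x. abs_moebius x \<in> U}"

instance
proof
  show "open (UNIV :: moebius set)"
    by (simp add: open_moebius_def)
  show "open (S \<inter> T)" if "open S" "open T" for S T :: "moebius set"
    using that open_Int by (force simp: open_moebius_def Collect_conj_eq)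
  show "open (\<Union>K)" if "\<forall>S\<in>K. open S" for K :: "moebius set set"
  proof -
    have "{x. abs_moebius x \<in> \<Union>K} = (\<Union>S\<in>K. {x. abs_moebius x \<in> S})" by auto
    then show ?thesis using that by (simp add: open_moebius_def open_UN)
  qed
qed

end

text \<open>Signed height of a point over the oriented line with direction \<open>(cos \<theta>, sin \<theta>)\<close> and signed
  distance \<open>d\<close> to the origin. Replacing \<open>(\<theta>, d)\<close> by \<open>(\<theta> + pi, - d)\<close> only changes its sign, so the
  notions below do not depend on the representative.\<close>

definition line_height :: "real \<Rightarrow> real \<Rightarrow> complex \<Rightarrow> real" where
  "line_height \<theta> d p = Im p * cos \<theta> - Re p * sin \<theta> - d"

definition on_line :: "complex \<Rightarrow> moebius \<Rightarrow> bool" where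
  "on_line p l \<longleftrightarrow> (\<exists>\<theta> d. l = mline \<theta> d \<and> line_height \<theta> d p = 0)"

text \<open>The points lie in opposite, resp. in the same, closed half-plane of the line.\<close>

definition opposite_sides :: "moebius \<Rightarrow> complex \<Rightarrow> complex \<Rightarrow> bool" where
  "opposite_sides l a b \<longleftrightarrow>
     (\<exists>\<theta> d. l = mline \<theta> d \<and> line_height \<theta> d a * line_height \<theta> d b \<le> 0)"

definition same_side :: "moebius \<Rightarrow> complex \<Rightarrow> complex \<Rightarrow> bool" where
  "same_side l a b \<longleftrightarrow>
     (\<exists>\<theta> d. l = mline \<theta> d \<and> line_height \<theta> d a * line_height \<theta> d b \<ge> 0)"

definition dual_point :: "complex \<Rightarrow> moebius set" where
  "dual_point p = {l. on_line p l}"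

definition dual_points :: "complex set \<Rightarrow> moebius set set" where
  "dual_points P = dual_point ` P"


section \<open>Pseudoline arrangements with contact points\<close>

definition represents :: "(real \<Rightarrow> real) \<Rightarrow> moebius set \<Rightarrow> bool" where
  "represents f \<gamma> \<longleftrightarrow> continuous_on UNIV f \<and> (\<forall>x. f (x + pi) = - f x) \<and>
     \<gamma> = range (\<lambda>x. mline x (f x))"

definition pseudoline :: "moebius set \<Rightarrow> bool" where
  "pseudoline \<gamma> \<longleftrightarrow> (\<exists>f. represents f \<gamma>)"

text \<open>Crossing and contact points are isolated points of the intersection where the difference of
  the two representing functions changes, resp. keeps, its sign.\<close>

definition crosses_at :: "moebius set \<Rightarrow> moebius set \<Rightarrow> moebius \<Rightarrow> bool" where
  "crosses_at \<gamma> \<mu> z \<longleftrightarrow>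
     (\<exists>f g x. represents f \<gamma> \<and> represents g \<mu> \<and> z = mline x (f x) \<and> f x = g x \<and>
        (\<exists>\<epsilon>>0. \<forall>s\<in>{x - \<epsilon><..<x}. \<forall>t\<in>{x<..<x + \<epsilon>}. (f s - g s) * (f t - g t) < 0))"

definition touches_at :: "moebius set \<Rightarrow> moebius set \<Rightarrow> moebius \<Rightarrow> bool" where
  "touches_at \<gamma> \<mu> z \<longleftrightarrow>
     (\<exists>f g x. represents f \<gamma> \<and> represents g \<mu> \<and> z = mline x (f x) \<and> f x = g x \<and>
        (\<exists>\<epsilon>>0. \<forall>s\<in>{x - \<epsilon><..<x}. \<forall>t\<in>{x<..<x + \<epsilon>}. (f s - g s) * (f t - g t) > 0))"

text \<open>Every common point is required to be a crossing or a contact point; since these are isolated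
  and pseudolines are compact, two pseudolines of an arrangement have finite intersection.\<close>

definition pseudoline_arrangement :: "moebius set set \<Rightarrow> bool" where
  "pseudoline_arrangement \<Lambda> \<longleftrightarrow> finite \<Lambda> \<and> (\<forall>\<gamma>\<in>\<Lambda>. pseudoline \<gamma>) \<and>
     (\<forall>\<gamma>\<in>\<Lambda>. \<forall>\<mu>\<in>\<Lambda>. \<gamma> \<noteq> \<mu> \<longrightarrow>
        (\<exists>!z. crosses_at \<gamma> \<mu> z) \<and>
        (\<forall>z\<in>\<gamma> \<inter> \<mu>. crosses_at \<gamma> \<mu> z \<or> touches_at \<gamma> \<mu> z))"

definition crossing :: "moebius set \<Rightarrow> moebius set \<Rightarrow> moebius" where
  "crossing \<gamma> \<mu> = (THE z. crosses_at \<gamma> \<mu> z)"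

definition contact_point :: "moebius set set \<Rightarrow> moebius \<Rightarrow> bool" where
  "contact_point \<Lambda> z \<longleftrightarrow> (\<exists>\<gamma>\<in>\<Lambda>. \<exists>\<mu>\<in>\<Lambda>. \<gamma> \<noteq> \<mu> \<and> touches_at \<gamma> \<mu> z)"

definition support :: "moebius set set \<Rightarrow> moebius set" where
  "support \<Lambda> = \<Union>\<Lambda>"


section \<open>First level\<close>

text \<open>A set of lines is bounded if its lines have bounded distance to the origin.\<close>

definition bounded_lines :: "moebius set \<Rightarrow> bool" where
  "bounded_lines A \<longleftrightarrow> (\<exists>r. A \<subseteq> {mline \<theta> d | \<theta> d. \<bar>d\<bar> \<le> r})"

definition external_face :: "moebius set \<Rightarrow> moebius set" where
  "external_face S = \<Union>{C \<in> components (- S). \<not> bounded_lines C}"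

definition first_level :: "moebius set set \<Rightarrow> moebius set" where
  "first_level \<Lambda> = frontier (external_face (support \<Lambda>))"

text \<open>Only the open edges of the first level are removed: the closure restores the vertices at
  which the remaining edges end.\<close>

definition support_minus_first_level :: "moebius set set \<Rightarrow> moebius set" where
  "support_minus_first_level \<Lambda> = closure (support \<Lambda> - first_level \<Lambda>)"


section \<open>Pseudotriangles\<close>

text \<open>A polygon is given by the cyclic list of its vertices.\<close>

definition next_vertex :: "complex list \<Rightarrow> nat \<Rightarrow> complex" where
  "next_vertex vs i = vs ! (Suc i mod length vs)"

definition prev_vertex :: "complex list \<Rightarrow> nat \<Rightarrow> complex" where
  "prev_vertex vs i = vs ! ((i + length vs - 1) mod length vs)"

definition polygon_edge :: "complex list \<Rightarrow> nat \<Rightarrow> complex set" where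
  "polygon_edge vs i = closed_segment (vs ! i) (next_vertex vs i)"

definition polygon_edges :: "complex list \<Rightarrow> complex set set" where
  "polygon_edges vs = polygon_edge vs ` {..<length vs}"

definition simple_polygon :: "complex list \<Rightarrow> bool" where
  "simple_polygon vs \<longleftrightarrow> length vs \<ge> 3 \<and> distinct vs \<and>
     (\<forall>i<length vs. \<not> collinear {prev_vertex vs i, vs ! i, next_vertex vs i}) \<and>
     (\<forall>i<length vs. \<forall>j<length vs. i \<noteq> j \<longrightarrow>
        polygon_edge vs i \<inter> polygon_edge vs j =
          {vs ! i, next_vertex vs i} \<inter> {vs ! j, next_vertex vs j})"

definition polygon_interior :: "complex list \<Rightarrow> complex set" where
  "polygon_interior vs = inside (\<Union>(polygon_edges vs))"

definition polygon_region :: "complex list \<Rightarrow> complex set" where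
  "polygon_region vs = \<Union>(polygon_edges vs) \<union> polygon_interior vs"

text \<open>Interior angle smaller than \<open>pi\<close>; flat vertices are excluded in \<^const>\<open>simple_polygon\<close>, so all
  other vertices are concave.\<close>

definition convex_vertex :: "complex list \<Rightarrow> nat \<Rightarrow> bool" where
  "convex_vertex vs i \<longleftrightarrow> (\<exists>\<epsilon>>0. convex (polygon_region vs \<inter> ball (vs ! i) \<epsilon>))"

definition pseudotriangle :: "complex list \<Rightarrow> bool" where
  "pseudotriangle vs \<longleftrightarrow> simple_polygon vs \<and> card {i. i < length vs \<and> convex_vertex vs i} = 3"

text \<open>Separation is meant with respect to closed half-planes, so that the line supporting an edge
  is a tangent, also when the edge joins two corners.\<close>

definition tangent_to :: "complex list \<Rightarrow> moebius \<Rightarrow> bool" where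
  "tangent_to vs l \<longleftrightarrow>
     (\<exists>i<length vs. on_line (vs ! i) l \<and>
        (if convex_vertex vs i
         then opposite_sides l (prev_vertex vs i) (next_vertex vs i)
         else same_side l (prev_vertex vs i) (next_vertex vs i)))"

definition dual_pseudotriangle :: "complex list \<Rightarrow> moebius set" where
  "dual_pseudotriangle vs = {l. tangent_to vs l}"


section \<open>Pointed pseudotriangulations\<close>

text \<open>An edge is a segment between two distinct points of the point set.\<close>

definition edges_on :: "complex set \<Rightarrow> complex set set" where
  "edges_on P = {closed_segment p q | p q. p \<in> P \<and> q \<in> P \<and> p \<noteq> q}"

text \<open>The pseudotriangles of a set of edges: those whose interior is a face. As the isolated points
  of \<open>P\<close> are removed too, no point of \<open>P\<close> lies in the interior.\<close>

definition pseudotriangles_of :: "complex set \<Rightarrow> complex set set \<Rightarrow> complex list set" where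
  "pseudotriangles_of P T =
     {vs. pseudotriangle vs \<and> set vs \<subseteq> P \<and> polygon_edges vs \<subseteq> T \<and>
          polygon_interior vs \<in> components (- (P \<union> \<Union>T))}"

definition pseudotriangulation :: "complex set \<Rightarrow> complex set set \<Rightarrow> bool" where
  "pseudotriangulation P T \<longleftrightarrow> T \<subseteq> edges_on P \<and>
     (\<forall>e\<in>T. \<forall>f\<in>T. e \<noteq> f \<longrightarrow> e \<inter> f \<subseteq> P) \<and>
     convex hull P = P \<union> \<Union>T \<union> (\<Union>vs\<in>pseudotriangles_of P T. polygon_interior vs)"

definition pointed :: "complex set \<Rightarrow> complex set set \<Rightarrow> bool" where
  "pointed P T \<longleftrightarrow>
     (\<forall>p\<in>P. \<exists>a. a \<noteq> 0 \<and> (\<forall>e\<in>T. p \<in> e \<longrightarrow> e \<subseteq> {z. a \<bullet> z \<ge> a \<bullet> p}))"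

definition pointed_pseudotriangulation :: "complex set \<Rightarrow> complex set set \<Rightarrow> bool" where
  "pointed_pseudotriangulation P T \<longleftrightarrow> pseudotriangulation P T \<and> pointed P T"


section \<open>Duality\<close>

definition dual_arrangement :: "complex set \<Rightarrow> complex set set \<Rightarrow> moebius set set" where
  "dual_arrangement P T = dual_pseudotriangle ` pseudotriangles_of P T"

text \<open>The vertices of the first level count as contact points of \<open>\<Lambda>\<close>: there \<open>\<Lambda>\<close> touches the removed
  first level. They are the lines spanned by the edges of the convex hull, which belong to every
  pseudotriangulation but would otherwise be missing: for three points, \<open>\<Lambda>\<close> is a single
  pseudoline, and all three edges come from the first level.\<close>

definition primal_edges :: "complex set \<Rightarrow> moebius set set \<Rightarrow> complex set set" where
  "primal_edges P \<Lambda> =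
     {closed_segment p q | p q. p \<in> P \<and> q \<in> P \<and> p \<noteq> q \<and>
        (let z = crossing (dual_point p) (dual_point q)
         in contact_point \<Lambda> z \<or> z \<in> first_level (dual_points P))}"

end

theory Submission
  imports Defs
begin

text \<open>For three or more points, \<open>P\<^sup>*\<close> without its first level consists of the lines that pass through a
  point of \<open>P\<close> and have another point on either closed side. A pseudoline supported by this set follows
  the curves \<open>p\<^sup>*\<close> and switches between them at lines through two points: it describes a line
  rolling around a closed polygon with vertices in \<open>P\<close>. A rolling line turns by \<open>pi\<close>, so that its
  polygon has at least three corners (right turns), and with exactly three it is a simple polygon, hence
  a pseudotriangle; conversely the turning number shows that the tangents to a pseudotriangle roll
  around it. An arrangement has \<open>n - 2\<close> pseudolines, and counting the ordered pairs of points according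
  to whether their line is a switch, a crossing or on the hull forces each polygon to have three corners,
  each two pseudolines to cross once, and each inner point to be pointed. Every edge in the interior of
  the hull bounds two of the polygons, on opposite sides, so that the number of polygons around a point
  is constant on the complement of the edges; it is one next to the hull. Hence the polygons tile the
  hull. Conversely, a generic line of the support, through \<open>p \<in> P\<close>, is tangent at \<open>p\<close> to exactly one
  pseudotriangle of a pointed pseudotriangulation, so that the duals fill the support without overlaps
  and the same count applies to them.\<close>

text \<open>The count serves both directions because \<open>rolling\<close> asks only that sheets
  meet in isolated points and that each of them switches somewhere. That two sheets cross once is
  then a conclusion, which is what (i) needs; in (ii), where it is given, it serves to show that no
  pseudoline follows a single dual all the way round. A polygon traced by a sheet is at first known
  only through the angles and signed lengths of its edges, and nothing excludes self-intersections.
  Simplicity comes from the number of corners, and the side of the interior from the turning number: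
  the line turns by pi in all and each corner contributes -pi to the turning of the edges, so that
  three corners give -2 pi and put the interior to the right of every edge. Lines through two points
  are exceptional throughout, so that statements are proved at generic angles and then carried over
  by continuity.\<close>

definition hgt :: "real \<Rightarrow> complex \<Rightarrow> real" where
  "hgt \<theta> p = Im p * cos \<theta> - Re p * sin \<theta>"

text \<open>The determinant of two plane vectors, positive if \<open>b\<close> lies to the left of
  \<open>a\<close>. The height \<open>hgt \<theta>\<close> is this product with
  \<open>cis \<theta>\<close>; read as a function of the angle, \<open>hgt\<close> at a fixed point
  is the function whose graph is the dual pseudoline.\<close>

definition crs :: "complex \<Rightarrow> complex \<Rightarrow> real" where
  "crs a b = Re a * Im b - Im a * Re b"

lemma hgt_add: "hgt \<theta> (p + q) = hgt \<theta> p + hgt \<theta> q"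
  and hgt_diff: "hgt \<theta> (p - q) = hgt \<theta> p - hgt \<theta> q"
  and hgt_zero [simp]: "hgt \<theta> 0 = 0"
  and hgt_scale: "hgt \<theta> (of_real c * p) = c * hgt \<theta> p"
  by (simp_all add: hgt_def algebra_simps)

lemma hgt_sum: "hgt \<theta> (\<Sum>i\<in>A. g i) = (\<Sum>i\<in>A. hgt \<theta> (g i))"
  by (induction A rule: infinite_finite_induct) (auto simp: hgt_add)

lemma hgt_cis: "hgt \<theta> (cis \<phi>) = sin (\<phi> - \<theta>)"
  by (simp add: hgt_def sin_diff)

lemma hgt_pi [simp]: "hgt (\<theta> + pi) p = - hgt \<theta> p"
  by (simp add: hgt_def)

lemma hgt_dir: "q - p = of_real c * cis \<phi> \<Longrightarrow> hgt \<theta> q = hgt \<theta> p + c * sin (\<phi> - \<theta>)"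
  by (metis diff_add_cancel hgt_add add.commute hgt_scale hgt_cis)

lemma continuous_hgt [continuous_intros]: "continuous_on A (\<lambda>x. hgt x p)"
  unfolding hgt_def by (intro continuous_intros)

lemma isCont_hgt: "isCont (\<lambda>x. hgt x p) x"
  unfolding hgt_def by (intro continuous_intros)

lemma hgt_zero_iff: "hgt \<theta> p = 0 \<longleftrightarrow> (\<exists>c. p = of_real c * cis \<theta>)"
proof
  assume "hgt \<theta> p = 0"
  then have h: "Im p * cos \<theta> = Re p * sin \<theta>" by (simp add: hgt_def)
  have sc: "sin \<theta> * sin \<theta> + cos \<theta> * cos \<theta> = 1"
    by (metis power2_eq_square sin_cos_squared_add)
  define c where "c = Re p * cos \<theta> + Im p * sin \<theta>"
  have "Re p = c * cos \<theta>" "Im p = c * sin \<theta>"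
    using h sc unfolding c_def by algebra+
  then have "p = of_real c * cis \<theta>" by (simp add: complex_eq_iff)
  then show "\<exists>c. p = of_real c * cis \<theta>" by blast
qed (auto simp: hgt_scale hgt_cis)

lemma hgt_eq_dir: "hgt \<theta> p = hgt \<theta> q \<longleftrightarrow> (\<exists>c. q - p = of_real c * cis \<theta>)"
  using hgt_zero_iff[of \<theta> "q - p"] by (auto simp: hgt_diff)

lemma dir_exists:
  assumes "p \<noteq> q" shows "\<exists>x\<in>{0..<pi}. hgt x p = hgt x q"
proof -
  let ?w = "q - p"
  have w: "?w \<noteq> 0" using assms by auto
  define a where "a = Arg ?w"
  have a: "?w = of_real (cmod ?w) * cis a" "- pi < a" "a \<le> pi"
    using rcis_cmod_Arg[of ?w] Arg_bounded[of ?w] by (auto simp: a_def rcis_def)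
  have e: "hgt a p = hgt a q" using a(1) hgt_eq_dir by blast
  show ?thesis
  proof (cases "0 \<le> a \<and> a < pi")
    case True then show ?thesis using e by auto
  next
    case False
    show ?thesis
    proof (cases "a = pi")
      case True
      then have "hgt 0 p = hgt 0 q" using e by (simp add: hgt_def)
      then show ?thesis by force
    next
      case F: False
      then have "hgt (a + pi) p = hgt (a + pi) q" "a + pi \<in> {0..<pi}" using e a False by auto
      then show ?thesis by blast
    qed
  qed
qed

text \<open>The difference of the two heights is a nonzero multiple of a sine, so two duals meet
  only at the line through the points, in any of its representations.\<close>

lemma hgt_same_dir:
  assumes "p \<noteq> q" "hgt x p = hgt x q"
  shows "hgt y p = hgt y q \<longleftrightarrow> (\<exists>k::int. y = x + of_int k * pi)"
proof -
  obtain c where c: "q - p = of_real c * cis x" using assms(2) hgt_eq_dir by blast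
  have "c \<noteq> 0" using c assms by auto
  then have "hgt y p = hgt y q \<longleftrightarrow> sin (x - y) = 0"
    using hgt_dir[OF c, of y] by auto
  also have "\<dots> \<longleftrightarrow> (\<exists>k::int. x - y = of_int k * pi)"
    by (simp add: sin_zero_iff_int2)
  also have "\<dots> \<longleftrightarrow> (\<exists>k::int. y = x + of_int k * pi)"
  proof
    assume "\<exists>k::int. x - y = of_int k * pi"
    then obtain k :: int where "x - y = of_int k * pi" by blast
    then have "y = x + of_int (-k) * pi" by simp
    then show "\<exists>k::int. y = x + of_int k * pi" by blast
  next
    assume "\<exists>k::int. y = x + of_int k * pi"
    then obtain k :: int where "y = x + of_int k * pi" by blast
    then have "x - y = of_int (-k) * pi" by simp
    then show "\<exists>k::int. x - y = of_int k * pi" by blast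
  qed
  finally show ?thesis .
qed

lemma collinear_iff_hgt: assumes "hgt x p = hgt x q" "hgt x q = hgt x r" shows "collinear {p, q, r}"
proof -
  have "\<exists>c. a - b = c *\<^sub>R cis x" if "a \<in> {p, q, r}" "b \<in> {p, q, r}" for a b
  proof -
    have "hgt x b = hgt x a" using that assms by auto
    then show ?thesis unfolding hgt_eq_dir scaleR_conv_of_real .
  qed
  then show ?thesis unfolding collinear_def by blast
qed

section \<open>Cross products and collinearity\<close>

lemma crs_add1: "crs (a + b) c = crs a c + crs b c"
  and crs_add2: "crs c (a + b) = crs c a + crs c b"
  and crs_diff1: "crs (a - b) c = crs a c - crs b c"
  and crs_diff2: "crs c (a - b) = crs c a - crs c b"
  and crs_minus1: "crs (- a) c = - crs a c"
  and crs_minus2: "crs c (- a) = - crs c a"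
  and crs_scale1: "crs (of_real x * a) c = x * crs a c"
  and crs_scale2: "crs c (of_real x * a) = x * crs c a"
  and crs_scaleR1: "crs (x *\<^sub>R a) c = x * crs a c"
  and crs_scaleR2: "crs c (x *\<^sub>R a) = x * crs c a"
  and crs_self [simp]: "crs a a = 0"
  and crs_zero1 [simp]: "crs 0 a = 0"
  and crs_zero2 [simp]: "crs a 0 = 0"
  by (simp_all add: crs_def algebra_simps)

lemma crs_comm: "crs a b = - crs b a" by (simp add: crs_def)

lemma crs_cis: "crs (cis a) (cis b) = sin (b - a)"
  by (simp add: crs_def sin_diff mult.commute)

lemma crs_mult: "crs (x * a) (x * b) = (cmod x)\<^sup>2 * crs a b"
  by (simp only: cmod_power2) (simp add: crs_def algebra_simps power2_eq_square)

lemma hgt_crs: "hgt x p = crs (cis x) p"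
  by (simp add: hgt_def crs_def mult.commute)

lemma crs_zero_dir: assumes "a \<noteq> 0" "crs a b = 0" shows "\<exists>x. b = of_real x * a"
proof -
  have "crs (of_real (cmod a) * cis (Arg a)) b = 0" using assms rcis_cmod_Arg[of a] by (simp add: rcis_def)
  then have "hgt (Arg a) b = 0" using assms by (simp add: crs_scale1 hgt_crs)
  then obtain c where "b = of_real c * cis (Arg a)" using hgt_zero_iff by blast
  moreover have "a = of_real (cmod a) * cis (Arg a)" using rcis_cmod_Arg[of a] by (simp add: rcis_def)
  then have "cis (Arg a) = a / of_real (cmod a)" using assms by (simp add: nonzero_eq_divide_eq mult.commute)
  ultimately have "b = of_real (c / cmod a) * a" by simp
  then show ?thesis by blast
qed

lemma collinear_crs: "collinear {p, q, r} \<longleftrightarrow> crs (q - p) (r - p) = 0"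
proof (cases "p = q")
  case True then show ?thesis by simp
next
  case False
  show ?thesis
  proof
    assume "crs (q - p) (r - p) = 0"
    then obtain x where x: "r - p = of_real x * (q - p)" using crs_zero_dir[of "q-p"] False by auto
    obtain y where y: "hgt y p = hgt y q" using dir_exists False by blast
    have "hgt y r - hgt y p = x * (hgt y q - hgt y p)" using x by (metis hgt_diff hgt_scale)
    moreover have "hgt y q - hgt y p = 0" using y by simp
    ultimately have "hgt y q = hgt y r" by simp
    with y show "collinear {p, q, r}" by (rule collinear_iff_hgt)
  next
    assume c: "collinear {p, q, r}"
    from c[unfolded collinear_def] obtain u where u: "\<forall>x\<in>{p,q,r}. \<forall>y\<in>{p,q,r}. \<exists>c. x - y = c *\<^sub>R u"
      by (rule exE)
    have "\<exists>a. q - p = a *\<^sub>R u" by (rule u[rule_format]) simp_all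
    then obtain a where "q - p = a *\<^sub>R u" ..
    moreover have "\<exists>a. r - p = a *\<^sub>R u" by (rule u[rule_format]) simp_all
    then obtain b where "r - p = b *\<^sub>R u" ..
    ultimately
    show "crs (q - p) (r - p) = 0" by (simp add: crs_scaleR1 crs_scaleR2)
  qed
qed

lemma general_position_hgt:
  assumes "general_position P" "p \<in> P" "q \<in> P" "r \<in> P" "hgt x p = hgt x q" "hgt x q = hgt x r"
  shows "p = q \<or> q = r \<or> p = r"
  using assms collinear_iff_hgt unfolding general_position_def by blast

section \<open>Rolling a line around a polygon\<close>

lemma int_step_less:
  fixes t :: "int \<Rightarrow> real"
  assumes "\<And>i. t i < t (i + 1)" "i < j" shows "t i < t j"
  using assms(2)
proof (induction j rule: int_gr_induct)
  case base show ?case using assms(1) by simp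
next
  case (step k) then show ?case using assms(1)[of k] by simp
qed

text \<open>Reduction modulo \<open>m\<close> maps any window of length \<open>m\<close> onto the
  standard one. Corners can thus be counted from whichever vertex is convenient.\<close>

lemma window_bij:
  fixes m :: int
  assumes "0 < m" and per: "\<And>k. Q (k + m) \<longleftrightarrow> Q k"
  shows "bij_betw (\<lambda>k. k mod m) {k\<in>{i..<i+m}. Q k} {k\<in>{0..<m}. Q k}"
proof -
  have pern: "Q (k + int n * m) \<longleftrightarrow> Q k" for n k
  proof (induction n)
    case (Suc n)
    have "Q (k + int (Suc n) * m) = Q ((k + int n * m) + m)" by (simp add: algebra_simps)
    then show ?case using per Suc by simp
  qed simp
  have perz: "Q (k + z * m) \<longleftrightarrow> Q k" for z k
  proof (cases "0 \<le> z")
    case True then show ?thesis using pern[of k "nat z"] by simp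
  next
    case False
    then show ?thesis using pern[of "k + z * m" "nat (-z)"] by (simp add: algebra_simps)
  qed
  have mQ: "Q (k mod m) \<longleftrightarrow> Q k" for k
    using perz[of "k mod m" "k div m"] by simp
  show ?thesis
  proof (rule bij_betw_imageI)
    show "inj_on (\<lambda>k. k mod m) {k \<in> {i..<i + m}. Q k}"
    proof (rule inj_onI)
      fix x y assume "x \<in> {k \<in> {i..<i + m}. Q k}" "y \<in> {k \<in> {i..<i + m}. Q k}" and e: "x mod m = y mod m"
      then have "\<bar>x - y\<bar> < m" by auto
      moreover have "m dvd x - y" using e by (simp add: mod_eq_dvd_iff)
      ultimately show "x = y" using zdvd_imp_le[of m "\<bar>x - y\<bar>"] by fastforce
    qed
    show "(\<lambda>k. k mod m) ` {k \<in> {i..<i + m}. Q k} = {k \<in> {0..<m}. Q k}"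
    proof (intro equalityI subsetI)
      fix y assume "y \<in> {k \<in> {0..<m}. Q k}"
      then have y: "0 \<le> y" "y < m" "Q y" by auto
      define x where "x = i + (y - i) mod m"
      have "x mod m = y" using y by (simp add: x_def mod_simps)
      moreover have "x \<in> {i..<i+m}" using assms(1) by (simp add: x_def)
      ultimately show "y \<in> (\<lambda>k. k mod m) ` {k \<in> {i..<i + m}. Q k}"
        using mQ[of x] y by (metis (mono_tags, lifting) image_eqI mem_Collect_eq)
    qed (use mQ assms in auto)
  qed
qed

lemma window_card:
  fixes m :: int
  assumes "0 < m" and "\<And>k. Q (k + m) \<longleftrightarrow> Q k"
  shows "card {k\<in>{i..<i+m}. Q k} = card {k\<in>{0..<m}. Q k}"
  using bij_betw_same_card[OF window_bij[of m Q i]] assms by blast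

lemma window_card':
  fixes m :: int
  assumes "0 < m" and "\<And>k. Q (k + m) \<longleftrightarrow> Q k"
  shows "card {k\<in>{i<..i+m}. Q k} = card {k\<in>{0..<m}. Q k}"
proof -
  have "{i<..i+m} = {i+1..<(i+1)+m}" by auto
  then show ?thesis using window_card[of m Q "i+1"] assms by simp
qed

text \<open>A line rolls around the closed polygon \<open>v\<close> of period \<open>m\<close>: it rotates about \<open>v i\<close> while its angle
  runs through \<open>[t i, t (i + 1)]\<close>, and contains the edge from \<open>v i\<close> to \<open>v (i + 1)\<close> at angle
  \<open>t (i + 1)\<close>. After one turn around the polygon the line has reversed its orientation.\<close>

lemma sign_trans_pn: "a * b > 0 \<Longrightarrow> b * c < 0 \<Longrightarrow> a * c < (0::real)"
  by (auto simp: zero_less_mult_iff mult_less_0_iff)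

lemma sign_trans_pp: "a * b > 0 \<Longrightarrow> b * c > 0 \<Longrightarrow> a * c > (0::real)"
  by (auto simp: zero_less_mult_iff)

locale roll =
  fixes m :: int and v :: "int \<Rightarrow> complex" and t c :: "int \<Rightarrow> real"
  assumes m_pos: "0 < m" and v_per: "v (i + m) = v i" and t_per: "t (i + m) = t i + pi"
    and t_step: "t i < t (i + 1)" and edge: "v (i + 1) - v i = of_real (c i) * cis (t (i + 1))"
    and c_nz: "c i \<noteq> 0"
begin

text \<open>The sign of \<open>c i\<close> tells whether the edge runs along the oriented rolling
  line or against it. The line turns left by less than pi, so a walk along the polygon turns left
  where the sign persists and right where it changes.\<close>

definition corner :: "int \<Rightarrow> bool" where "corner i \<longleftrightarrow> c (i - 1) * c i < 0"

definition ncorners :: nat where "ncorners = card {k\<in>{0..<m}. corner k}"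

lemma t_less: "i < j \<Longrightarrow> t i < t j"
  using int_step_less[of t i j] t_step by blast

lemma t_le: "i \<le> j \<Longrightarrow> t i \<le> t j"
  using t_less[of i j] by (cases "i = j") auto

lemma t_less_iff: "t i < t j \<longleftrightarrow> i < j"
  by (meson not_less t_le t_less)

text \<open>After one period the edge is the same but the line is reversed. Hence \<open>c\<close>
  is antiperiodic, while \<open>corner\<close>, which depends on a product of two of its values, is
  periodic.\<close>

lemma c_per: "c (i + m) = - c i"
proof -
  have "v (i + m + 1) - v (i + m) = v (i + 1) - v i"
    using v_per[of i] v_per[of "i+1"] by (simp add: algebra_simps)
  then have "of_real (c (i + m)) * cis (t (i + m + 1)) = of_real (c i) * cis (t (i + 1))"
    using edge[of i] edge[of "i+m"] by simp
  moreover have "t (i + m + 1) = t (i + 1) + pi" using t_per[of "i+1"] by (simp add: algebra_simps)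
  ultimately have "of_real (- c (i + m)) * cis (t (i + 1)) = of_real (c i) * cis (t (i + 1))"
    by (simp add: cis_mult[symmetric])
  then have "complex_of_real (- c (i + m)) = of_real (c i)" by (metis cis_neq_zero mult_right_cancel)
  then show ?thesis using of_real_eq_iff by fastforce
qed

lemma corner_per: "corner (i + m) \<longleftrightarrow> corner i"
  using c_per[of i] c_per[of "i - 1"] by (simp add: corner_def algebra_simps)

lemma ncorners_window: "card {k\<in>{i<..i+m}. corner k} = ncorners"
  unfolding ncorners_def using window_card'[of m corner i] m_pos corner_per by blast

lemma v_neq: "v (i + 1) \<noteq> v i"
  using edge[of i] c_nz[of i] by auto

lemma m_ge2: "m \<ge> 2"
  using v_neq[of 0] v_per[of 0] m_pos by (cases "m = 1") auto

lemma t_gap: "t (i + 1) < t i + pi"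
  using t_per[of i] t_less[of "i+1" "i+m"] m_ge2 by simp

lemma v_sum: "i \<le> j \<Longrightarrow> v j - v i = (\<Sum>k\<in>{i..<j}. of_real (c k) * cis (t (k + 1)))"
proof (induction j rule: int_ge_induct)
  case (step j)
  have "{i..<j+1} = insert j {i..<j}" using step by auto
  then show ?case using step edge[of j] by (simp add: algebra_simps)
qed simp

lemma same_sign_run:
  assumes "i \<le> j" "\<And>k. k \<in> {i<..j} \<Longrightarrow> \<not> corner k" shows "c i * c j > 0"
  using assms
proof (induction j rule: int_ge_induct)
  case base then show ?case using c_nz[of i] by (auto simp: zero_less_mult_iff)
next
  case (step j)
  then have 1: "c i * c j > 0" and "\<not> corner (j + 1)" by auto
  then have "c j * c (j + 1) > 0" using c_nz[of "j+1"] c_nz[of j]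
    by (simp add: corner_def not_less le_less)
  with 1 show ?case by (rule sign_trans_pp)
qed

text \<open>With at most one sign change, all weighted edges would have heights of one sign over a
  suitable direction and could not add up to zero. Fewer than \<open>m\<close> steps keep the edge
  directions within less than pi of each other. The weights make room for cutting off parts of the
  first and last edge.\<close>

lemma two_corners:
  assumes ij: "i \<le> j" "j < i + m" and a: "\<And>k. k \<in> {i..j} \<Longrightarrow> 0 \<le> a k"
    and pos: "\<exists>k\<in>{i..j}. 0 < a k"
    and zero: "(\<Sum>k\<in>{i..j}. of_real (a k) * (of_real (c k) * cis (t (k + 1)))) = 0"
  shows "2 \<le> card {k\<in>{i<..j}. corner k}"
proof (rule ccontr)
  let ?C = "{k\<in>{i<..j}. corner k}"
  assume "\<not> 2 \<le> card ?C"
  then have card1: "card ?C \<le> 1" by simp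
  have fin: "finite ?C" by (rule finite_subset[of _ "{i..j}"]) auto
  obtain k0 where k0: "k0 \<in> {i..j}" "k0 = i \<or> corner k0" "\<And>k. k \<in> {i<..j} \<Longrightarrow> corner k \<Longrightarrow> k = k0"
  proof (cases "?C = {}")
    case True then show ?thesis using that[of i] ij by auto
  next
    case False
    then obtain k where k: "k \<in> ?C" by blast
    have one: "\<forall>x\<in>?C. \<forall>y\<in>?C. x = y"
      using card_le_Suc0_iff_eq[OF fin] card1 by simp
    show ?thesis
    proof (rule that[of k])
      show "l = k" if "l \<in> {i<..j}" "corner l" for l using one k that by blast
    qed (use k in auto)
  qed
  \<comment> \<open>A direction strictly between those of the edges \<open>k0 - 1\<close> and
    \<open>k0\<close>, so that the sine changes its sign exactly where \<open>c\<close>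
    does.\<close>
  define \<tau> where "\<tau> = (t k0 + t (k0 + 1)) / 2"
  have \<tau>: "t k0 < \<tau>" "\<tau> < t (k0 + 1)" using t_step[of k0] by (auto simp: \<tau>_def)
  have key: "0 < c k0 * (c k * sin (t (k + 1) - \<tau>))" if k: "k \<in> {i..j}" for k
  proof (cases "k < k0")
    case True
    have c1: "c k * c (k0 - 1) > 0"
    proof (rule same_sign_run)
      show "\<not> corner l" if "l \<in> {k<..k0 - 1}" for l
      proof
        assume "corner l"
        moreover have "l \<in> {i<..j}" using that k k0(1) by auto
        ultimately have "l = k0" using k0(3) by blast
        then show False using that by simp
      qed
    qed (use True in auto)
    have "corner k0" using k0 True k by auto
    then have c2: "c (k0 - 1) * c k0 < 0" by (simp add: corner_def)
    have "t (k + 1) \<le> t k0" using True by (intro t_le) auto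
    moreover have "t (k0 + 1) \<le> t (k + m)" using k k0 ij by (intro t_le) auto
    ultimately have "t (k + 1) - \<tau> < 0" "- pi < t (k + 1) - \<tau>"
      using \<tau> t_per[of k] t_step[of k] by linarith+
    then have s: "sin (t (k + 1) - \<tau>) < 0" using sin_gt_zero[of "-(t (k + 1) - \<tau>)"] sin_minus[of "t (k + 1) - \<tau>"] by linarith
    have "c k0 * c k < 0" using sign_trans_pn[OF c1 c2] by (simp add: mult.commute)
    then have "0 < (c k0 * c k) * sin (t (k + 1) - \<tau>)" using s by (rule mult_neg_neg)
    then show ?thesis by (simp only: mult.assoc)
  next
    case False
    have c1: "c k0 * c k > 0"
    proof (rule same_sign_run)
      show "\<not> corner l" if "l \<in> {k0<..k}" for l
      proof
        assume "corner l"
        moreover have "l \<in> {i<..j}" using that k k0(1) by auto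
        ultimately have "l = k0" using k0(3) by blast
        then show False using that by simp
      qed
    qed (use False in auto)
    have "t (k0 + 1) \<le> t (k + 1)" using False by (intro t_le) auto
    moreover have "t (k + 1) \<le> t (k0 + m)" using k k0 ij by (intro t_le) auto
    ultimately have "0 < t (k + 1) - \<tau>" "t (k + 1) - \<tau> < pi"
      using \<tau> t_per[of k0] by linarith+
    then have s: "sin (t (k + 1) - \<tau>) > 0" by (rule sin_gt_zero)
    with c1 have "0 < (c k0 * c k) * sin (t (k + 1) - \<tau>)" by (rule mult_pos_pos)
    then show ?thesis by (simp only: mult.assoc)
  qed
  have "0 = c k0 * hgt \<tau> (\<Sum>k\<in>{i..j}. of_real (a k) * (of_real (c k) * cis (t (k + 1))))"
    using zero by simp
  also have "\<dots> = (\<Sum>k\<in>{i..j}. a k * (c k0 * (c k * sin (t (k + 1) - \<tau>))))"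
    by (simp add: hgt_sum hgt_scale hgt_cis sum_distrib_left algebra_simps)
  also have "\<dots> > 0"
  proof -
    from pos obtain k where k: "k \<in> {i..j}" "0 < a k" by blast
    show ?thesis
    proof (rule sum_pos2[OF _ k(1)])
      show "0 < a k * (c k0 * (c k * sin (t (k + 1) - \<tau>)))" using k(2) key[OF k(1)] by (rule mult_pos_pos)
      show "0 \<le> a l * (c k0 * (c l * sin (t (l + 1) - \<tau>)))" if "l \<in> {i..j}" for l
        using a[OF that] less_imp_le[OF key[OF that]] by (rule mult_nonneg_nonneg)
    qed simp
  qed
  finally show False by simp
qed

text \<open>The edges of one period form a closed chain, which has two corners besides its first
  vertex. If the chain starts at a corner, that corner recurs at the end of the period and is the
  third.\<close>

lemma three_corners: "3 \<le> ncorners"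
proof -
  have z: "(\<Sum>k\<in>{i..i+m-1}. of_real 1 * (of_real (c k) * cis (t (k + 1)))) = 0" for i
  proof -
    have "{i..i+m-1} = {i..<i+m}" by auto
    then show ?thesis using v_sum[of i "i+m"] v_per[of i] m_pos by simp
  qed
  have "2 \<le> card {k\<in>{i<..i+m-1}. corner k}" for i
    by (rule two_corners[where a = "\<lambda>_. 1"]) (use m_pos z[of i] in auto)
  note two = this
  have "{k\<in>{0<..0+m-1}. corner k} \<noteq> {}" using two[of 0] by (metis card.empty not_numeral_le_zero)
  then obtain k where k: "corner k" by blast
  have "{j\<in>{k<..k+m}. corner j} = insert (k + m) {j\<in>{k<..k+m-1}. corner j}"
    using k corner_per[of k] m_pos by (auto simp: le_less)
  then have "card {j\<in>{k<..k+m}. corner j} = Suc (card {j\<in>{k<..k+m-1}. corner j})"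
  proof -
    assume e: "{j\<in>{k<..k+m}. corner j} = insert (k + m) {j\<in>{k<..k+m-1}. corner j}"
    have "finite {j\<in>{k<..k+m-1}. corner j}" by (rule finite_subset[of _ "{k..k+m}"]) auto
    moreover have "k + m \<notin> {j\<in>{k<..k+m-1}. corner j}" by simp
    ultimately show ?thesis unfolding e by (rule card_insert_disjoint)
  qed
  then show ?thesis using two[of k] ncorners_window[of k] by simp
qed

text \<open>A common point of the edges \<open>i\<close> and \<open>j\<close> closes up the part of
  the polygon between them; its end edges are shortened to the fractions \<open>1 - a\<close> and
  \<open>b\<close>, which become the weights in \<open>two_corners\<close>. The exception is the
  chain without length, at the vertex shared by consecutive edges.\<close>

lemma chain_meets:
  assumes ij: "i < j" "j < i + m" and a: "0 \<le> a" "a \<le> 1" and b: "0 \<le> b" "b \<le> 1"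
    and eq: "v i + of_real a * (v (i+1) - v i) = v j + of_real b * (v (j+1) - v j)"
  shows "2 \<le> card {k\<in>{i<..j}. corner k} \<or> j = i + 1 \<and> a = 1 \<and> b = 0"
proof -
  define w where "w k = (if k = i then 1 - a else if k = j then b else 1)" for k
  let ?e = "\<lambda>k. of_real (c k) * cis (t (k + 1))"
  have "{i..j} = insert j (insert i {i+1..<j})" using ij by auto
  then have "(\<Sum>k\<in>{i..j}. of_real (w k) * ?e k) = of_real b * ?e j + (of_real (1 - a) * ?e i
      + (\<Sum>k\<in>{i+1..<j}. of_real (w k) * ?e k))"
    using ij by (simp add: w_def)
  also have "(\<Sum>k\<in>{i+1..<j}. of_real (w k) * ?e k) = (\<Sum>k\<in>{i+1..<j}. ?e k)"
    by (rule sum.cong) (auto simp: w_def)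
  also have "\<dots> = v j - v (i + 1)" using v_sum[of "i+1" j] ij by simp
  also have "of_real b * ?e j + (of_real (1 - a) * ?e i + (v j - v (i + 1))) = 0"
    using eq edge[of i] edge[of j] by (simp add: algebra_simps)
  finally have z: "(\<Sum>k\<in>{i..j}. of_real (w k) * ?e k) = 0" .
  show ?thesis
  proof (cases "\<exists>k\<in>{i..j}. 0 < w k")
    case True
    have "2 \<le> card {k\<in>{i<..j}. corner k}"
      by (rule two_corners[OF _ _ _ True z]) (use ij a b in \<open>auto simp: w_def\<close>)
    then show ?thesis by blast
  next
    case False
    then have w: "w i \<le> 0" "w j \<le> 0" "w (i + 1) \<le> 0" using ij by (auto simp: not_less)
    then have "j = i + 1" using ij by (auto simp: w_def split: if_splits)
    then show ?thesis using w a b by (auto simp: w_def split: if_splits)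
  qed
qed

text \<open>A common point splits the polygon into two closed chains, and each of them would need
  two corners of its own, more than the three that exist.\<close>

lemma edges_meet:
  assumes n3: "ncorners = 3" and ij: "i < j" "j < i + m" and a: "0 \<le> a" "a \<le> 1" and b: "0 \<le> b" "b \<le> 1"
    and eq: "v i + of_real a * (v (i+1) - v i) = v j + of_real b * (v (j+1) - v j)"
  shows "j = i + 1 \<and> a = 1 \<and> b = 0 \<or> j = i + m - 1 \<and> a = 0 \<and> b = 1"
proof (rule ccontr)
  assume neg: "\<not> ?thesis"
  have 1: "2 \<le> card {k\<in>{i<..j}. corner k}" using chain_meets[OF ij a b eq] neg by blast
  \<comment> \<open>The second chain runs from edge \<open>j\<close> to edge \<open>i\<close> of the
    next period.\<close>
  have "v (i + m) = v i" "v (i + m + 1) = v (i + 1)" using v_per[of i] v_per[of "i+1"] by (simp_all add: algebra_simps)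
  then have "v j + of_real b * (v (j+1) - v j) = v (i+m) + of_real a * (v (i+m+1) - v (i+m))"
    using eq by simp
  from chain_meets[OF _ _ b a this] have 2: "2 \<le> card {k\<in>{j<..i+m}. corner k}"
    using neg ij by auto
  have "{k\<in>{i<..i+m}. corner k} = {k\<in>{i<..j}. corner k} \<union> {k\<in>{j<..i+m}. corner k}" using ij by auto
  moreover have "card ({k\<in>{i<..j}. corner k} \<union> {k\<in>{j<..i+m}. corner k})
     = card {k\<in>{i<..j}. corner k} + card {k\<in>{j<..i+m}. corner k}"
    by (rule card_Un_disjoint)
      (auto intro: finite_subset[of _ "{i..j}"] finite_subset[of _ "{j..i+m}"])
  ultimately show False using 1 2 n3 ncorners_window[of i] by simp
qed

end

section \<open>Sheets of the dual arrangement\<close>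

lemma periodic_add:
  fixes m :: int assumes per: "\<And>k. g (k + m) = g k" shows "g (k + z * m) = g k"
proof -
  have pern: "g (k + int n * m) = g k" for n k
  proof (induction n)
    case (Suc n)
    have "g (k + int (Suc n) * m) = g ((k + int n * m) + m)" by (simp add: algebra_simps)
    then show ?case using per Suc by simp
  qed simp
  show ?thesis
  proof (cases "0 \<le> z")
    case True then show ?thesis using pern[of k "nat z"] by simp
  next
    case False
    then show ?thesis using pern[of "k + z * m" "nat (-z)"] by (simp add: algebra_simps)
  qed
qed

lemma periodic_mod:
  fixes m :: int assumes "\<And>k. g (k + m) = g k" shows "g (k mod m) = g k"
  using periodic_add[of g m "k mod m" "k div m"] assms by simp

lemma shift_add:
  fixes m :: int and t :: "int \<Rightarrow> real" and w :: real
  assumes per: "\<And>k. t (k + m) = t k + w" shows "t (k + z * m) = t k + of_int z * w"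
proof -
  have pern: "t (k + int n * m) = t k + of_nat n * w" for n k
  proof (induction n)
    case (Suc n)
    have "t (k + int (Suc n) * m) = t ((k + int n * m) + m)" by (simp add: algebra_simps)
    then show ?case using per[of "k + int n * m"] Suc by (simp add: algebra_simps)
  qed simp
  show ?thesis
  proof (cases "0 \<le> z")
    case True then show ?thesis using pern[of k "nat z"] by simp
  next
    case False
    then show ?thesis using pern[of "k + z * m" "nat (-z)"] by (simp add: algebra_simps)
  qed
qed

text \<open>A floor finds the period that contains \<open>x\<close>; within it, the last index whose
  angle does not exceed \<open>x\<close> is the right one.\<close>

lemma shift_cover:
  fixes m :: int and t :: "int \<Rightarrow> real"
  assumes "0 < m" and per: "\<And>k. t (k + m) = t k + pi"
  shows "\<exists>i. t i \<le> x \<and> x < t (i + 1)"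
proof -
  define z where "z = \<lfloor>(x - t 0) / pi\<rfloor>"
  have "of_int z \<le> (x - t 0) / pi" "(x - t 0) / pi < of_int z + 1"
    unfolding z_def by linarith+
  then have z: "of_int z * pi \<le> x - t 0" "x - t 0 < (of_int z + 1) * pi"
    by (simp_all add: pos_le_divide_eq pos_divide_less_eq)
  have t: "t (z * m) = t 0 + of_int z * pi" using shift_add[of t m pi 0 z] per by simp
  then have a: "t (z * m) \<le> x" using z by simp
  have b: "x < t (z * m + m)" using z t per[of "z * m"] by (simp add: algebra_simps)
  let ?S = "{j\<in>{z*m..z*m+m}. t j \<le> x}"
  have fin: "finite ?S" by (rule finite_subset[of _ "{z*m..z*m+m}"]) auto
  have ne: "z * m \<in> ?S" using a assms(1) by simp
  define i where "i = Max ?S"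
  have i: "i \<in> ?S" "\<And>j. j \<in> ?S \<Longrightarrow> j \<le> i"
    unfolding i_def using Max_in[OF fin] Max_ge[OF fin] ne by blast+
  have "i \<noteq> z*m+m" using i b by auto
  then have "i + 1 \<in> {z*m..z*m+m}" using i(1) by auto
  then have "\<not> t (i + 1) \<le> x" using i(2)[of "i+1"] by fastforce
  then show ?thesis using i(1) by auto
qed

lemma (in roll) t_cover: "\<exists>i. t i \<le> x \<and> x < t (i + 1)"
  using shift_cover[of m t x] m_pos t_per by blast

lemma (in roll) t_add: "t (k + z * m) = t k + of_int z * pi"
  using shift_add[of t m pi k z] t_per by blast

lemma (in roll) idx_unique: "t i \<le> x \<Longrightarrow> x < t (i + 1) \<Longrightarrow> t j \<le> x \<Longrightarrow> x < t (j + 1) \<Longrightarrow> i = j"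
  using t_le[of "i+1" j] t_le[of "j+1" i] by (cases i j rule: linorder_cases) linarith+

text \<open>The sorted elements of one period are repeated with shifts by pi. Integer indices make
  the enumeration uniform, without a first element.\<close>

lemma periodic_enum:
  fixes K :: "real set"
  assumes fin: "finite (K \<inter> {0..<pi})" and ne: "K \<noteq> {}" and per: "\<And>x. x + pi \<in> K \<longleftrightarrow> x \<in> K"
  obtains m :: int and t where "0 < m" "\<And>i. t i < t (i + 1)" "\<And>i. t (i + m) = t i + pi" "range t = K"
proof -
  have pern: "x + of_nat n * pi \<in> K \<longleftrightarrow> x \<in> K" for n x
  proof (induction n)
    case (Suc n)
    have "x + of_nat (Suc n) * pi = (x + of_nat n * pi) + pi" by (simp add: algebra_simps)
    then show ?case using per Suc by metis
  qed simp
  have perz: "x + of_int z * pi \<in> K \<longleftrightarrow> x \<in> K" for z x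
  proof (cases "0 \<le> z")
    case True then show ?thesis using pern[of x "nat z"] by simp
  next
    case False then show ?thesis using pern[of "x + of_int z * pi" "nat (-z)"] by (simp add: algebra_simps)
  qed
  have dec: "\<exists>y z. y \<in> K \<inter> {0..<pi} \<and> x = y + of_int z * pi" if "x \<in> K" for x
  proof -
    define z where "z = \<lfloor>x / pi\<rfloor>"
    have "of_int z \<le> x / pi" "x / pi < of_int z + 1" unfolding z_def by linarith+
    then have "of_int z * pi \<le> x" "x < (of_int z + 1) * pi"
      by (simp_all add: pos_le_divide_eq pos_divide_less_eq)
    moreover have "x - of_int z * pi \<in> K" using perz[of "x - of_int z * pi" z] that by simp
    ultimately have "x - of_int z * pi \<in> K \<inter> {0..<pi}" by (auto simp: algebra_simps)
    moreover have "x = (x - of_int z * pi) + of_int z * pi" by simp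
    ultimately show ?thesis by blast
  qed
  define ks where "ks = sorted_list_of_set (K \<inter> {0..<pi})"
  have set_ks: "set ks = K \<inter> {0..<pi}" and ss: "sorted_wrt (<) ks"
    using fin by (simp_all add: ks_def)
  define m where "m = int (length ks)"
  define t where "t i = ks ! nat (i mod m) + pi * of_int (i div m)" for i
  obtain x0 where "x0 \<in> K" using ne by blast
  from dec[OF this] have "set ks \<noteq> {}" unfolding set_ks by (elim exE conjE) (rule ex_in_conv[THEN iffD1], rule exI)
  then have m0: "0 < m" by (simp add: m_def)
  have nth: "ks ! nat (i mod m) \<in> K \<inter> {0..<pi}" for i
  proof -
    have "nat (i mod m) < length ks" using m0 by (simp add: m_def nat_less_iff)
    then show ?thesis using set_ks nth_mem by blast
  qed
  have step: "t i < t (i + 1)" for i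
  proof (cases "i mod m + 1 < m")
    case True
    have "(i + 1) mod m = (i mod m + 1) mod m" by (simp add: mod_simps)
    also have "\<dots> = i mod m + 1" using True m0 by (intro mod_pos_pos_trivial) auto
    finally have 1: "(i + 1) mod m = i mod m + 1" .
    then have "m * ((i + 1) div m) = m * (i div m)"
      using mult_div_mod_eq[of m "i + 1"] mult_div_mod_eq[of m i] by linarith
    then have 2: "(i + 1) div m = i div m" using m0 by simp
    have "0 \<le> i mod m" using m0 by simp
    then have "nat (i mod m) < nat (i mod m + 1)" "nat (i mod m + 1) < length ks"
      using True unfolding m_def by linarith+
    then have "ks ! nat (i mod m) < ks ! nat (i mod m + 1)" by (rule sorted_wrt_nth_less[OF ss])
    then show ?thesis by (simp add: t_def 1 2)
  next
    \<comment> \<open>The step from the last element of a period to the first of the next: the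
      quotient grows by one, and the added pi exceeds the difference of any two elements of a
      period.\<close>
    case False
    moreover have "i mod m < m" using m0 by simp
    ultimately have e: "i mod m = m - 1" by simp
    have "(i + 1) mod m = (i mod m + 1) mod m" by (simp add: mod_simps)
    then have 1: "(i + 1) mod m = 0" by (simp add: e)
    then have "m * ((i + 1) div m) = m * (i div m + 1)"
      using mult_div_mod_eq[of m "i + 1"] mult_div_mod_eq[of m i] e by (simp add: algebra_simps)
    then have 2: "(i + 1) div m = i div m + 1" using m0 by simp
    have "ks ! nat (i mod m) < pi" "0 \<le> ks ! nat ((i + 1) mod m)" using nth[of i] nth[of "i+1"] by auto
    then have "ks ! nat (i mod m) < ks ! nat ((i + 1) mod m) + pi" by linarith
    then show ?thesis unfolding t_def 2 by (simp add: distrib_left)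
  qed
  have tper: "t (i + m) = t i + pi" for i using m0 by (simp add: t_def algebra_simps)
  have "range t = K"
  proof (intro equalityI subsetI)
    fix x assume "x \<in> range t"
    then obtain i where "x = ks ! nat (i mod m) + of_int (i div m) * pi" by (auto simp: t_def mult.commute)
    then show "x \<in> K" using nth[of i] perz[of "ks ! nat (i mod m)" "i div m"] by blast
  next
    fix x assume "x \<in> K"
    from dec[OF this] obtain y z where yz: "y \<in> set ks" "x = y + of_int z * pi" unfolding set_ks by blast
    then obtain n where n: "n < length ks" "y = ks ! n" by (metis in_set_conv_nth)
    have "t (int n + z * m) = x" using n yz m0 by (simp add: t_def m_def)
    then show "x \<in> range t" by blast
  qed
  then show ?thesis using that m0 step tper by blast
qed

text \<open>The condition for a line to belong to the support without its first level. The witnesses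
  \<open>q\<close> and \<open>r\<close> may both be the second point of the line, so the lines of
  the hull edges, which are the vertices of the first level, are included; a line that touches the
  hull in a single point is not.\<close>

definition sep :: "complex set \<Rightarrow> real \<Rightarrow> real \<Rightarrow> bool" where
  "sep P x d \<longleftrightarrow> (\<exists>p\<in>P. hgt x p = d \<and> (\<exists>q\<in>P. q \<noteq> p \<and> d \<le> hgt x q) \<and> (\<exists>r\<in>P. r \<noteq> p \<and> hgt x r \<le> d))"

section \<open>The point set and its generic angles\<close>

locale pts =
  fixes P :: "complex set"
  assumes finP: "finite P" and gp: "general_position P" and n3: "3 \<le> card P"
begin

text \<open>The generic angles: those that are not the direction of a line through two points. All
  but finitely many angles of a period qualify.\<close>

definition nice :: "real \<Rightarrow> bool" where
  "nice y \<longleftrightarrow> (\<forall>p\<in>P. \<forall>q\<in>P. hgt y p = hgt y q \<longrightarrow> p = q)"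

lemma gp3: "p \<in> P \<Longrightarrow> q \<in> P \<Longrightarrow> r \<in> P \<Longrightarrow> hgt x p = hgt x q \<Longrightarrow> hgt x q = hgt x r \<Longrightarrow> p = q \<or> q = r \<or> p = r"
  using general_position_hgt[OF gp] by blast

lemma third: "\<exists>r\<in>P. r \<noteq> p \<and> r \<noteq> q"
proof (rule ccontr)
  assume "\<not> ?thesis"
  then have "P \<subseteq> {p, q}" by auto
  then have "card P \<le> card {p, q}" by (intro card_mono) auto
  also have "card {p, q} \<le> 2" by (simp add: card_insert_if)
  finally show False using n3 by simp
qed

lemma off_line: "p \<in> P \<Longrightarrow> q \<in> P \<Longrightarrow> p \<noteq> q \<Longrightarrow> hgt x p = hgt x q \<Longrightarrow> r \<in> P \<Longrightarrow> hgt x r = hgt x p \<Longrightarrow> r = p \<or> r = q"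
  using gp3[of p q r x] by metis

lemma ev_neq:
  assumes "p \<noteq> q" shows "\<forall>\<^sub>F y in at x. hgt y p \<noteq> hgt y q"
proof (cases "hgt x p = hgt x q")
  case False
  have "isCont (\<lambda>y. hgt y p - hgt y q) x" by (intro continuous_intros isCont_hgt)
  then have "((\<lambda>y. hgt y p - hgt y q) \<longlongrightarrow> hgt x p - hgt x q) (at x)" by (simp add: isCont_def)
  then have "\<forall>\<^sub>F y in at x. hgt y p - hgt y q \<noteq> 0" by (rule tendsto_imp_eventually_ne) (use False in auto)
  then show ?thesis by (rule eventually_mono) auto
next
  case True
  have "\<forall>\<^sub>F y in at x. y \<noteq> x \<and> dist y x < pi" unfolding eventually_at by (rule exI[of _ pi]) simp
  then show ?thesis
  proof (rule eventually_mono)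
    fix y assume y: "y \<noteq> x \<and> dist y x < pi"
    show "hgt y p \<noteq> hgt y q"
    proof
      assume "hgt y p = hgt y q"
      then obtain k :: int where k: "y = x + of_int k * pi" using hgt_same_dir[OF assms True] by blast
      then have "\<bar>of_int k\<bar> * pi < 1 * pi" using y by (simp add: dist_real_def abs_mult)
      then have "\<bar>of_int k\<bar> < (1::real)" by simp
      then have "k = 0" by linarith
      then show False using k y by simp
    qed
  qed
qed

lemma ev_nice: "\<forall>\<^sub>F y in at x. nice y"
proof -
  have "\<forall>\<^sub>F y in at x. \<forall>p\<in>P. \<forall>q\<in>P. hgt y p = hgt y q \<longrightarrow> p = q"
  proof (intro eventually_ball_finite[OF finP] ballI)
    fix p q show "\<forall>\<^sub>F y in at x. hgt y p = hgt y q \<longrightarrow> p = q"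
      using ev_neq[of p q x] by (cases "p = q") (auto elim: eventually_mono)
  qed
  then show ?thesis by (simp add: nice_def)
qed

lemma ev_less: "hgt x p < hgt x q \<Longrightarrow> \<forall>\<^sub>F y in at x. hgt y p < hgt y q"
proof -
  assume "hgt x p < hgt x q"
  moreover have "((\<lambda>y. hgt y q - hgt y p) \<longlongrightarrow> hgt x q - hgt x p) (at x)"
    using isCont_hgt unfolding isCont_def by (intro tendsto_intros)
  ultimately have "\<forall>\<^sub>F y in at x. 0 < hgt y q - hgt y p" by (intro order_tendstoD(1)) auto
  then show ?thesis by (rule eventually_mono) simp
qed

lemma finite_coincidences: "finite ({x. \<exists>p\<in>P. \<exists>q\<in>P. p \<noteq> q \<and> hgt x p = hgt x q} \<inter> {0..<pi})"
proof -
  have "finite {x\<in>{0..<pi}. hgt x p = hgt x q}" if "p \<noteq> q" for p q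
  proof -
    have "x = y" if "x \<in> {x\<in>{0..<pi}. hgt x p = hgt x q}" "y \<in> {x\<in>{0..<pi}. hgt x p = hgt x q}" for x y
    proof -
      have "\<exists>k::int. y = x + of_int k * pi" using that hgt_same_dir[OF \<open>p \<noteq> q\<close>, of x y] by blast
      then obtain k :: int where k: "y = x + of_int k * pi" by blast
      have "\<bar>y - x\<bar> < pi" using that by auto
      then have "\<bar>of_int k\<bar> * pi < 1 * pi" using k by (simp add: abs_mult)
      then have "\<bar>of_int k\<bar> < (1::real)" by simp
      then have "k = 0" by linarith
      then show ?thesis using k by simp
    qed
    then have "\<exists>a. {x\<in>{0..<pi}. hgt x p = hgt x q} \<subseteq> {a}" by blast
    then show ?thesis using finite_subset by blast
  qed
  then have "finite (\<Union>p\<in>P. \<Union>q\<in>P-{p}. {x\<in>{0..<pi}. hgt x p = hgt x q})"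
    by (intro finite_UN_I finP finite_Diff) auto
  moreover have "{x. \<exists>p\<in>P. \<exists>q\<in>P. p \<noteq> q \<and> hgt x p = hgt x q} \<inter> {0..<pi}
    \<subseteq> (\<Union>p\<in>P. \<Union>q\<in>P-{p}. {x\<in>{0..<pi}. hgt x p = hgt x q})" by blast
  ultimately show ?thesis by (rule finite_subset[rotated])
qed

text \<open>At generic angles the heights of the points are pairwise distinct, so a continuous
  choice among them is locally constant as a choice of a point, hence constant on a connected
  set.\<close>

lemma branch_const:
  assumes con: "connected I" and nice: "\<And>y. y \<in> I \<Longrightarrow> nice y" and cont: "continuous_on UNIV f"
    and br: "\<And>y. \<exists>p\<in>P. f y = hgt y p" and ne: "y0 \<in> I"
  shows "\<exists>p\<in>P. \<forall>y\<in>I. f y = hgt y p"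
proof -
  obtain p where p: "p \<in> P" "f y0 = hgt y0 p" using br by blast
  have "f y = hgt y p" if "y \<in> I" for y
  proof (rule connected_induction_simple[OF con ne that, where P = "\<lambda>y. f y = hgt y p"])
    fix a assume a: "a \<in> I"
    obtain q where q: "q \<in> P" "f a = hgt a q" using br by blast
    have "\<forall>\<^sub>F y in nhds a. \<forall>r\<in>P-{q}. f y \<noteq> hgt y r"
    proof (rule eventually_ball_finite)
      show "\<forall>r\<in>P-{q}. \<forall>\<^sub>F y in nhds a. f y \<noteq> hgt y r"
      proof
        fix r assume r: "r \<in> P - {q}"
        then have ne: "f a \<noteq> hgt a r" using q nice[OF a] by (auto simp: nice_def)
        have "isCont f a" using cont by (simp add: continuous_on_eq_continuous_at)
        then have "((\<lambda>y. f y - hgt y r) \<longlongrightarrow> f a - hgt a r) (at a)"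
          using isCont_hgt[of a r] unfolding isCont_def by (intro tendsto_intros)
        then have "\<forall>\<^sub>F y in at a. f y - hgt y r \<noteq> 0" by (rule tendsto_imp_eventually_ne) (use ne in auto)
        then have "\<forall>\<^sub>F y in at a. f y \<noteq> hgt y r" by (rule eventually_mono) auto
        then show "\<forall>\<^sub>F y in nhds a. f y \<noteq> hgt y r" using ne by (simp add: eventually_nhds_conv_at)
      qed
    qed (use finP in auto)
    then obtain U where U: "open U" "a \<in> U" "\<And>y. y \<in> U \<Longrightarrow> \<forall>r\<in>P-{q}. f y \<noteq> hgt y r"
      by (auto simp: eventually_nhds)
    then have fU: "f y = hgt y q" if "y \<in> U" for y using br[of y] that by blast
    show "\<exists>T. openin (top_of_set I) T \<and> a \<in> T \<and> (\<forall>x\<in>T. \<forall>y\<in>T. f x = hgt x p \<longrightarrow> f y = hgt y p)"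
    proof (intro exI conjI ballI impI)
      show "openin (top_of_set I) (I \<inter> U)" using U by (auto simp: openin_open)
      show "a \<in> I \<inter> U" using a U by simp
      fix x y assume xy: "x \<in> I \<inter> U" "y \<in> I \<inter> U" "f x = hgt x p"
      then have "q = p" using fU[of x] nice[of x] p q by (auto simp: nice_def)
      then show "f y = hgt y p" using fU xy by simp
    qed
  qed (use p in auto)
  then show ?thesis using p by blast
qed

end

section \<open>Sheets, the functions whose graphs make up an arrangement, and the points that they
  follow\<close>

locale sheets = pts +
  fixes L :: "(real \<Rightarrow> real) set"
  assumes finL: "finite L" and contL: "f \<in> L \<Longrightarrow> continuous_on UNIV f"
    and antiL: "f \<in> L \<Longrightarrow> f (x + pi) = - f x"
    and suppL: "(\<exists>f\<in>L. f x = d) \<longleftrightarrow> sep P x d"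
    and isoL: "f \<in> L \<Longrightarrow> g \<in> L \<Longrightarrow> f \<noteq> g \<Longrightarrow> \<forall>\<^sub>F y in at x. f y \<noteq> g y"
begin

text \<open>The point about which the line of the sheet rotates on one side of an angle. With
  \<open>gl\<close> the point before and \<open>gr\<close> the point after the angle, all local
  questions about sheets become questions about points.\<close>

definition germ :: "real filter \<Rightarrow> (real \<Rightarrow> real) \<Rightarrow> complex" where
  "germ F f = (THE p. p \<in> P \<and> (\<forall>\<^sub>F y in F. f y = hgt y p))"

abbreviation "gl f x \<equiv> germ (at_left x) f"
abbreviation "gr f x \<equiv> germ (at_right x) f"

definition side :: "real filter \<Rightarrow> real \<Rightarrow> bool" where
  "side F x \<longleftrightarrow> F = at_left x \<or> F = at_right x"

lemma side_simps [simp]: "side (at_left x) x" "side (at_right x) x" by (auto simp: side_def)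

lemma side_le: "side F x \<Longrightarrow> F \<le> at x"
  by (auto simp: side_def at_le)

lemma side_bot: "side F x \<Longrightarrow> F \<noteq> bot"
  using trivial_limit_at_left_real trivial_limit_at_right_real by (metis side_def)

lemma side_ev: "side F x \<Longrightarrow> \<forall>\<^sub>F y in at x. Q y \<Longrightarrow> \<forall>\<^sub>F y in F. Q y"
  by (rule filter_leD[OF side_le])

lemma br: "f \<in> L \<Longrightarrow> \<exists>p\<in>P. f y = hgt y p"
proof -
  assume "f \<in> L"
  then have "sep P y (f y)" using suppL[of y "f y"] by blast
  then show ?thesis unfolding sep_def by force
qed

text \<open>A punctured neighbourhood contains only generic angles, so \<open>branch_const\<close>
  applies to each of its two halves.\<close>

lemma germ_ex:
  assumes "side F x" "f \<in> L" shows "\<exists>p\<in>P. \<forall>\<^sub>F y in F. f y = hgt y p"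
proof -
  obtain e where e: "e > 0" "\<And>y. y \<noteq> x \<Longrightarrow> dist y x < e \<Longrightarrow> nice y"
    using ev_nice[of x] unfolding eventually_at by auto
  from assms(1) consider "F = at_left x" | "F = at_right x" by (auto simp: side_def)
  then show ?thesis
  proof cases
    case 1
    have "\<exists>p\<in>P. \<forall>y\<in>{x-e<..<x}. f y = hgt y p"
      by (rule branch_const[of _ _ "x - e/2"]) (use e contL br assms in \<open>auto simp: dist_real_def\<close>)
    then obtain p where "p \<in> P" "\<forall>y\<in>{x-e<..<x}. f y = hgt y p" by blast
    then have "\<forall>\<^sub>F y in at_left x. f y = hgt y p" unfolding eventually_at_left_field
      by (intro exI[of _ "x - e"]) (use e in auto)
    then show ?thesis using 1 \<open>p \<in> P\<close> by blast
  next
    case 2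
    have "\<exists>p\<in>P. \<forall>y\<in>{x<..<x+e}. f y = hgt y p"
      by (rule branch_const[of _ _ "x + e/2"]) (use e contL br assms in \<open>auto simp: dist_real_def\<close>)
    then obtain p where "p \<in> P" "\<forall>y\<in>{x<..<x+e}. f y = hgt y p" by blast
    then have "\<forall>\<^sub>F y in at_right x. f y = hgt y p" unfolding eventually_at_right_field
      by (intro exI[of _ "x + e"]) (use e in auto)
    then show ?thesis using 2 \<open>p \<in> P\<close> by blast
  qed
qed

lemma ev_unique:
  assumes F: "side F x" and "p \<in> P" "q \<in> P" "\<forall>\<^sub>F y in F. f y = hgt y p" "\<forall>\<^sub>F y in F. f y = hgt y q"
  shows "p = q"
proof -
  have "\<forall>\<^sub>F y in F. nice y" using side_ev[OF F ev_nice] .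
  then have "\<forall>\<^sub>F y in F. p = q" using assms(4,5) by eventually_elim (use assms in \<open>auto simp: nice_def\<close>)
  then show ?thesis using side_bot[OF F] by simp
qed

lemma germ:
  assumes "side F x" "f \<in> L" shows germ_in: "germ F f \<in> P" and germ_ev: "\<forall>\<^sub>F y in F. f y = hgt y (germ F f)"
proof -
  have "\<exists>!p. p \<in> P \<and> (\<forall>\<^sub>F y in F. f y = hgt y p)"
    using germ_ex[OF assms] ev_unique[OF assms(1)] by blast
  then have "germ F f \<in> P \<and> (\<forall>\<^sub>F y in F. f y = hgt y (germ F f))" unfolding germ_def by (rule theI')
  then show "germ F f \<in> P" "\<forall>\<^sub>F y in F. f y = hgt y (germ F f)" by auto
qed

lemma germ_eqI:
  assumes "side F x" "f \<in> L" "p \<in> P" "\<forall>\<^sub>F y in F. f y = hgt y p" shows "germ F f = p"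
  by (rule ev_unique[OF assms(1) germ_in[OF assms(1,2)] assms(3) germ_ev[OF assms(1,2)] assms(4)])

lemma germ_at: assumes F: "side F x" and f: "f \<in> L" shows "hgt x (germ F f) = f x"
proof -
  have "isCont f x" using contL[OF f] by (simp add: continuous_on_eq_continuous_at)
  then have "(f \<longlongrightarrow> f x) (at x)" by (simp add: isCont_def)
  then have 1: "(f \<longlongrightarrow> f x) F" using tendsto_mono side_le[OF F] by blast
  have "((\<lambda>y. hgt y (germ F f)) \<longlongrightarrow> hgt x (germ F f)) (at x)" using isCont_hgt isCont_def by blast
  then have "((\<lambda>y. hgt y (germ F f)) \<longlongrightarrow> hgt x (germ F f)) F" using tendsto_mono side_le[OF F] by blast
  then have "(f \<longlongrightarrow> hgt x (germ F f)) F"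
    by (rule Lim_transform_eventually) (use germ_ev[OF F f] in \<open>auto elim: eventually_mono\<close>)
  then show ?thesis using tendsto_unique[OF side_bot[OF F]] 1 by blast
qed

text \<open>Two sheets following the same dual on one side would agree there, against the isolation
  of their common points.\<close>

lemma germ_inj:
  assumes F: "side F x" and "f \<in> L" "g \<in> L" "germ F f = germ F g" shows "f = g"
proof (rule ccontr)
  assume "f \<noteq> g"
  then have "\<forall>\<^sub>F y in F. f y \<noteq> g y" using side_ev[OF F isoL] assms by blast
  then have "\<forall>\<^sub>F y in F. False" using germ_ev[OF F assms(2)] germ_ev[OF F assms(3)]
    by eventually_elim (use assms in auto)
  then show False using side_bot[OF F] by simp
qed

text \<open>At a generic angle where all finitely many sheets already follow their germs, a sheet
  with the value \<open>hgt y p\<close> can only be one that follows the dual of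
  \<open>p\<close>.\<close>

lemma germ_surj:
  assumes F: "side F x" and p: "p \<in> P" and s: "\<forall>\<^sub>F y in F. sep P y (hgt y p)"
  shows "\<exists>f\<in>L. germ F f = p"
proof -
  have "\<forall>\<^sub>F y in F. \<forall>f\<in>L. f y = hgt y (germ F f)"
    by (rule eventually_ball_finite[OF finL]) (use germ_ev[OF F] in auto)
  moreover have "\<forall>\<^sub>F y in F. nice y" using side_ev[OF F ev_nice] .
  ultimately have "\<forall>\<^sub>F y in F. sep P y (hgt y p) \<and> nice y \<and> (\<forall>f\<in>L. f y = hgt y (germ F f))"
    using s by eventually_elim auto
  then obtain y where y: "sep P y (hgt y p)" "nice y" "\<And>f. f \<in> L \<Longrightarrow> f y = hgt y (germ F f)"
    using eventually_happens'[OF side_bot[OF F], of "\<lambda>y. sep P y (hgt y p) \<and> nice y \<and> (\<forall>f\<in>L. f y = hgt y (germ F f))"] by blast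
  then obtain f where "f \<in> L" "f y = hgt y p" using suppL[of y "hgt y p"] by blast
  then have "germ F f = p" using y germ_in[OF F] p unfolding nice_def by metis
  then show ?thesis using \<open>f \<in> L\<close> by blast
qed

lemma gr_near: assumes f: "f \<in> L"
  shows "\<exists>b>x. \<forall>y. x < y \<and> y < b \<longrightarrow> gr f y = gr f x \<and> gl f y = gr f x"
proof -
  obtain b where b: "b > x" "\<And>y. x < y \<Longrightarrow> y < b \<Longrightarrow> f y = hgt y (gr f x)"
    using germ_ev[of "at_right x" x f] f unfolding eventually_at_right_field by auto
  have "gr f y = gr f x \<and> gl f y = gr f x" if "x < y" "y < b" for y
  proof
    have "\<forall>\<^sub>F z in at_right y. f z = hgt z (gr f x)" unfolding eventually_at_right_field
      by (rule exI[of _ b]) (use that b in auto)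
    then show "gr f y = gr f x" by (rule germ_eqI[OF side_simps(2) f germ_in[OF side_simps(2) f]])
    have "\<forall>\<^sub>F z in at_left y. f z = hgt z (gr f x)" unfolding eventually_at_left_field
      by (rule exI[of _ x]) (use that b in auto)
    then show "gl f y = gr f x" by (rule germ_eqI[OF side_simps(1) f germ_in[OF side_simps(2) f]])
  qed
  then show ?thesis using b by blast
qed

lemma gl_near: assumes f: "f \<in> L"
  shows "\<exists>b<x. \<forall>y. b < y \<and> y < x \<longrightarrow> gr f y = gl f x \<and> gl f y = gl f x"
proof -
  obtain b where b: "b < x" "\<And>y. b < y \<Longrightarrow> y < x \<Longrightarrow> f y = hgt y (gl f x)"
    using germ_ev[of "at_left x" x f] f unfolding eventually_at_left_field by auto
  have "gr f y = gl f x \<and> gl f y = gl f x" if "b < y" "y < x" for y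
  proof
    have "\<forall>\<^sub>F z in at_right y. f z = hgt z (gl f x)" unfolding eventually_at_right_field
      by (rule exI[of _ x]) (use that b in auto)
    then show "gr f y = gl f x" by (rule germ_eqI[OF side_simps(2) f germ_in[OF side_simps(1) f]])
    have "\<forall>\<^sub>F z in at_left y. f z = hgt z (gl f x)" unfolding eventually_at_left_field
      by (rule exI[of _ b]) (use that b in auto)
    then show "gl f y = gl f x" by (rule germ_eqI[OF side_simps(1) f germ_in[OF side_simps(1) f]])
  qed
  then show ?thesis using b by blast
qed

lemma gr_pi: assumes f: "f \<in> L" shows "gr f (x + pi) = gr f x"
proof -
  obtain b where b: "b > x" "\<And>y. x < y \<Longrightarrow> y < b \<Longrightarrow> f y = hgt y (gr f x)"
    using germ_ev[of "at_right x" x f] f unfolding eventually_at_right_field by auto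
  have "f y = hgt y (gr f x)" if "x + pi < y" "y < b + pi" for y
  proof -
    have "f (y - pi) = hgt (y - pi) (gr f x)" using b(2)[of "y - pi"] that by simp
    then show ?thesis using antiL[OF f, of "y - pi"] hgt_pi[of "y - pi" "gr f x"] by simp
  qed
  then have "\<forall>\<^sub>F y in at_right (x + pi). f y = hgt y (gr f x)" unfolding eventually_at_right_field
    by (intro exI[of _ "b + pi"]) (use b in auto)
  then show ?thesis by (rule germ_eqI[OF side_simps(2) f germ_in[OF side_simps(2) f]])
qed

lemma gl_pi: assumes f: "f \<in> L" shows "gl f (x + pi) = gl f x"
proof -
  obtain b where b: "b < x" "\<And>y. b < y \<Longrightarrow> y < x \<Longrightarrow> f y = hgt y (gl f x)"
    using germ_ev[of "at_left x" x f] f unfolding eventually_at_left_field by auto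
  have "f y = hgt y (gl f x)" if "b + pi < y" "y < x + pi" for y
  proof -
    have "f (y - pi) = hgt (y - pi) (gl f x)" using b(2)[of "y - pi"] that by simp
    then show ?thesis using antiL[OF f, of "y - pi"] hgt_pi[of "y - pi" "gl f x"] by simp
  qed
  then have "\<forall>\<^sub>F y in at_left (x + pi). f y = hgt y (gl f x)" unfolding eventually_at_left_field
    by (intro exI[of _ "b + pi"]) (use b in auto)
  then show ?thesis by (rule germ_eqI[OF side_simps(1) f germ_in[OF side_simps(1) f]])
qed

lemma real_periodic:
  assumes "\<And>x::real. g (x + pi) = g x" shows "g (x + of_int k * pi) = g x"
proof -
  have "(\<lambda>k::int. g (x + of_int k * pi)) (0 + k * 1) = (\<lambda>k::int. g (x + of_int k * pi)) 0"
    by (rule periodic_add) (use assms[of "x + of_int _ * pi"] in \<open>simp add: algebra_simps\<close>)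
  then show ?thesis by simp
qed

lemma gl_per: "f \<in> L \<Longrightarrow> gl f (x + of_int k * pi) = gl f x"
  using real_periodic[of "\<lambda>x. gl f x" x k] gl_pi by blast

lemma gr_per: "f \<in> L \<Longrightarrow> gr f (x + of_int k * pi) = gr f x"
  using real_periodic[of "\<lambda>x. gr f x" x k] gr_pi by blast

definition switch :: "(real \<Rightarrow> real) \<Rightarrow> real \<Rightarrow> bool" where
  "switch f x \<longleftrightarrow> gl f x \<noteq> gr f x"

definition rolls_along :: "(real \<Rightarrow> real) \<Rightarrow> int \<Rightarrow> (int \<Rightarrow> complex) \<Rightarrow> (int \<Rightarrow> real) \<Rightarrow> (int \<Rightarrow> real) \<Rightarrow> bool" where
  "rolls_along f m v t c \<longleftrightarrow> roll m v t c \<and> (\<forall>i x. t i \<le> x \<longrightarrow> x < t (i + 1) \<longrightarrow> gr f x = v i)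
     \<and> (\<forall>i x. t i < x \<longrightarrow> x \<le> t (i + 1) \<longrightarrow> gl f x = v i)"

text \<open>The switches, enumerated over the periods, are the angles of a rolling line, and the
  points followed between them are its vertices. By continuity the old and the new point have equal
  height at a switch, so the edge between them lies on the line at that angle.\<close>

lemma roll_exists:
  assumes f: "f \<in> L" and sw: "switch f x0" shows "\<exists>m v t c. rolls_along f m v t c"
proof -
  let ?K = "{x. switch f x}"
  have heights: "hgt x (gl f x) = hgt x (gr f x)" for x
    using germ_at[of "at_left x" x f] germ_at[of "at_right x" x f] f by simp
  have "?K \<subseteq> {x. \<exists>p\<in>P. \<exists>q\<in>P. p \<noteq> q \<and> hgt x p = hgt x q}"
    using heights germ_in[OF side_simps(1) f] germ_in[OF side_simps(2) f] unfolding switch_def by fastforce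
  then have fin: "finite (?K \<inter> {0..<pi})" by (intro finite_subset[OF _ finite_coincidences]) auto
  have per: "x + pi \<in> ?K \<longleftrightarrow> x \<in> ?K" for x using gl_pi[OF f] gr_pi[OF f] by (simp add: switch_def)
  obtain m :: int and t where mt: "0 < m" "\<And>i. t i < t (i + 1)" "\<And>i. t (i + m) = t i + pi" "range t = ?K"
    using periodic_enum[OF fin _ per] sw by blast
  define v where "v i = gr f (t i)" for i
  have nosw: "\<not> switch f x" if "t i < x" "x < t (i + 1)" for i x
  proof
    assume "switch f x"
    then obtain j where "x = t j" using mt(4) by blast
    consider "j \<le> i" | "j = i + 1" | "i + 1 < j" by linarith
    then show False
    proof cases
      case 1 then show False using int_step_less[of t j i] mt(2) that \<open>x = t j\<close> by (cases "j = i") fastforce+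
    next
      case 3 then show False using int_step_less[of t "i+1" j] mt(2) that \<open>x = t j\<close> by fastforce
    qed (use that \<open>x = t j\<close> in simp)
  qed
  \<comment> \<open>The outgoing point is locally constant where no switch occurs. The interval is
    closed at its start because the outgoing point at \<open>t i\<close> is already the new
    one.\<close>
  have grv: "gr f x = v i" if x: "t i \<le> x" "x < t (i + 1)" for i x
  proof (rule connected_induction_simple[of "{t i..<t (i+1)}" "t i" x "\<lambda>x. gr f x = v i"])
    fix a assume a: "a \<in> {t i..<t (i+1)}"
    obtain b where b: "b > a" "\<And>y. a < y \<Longrightarrow> y < b \<Longrightarrow> gr f y = gr f a" using gr_near[OF f, of a] by blast
    obtain b' where b': "b' < a" "\<And>y. b' < y \<Longrightarrow> y < a \<Longrightarrow> gr f y = gl f a" using gl_near[OF f, of a] by blast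
    have "gr f y = gr f a" if "y \<in> {t i..<t (i+1)} \<inter> {b'<..<b}" for y
    proof (cases y a rule: linorder_cases)
      case less
      then have "gl f a = gr f a" using nosw[of i a] that a by (auto simp: switch_def)
      then show ?thesis using less b' that by auto
    qed (use b that in auto)
    then have "\<forall>x\<in>{t i..<t (i+1)} \<inter> {b'<..<b}. \<forall>y\<in>{t i..<t (i+1)} \<inter> {b'<..<b}. gr f x = v i \<longrightarrow> gr f y = v i"
      by simp
    moreover have "openin (top_of_set {t i..<t (i+1)}) ({t i..<t (i+1)} \<inter> {b'<..<b})" by (intro openin_open_Int) simp
    moreover have "a \<in> {t i..<t (i+1)} \<inter> {b'<..<b}" using a b b' by simp
    ultimately show "\<exists>T. openin (top_of_set {t i..<t (i+1)}) T \<and> a \<in> T \<and> (\<forall>x\<in>T. \<forall>y\<in>T. gr f x = v i \<longrightarrow> gr f y = v i)"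
      by blast
  qed (use x mt in \<open>auto simp: v_def\<close>)
  have glv: "gl f x = v i" if x: "t i < x" "x \<le> t (i + 1)" for i x
  proof -
    obtain b' where b': "b' < x" "\<And>y. b' < y \<Longrightarrow> y < x \<Longrightarrow> gr f y = gl f x" using gl_near[OF f, of x] by blast
    define y where "y = (max b' (t i) + x) / 2"
    have "b' < y" "y < x" "t i < y" using b' x by (auto simp: y_def)
    then show ?thesis using b'(2)[of y] grv[of i y] x by simp
  qed
  have "\<exists>c. v (i + 1) - v i = of_real c * cis (t (i + 1)) \<and> c \<noteq> 0" for i
  proof -
    have 1: "v (i + 1) = gr f (t (i + 1))" by (simp add: v_def)
    have 2: "v i = gl f (t (i + 1))" using glv[of i "t (i+1)"] mt(2) by simp
    have "t (i+1) \<in> ?K" using mt(4) by blast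
    then have "v (i + 1) \<noteq> v i" using 1 2 by (simp add: switch_def)
    moreover have "hgt (t (i+1)) (v i) = hgt (t (i+1)) (v (i + 1))" using heights 1 2 by simp
    ultimately show ?thesis using hgt_eq_dir by (metis mult_zero_left of_real_0 right_minus_eq)
  qed
  then obtain c where c: "\<And>i. v (i + 1) - v i = of_real (c i) * cis (t (i + 1)) \<and> c i \<noteq> 0" by metis
  have "roll m v t c"
    by unfold_locales (use mt c gr_pi[OF f] in \<open>auto simp: v_def\<close>)
  then show ?thesis unfolding rolls_along_def using grv glv by blast
qed

end

section \<open>How two sheets meet, and how many sheets there are\<close>

lemma finite_max:
  fixes g :: "'a \<Rightarrow> real" assumes "finite A" "A \<noteq> {}" shows "\<exists>a\<in>A. \<forall>b\<in>A. g b \<le> g a"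
proof -
  have "Max (g ` A) \<in> g ` A" using assms by (intro Max_in) auto
  then obtain a where a: "a \<in> A" "Max (g ` A) = g a" by blast
  have "g b \<le> g a" if "b \<in> A" for b using Max_ge[of "g ` A" "g b"] assms(1) that a(2) by simp
  then show ?thesis using a by blast
qed

lemma eventually_at_dist: "\<forall>\<^sub>F y in at (a::real). Q y \<Longrightarrow> \<exists>e>0. \<forall>y. y \<noteq> a \<longrightarrow> \<bar>y - a\<bar> < e \<longrightarrow> Q y"
  unfolding eventually_at dist_real_def by auto

context sheets
begin

lemma on_germs:
  assumes "side F x" "f \<in> L" "p \<in> P" "q \<in> P" "p \<noteq> q" "hgt x p = hgt x q" "f x = hgt x p"
  shows "germ F f = p \<or> germ F f = q"
  using off_line[OF assms(3-6) germ_in[OF assms(1,2)]] germ_at[OF assms(1,2)] assms(7) by metis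

lemma order_near:
  assumes "q - p = of_real c * cis a"
  shows "0 < c \<Longrightarrow> \<forall>\<^sub>F y in at_left a. hgt y p < hgt y q"
    and "0 < c \<Longrightarrow> \<forall>\<^sub>F y in at_right a. hgt y q < hgt y p"
    and "c < 0 \<Longrightarrow> \<forall>\<^sub>F y in at_left a. hgt y q < hgt y p"
    and "c < 0 \<Longrightarrow> \<forall>\<^sub>F y in at_right a. hgt y p < hgt y q"
proof -
  have h: "hgt y q = hgt y p + c * sin (a - y)" for y using hgt_dir[OF assms] .
  have l: "0 < sin (a - y)" if "a - pi < y" "y < a" for y using sin_gt_zero[of "a - y"] that by simp
  have r: "sin (a - y) < 0" if "y < a + pi" "a < y" for y
    using sin_gt_zero[of "y - a"] that sin_minus[of "y - a"] by simp
  show "0 < c \<Longrightarrow> \<forall>\<^sub>F y in at_left a. hgt y p < hgt y q"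
    unfolding eventually_at_left_field
    by (rule exI[of _ "a - pi"]) (use l in \<open>auto simp: h\<close>)
  show "c < 0 \<Longrightarrow> \<forall>\<^sub>F y in at_left a. hgt y q < hgt y p"
    unfolding eventually_at_left_field
    by (rule exI[of _ "a - pi"]) (use l in \<open>auto simp: h mult_neg_pos\<close>)
  show "0 < c \<Longrightarrow> \<forall>\<^sub>F y in at_right a. hgt y q < hgt y p"
    unfolding eventually_at_right_field
    by (rule exI[of _ "a + pi"]) (use r in \<open>auto simp: h mult_pos_neg\<close>)
  show "c < 0 \<Longrightarrow> \<forall>\<^sub>F y in at_right a. hgt y p < hgt y q"
    unfolding eventually_at_right_field
    by (rule exI[of _ "a + pi"]) (use r in \<open>auto simp: h mult_neg_neg\<close>)
qed

text \<open>Stated by germs instead of signs: neither sheet switches at the common line. For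
  distinct sheets the only alternative is that both switch, and \<open>cross_sign\<close> and
  \<open>touch_sign\<close> show that these two cases are the crossings and the contacts.\<close>

definition crosses :: "(real \<Rightarrow> real) \<Rightarrow> (real \<Rightarrow> real) \<Rightarrow> real \<Rightarrow> bool" where
  "crosses f g x \<longleftrightarrow> gl f x = gr f x \<and> gl g x = gr g x \<and> f x = g x"

text \<open>By general position the common line contains just two points, and distinct sheets have
  distinct germs; so the sheets occupy both points before the line and both after it.\<close>

lemma meet_cases:
  assumes fg: "f \<in> L" "g \<in> L" "f \<noteq> g" and eq: "f x = g x"
  shows "gl f x \<noteq> gl g x \<and> hgt x (gl f x) = hgt x (gl g x) \<and> hgt x (gl f x) = f x \<and>
     (gr f x = gl f x \<and> gr g x = gl g x \<or> gr f x = gl g x \<and> gr g x = gl f x)"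
proof -
  have ne: "gl f x \<noteq> gl g x" "gr f x \<noteq> gr g x" using germ_inj fg by (metis side_simps)+
  have h: "hgt x (gl f x) = f x" "hgt x (gl g x) = f x"
    using germ_at[OF side_simps(1) fg(1)] germ_at[OF side_simps(1) fg(2)] eq by auto
  have "gr f x = gl f x \<or> gr f x = gl g x"
    by (rule on_germs[OF side_simps(2) fg(1)]) (use germ_in[OF side_simps(1)] fg ne h in auto)
  moreover have "gr g x = gl f x \<or> gr g x = gl g x"
    by (rule on_germs[OF side_simps(2) fg(2)]) (use germ_in[OF side_simps(1)] fg ne h eq in auto)
  ultimately show ?thesis using ne h by metis
qed

lemma at_from_sides: "\<forall>\<^sub>F y in at_left x. Q y \<Longrightarrow> \<forall>\<^sub>F y in at_right x. Q y \<Longrightarrow> \<forall>\<^sub>F y in at (x::real). Q y"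
  by (simp add: eventually_at_split)

text \<open>At a contact the sheets exchange their points at the very angle where the two duals
  exchange their order, so the order of the sheets persists.\<close>

lemma ordered_near:
  assumes fg: "f \<in> L" "g \<in> L" "f \<noteq> g" and ncr: "\<not> crosses f g x"
  shows "(\<forall>\<^sub>F y in at x. f y < g y) \<or> (\<forall>\<^sub>F y in at x. g y < f y)"
proof (cases "f x = g x")
  case False
  have "isCont f x" "isCont g x" using contL fg by (auto simp: continuous_on_eq_continuous_at)
  then have t: "((\<lambda>y. f y - g y) \<longlongrightarrow> f x - g x) (at x)" unfolding isCont_def by (intro tendsto_intros)
  show ?thesis
  proof (cases "f x < g x")
    case True
    have "\<forall>\<^sub>F y in at x. f y - g y < 0" by (rule order_tendstoD(2)[OF t]) (use True in auto)
    then show ?thesis by (auto elim: eventually_mono)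
  next
    case F: False
    have "\<forall>\<^sub>F y in at x. 0 < f y - g y" by (rule order_tendstoD(1)[OF t]) (use False F in auto)
    then show ?thesis by (auto elim: eventually_mono)
  qed
next
  case True
  define p q where "p = gl f x" and "q = gl g x"
  have m: "p \<noteq> q" "hgt x p = hgt x q" "gr f x = q" "gr g x = p"
    using meet_cases[OF fg True] ncr True by (auto simp: crosses_def p_def q_def)
  obtain c where c: "q - p = of_real c * cis x" using m(2) hgt_eq_dir by blast
  have "c \<noteq> 0" using c m(1) by auto
  have ev: "\<forall>\<^sub>F y in at_left x. f y = hgt y p" "\<forall>\<^sub>F y in at_left x. g y = hgt y q"
    "\<forall>\<^sub>F y in at_right x. f y = hgt y q" "\<forall>\<^sub>F y in at_right x. g y = hgt y p"
    using germ_ev[OF side_simps(1) fg(1), of x] germ_ev[OF side_simps(1) fg(2), of x]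
      germ_ev[OF side_simps(2) fg(1), of x] germ_ev[OF side_simps(2) fg(2), of x] m
    by (simp_all only: p_def q_def)
  show ?thesis
  proof (cases "0 < c")
    case True
    have "\<forall>\<^sub>F y in at x. f y < g y"
    proof (rule at_from_sides)
      show "\<forall>\<^sub>F y in at_left x. f y < g y" using ev(1,2) order_near(1)[OF c True] by eventually_elim simp
      show "\<forall>\<^sub>F y in at_right x. f y < g y" using ev(3,4) order_near(2)[OF c True] by eventually_elim simp
    qed
    then show ?thesis ..
  next
    case False
    then have neg: "c < 0" using \<open>c \<noteq> 0\<close> by simp
    have "\<forall>\<^sub>F y in at x. g y < f y"
    proof (rule at_from_sides)
      show "\<forall>\<^sub>F y in at_left x. g y < f y" using ev(1,2) order_near(3)[OF c neg] by eventually_elim simp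
      show "\<forall>\<^sub>F y in at_right x. g y < f y" using ev(3,4) order_near(4)[OF c neg] by eventually_elim simp
    qed
    then show ?thesis ..
  qed
qed

lemma ev_at_spread:
  assumes "\<forall>\<^sub>F y in at a. Q (y::real)"
  shows "\<exists>e>0. \<forall>y\<in>ball a e. \<forall>\<^sub>F z in at y. Q z"
proof -
  obtain e where e: "e > 0" "\<And>y. y \<noteq> a \<Longrightarrow> dist y a < e \<Longrightarrow> Q y" using assms unfolding eventually_at by auto
  have "\<forall>\<^sub>F z in at y. Q z" if y: "y \<in> ball a e" for y
  proof (cases "y = a")
    case False
    have "open (ball a e - {a})" by (intro open_Diff) auto
    moreover have "y \<in> ball a e - {a}" using y False by simp
    ultimately have "\<forall>\<^sub>F z in nhds y. z \<in> ball a e - {a}" by (rule eventually_nhds_in_open)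
    then have "\<forall>\<^sub>F z in at y. z \<in> ball a e - {a}" by (simp add: eventually_nhds_conv_at)
    then show ?thesis by (rule eventually_mono) (use e in \<open>auto simp: dist_commute\<close>)
  qed (use assms in simp)
  then show ?thesis using e by blast
qed

text \<open>Without a crossing one sheet would stay above the other all along, but the difference of
  two antiperiodic functions reverses its sign over pi.\<close>

lemma cross_ex:
  assumes fg: "f \<in> L" "g \<in> L" "f \<noteq> g" shows "\<exists>x. crosses f g x"
proof (rule ccontr)
  assume none: "\<not> ?thesis"
  \<comment> \<open>The order is read off in punctured neighbourhoods, since the sheets may touch at
    the angle itself.\<close>
  define Q where "Q a \<longleftrightarrow> (\<forall>\<^sub>F y in at a. f y < g y)" for a
  have dich: "Q a \<or> (\<forall>\<^sub>F y in at a. g y < f y)" for a using ordered_near[OF fg] none Q_def by blast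
  have excl: False if "\<forall>\<^sub>F y in at a. f y < g y" "\<forall>\<^sub>F y in at a. g y < f y" for a
  proof -
    from that have "\<forall>\<^sub>F y in at a. False" by eventually_elim simp
    then show False by simp
  qed
  have const: "Q b" if "Q a" for a b
  proof (rule connected_induction_simple[of UNIV a b Q])
    fix a
    have "\<exists>e>0. \<forall>x\<in>ball a e. \<forall>y\<in>ball a e. Q x \<longrightarrow> Q y"
    proof (cases "Q a")
      case True
      then show ?thesis using ev_at_spread[of "\<lambda>y. f y < g y" a] unfolding Q_def by blast
    next
      case False
      then have "\<forall>\<^sub>F y in at a. g y < f y" using dich by blast
      then obtain e where "e > 0" "\<forall>y\<in>ball a e. \<forall>\<^sub>F z in at y. g z < f z" using ev_at_spread by blast
      then show ?thesis using excl unfolding Q_def by blast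
    qed
    then obtain e where e: "e > 0" "\<forall>x\<in>ball a e. \<forall>y\<in>ball a e. Q x \<longrightarrow> Q y" by blast
    then show "\<exists>T. openin (top_of_set UNIV) T \<and> a \<in> T \<and> (\<forall>x\<in>T. \<forall>y\<in>T. Q x \<longrightarrow> Q y)"
      by (intro exI[of _ "ball a e"]) simp
  qed (use that in auto)
  have flip: False if t1: "\<forall>\<^sub>F y in at 0. u y < w y" and t2: "\<forall>\<^sub>F y in at pi. u y < w y" and t3: "u \<in> L" "w \<in> L" for u w
  proof -
    obtain e where e: "e > 0" "\<And>y. y \<noteq> 0 \<Longrightarrow> \<bar>y - 0\<bar> < e \<Longrightarrow> u y < w y"
      using eventually_at_dist[OF t1] by blast
    obtain e' where e': "e' > 0" "\<And>y. y \<noteq> pi \<Longrightarrow> \<bar>y - pi\<bar> < e' \<Longrightarrow> u y < w y"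
      using eventually_at_dist[OF t2] by blast
    define y where "y = min e e' / 2"
    have "u y < w y" using e e' by (intro e(2)) (auto simp: y_def)
    moreover have "u (y + pi) < w (y + pi)" using e e' by (intro e'(2)) (auto simp: y_def)
    ultimately show False using antiL[OF t3(1), of y] antiL[OF t3(2), of y] by simp
  qed
  show False
  proof (cases "Q 0")
    case True
    then show False using flip[of f g] const[of 0 pi] fg unfolding Q_def by blast
  next
    case False
    then have "\<not> Q pi" using const by blast
    then show False using flip[of g f] dich[of 0] dich[of pi] False fg by blast
  qed
qed

definition extreme :: "complex \<Rightarrow> bool" where
  "extreme p \<longleftrightarrow> p \<in> P \<and> (\<exists>x. \<forall>q\<in>P. q \<noteq> p \<longrightarrow> hgt x q < hgt x p)"

text \<open>Not being strictly highest at \<open>x\<close> yields one witness, and the same at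
  \<open>x + pi\<close> the other. Consequently the whole dual of an inner point belongs to the
  support.\<close>

lemma sep_nonextreme: assumes "p \<in> P" "\<not> extreme p" shows "sep P x (hgt x p)"
proof -
  obtain q where q: "q \<in> P" "q \<noteq> p" "\<not> hgt x q < hgt x p" using assms unfolding extreme_def by blast
  obtain r where "r \<in> P" "r \<noteq> p" "\<not> hgt (x + pi) r < hgt (x + pi) p" using assms unfolding extreme_def by blast
  then have "hgt x r \<le> hgt x p" by simp
  then show ?thesis unfolding sep_def using q \<open>r \<in> P\<close> \<open>r \<noteq> p\<close> assms(1)
    by (intro bexI[of _ p]) (auto simp: not_less)
qed

lemma ev_sep_strict:
  assumes "p \<in> P" "q \<in> P" "r \<in> P" "hgt x p < hgt x q" "hgt x r < hgt x p"
  shows "\<forall>\<^sub>F y in at x. sep P y (hgt y p)"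
  using ev_less[OF assms(4)] ev_less[OF assms(5)]
proof eventually_elim
  case (elim y)
  then show ?case unfolding sep_def using assms
    by (intro bexI[of _ p] conjI bexI[of _ q] bexI[of _ r]) auto
qed

text \<open>At a generic angle the sheets correspond to the points other than the unique highest and
  the unique lowest one.\<close>

lemma cardL: "card L + 2 = card P"
proof -
  obtain x where nx: "nice x" using eventually_happens'[OF _ ev_nice[of 0]] by auto
  have ne: "P \<noteq> {}" using n3 by auto
  obtain u where u: "u \<in> P" "\<And>q. q \<in> P \<Longrightarrow> hgt x q \<le> hgt x u"
    using finite_max[OF finP ne, of "hgt x"] by blast
  obtain w where w: "w \<in> P" "\<And>q. q \<in> P \<Longrightarrow> hgt x w \<le> hgt x q"
    using finite_max[OF finP ne, of "\<lambda>p. - hgt x p"] by auto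
  have injP: "hgt x p = hgt x q \<Longrightarrow> p = q" if "p \<in> P" "q \<in> P" for p q using nx that by (auto simp: nice_def)
  have uw: "u \<noteq> w"
  proof
    assume "u = w"
    obtain r where "r \<in> P" "r \<noteq> u" using third by blast
    then show False using u(2)[of r] w(2)[of r] \<open>u = w\<close> injP[of r u] u(1) by force
  qed
  have sepx: "sep P x (hgt x p) \<longleftrightarrow> p \<noteq> u \<and> p \<noteq> w" if p: "p \<in> P" for p
  proof
    assume "sep P x (hgt x p)"
    then obtain p' q r where "p' \<in> P" "hgt x p' = hgt x p" "q \<in> P" "q \<noteq> p'" "hgt x p \<le> hgt x q"
      "r \<in> P" "r \<noteq> p'" "hgt x r \<le> hgt x p" unfolding sep_def by blast
    then show "p \<noteq> u \<and> p \<noteq> w" using injP[of p' p] u(2)[of q] w(2)[of r] injP[of q p] injP[of r p] p by force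
  next
    assume "p \<noteq> u \<and> p \<noteq> w"
    then show "sep P x (hgt x p)" unfolding sep_def using p u w
      by (intro bexI[of _ p] conjI bexI[of _ u] bexI[of _ w]) auto
  qed
  have "bij_betw (\<lambda>f. gr f x) L (P - {u, w})"
  proof (rule bij_betw_imageI)
    show "inj_on (\<lambda>f. gr f x) L" using germ_inj[OF side_simps(2)] by (auto intro: inj_onI)
    show "(\<lambda>f. gr f x) ` L = P - {u, w}"
    proof (intro equalityI subsetI)
      fix p assume "p \<in> (\<lambda>f. gr f x) ` L"
      then obtain f where f: "f \<in> L" "p = gr f x" by blast
      have "p \<in> P" "hgt x p = f x" using germ_in[OF side_simps(2) f(1)] germ_at[OF side_simps(2) f(1)] f(2) by auto
      then show "p \<in> P - {u, w}" using sepx[of p] suppL[of x "f x"] f(1) by auto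
    next
      fix p assume p: "p \<in> P - {u, w}"
      then obtain f where f: "f \<in> L" "f x = hgt x p" using sepx[of p] suppL[of x "hgt x p"] by auto
      then have "gr f x = p" using germ_in[OF side_simps(2) f(1)] germ_at[OF side_simps(2) f(1)] injP p by force
      then show "p \<in> (\<lambda>f. gr f x) ` L" using f by blast
    qed
  qed
  then have "card L = card (P - {u, w})" by (rule bij_betw_same_card)
  also have "\<dots> = card P - 2" using u w uw finP by (subst card_Diff_subset) auto
  finally show ?thesis using n3 by simp
qed

section \<open>The directed edges of the convex hull, with all other points on their left\<close>

definition hull_pairs :: "(complex \<times> complex) set" where
  "hull_pairs = {(p, q). p \<in> P \<and> q \<in> P \<and> p \<noteq> q \<and> (\<forall>r\<in>P. r \<noteq> p \<longrightarrow> r \<noteq> q \<longrightarrow> 0 < crs (q - p) (r - p))}"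

text \<open>Seen from \<open>p\<close>, and after rotating the direction \<open>x\<close> to the
  real axis, all other points lie below. There the cotangent \<open>\<kappa>\<close> orders the
  directions, and all remaining points are to the left of the one where it is largest.\<close>

lemma hull_pair_extreme: "extreme p \<Longrightarrow> \<exists>q. (p, q) \<in> hull_pairs"
proof -
  assume "extreme p"
  then obtain x where p: "p \<in> P" and x: "\<And>q. q \<in> P \<Longrightarrow> q \<noteq> p \<Longrightarrow> hgt x q < hgt x p"
    unfolding extreme_def by blast
  define w where "w = cis x"
  define \<kappa> where "\<kappa> r = (Re (cnj w * (r - p))) / Im (cnj w * (r - p))" for r
  have im: "Im (cnj w * (r - p)) = hgt x r - hgt x p" for r
    by (simp add: w_def hgt_def algebra_simps)
  have im0: "Im (cnj w * (r - p)) < 0" if "r \<in> P" "r \<noteq> p" for r using im x[OF that] by simp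
  have cw: "crs (a) (b) = crs (cnj w * a) (cnj w * b)" for a b
    unfolding crs_mult by (simp add: w_def)
  have fin: "finite (P - {p})" "P - {p} \<noteq> {}" using finP third[of p p] by auto
  obtain q where q: "q \<in> P" "q \<noteq> p" "\<And>r. r \<in> P \<Longrightarrow> r \<noteq> p \<Longrightarrow> \<kappa> r \<le> \<kappa> q"
    using finite_max[OF fin, of \<kappa>] by blast
  have "0 < crs (q - p) (r - p)" if r: "r \<in> P" "r \<noteq> p" "r \<noteq> q" for r
  proof -
    have "\<not> collinear {p, q, r}" using gp p q r unfolding general_position_def by metis
    then have nz: "crs (q - p) (r - p) \<noteq> 0" using collinear_crs by blast
    define A B where "A = cnj w * (q - p)" and "B = cnj w * (r - p)"
    have AB: "Im A < 0" "Im B < 0" "Re B / Im B \<le> Re A / Im A"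
      using im0 q r unfolding \<kappa>_def A_def B_def by auto
    have "0 < Im A * Im B" using AB by (simp add: mult_neg_neg)
    then have "(Re B / Im B) * (Im A * Im B) \<le> (Re A / Im A) * (Im A * Im B)" using AB by (intro mult_right_mono) auto
    then have "Re B * Im A \<le> Re A * Im B" using AB by simp
    then have "0 \<le> crs A B" by (simp add: crs_def mult.commute)
    then show ?thesis using nz cw[of "q - p" "r - p"] unfolding A_def B_def by simp
  qed
  then show ?thesis unfolding hull_pairs_def using p q by blast
qed

lemma hull_pairs_height:
  assumes "(p, q) \<in> hull_pairs" "q - p = of_real c * cis x" "r \<in> P" "r \<noteq> p" "r \<noteq> q"
  shows "0 < c * (hgt x r - hgt x p)"
proof -
  have "0 < crs (q - p) (r - p)" using assms unfolding hull_pairs_def by blast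
  also have "\<dots> = c * (hgt x r - hgt x p)" by (simp add: assms(2) crs_scale1 hgt_crs crs_diff2 right_diff_distrib)
  finally show ?thesis .
qed

lemma hull_pairs_asym: assumes "(p, q) \<in> hull_pairs" shows "(q, p) \<notin> hull_pairs"
proof
  assume b: "(q, p) \<in> hull_pairs"
  obtain r where r: "r \<in> P" "r \<noteq> p" "r \<noteq> q" using third by blast
  have "0 < crs (q - p) (r - p)" "0 < crs (p - q) (r - q)" using assms b r unfolding hull_pairs_def by blast+
  moreover have "crs (p - q) (r - q) = - crs (q - p) (r - p)" by (simp add: crs_def algebra_simps)
  ultimately show False by simp
qed

text \<open>Just after a hull line two sheets through it would follow both of its points, and either
  point would have points on both sides. As all others lie on one and the same side, each of the two
  would have to lie beyond the other.\<close>

lemma hull_unique: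
  assumes H: "(p, q) \<in> hull_pairs" and x: "hgt x p = hgt x q" and f: "f \<in> L" "f x = hgt x p" and g: "g \<in> L" "g x = hgt x p"
  shows "f = g"
proof (rule ccontr)
  assume ne: "f \<noteq> g"
  have pq: "p \<in> P" "q \<in> P" "p \<noteq> q" using H by (auto simp: hull_pairs_def)
  have g1: "gr f x \<in> {p, q}" "gr g x \<in> {p, q}" "gr f x \<noteq> gr g x"
    using on_germs[OF side_simps(2) f(1) pq x f(2)] on_germs[OF side_simps(2) g(1) pq x g(2)]
      germ_inj[OF side_simps(2) f(1) g(1)] ne by auto
  obtain c where c: "q - p = of_real c * cis x" using x hgt_eq_dir by blast
  have "c \<noteq> 0" using c pq by auto
  have E: "\<forall>\<^sub>F y in at x. \<forall>r\<in>P-{p,q}. 0 < c * (hgt y r - hgt y p) \<and> 0 < c * (hgt y r - hgt y q)"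
  proof (rule eventually_ball_finite, use finP in simp, rule ballI)
    fix r assume r: "r \<in> P - {p, q}"
    have 1: "0 < c * (hgt x r - hgt x p)" using hull_pairs_height[OF H c] r by auto
    have t: "((\<lambda>y. c * (hgt y r - hgt y s)) \<longlongrightarrow> c * (hgt x r - hgt x s)) (at x)" for s
      using isCont_hgt unfolding isCont_def by (intro tendsto_intros)
    have "\<forall>\<^sub>F y in at x. 0 < c * (hgt y r - hgt y p)" by (rule order_tendstoD(1)[OF t 1])
    moreover have "\<forall>\<^sub>F y in at x. 0 < c * (hgt y r - hgt y q)"
      by (rule order_tendstoD(1)[OF t]) (use 1 in \<open>simp only: x\<close>)
    ultimately show "\<forall>\<^sub>F y in at x. 0 < c * (hgt y r - hgt y p) \<and> 0 < c * (hgt y r - hgt y q)"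
      by eventually_elim simp
  qed
  have "\<forall>\<^sub>F y in at_right x. nice y \<and> (\<forall>r\<in>P-{p,q}. 0 < c * (hgt y r - hgt y p) \<and> 0 < c * (hgt y r - hgt y q))
     \<and> f y = hgt y (gr f x) \<and> g y = hgt y (gr g x)"
    using side_ev[OF side_simps(2) E] side_ev[OF side_simps(2) ev_nice] germ_ev[OF side_simps(2) f(1)]
      germ_ev[OF side_simps(2) g(1)] by eventually_elim auto
  then obtain y where y: "nice y" "\<And>r. r \<in> P-{p,q} \<Longrightarrow> 0 < c * (hgt y r - hgt y p) \<and> 0 < c * (hgt y r - hgt y q)"
     "f y = hgt y (gr f x)" "g y = hgt y (gr g x)"
    using eventually_happens'[OF trivial_limit_at_right_real] by blast
  have sp: "sep P y (hgt y p)" "sep P y (hgt y q)"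
    using y(3,4) g1 suppL[of y "hgt y p"] suppL[of y "hgt y q"] f(1) g(1) by auto
  have inj: "\<And>a b. a \<in> P \<Longrightarrow> b \<in> P \<Longrightarrow> hgt y a = hgt y b \<Longrightarrow> a = b" using y(1) by (auto simp: nice_def)
  have both: "\<exists>r\<in>P. r \<noteq> a \<and> 0 < c * (hgt y a - hgt y r)" if a: "a = p \<or> a = q" for a
  proof -
    have aP: "a \<in> P" and "sep P y (hgt y a)" using a sp pq by auto
    then obtain a' u w where "a' \<in> P" "hgt y a' = hgt y a" "u \<in> P" "u \<noteq> a'" "hgt y a \<le> hgt y u"
      "w \<in> P" "w \<noteq> a'" "hgt y w \<le> hgt y a" unfolding sep_def by blast
    then have uw: "u \<in> P" "w \<in> P" "u \<noteq> a" "w \<noteq> a" "hgt y a < hgt y u" "hgt y w < hgt y a"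
      using inj[of a' a] inj[of u a] inj[of w a] aP by force+
    show ?thesis
    proof (cases "0 < c")
      case True then show ?thesis using uw by (intro bexI[of _ w]) auto
    next
      case False then show ?thesis using uw \<open>c \<noteq> 0\<close> by (intro bexI[of _ u]) (auto intro!: mult_neg_neg)
    qed
  qed
  have "c * (hgt y p - hgt y q) > 0"
  proof -
    obtain r where r: "r \<in> P" "r \<noteq> p" "0 < c * (hgt y p - hgt y r)" using both[of p] by blast
    moreover have "c * (hgt y p - hgt y r) = - (c * (hgt y r - hgt y p))" by (simp add: algebra_simps)
    ultimately have "r = q" using y(2)[of r] by force
    then show ?thesis using r by simp
  qed
  moreover have "c * (hgt y q - hgt y p) > 0"
  proof -
    obtain r where r: "r \<in> P" "r \<noteq> q" "0 < c * (hgt y q - hgt y r)" using both[of q] by blast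
    moreover have "c * (hgt y q - hgt y r) = - (c * (hgt y r - hgt y q))" by (simp add: algebra_simps)
    ultimately have "r = p" using y(2)[of r] by force
    then show ?thesis using r by simp
  qed
  moreover have "c * (hgt y q - hgt y p) = - (c * (hgt y p - hgt y q))" by (simp add: algebra_simps)
  ultimately show False by simp
qed

end

lemma (in roll) v_mod: "v (k mod m) = v k" using periodic_mod[of v m k] v_per by blast
lemma (in roll) v_add: "v (k + z * m) = v k" using periodic_add[of v m k z] v_per by blast
lemma (in roll) corner_mod: "corner (k mod m) = corner k" using periodic_mod[of corner m k] corner_per by blast

text \<open>A switch is what turns a sheet into a rolling line. For a given arrangement the
  assumption is provided by \<open>switch_exists\<close>, for the tangents to pseudotriangles by the
  edges of these.\<close>

locale rolling = sheets +
  assumes all_switch: "f \<in> L \<Longrightarrow> \<exists>x. switch f x"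
begin

definition "R f = (SOME q. case q of (m, v, t, c) \<Rightarrow> rolls_along f m v t c)"
definition "M f = fst (R f)"
definition "V f = fst (snd (R f))"
definition "T f = fst (snd (snd (R f)))"
definition "C f = snd (snd (snd (R f)))"

lemma rolls_V: assumes "f \<in> L" shows "rolls_along f (M f) (V f) (T f) (C f)"
proof -
  obtain m v t c where "rolls_along f m v t c" using roll_exists all_switch assms by blast
  then have "case (m, v, t, c) of (m, v, t, c) \<Rightarrow> rolls_along f m v t c" by simp
  then have "case R f of (m, v, t, c) \<Rightarrow> rolls_along f m v t c" unfolding R_def by (rule someI)
  then show ?thesis by (simp add: M_def V_def T_def C_def split_beta)
qed

lemma roll: "f \<in> L \<Longrightarrow> roll (M f) (V f) (T f) (C f)"
  using rolls_V by (auto simp: rolls_along_def)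

lemma gr_V: "f \<in> L \<Longrightarrow> T f i \<le> x \<Longrightarrow> x < T f (i + 1) \<Longrightarrow> gr f x = V f i"
  and gl_V: "f \<in> L \<Longrightarrow> T f i < x \<Longrightarrow> x \<le> T f (i + 1) \<Longrightarrow> gl f x = V f i"
  using rolls_V[of f] unfolding rolls_along_def by blast+

lemma gr_T: "f \<in> L \<Longrightarrow> gr f (T f i) = V f i"
  using gr_V[of f i "T f i"] roll.t_step[OF roll] by simp

lemma gl_T: "f \<in> L \<Longrightarrow> gl f (T f (i + 1)) = V f i"
  using gl_V[of f i "T f (i + 1)"] roll.t_step[OF roll] by simp

lemma V_in: "f \<in> L \<Longrightarrow> V f i \<in> P"
  using gr_T[of f i] germ_in[OF side_simps(2), of f] by metis

abbreviation "crn f i \<equiv> roll.corner (C f) i"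

lemma corner_iff: "f \<in> L \<Longrightarrow> crn f i \<longleftrightarrow> C f (i - 1) * C f i < 0"
  using roll.corner_def[OF roll] .

lemma switch_T: assumes f: "f \<in> L" and x: "gl f x \<noteq> gr f x" shows "\<exists>i. x = T f (i + 1)"
proof -
  obtain i where i: "T f i \<le> x" "x < T f (i + 1)" using roll.t_cover[OF roll[OF f]] by blast
  have "x = T f i" using i gl_V[OF f, of i x] gr_V[OF f i] x by (cases "x = T f i") auto
  then show ?thesis by (intro exI[of _ "i - 1"]) simp
qed

subsection \<open>Counting corners\<close>

definition "arcs = (SIGMA f:L. {0..<M f})"
definition "flat_arcs = {(f, i) \<in> arcs. \<not> crn f i}"
definition "offdiag = (SIGMA p:P. P - {p})"
text \<open>The order of the points is that of the switch. The count is over ordered pairs because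
  the line of two points can be used twice, by the two sheets that touch or cross there.\<close>

definition "switching = {(p, q). p \<in> P \<and> q \<in> P \<and> p \<noteq> q \<and> (\<exists>f\<in>L. \<exists>x. gl f x = p \<and> gr f x = q)}"
definition "crossing_pairs = {(p, q). p \<in> P \<and> q \<in> P \<and> p \<noteq> q \<and>
  (\<exists>f\<in>L. \<exists>g\<in>L. \<exists>x. crosses f g x \<and> gl f x = p \<and> gl g x = q)}"

lemma finite_arcs: "finite arcs" unfolding arcs_def using finL by auto
lemma finite_flat: "finite flat_arcs" unfolding flat_arcs_def using finite_arcs by (rule rev_finite_subset) auto
lemma finite_offdiag: "finite offdiag" unfolding offdiag_def using finP by auto

lemma card_offdiag: "card offdiag = card P * (card P - 1)"
proof -
  have "card offdiag = (\<Sum>p\<in>P. card (P - {p}))" unfolding offdiag_def by (rule card_SigmaI) (use finP in auto)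
  also have "\<dots> = (\<Sum>p\<in>P. card P - 1)" by (rule sum.cong) auto
  finally show ?thesis by simp
qed

lemma heights_meet: "f \<in> L \<Longrightarrow> hgt x (gl f x) = hgt x (gr f x)"
  using germ_at[of "at_left x" x f] germ_at[of "at_right x" x f] by simp

text \<open>The pair determines the line up to reversal, the incoming point at this line determines
  the sheet, and the angle modulo pi determines the arc within one period of the sheet.\<close>

lemma card_arcs_le: "card arcs \<le> card switching"
proof (rule card_inj_on_le)
  show "finite switching" unfolding switching_def by (rule finite_subset[of _ "P \<times> P"]) (use finP in auto)
  show "(\<lambda>(f, i). (V f i, V f (i + 1))) ` arcs \<subseteq> switching"
  proof clarify
    fix f i assume "(f, i) \<in> arcs"
    then have f: "f \<in> L" by (simp add: arcs_def)
    then show "(V f i, V f (i + 1)) \<in> switching" unfolding switching_def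
      using V_in roll.v_neq[OF roll[OF f], of i] gl_T gr_T by force
  qed
  show "inj_on (\<lambda>(f, i). (V f i, V f (i + 1))) arcs"
  proof (rule inj_onI, clarify)
    fix f i g j assume a: "(f, i) \<in> arcs" "(g, j) \<in> arcs" and e: "V f i = V g j" "V f (i + 1) = V g (j + 1)"
    have f: "f \<in> L" "0 \<le> i" "i < M f" and g: "g \<in> L" "0 \<le> j" "j < M g" using a by (auto simp: arcs_def)
    have ne: "V f i \<noteq> V f (i + 1)" using roll.v_neq[OF roll[OF f(1)], of i] by simp
    have hf: "hgt (T f (i+1)) (V f i) = hgt (T f (i+1)) (V f (i + 1))"
      using heights_meet[OF f(1), of "T f (i+1)"] gl_T[OF f(1)] gr_T[OF f(1)] by simp
    have hg: "hgt (T g (j+1)) (V f i) = hgt (T g (j+1)) (V f (i + 1))"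
      using heights_meet[OF g(1), of "T g (j+1)"] gl_T[OF g(1)] gr_T[OF g(1)] e by simp
    obtain k :: int where k: "T g (j+1) = T f (i+1) + of_int k * pi" using hgt_same_dir[OF ne hf] hg by blast
    have "gl g (T f (i+1)) = gl g (T g (j+1))" using k gl_per[OF g(1)] by simp
    then have fg: "f = g" using germ_inj[OF side_simps(1) f(1) g(1), of "T f (i+1)"] gl_T f g e by simp
    then have "T f (j + 1) = T f (i + 1 + k * M f)" using k roll.t_add[OF roll[OF f(1)], of "i+1" k] by simp
    then have "j + 1 = i + 1 + k * M f" using roll.t_less_iff[OF roll[OF f(1)]] by (metis less_irrefl linorder_neqE)
    then have "j = i + k * M f" by simp
    then have "j mod M f = i mod M f" by simp
    then show "f = g \<and> i = j" using f g fg by simp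
  qed
qed

lemma same_line:
  assumes "p \<noteq> q" "hgt x p = hgt x q" "hgt y p = hgt y q" "f \<in> L" "g \<in> L" "gl f x = gl g y"
  shows "f = g \<and> gr f x = gr g y"
proof -
  obtain k :: int where k: "y = x + of_int k * pi" using hgt_same_dir[OF assms(1,2)] assms(3) by blast
  have "gl g y = gl g x" "gr g y = gr g x" using k gl_per gr_per assms by auto
  then show ?thesis using germ_inj[OF side_simps(1) assms(4,5), of x] assms(6) by auto
qed

lemma crosses_facts:
  assumes "f \<in> L" "g \<in> L" "crosses f g x"
  shows "hgt x (gl f x) = hgt x (gl g x)"
  using germ_at[OF side_simps(1), of f x] germ_at[OF side_simps(1), of g x] assms by (simp add: crosses_def)

text \<open>The sheet that reaches the line of \<open>p\<close> and \<open>q\<close> along the dual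
  of \<open>p\<close> is unique, and it either switches there or does not.\<close>

lemma disjoint_SX: "switching \<inter> crossing_pairs = {}"
proof (rule ccontr)
  assume "\<not> ?thesis"
  then obtain p q where "(p, q) \<in> switching" "(p, q) \<in> crossing_pairs" by auto
  then obtain f x f' g' y where f: "p \<noteq> q" "f \<in> L" "gl f x = p" "gr f x = q" "f' \<in> L" "g' \<in> L" "crosses f' g' y"
    "gl f' y = p" "gl g' y = q" unfolding switching_def crossing_pairs_def by auto
  have "f = f' \<and> gr f x = gr f' y"
    by (rule same_line[OF f(1)]) (use f heights_meet[OF f(2), of x] crosses_facts[OF f(5-7)] in auto)
  then show False using f by (auto simp: crosses_def)
qed

text \<open>A crossing needs two sheets through the line, and a hull line carries only one.\<close>

lemma hull_not_X:
  assumes H: "(p, q) \<in> hull_pairs" shows "(p, q) \<notin> crossing_pairs" "(q, p) \<notin> crossing_pairs"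
proof -
  have *: False if "f \<in> L" "g \<in> L" "gl f y = p" "gl g y = q" "hgt y p = hgt y q" for f g y
  proof -
    have fy: "f y = hgt y p" using germ_at[OF side_simps(1) that(1), of y] that(3) by metis
    have gy: "g y = hgt y p" using germ_at[OF side_simps(1) that(2), of y] that(4,5) by metis
    have "f = g" by (rule hull_unique[OF H that(5) that(1) fy that(2) gy])
    then have "p = q" using that by metis
    then show False using H by (auto simp: hull_pairs_def)
  qed
  show "(p, q) \<notin> crossing_pairs"
  proof
    assume "(p, q) \<in> crossing_pairs"
    then obtain f g x where "f \<in> L" "g \<in> L" "crosses f g x" "gl f x = p" "gl g x = q" unfolding crossing_pairs_def by auto
    then show False using *[of f g x] crosses_facts by metis
  qed
  show "(q, p) \<notin> crossing_pairs"
  proof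
    assume "(q, p) \<in> crossing_pairs"
    then obtain f g x where "f \<in> L" "g \<in> L" "crosses f g x" "gl f x = q" "gl g x = p" unfolding crossing_pairs_def by auto
    then show False using *[of g f x] crosses_facts by metis
  qed
qed

lemma hull_one_switch:
  assumes H: "(p, q) \<in> hull_pairs" and S: "(p, q) \<in> switching" shows "(q, p) \<notin> switching"
proof
  assume "(q, p) \<in> switching"
  then obtain f x f' y where f: "p \<noteq> q" "f \<in> L" "gl f x = p" "gr f x = q" "f' \<in> L" "gl f' y = q" "gr f' y = p"
    using S unfolding switching_def by auto
  have hx: "hgt x p = hgt x q" using heights_meet[OF f(2), of x] f by simp
  have hy: "hgt y p = hgt y q" using heights_meet[OF f(5), of y] f by simp
  obtain k :: int where k: "y = x + of_int k * pi" using hgt_same_dir[OF f(1) hx] hy by blast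
  have g: "gl f' x = q" using f k gl_per by auto
  have f1: "f x = hgt x p" using germ_at[OF side_simps(1) f(2), of x] f(3) by metis
  have f2: "f' x = hgt x p" using germ_at[OF side_simps(1) f(5), of x] g hx by metis
  have "f = f'" by (rule hull_unique[OF H hx f(2) f1 f(5) f2])
  then show False using f g by metis
qed

lemma card_extreme_le: "card {p. extreme p} \<le> card hull_pairs"
proof -
  have fin: "finite hull_pairs" unfolding hull_pairs_def by (rule finite_subset[of _ "P \<times> P"]) (use finP in auto)
  have "{p. extreme p} \<subseteq> fst ` hull_pairs" using hull_pair_extreme by force
  then have "card {p. extreme p} \<le> card (fst ` hull_pairs)" using fin by (intro card_mono) auto
  also have "\<dots> \<le> card hull_pairs" using fin by (rule card_image_le)
  finally show ?thesis .
qed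

lemma pairs_bound: "card switching + card crossing_pairs + card hull_pairs \<le> card P * (card P - 1)"
proof -
  \<comment> \<open>Selects for each hull edge an ordered pair that neither a switch nor a crossing
    uses: the given one, or its reverse if the given one is a switch.\<close>
  define \<omega> where "\<omega> z = (if z \<in> switching then (snd z, fst z) else z)" for z :: "complex \<times> complex"
  have sub: "switching \<subseteq> offdiag" "crossing_pairs \<subseteq> offdiag"
    unfolding switching_def crossing_pairs_def offdiag_def by auto
  have w: "\<omega> ` hull_pairs \<subseteq> offdiag" unfolding \<omega>_def hull_pairs_def offdiag_def by auto
  have inj: "inj_on \<omega> hull_pairs"
  proof (rule inj_onI)
    fix a b assume "a \<in> hull_pairs" "b \<in> hull_pairs" "\<omega> a = \<omega> b"
    then show "a = b" using hull_pairs_asym[of "fst a" "snd a"] unfolding \<omega>_def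
      by (auto split: if_splits simp: prod_eq_iff)
  qed
  have d1: "\<omega> ` hull_pairs \<inter> switching = {}"
  proof (rule ccontr)
    assume "\<not> ?thesis"
    then obtain z where z: "z \<in> hull_pairs" "\<omega> z \<in> switching" by auto
    then show False using hull_one_switch[of "fst z" "snd z"] unfolding \<omega>_def by (auto split: if_splits)
  qed
  have d2: "\<omega> ` hull_pairs \<inter> crossing_pairs = {}"
  proof (rule ccontr)
    assume "\<not> ?thesis"
    then obtain z where z: "z \<in> hull_pairs" "\<omega> z \<in> crossing_pairs" by auto
    then show False using hull_not_X[of "fst z" "snd z"] unfolding \<omega>_def by (auto split: if_splits)
  qed
  have fin: "finite switching" "finite crossing_pairs" "finite (\<omega> ` hull_pairs)"
    using sub w finite_offdiag finite_subset by blast+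
  have "card switching + card crossing_pairs + card hull_pairs = card switching + card crossing_pairs + card (\<omega> ` hull_pairs)"
    using card_image[OF inj] by simp
  also have "\<dots> = card ((switching \<union> crossing_pairs) \<union> \<omega> ` hull_pairs)"
    using fin disjoint_SX d1 d2 by (subst card_Un_disjoint, simp, simp, blast, subst card_Un_disjoint) auto
  also have "\<dots> \<le> card offdiag" using sub w finite_offdiag by (intro card_mono) auto
  finally show ?thesis using card_offdiag by simp
qed

definition "cross_at f g = (SOME x. crosses f g x)"

lemma cross_at: "f \<in> L \<Longrightarrow> g \<in> L \<Longrightarrow> f \<noteq> g \<Longrightarrow> crosses f g (cross_at f g)"
  unfolding cross_at_def using cross_ex[of f g] by (rule someI_ex)

definition "offL = (SIGMA f:L. L - {f})"
definition "cpair = (\<lambda>(f, g). (gl f (cross_at f g), gl g (cross_at f g)))"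

lemma card_offL: "card offL = card L * (card L - 1)"
proof -
  have "card offL = (\<Sum>p\<in>L. card (L - {p}))" unfolding offL_def by (rule card_SigmaI) (use finL in auto)
  also have "\<dots> = (\<Sum>p\<in>L. card L - 1)" by (rule sum.cong) auto
  finally show ?thesis by simp
qed

lemma gl_neq: "f \<in> L \<Longrightarrow> g \<in> L \<Longrightarrow> f \<noteq> g \<Longrightarrow> gl f x \<noteq> gl g x"
  using germ_inj[OF side_simps(1)] by blast

lemma crossing_pairsI: "f \<in> L \<Longrightarrow> g \<in> L \<Longrightarrow> f \<noteq> g \<Longrightarrow> crosses f g x \<Longrightarrow> (gl f x, gl g x) \<in> crossing_pairs"
  unfolding crossing_pairs_def using germ_in[OF side_simps(1)] gl_neq by blast

text \<open>The two incoming points determine the line up to reversal, and at that line each of them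
  determines its sheet.\<close>

lemma crossing_pair_same:
  assumes "f \<in> L" "g \<in> L" "f \<noteq> g" "crosses f g x" "f' \<in> L" "g' \<in> L" "crosses f' g' y"
    "gl f x = gl f' y" "gl g x = gl g' y"
  shows "f = f' \<and> g = g' \<and> (\<exists>k::int. y = x + of_int k * pi)"
proof -
  have ne: "gl f x \<noteq> gl g x" using gl_neq assms by blast
  have hx: "hgt x (gl f x) = hgt x (gl g x)" using crosses_facts assms by blast
  have hy: "hgt y (gl f x) = hgt y (gl g x)" using crosses_facts[OF assms(5-7)] assms(8,9) by simp
  show ?thesis using same_line[OF ne hx hy] assms hgt_same_dir[OF ne hx] hy by blast
qed

lemma cpair_inj: "inj_on cpair offL"
  by (rule inj_onI) (auto simp: cpair_def offL_def dest: crossing_pair_same[OF _ _ _ cross_at _ _ cross_at])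

lemma cpair_img: "cpair ` offL \<subseteq> crossing_pairs"
  using crossing_pairsI[OF _ _ _ cross_at] by (auto simp: cpair_def offL_def)

lemma finite_X: "finite crossing_pairs"
  unfolding crossing_pairs_def by (rule finite_subset[of _ "P \<times> P"]) (use finP in auto)

lemma card_X_ge: "card L * (card L - 1) \<le> card crossing_pairs"
  using card_mono[OF finite_X cpair_img] card_image[OF cpair_inj] card_offL by simp

text \<open>While the line rotates about \<open>p\<close>, this tells whether the next vertex that
  it meets lies ahead of \<open>p\<close> or behind it.\<close>

definition next_up :: "complex \<Rightarrow> real \<Rightarrow> bool" where
  "next_up p x \<longleftrightarrow> (\<exists>f\<in>L. \<exists>i. T f i \<le> x \<and> x < T f (i + 1) \<and> V f i = p \<and> 0 < C f i)"

lemma next_up_iff: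
  assumes "f \<in> L" "T f i \<le> x" "x < T f (i + 1)" "V f i = p" shows "next_up p x \<longleftrightarrow> 0 < C f i"
proof
  assume "next_up p x"
  then obtain g j where g: "g \<in> L" "T g j \<le> x" "x < T g (j + 1)" "V g j = p" "0 < C g j" unfolding next_up_def by blast
  have "gr g x = gr f x" using gr_V assms g by simp
  then have "g = f" using germ_inj[OF side_simps(2) g(1) assms(1)] by blast
  then show "0 < C f i" using roll.idx_unique[OF roll[OF assms(1)] assms(2,3)] g by blast
qed (use assms next_up_def in blast)

text \<open>At a switch on \<open>p\<^sup>*\<close> the sheet leaving \<open>p\<^sup>*\<close> and the one entering it run along the same edge in
  opposite directions, so that the direction towards the next vertex persists along \<open>p\<^sup>*\<close> across
  corners.\<close>

lemma next_up_const:
  assumes p: "p \<in> P" "\<not> extreme p" and J: "connected J" "a \<in> J" "b \<in> J"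
    and cr: "\<And>f i y. f \<in> L \<Longrightarrow> V f i = p \<Longrightarrow> T f i \<in> J \<Longrightarrow> y \<in> J \<Longrightarrow> y < T f i \<Longrightarrow> crn f i"
    and up: "next_up p a"
  shows "next_up p b"
proof (rule connected_induction_simple[OF J, of "next_up p"])
  show "next_up p a" by (rule up)
  fix a assume a: "a \<in> J"
  have ev: "\<forall>\<^sub>F y in F. sep P y (hgt y p)" for F using sep_nonextreme[OF p] by simp
  obtain f where f: "f \<in> L" "gr f a = p" using germ_surj[OF side_simps(2) p(1) ev] by blast
  obtain i where i: "T f i \<le> a" "a < T f (i + 1)" using roll.t_cover[OF roll[OF f(1)]] by blast
  have Vi: "V f i = p" using gr_V[OF f(1) i] f by simp
  have right: "next_up p y \<longleftrightarrow> 0 < C f i" if "T f i \<le> y" "y < T f (i + 1)" for y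
    by (rule next_up_iff[OF f(1) that Vi])
  have "\<exists>w<a. \<forall>y\<in>J. w < y \<longrightarrow> y < a \<longrightarrow> (next_up p y \<longleftrightarrow> 0 < C f i)"
  proof (cases "T f i < a")
    case True
    then show ?thesis using right i by (intro exI[of _ "T f i"]) auto
  next
    case False
    then have ai: "a = T f i" using i by simp
    obtain g where g: "g \<in> L" "gl g a = p" using germ_surj[OF side_simps(1) p(1) ev] by blast
    have glf: "gl f a = V f (i - 1)" using gl_T[OF f(1), of "i - 1"] ai by simp
    have nefi: "V f (i - 1) \<noteq> p" using roll.v_neq[OF roll[OF f(1)], of "i - 1"] Vi by simp
    obtain j where j: "T g j \<le> a" "a < T g (j + 1)" using roll.t_cover[OF roll[OF g(1)]] by blast
    have "a = T g j"
    proof (rule ccontr)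
      assume "a \<noteq> T g j"
      then have "V g j = p" using gl_V[OF g(1), of j a] g j by simp
      then have "gr g a = p" using gr_V[OF g(1) j] by simp
      then have "g = f" using germ_inj[OF side_simps(2) g(1) f(1), of a] f by simp
      then show False using g glf nefi by simp
    qed
    define l where "l = j - 1"
    have al: "a = T g (l + 1)" using \<open>a = T g j\<close> by (simp add: l_def)
    have Vl: "V g l = p" using gl_T[OF g(1), of l] al g by simp
    have e1: "V g (l + 1) - p = of_real (C g l) * cis a" using roll.edge[OF roll[OF g(1)], of l] Vl al by simp
    have e2: "p - V f (i - 1) = of_real (C f (i - 1)) * cis a"
      using roll.edge[OF roll[OF f(1)], of "i - 1"] Vi ai by simp
    \<comment> \<open>The vertex that \<open>f\<close> comes from and the vertex that
      \<open>g\<close> goes to both lie on the line at angle \<open>a\<close>, which contains a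
      single point besides \<open>p\<close>.\<close>
    have "V g (l + 1) = p \<or> V g (l + 1) = V f (i - 1)"
    proof (rule off_line[of p "V f (i - 1)" a])
      show "hgt a p = hgt a (V f (i - 1))" using e2 hgt_eq_dir by metis
      show "hgt a (V g (l + 1)) = hgt a p" using e1 hgt_eq_dir by metis
    qed (use p V_in f g nefi in auto)
    then have q: "V g (l + 1) = V f (i - 1)" using roll.v_neq[OF roll[OF g(1)], of l] Vl by simp
    have "of_real (C g l) * cis a = - (p - V f (i - 1))" using e1 q by simp
    also have "\<dots> = of_real (- C f (i - 1)) * cis a" using e2 by simp
    finally have "of_real (C g l) * cis a = of_real (- C f (i - 1)) * cis a" .
    then have "complex_of_real (C g l) = of_real (- C f (i - 1))" by (metis cis_neq_zero mult_right_cancel)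
    then have opp: "C g l = - C f (i - 1)" using of_real_eq_iff by blast
    show ?thesis
    proof (intro exI[of _ "T g l"] conjI ballI impI)
      show "T g l < a" using al roll.t_step[OF roll[OF g(1)]] by simp
      fix y assume y: "y \<in> J" "T g l < y" "y < a"
      have "next_up p y \<longleftrightarrow> 0 < C g l" by (rule next_up_iff[OF g(1) _ _ Vl]) (use y al in auto)
      also have "\<dots> \<longleftrightarrow> 0 < C f i"
      proof -
        have "crn f i" using cr[OF f(1) Vi _ y(1)] a ai y by simp
        then have "C f (i - 1) * C f i < 0" using corner_iff[OF f(1)] by simp
        then show ?thesis unfolding opp by (auto simp: mult_less_0_iff)
      qed
      finally show "next_up p y \<longleftrightarrow> 0 < C f i" .
    qed
  qed
  then obtain w where w: "w < a" "\<And>y. y \<in> J \<Longrightarrow> w < y \<Longrightarrow> y < a \<Longrightarrow> next_up p y \<longleftrightarrow> 0 < C f i" by blast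
  have "next_up p y \<longleftrightarrow> 0 < C f i" if "y \<in> J \<inter> {w<..<T f (i+1)}" for y
    using w(2)[of y] right[of y] that i by (cases "y < a") auto
  then have "\<forall>x\<in>J \<inter> {w<..<T f (i+1)}. \<forall>y\<in>J \<inter> {w<..<T f (i+1)}. next_up p x \<longrightarrow> next_up p y" by blast
  moreover have "openin (top_of_set J) (J \<inter> {w<..<T f (i+1)})" by (intro openin_open_Int) simp
  moreover have "a \<in> J \<inter> {w<..<T f (i+1)}" using a i w by simp
  ultimately show "\<exists>T. openin (top_of_set J) T \<and> a \<in> T \<and> (\<forall>x\<in>T. \<forall>y\<in>T. next_up p x \<longrightarrow> next_up p y)" by blast
qed

text \<open>Half a turn brings back the same arc with the line reversed, which exchanges ahead and
  behind.\<close>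

lemma next_up_pi:
  assumes p: "p \<in> P" "\<not> extreme p" shows "next_up p (x + pi) \<longleftrightarrow> \<not> next_up p x"
proof -
  have ev: "\<forall>\<^sub>F y in F. sep P y (hgt y p)" for F using sep_nonextreme[OF p] by simp
  obtain f where f: "f \<in> L" "gr f x = p" using germ_surj[OF side_simps(2) p(1) ev] by blast
  obtain i where i: "T f i \<le> x" "x < T f (i + 1)" using roll.t_cover[OF roll[OF f(1)]] by blast
  have Vi: "V f i = p" using gr_V[OF f(1) i] f by simp
  note r = roll[OF f(1)]
  have 1: "next_up p x \<longleftrightarrow> 0 < C f i" by (rule next_up_iff[OF f(1) i Vi])
  have "T f (i + M f) = T f i + pi" "T f (i + M f + 1) = T f (i + 1) + pi"
    using roll.t_per[OF r, of i] roll.t_per[OF r, of "i+1"] by (simp_all add: algebra_simps)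
  then have "next_up p (x + pi) \<longleftrightarrow> 0 < C f (i + M f)"
    by (intro next_up_iff[OF f(1)]) (use i Vi roll.v_per[OF r] in auto)
  then show ?thesis using 1 roll.c_per[OF r, of i] roll.c_nz[OF r, of i] by auto
qed

text \<open>If the polygons had only corners at \<open>p\<close>, then \<open>next_up\<close> would
  never change, although half a turn must reverse it.\<close>

lemma flat_arc_ex:
  assumes p: "p \<in> P" "\<not> extreme p" shows "\<exists>f i. (f, i) \<in> flat_arcs \<and> V f i = p"
proof (rule ccontr)
  assume none: "\<not> ?thesis"
  have cr: "crn f i" if f: "f \<in> L" and v: "V f i = p" for f i
  proof (rule ccontr)
    assume n: "\<not> crn f i"
    have "(f, i mod M f) \<in> flat_arcs" unfolding flat_arcs_def arcs_def
      using roll.corner_mod[OF roll[OF f]] n f roll.m_pos[OF roll[OF f]] by simp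
    moreover have "V f (i mod M f) = p" using roll.v_mod[OF roll[OF f]] v by simp
    ultimately show False using none by blast
  qed
  have up: "next_up p b" if "next_up p a" for a b
    using next_up_const[OF p connected_UNIV UNIV_I UNIV_I _ that] cr by blast
  show False using next_up_pi[OF p, of 0] up[of 0 "0 + pi"] up[of "0 + pi" 0] by blast
qed

lemma card_arcs: "card arcs = (\<Sum>f\<in>L. roll.ncorners (M f) (C f)) + card flat_arcs"
proof -
  define corn where "corn = (SIGMA f:L. {k\<in>{0..<M f}. crn f k})"
  have "card corn = (\<Sum>f\<in>L. card {k\<in>{0..<M f}. crn f k})" unfolding corn_def
    by (rule card_SigmaI[OF finL]) (auto intro: finite_subset[of _ "{0..<M _}"])
  also have "\<dots> = (\<Sum>f\<in>L. roll.ncorners (M f) (C f))"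
    by (rule sum.cong) (use roll.ncorners_def[OF roll] in auto)
  finally have 1: "card corn = (\<Sum>f\<in>L. roll.ncorners (M f) (C f))" .
  have "arcs = corn \<union> flat_arcs" "corn \<inter> flat_arcs = {}" by (auto simp: arcs_def corn_def flat_arcs_def)
  moreover have "finite corn" using finite_arcs calculation by (metis finite_Un)
  ultimately show ?thesis using 1 finite_flat by (simp add: card_Un_disjoint)
qed

lemma core:
  shows three_corners_each: "f \<in> L \<Longrightarrow> roll.ncorners (M f) (C f) = 3"
    and card_flat: "card flat_arcs + card {p. extreme p} = card P"
    and card_X: "card crossing_pairs = card L * (card L - 1)"
proof -
  have finE: "finite {p. extreme p}" by (rule finite_subset[OF _ finP]) (auto simp: extreme_def)
  have subE: "{p. extreme p} \<subseteq> P" by (auto simp: extreme_def)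
  have "P - {p. extreme p} \<subseteq> (\<lambda>(f, i). V f i) ` flat_arcs" using flat_arc_ex by force
  then have "card (P - {p. extreme p}) \<le> card ((\<lambda>(f, i). V f i) ` flat_arcs)" using finite_flat by (intro card_mono) auto
  also have "\<dots> \<le> card flat_arcs" using finite_flat by (rule card_image_le)
  finally have "card P - card {p. extreme p} \<le> card flat_arcs" using card_Diff_subset[OF finE subE] by simp
  then have NC: "card P \<le> card flat_arcs + card {p. extreme p}" by simp
  have tc: "(\<Sum>f\<in>L. 3) \<le> (\<Sum>f\<in>L. roll.ncorners (M f) (C f))"
    by (rule sum_mono) (use roll.three_corners[OF roll] in auto)
  define l where "l = card L"
  have n: "card P = l + 2" using cardL by (simp add: l_def)
  have sq: "l * (l - 1) + l = l * l" by (cases l) (auto simp: algebra_simps)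
  have pn: "card P * (card P - 1) = l * l + 3 * l + 2" unfolding n by (simp add: algebra_simps)
  have s3: "(\<Sum>f\<in>L. 3) = 3 * l" by (simp add: l_def)
  note F = card_arcs card_arcs_le pairs_bound card_extreme_le NC tc card_X_ge
  have "(\<Sum>f\<in>L. roll.ncorners (M f) (C f)) \<le> 3 * l" using F sq n unfolding pn s3 l_def[symmetric] by linarith
  then have eq: "(\<Sum>f\<in>L. 3) = (\<Sum>f\<in>L. roll.ncorners (M f) (C f))" using tc s3 by linarith
  show "card flat_arcs + card {p. extreme p} = card P" using F sq n unfolding pn s3 l_def[symmetric] by linarith
  show "card crossing_pairs = card L * (card L - 1)" using F sq n unfolding pn s3 l_def[symmetric] by linarith
  show "roll.ncorners (M f) (C f) = 3" if "f \<in> L"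
    using sum_mono_inv[OF eq _ that finL] roll.three_corners[OF roll] by auto
qed

text \<open>Equality in the count makes \<open>cpair\<close> surjective: the crossing pairs are
  those of the one chosen crossing for each pair of sheets, and any further crossing would show up
  as another pair.\<close>

lemma cross_unique:
  assumes fg: "f \<in> L" "g \<in> L" "f \<noteq> g" and x: "crosses f g x" and y: "crosses f g y"
  shows "\<exists>k::int. y = x + of_int k * pi"
proof -
  have "cpair ` offL = crossing_pairs"
    by (rule card_subset_eq[OF finite_X cpair_img]) (use card_image[OF cpair_inj] card_offL card_X in simp)
  have *: "\<exists>k::int. z = cross_at f g + of_int k * pi" if z: "crosses f g z" for z
  proof -
    have "(gl f z, gl g z) \<in> cpair ` offL" using crossing_pairsI[OF fg z] \<open>cpair ` offL = crossing_pairs\<close> by simp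
    then obtain f' g' where f': "(f', g') \<in> offL" "(gl f z, gl g z) = cpair (f', g')" by force
    define w where "w = cross_at f' g'"
    have g: "f' \<in> L" "g' \<in> L" "f' \<noteq> g'" using f' by (auto simp: offL_def)
    have gl: "gl f' w = gl f z" "gl g' w = gl g z" using f' by (auto simp: cpair_def w_def)
    have cw: "crosses f' g' w" using cross_at[OF g] by (simp add: w_def)
    have "f' = f \<and> g' = g \<and> (\<exists>k::int. z = w + of_int k * pi)"
      by (rule crossing_pair_same[OF g cw fg(1,2) z gl])
    then show ?thesis unfolding w_def by blast
  qed
  obtain k l :: int where k: "x = cross_at f g + of_int k * pi" "y = cross_at f g + of_int l * pi" using *[OF x] *[OF y] by blast
  have "y = x + of_int (l - k) * pi" unfolding k by (simp add: algebra_simps)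
  then show ?thesis by blast
qed

text \<open>There are just as many flat arcs as inner points, and every inner point has one; so no
  flat arc remains for a second one.\<close>

lemma flat_arc_unique:
  assumes "(f, i) \<in> flat_arcs" "(g, j) \<in> flat_arcs" "V f i = V g j" "\<not> extreme (V f i)"
  shows "f = g \<and> i = j"
proof -
  have finE: "finite {p. extreme p}" by (rule finite_subset[OF _ finP]) (auto simp: extreme_def)
  have subE: "{p. extreme p} \<subseteq> P" by (auto simp: extreme_def)
  define S where "S = {(f, i) \<in> flat_arcs. \<not> extreme (V f i)}"
  have finS: "finite S" unfolding S_def by (rule finite_subset[OF _ finite_flat]) auto
  have sub: "P - {p. extreme p} \<subseteq> (\<lambda>(f, i). V f i) ` S" using flat_arc_ex unfolding S_def by force
  have c: "card (P - {p. extreme p}) = card flat_arcs" using card_Diff_subset[OF finE subE] card_flat by simp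
  have "card S \<le> card flat_arcs" unfolding S_def by (rule card_mono[OF finite_flat]) auto
  moreover have "card (P - {p. extreme p}) \<le> card ((\<lambda>(f, i). V f i) ` S)" using finS sub by (intro card_mono) auto
  moreover have "card ((\<lambda>(f, i). V f i) ` S) \<le> card S" by (rule card_image_le[OF finS])
  ultimately have "card ((\<lambda>(f, i). V f i) ` S) = card S" using c by linarith
  then have "inj_on (\<lambda>(f, i). V f i) S" by (rule eq_card_imp_inj_on[OF finS])
  then show ?thesis using assms unfolding inj_on_def S_def by fastforce
qed

end

section \<open>Simple polygons\<close>

lemma small_ex:
  fixes r A K B :: real assumes "0 < r" "0 < A" shows "\<exists>\<eta>>0. \<eta> < 1 \<and> \<eta> * K < r \<and> \<eta> * B < A"
proof -
  have t: "((\<lambda>\<eta>. \<eta> * k) \<longlongrightarrow> 0 * k) (at_right 0)" for k :: real by (intro tendsto_intros)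
  have "\<forall>\<^sub>F \<eta> in at_right 0. \<eta> * K < r" by (rule order_tendstoD(2)[OF t]) (use assms in simp)
  moreover have "\<forall>\<^sub>F \<eta> in at_right 0. \<eta> * B < A" by (rule order_tendstoD(2)[OF t]) (use assms in simp)
  moreover have "\<forall>\<^sub>F \<eta> in at_right 0. \<eta> * 1 < (1::real)" by (rule order_tendstoD(2)[OF t]) simp
  moreover have "\<forall>\<^sub>F \<eta> in at_right 0. 0 < (\<eta>::real)" by (simp add: eventually_at_right_less)
  ultimately have "\<forall>\<^sub>F \<eta> in at_right 0. 0 < \<eta> \<and> \<eta> < 1 \<and> \<eta> * K < r \<and> \<eta> * B < A" by eventually_elim simp
  from eventually_happens'[OF trivial_limit_at_right_real this] show ?thesis by auto
qed

lemma ball_avoid: assumes "closed D" "z \<notin> D" shows "\<exists>r>0. ball z r \<inter> D = {}"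
proof -
  have "open (- D)" "z \<in> - D" using assms by auto
  then obtain r where "r > 0" "ball z r \<subseteq> - D" using open_contains_ball by blast
  then show ?thesis by blast
qed

lemma crs_inner: "crs a b = inner (\<i> * a) b"
  by (simp add: crs_def inner_complex_def)

lemma convex_crs_pos: "convex {y. 0 < crs a (y - z)}"
proof -
  have "{y. 0 < crs a (y - z)} = {y. inner (\<i> * a) y > inner (\<i> * a) z}" by (auto simp: crs_inner inner_diff_right)
  then show ?thesis using convex_halfspace_gt[of "inner (\<i> * a) z" "\<i> * a"] by metis
qed

lemma convex_crs_nonneg: "convex {y. 0 \<le> crs a (y - z)}"
proof -
  have "{y. 0 \<le> crs a (y - z)} = {y. inner (\<i> * a) y \<ge> inner (\<i> * a) z}" by (auto simp: crs_inner inner_diff_right)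
  then show ?thesis using convex_halfspace_ge[of "inner (\<i> * a) z" "\<i> * a"] by metis
qed

lemma crs_ii: "crs a (\<i> * a) = (cmod a)\<^sup>2"
  unfolding cmod_power2 by (simp add: crs_def power2_eq_square)

lemma segmentE: assumes "z \<in> closed_segment a b"
  obtains x where "0 \<le> x" "x \<le> 1" "z = a + of_real x * (b - a)"
proof -
  obtain u where u: "0 \<le> u" "u \<le> 1" "z = (1 - u) *\<^sub>R a + u *\<^sub>R b" using assms unfolding in_segment by blast
  then have "z = a + of_real u * (b - a)" by (simp add: scaleR_conv_of_real algebra_simps)
  then show ?thesis using that u by blast
qed

lemma segmentI: assumes "0 \<le> x" "x \<le> 1" shows "a + of_real x * (b - a) \<in> closed_segment a (b::complex)"
proof -
  have "a + of_real x * (b - a) = (1 - x) *\<^sub>R a + x *\<^sub>R b" by (simp add: scaleR_conv_of_real algebra_simps)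
  then show ?thesis unfolding in_segment using assms by blast
qed

lemma open_segmentE: assumes "z \<in> open_segment a b"
  obtains x where "0 < x" "x < 1" "z = a + of_real x * (b - a)"
proof -
  obtain u where u: "0 < u" "u < 1" "z = (1 - u) *\<^sub>R a + u *\<^sub>R b" using assms unfolding in_segment by blast
  then have "z = a + of_real u * (b - a)" by (simp add: scaleR_conv_of_real algebra_simps)
  then show ?thesis using that u by blast
qed

lemma open_segmentI: assumes "0 < x" "x < 1" "a \<noteq> b" shows "a + of_real x * (b - a) \<in> open_segment a (b::complex)"
proof -
  have "a + of_real x * (b - a) = (1 - x) *\<^sub>R a + x *\<^sub>R b" by (simp add: scaleR_conv_of_real algebra_simps)
  then show ?thesis unfolding in_segment using assms by blast
qed

text \<open>\<open>v\<close> is the periodic sequence of the vertices of a simple closed polygon with \<open>m\<close> vertices.\<close>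

locale spoly =
  fixes m :: int and v :: "int \<Rightarrow> complex"
  assumes m3: "3 \<le> m" and per: "v (i + m) = v i"
    and bend: "crs (v i - v (i - 1)) (v (i + 1) - v i) \<noteq> 0"
    and meet: "i < j \<Longrightarrow> j < i + m \<Longrightarrow> z \<in> closed_segment (v i) (v (i + 1)) \<Longrightarrow> z \<in> closed_segment (v j) (v (j + 1)) \<Longrightarrow>
       j = i + 1 \<and> z = v j \<or> j = i + m - 1 \<and> z = v i"
begin

abbreviation seg :: "int \<Rightarrow> complex set" where "seg i \<equiv> closed_segment (v i) (v (i + 1))"
abbreviation e :: "int \<Rightarrow> complex" where "e i \<equiv> v (i + 1) - v i"

definition curve :: "complex set" where "curve = (\<Union>i. seg i)"

lemma step_neq: "v i \<noteq> v (i + 1)"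
  using bend[of i] by auto

lemma v_distinct: "i < j \<Longrightarrow> j < i + m \<Longrightarrow> v i \<noteq> v j"
proof
  assume ij: "i < j" "j < i + m" and eq: "v i = v j"
  have "j = i + 1 \<or> j = i + m - 1" using meet[OF ij, of "v i"] eq by auto
  then show False
  proof
    assume "j = i + 1" then show False using eq step_neq[of i] by simp
  next
    assume "j = i + m - 1"
    then have "j = i - 1 + m" by simp
    then have "v j = v (i - 1)" using per[of "i - 1"] by (simp only:)
    then show False using eq step_neq[of "i - 1"] by simp
  qed
qed

lemma seg_per: "seg (i + m) = seg i"
  using per[of i] per[of "i + 1"] by (simp add: add.commute add.left_commute)

lemma seg_mod: "seg (i mod m) = seg i"
  by (rule periodic_mod[of seg]) (rule seg_per)

lemma curve_window: "curve = (\<Union>j\<in>{i..<i+m}. seg j)"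
proof (intro equalityI subsetI)
  fix z assume "z \<in> curve"
  then obtain j where j: "z \<in> seg j" by (auto simp: curve_def)
  define k where "k = i + (j - i) mod m"
  have "k mod m = j mod m" by (simp add: k_def mod_simps)
  then have "seg k = seg j" using seg_mod by metis
  moreover have "k \<in> {i..<i+m}" using m3 by (simp add: k_def)
  ultimately show "z \<in> (\<Union>j\<in>{i..<i+m}. seg j)" using j by blast
qed (auto simp: curve_def)

lemma chain_path:
  "1 \<le> k \<Longrightarrow> k < m \<Longrightarrow> \<exists>g. arc g \<and> pathstart g = v 0 \<and> pathfinish g = v k \<and> path_image g = (\<Union>i\<in>{0..<k}. seg i)"
proof (induction k rule: int_ge_induct)
  case base
  have "{0..<1::int} = {0}" by auto
  then show ?case using step_neq[of 0] by (intro exI[of _ "linepath (v 0) (v 1)"]) simp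
next
  case (step k)
  then obtain g where g: "arc g" "pathstart g = v 0" "pathfinish g = v k" "path_image g = (\<Union>i\<in>{0..<k}. seg i)" by auto
  let ?h = "linepath (v k) (v (k + 1))"
  have "z = v k" if "z \<in> seg i" "z \<in> seg k" "i \<in> {0..<k}" for z i
    using meet[of i k z] that step by auto
  then have "path_image g \<inter> path_image ?h \<subseteq> {pathstart ?h}" using g by auto
  then have "arc (g +++ ?h)" using g step_neq[of k] by (intro arc_join) auto
  moreover have "{0..<k+1} = insert k {0..<k}" using step by auto
  then have "path_image (g +++ ?h) = (\<Union>i\<in>{0..<k+1}. seg i)"
    using g by (subst path_image_join) auto
  ultimately show ?case using g by (intro exI[of _ "g +++ ?h"]) auto
qed

text \<open>The first \<open>m - 1\<close> edges form an arc, which the last edge closes. This is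
  the form in which the Jordan curve theorem applies.\<close>

lemma curve_path: "\<exists>g. simple_path g \<and> pathfinish g = pathstart g \<and> path_image g = curve"
proof -
  obtain g where g: "arc g" "pathstart g = v 0" "pathfinish g = v (m - 1)" "path_image g = (\<Union>i\<in>{0..<m-1}. seg i)"
    using chain_path[of "m - 1"] m3 by auto
  let ?h = "linepath (v (m - 1)) (v m)"
  have vm: "v m = v 0" using per[of 0] by simp
  have "z = v (m - 1) \<or> z = v 0" if "z \<in> seg i" "z \<in> seg (m - 1)" "i \<in> {0..<m - 1}" for z i
    using meet[of i "m - 1" z] that by auto
  then have "path_image g \<inter> path_image ?h \<subseteq> {pathstart g, pathstart ?h}" using g by fastforce
  then have "simple_path (g +++ ?h)" using g vm step_neq[of "m - 1"] by (intro simple_path_join_loop) auto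
  moreover have "{0..<0+m} = insert (m - 1) {0..<m - 1}" using m3 by auto
  then have "path_image (g +++ ?h) = curve" unfolding curve_window[of 0]
    using g by (subst path_image_join) auto
  ultimately show ?thesis using g vm by (intro exI[of _ "g +++ ?h"]) auto
qed

lemma jordan:
  shows in_ne: "inside curve \<noteq> {}" and in_open: "open (inside curve)" and in_con: "connected (inside curve)"
    and out_open: "open (outside curve)" and out_con: "connected (outside curve)"
    and io_disj: "inside curve \<inter> outside curve = {}" and io_un: "inside curve \<union> outside curve = - curve"
    and fr_in: "frontier (inside curve) = curve" and fr_out: "frontier (outside curve) = curve"
    and in_bd: "bounded (inside curve)"
  using curve_path Jordan_inside_outside by metis+

lemma connected_sub:
  assumes "connected K" "K \<inter> curve = {}" "x \<in> K"
  shows "x \<in> inside curve \<Longrightarrow> K \<subseteq> inside curve" and "x \<in> outside curve \<Longrightarrow> K \<subseteq> outside curve"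
proof -
  have sub: "K \<subseteq> inside curve \<union> outside curve" using io_un assms by auto
  have "inside curve \<inter> K = {} \<or> outside curve \<inter> K = {}"
    by (rule connectedD[OF assms(1) in_open out_open]) (use sub io_disj in auto)
  then show "x \<in> inside curve \<Longrightarrow> K \<subseteq> inside curve" "x \<in> outside curve \<Longrightarrow> K \<subseteq> outside curve"
    using sub assms(3) by blast+
qed

lemma curve_limit:
  assumes "z \<in> curve" "0 < r" shows "\<exists>y\<in>ball z r. y \<in> inside curve" and "\<exists>y\<in>ball z r. y \<in> outside curve"
proof -
  have "z \<in> closure (inside curve)" "z \<in> closure (outside curve)"
    using fr_in fr_out assms(1) unfolding frontier_def by auto
  moreover have "\<exists>y\<in>ball z r. y \<in> S" if cl: "z \<in> closure S" for S
  proof -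
    obtain y where "y \<in> S" "dist y z < r" using cl assms(2) unfolding closure_approachable by blast
    then show ?thesis by (intro bexI[of _ y]) (auto simp: dist_commute)
  qed
  ultimately show "\<exists>y\<in>ball z r. y \<in> inside curve" "\<exists>y\<in>ball z r. y \<in> outside curve" by blast+
qed

subsection \<open>Local structure\<close>

text \<open>The other edges form a closed set that avoids \<open>z\<close>, so a small disc around
  \<open>z\<close> sees only the line of its own edge.\<close>

lemma near_edge:
  assumes z: "z \<in> open_segment (v i) (v (i + 1))"
  shows "\<exists>r>0. \<forall>y\<in>ball z r. y \<in> curve \<longleftrightarrow> crs (e i) (y - z) = 0"
proof -
  obtain a where a: "0 < a" "a < 1" "z = v i + of_real a * e i" using open_segmentE[OF z] by blast
  define D where "D = (\<Union>j\<in>{i+1..<i+m}. seg j)"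
  have "closed D" unfolding D_def by (intro closed_UN) auto
  moreover have "z \<notin> D"
  proof
    assume "z \<in> D"
    then obtain j where j: "j \<in> {i+1..<i+m}" "z \<in> seg j" by (auto simp: D_def)
    moreover have "z \<in> seg i" "z \<noteq> v i" "z \<noteq> v (i + 1)" using z by (auto simp: open_segment_def)
    ultimately show False using meet[of i j z] by auto
  qed
  ultimately obtain r1 where r1: "r1 > 0" "ball z r1 \<inter> D = {}"
    using ball_avoid by blast
  define r where "r = min r1 (min a (1 - a) * cmod (e i))"
  have ne: "e i \<noteq> 0" using step_neq[of i] by simp
  then have "r > 0" using r1 a by (simp add: r_def)
  moreover have "y \<in> curve \<longleftrightarrow> crs (e i) (y - z) = 0" if y: "y \<in> ball z r" for y
  proof
    have "{i..<i+m} = insert i {i+1..<i+m}" using m3 by auto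
    then have C: "curve = seg i \<union> D" unfolding curve_window[of i] D_def by simp
    { assume "y \<in> curve"
      moreover have "y \<in> ball z r1" using y by (simp add: r_def)
      ultimately have "y \<in> seg i" using C r1(2) by blast
      then obtain b where b: "y = v i + of_real b * e i" using segmentE by metis
      have "y - z = of_real (b - a) * e i" unfolding b a(3) by (simp add: algebra_simps)
      then show "crs (e i) (y - z) = 0" by (simp only: crs_scale2 crs_self mult_zero_right) }
    { assume "crs (e i) (y - z) = 0"
      then obtain x where x: "y - z = of_real x * e i" using crs_zero_dir[OF ne] by blast
      have "\<bar>x\<bar> * cmod (e i) < min a (1 - a) * cmod (e i)"
        using y x by (simp add: r_def dist_norm norm_minus_commute norm_mult)
      then have "\<bar>x\<bar> < min a (1 - a)" using ne by (simp add: mult_less_cancel_right)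
      then have "0 \<le> a + x" "a + x \<le> 1" by auto
      moreover have "y = v i + of_real (a + x) * e i" using x a(3) by (simp add: algebra_simps)
      ultimately have "y \<in> seg i" using segmentI by metis
      then show "y \<in> curve" using C by blast }
  qed
  ultimately show ?thesis by blast
qed

lemma near_vertex:
  shows "\<exists>r>0. \<forall>y\<in>ball (v i) r. y \<in> curve \<longleftrightarrow>
     (\<exists>x\<ge>0. y - v i = of_real x * (v (i - 1) - v i)) \<or> (\<exists>x\<ge>0. y - v i = of_real x * (v (i + 1) - v i))"
proof -
  define D where "D = (\<Union>j\<in>{i+1..<i+m-1}. seg j)"
  have "closed D" unfolding D_def by (intro closed_UN) auto
  moreover have "v i \<notin> D"
  proof
    assume "v i \<in> D"
    then obtain j where j: "j \<in> {i+1..<i+m-1}" "v i \<in> seg j" by (auto simp: D_def)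
    then show False using meet[of i j "v i"] step_neq[of i] by auto
  qed
  ultimately obtain r1 where r1: "r1 > 0" "ball (v i) r1 \<inter> D = {}"
    using ball_avoid by blast
  define a b where "a = v (i - 1) - v i" and "b = v (i + 1) - v i"
  have ab: "a \<noteq> 0" "b \<noteq> 0" using step_neq[of i] step_neq[of "i - 1"] by (auto simp: a_def b_def)
  define r where "r = min r1 (min (cmod a) (cmod b))"
  have r0: "r > 0" using r1 ab by (simp add: r_def)
  have "{i..<i+m} = insert i (insert (i-1+m) {i+1..<i+m-1})" using m3 by auto
  then have C: "curve = seg i \<union> (seg (i - 1) \<union> D)" unfolding curve_window[of i] D_def
    by (simp only: UN_insert seg_per)
  have S: "\<exists>x\<ge>0. y - v i = of_real x * b" if "y \<in> seg i" for y
    using that by (elim segmentE) (auto simp: b_def)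
  have S': "\<exists>x\<ge>0. y - v i = of_real x * a" if y: "y \<in> seg (i - 1)" for y
  proof -
    have "y \<in> closed_segment (v i) (v (i - 1))" using y by (simp add: closed_segment_commute)
    then show ?thesis by (elim segmentE) (auto simp: a_def)
  qed
  have *: "x < 1" if "y \<in> ball (v i) r" "y - v i = of_real x * w" "w = a \<or> w = b" "0 \<le> x" for x y w
  proof -
    have "x * cmod w < r" using that by (simp add: dist_norm norm_minus_commute norm_mult)
    also have "r \<le> 1 * cmod w" using that by (auto simp: r_def)
    finally show ?thesis by (rule mult_right_less_imp_less) simp
  qed
  have "y \<in> curve \<longleftrightarrow> (\<exists>x\<ge>0. y - v i = of_real x * a) \<or> (\<exists>x\<ge>0. y - v i = of_real x * b)" if y: "y \<in> ball (v i) r" for y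
  proof
    assume "y \<in> curve"
    moreover have "y \<notin> D" using r1 y by (auto simp: r_def)
    ultimately show "(\<exists>x\<ge>0. y - v i = of_real x * a) \<or> (\<exists>x\<ge>0. y - v i = of_real x * b)" using C S S' by blast
  next
    assume "(\<exists>x\<ge>0. y - v i = of_real x * a) \<or> (\<exists>x\<ge>0. y - v i = of_real x * b)"
    then show "y \<in> curve"
    proof
      assume "\<exists>x\<ge>0. y - v i = of_real x * a"
      then obtain x where x: "0 \<le> x" "y - v i = of_real x * a" by blast
      have "x \<le> 1" using *[OF y x(2)] x by simp
      then have "v i + of_real x * (v (i - 1) - v i) \<in> closed_segment (v i) (v (i - 1))" using x by (intro segmentI) auto
      moreover have "v i + of_real x * (v (i - 1) - v i) = y" using x by (simp add: a_def algebra_simps)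
      ultimately show ?thesis using C by (simp add: closed_segment_commute)
    next
      assume "\<exists>x\<ge>0. y - v i = of_real x * b"
      then obtain x where x: "0 \<le> x" "y - v i = of_real x * b" by blast
      have "x \<le> 1" using *[OF y x(2)] x by simp
      then have "v i + of_real x * (v (i + 1) - v i) \<in> seg i" using x by (intro segmentI) auto
      moreover have "v i + of_real x * (v (i + 1) - v i) = y" using x by (simp add: b_def algebra_simps)
      ultimately show ?thesis using C by simp
    qed
  qed
  then show ?thesis using r0 unfolding a_def b_def by blast
qed

text \<open>\<open>on_side s i z\<close>: near the point \<open>z\<close> of the edge \<open>i\<close> the interior lies to the right (\<open>s = 1\<close>) or
  to the left (\<open>s = - 1\<close>) of the edge.\<close>

definition on_side :: "real \<Rightarrow> int \<Rightarrow> complex \<Rightarrow> bool" where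
  "on_side s i z \<longleftrightarrow> (\<exists>r>0. \<forall>y\<in>ball z r. (s * crs (e i) (y - z) < 0 \<longrightarrow> y \<in> inside curve) \<and>
     (0 < s * crs (e i) (y - z) \<longrightarrow> y \<in> outside curve))"

lemma half_ball_connected: "connected (ball z r \<inter> {y. 0 < crs a (y - z)})"
  by (intro convex_connected convex_Int convex_crs_pos convex_ball)

text \<open>The two half-discs beside the edge miss the curve, so each lies in one component of the
  complement. Both components accumulate at \<open>z\<close>, so the half-discs belong to different
  ones.\<close>

lemma edge_sides:
  assumes z: "z \<in> open_segment (v i) (v (i + 1))" shows "on_side 1 i z \<or> on_side (- 1) i z"
proof -
  obtain r where r: "r > 0" "\<And>y. y \<in> ball z r \<Longrightarrow> y \<in> curve \<longleftrightarrow> crs (e i) (y - z) = 0" using near_edge[OF z] by blast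
  have zC: "z \<in> curve" using r by force
  define H1 where "H1 = ball z r \<inter> {y. 0 < crs (e i) (y - z)}"
  define H2 where "H2 = ball z r \<inter> {y. crs (e i) (y - z) < 0}"
  have "H2 = ball z r \<inter> {y. 0 < crs (- e i) (y - z)}" unfolding H2_def crs_minus1 by simp
  then have con: "connected H1" "connected H2" unfolding H1_def using half_ball_connected by simp_all
  have dis: "H1 \<inter> curve = {}" "H2 \<inter> curve = {}" unfolding H1_def H2_def using r(2) by fastforce+
  obtain y1 where y1: "y1 \<in> ball z r" "y1 \<in> inside curve" using curve_limit(1)[OF zC r(1)] by blast
  obtain y2 where y2: "y2 \<in> ball z r" "y2 \<in> outside curve" using curve_limit(2)[OF zC r(1)] by blast
  have nc: "y1 \<notin> curve" "y2 \<notin> curve" using y1(2) y2(2) io_un by blast+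
  have y12: "y1 \<in> H1 \<or> y1 \<in> H2" "y2 \<in> H1 \<or> y2 \<in> H2"
    using nc r(2)[OF y1(1)] r(2)[OF y2(1)] y1 y2 unfolding H1_def H2_def by (simp_all, linarith+)
  note in1 = connected_sub(1)[OF con(1) dis(1)] and in2 = connected_sub(1)[OF con(2) dis(2)]
  note out1 = connected_sub(2)[OF con(1) dis(1)] and out2 = connected_sub(2)[OF con(2) dis(2)]
  consider "H2 \<subseteq> inside curve" "H1 \<subseteq> outside curve" | "H1 \<subseteq> inside curve" "H2 \<subseteq> outside curve"
    using y12 in1[of y1] in2[of y1] out1[of y2] out2[of y2] y1 y2 io_disj by blast
  then show ?thesis
  proof cases
    case 1
    then have "on_side 1 i z" unfolding on_side_def H1_def H2_def using r(1)
      by (intro exI[of _ r] conjI ballI) auto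
    then show ?thesis ..
  next
    case 2
    then have "on_side (- 1) i z" unfolding on_side_def H1_def H2_def using r(1)
      by (intro exI[of _ r] conjI ballI) auto
    then show ?thesis ..
  qed
qed

text \<open>The point is \<open>z\<close> displaced perpendicularly to the edge. The free constants
  \<open>K\<close> and \<open>A\<close> let a caller at a vertex keep a second cross product
  positive during this displacement.\<close>

lemma side_point:
  assumes s: "s = 1 \<or> s = - 1" and os: "on_side s i z" and "0 < r" "0 < A"
  shows "\<exists>\<eta>>0. \<eta> < 1 \<and> \<eta> * K < A \<and> z - of_real (s * \<eta>) * (\<i> * e i) \<in> ball z r \<inter> inside curve"
proof -
  obtain r' where r': "r' > 0" "\<And>y. y \<in> ball z r' \<Longrightarrow> s * crs (e i) (y - z) < 0 \<Longrightarrow> y \<in> inside curve"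
    using os unfolding on_side_def by blast
  obtain \<eta> where \<eta>: "\<eta> > 0" "\<eta> < 1" "\<eta> * cmod (e i) < min r r'" "\<eta> * K < A"
    using small_ex[of "min r r'" A "cmod (e i)" K] assms r' by auto
  let ?y = "z - of_real (s * \<eta>) * (\<i> * e i)"
  have "dist z ?y = \<eta> * cmod (e i)" using s \<eta> by (auto simp: dist_norm norm_mult)
  then have b: "?y \<in> ball z r" "?y \<in> ball z r'" using \<eta> by auto
  have "crs (e i) (?y - z) = - (s * \<eta> * (cmod (e i))\<^sup>2)"
  proof -
    have "?y - z = - (of_real (s * \<eta>) * (\<i> * e i))" by simp
    then show ?thesis by (simp only: crs_minus2 crs_scale2 crs_ii)
  qed
  then have "s * crs (e i) (?y - z) = - (\<eta> * (cmod (e i))\<^sup>2)" using s by auto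
  moreover have "0 < \<eta> * (cmod (e i))\<^sup>2" using \<eta> step_neq[of i] by simp
  ultimately have "?y \<in> inside curve" using r'(2)[OF b(2)] by linarith
  then show ?thesis using \<eta> b by blast
qed

lemma on_side_excl:
  assumes "on_side s i z" "on_side (- s) i z" "s = 1 \<or> s = - 1" shows False
proof -
  obtain r where r: "r > 0" "\<And>y. y \<in> ball z r \<Longrightarrow> 0 < (- s) * crs (e i) (y - z) \<Longrightarrow> y \<in> outside curve"
    using assms(2) unfolding on_side_def by blast
  obtain \<eta> where \<eta>: "\<eta> > 0" "z - of_real (s * \<eta>) * (\<i> * e i) \<in> ball z r \<inter> inside curve"
    using side_point[OF assms(3,1) r(1), of 1 1] by auto
  let ?y = "z - of_real (s * \<eta>) * (\<i> * e i)"
  have "crs (e i) (?y - z) = - (s * \<eta> * (cmod (e i))\<^sup>2)"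
  proof -
    have "?y - z = - (of_real (s * \<eta>) * (\<i> * e i))" by simp
    then show ?thesis by (simp only: crs_minus2 crs_scale2 crs_ii)
  qed
  then have "(- s) * crs (e i) (?y - z) = \<eta> * (cmod (e i))\<^sup>2" using assms(3) by auto
  moreover have "0 < \<eta> * (cmod (e i))\<^sup>2" using \<eta> step_neq[of i] by simp
  ultimately have "?y \<in> outside curve" using r(2)[of ?y] \<eta> by auto
  then show False using \<eta> io_disj by blast
qed

text \<open>Moving \<open>z\<close> along the edge does not change the cross product with the
  direction of the edge, so the side is locally constant on the connected open edge.\<close>

lemma on_side_move:
  assumes "z \<in> open_segment (v i) (v (i + 1))" "z' \<in> open_segment (v i) (v (i + 1))" and os: "on_side s i z" and s: "s = 1 \<or> s = - 1"
  shows "on_side s i z'"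
proof (rule connected_induction_simple[of "open_segment (v i) (v (i + 1))" z z' "on_side s i"])
  show "connected (open_segment (v i) (v (i + 1)))" by (intro convex_connected convex_open_segment)
  fix a assume a: "a \<in> open_segment (v i) (v (i + 1))"
  obtain s0 where s0: "s0 = 1 \<or> s0 = - 1" "on_side s0 i a" using edge_sides[OF a] by blast
  obtain r where r: "r > 0" "\<And>y. y \<in> ball a r \<Longrightarrow> s0 * crs (e i) (y - a) < 0 \<Longrightarrow> y \<in> inside curve"
    "\<And>y. y \<in> ball a r \<Longrightarrow> 0 < s0 * crs (e i) (y - a) \<Longrightarrow> y \<in> outside curve"
    using s0(2) unfolding on_side_def by blast
  have near: "on_side s0 i x" if x: "x \<in> open_segment (v i) (v (i + 1)) \<inter> ball a r" for x
  proof -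
    obtain p where p: "x = v i + of_real p * e i" using x open_segmentE by (metis IntD1)
    obtain q where q: "a = v i + of_real q * e i" using a open_segmentE by metis
    have xa: "x - a = of_real (p - q) * e i" unfolding p q by (simp add: algebra_simps)
    have "crs (e i) (y - x) = crs (e i) (y - a)" for y
    proof -
      have "y - x = (y - a) - (x - a)" by simp
      then have "crs (e i) (y - x) = crs (e i) (y - a) - crs (e i) (x - a)" by (simp only: crs_diff2)
      also have "crs (e i) (x - a) = 0" unfolding xa by (simp only: crs_scale2 crs_self mult_zero_right)
      finally show ?thesis by simp
    qed
    moreover have "y \<in> ball a r" if "y \<in> ball x (r - dist a x)" for y
      using that dist_triangle[of a y x] by auto
    moreover have "0 < r - dist a x" using x by simp
    ultimately show ?thesis unfolding on_side_def using r(2,3) by (intro exI[of _ "r - dist a x"]) auto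
  qed
  have "\<forall>x\<in>open_segment (v i) (v (i + 1)) \<inter> ball a r. \<forall>y\<in>open_segment (v i) (v (i + 1)) \<inter> ball a r. on_side s i x \<longrightarrow> on_side s i y"
  proof (intro ballI impI)
    fix x y assume x: "x \<in> open_segment (v i) (v (i + 1)) \<inter> ball a r" "on_side s i x" and y: "y \<in> open_segment (v i) (v (i + 1)) \<inter> ball a r"
    have "s0 = s"
    proof (rule ccontr)
      assume "s0 \<noteq> s"
      then have "s0 = - s" using s s0 by auto
      then show False using on_side_excl[OF x(2) _ s] near[OF x(1)] by simp
    qed
    then show "on_side s i y" using near[OF y] by simp
  qed
  moreover have "openin (top_of_set (open_segment (v i) (v (i + 1)))) (open_segment (v i) (v (i + 1)) \<inter> ball a r)"
    by (intro openin_open_Int) simp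
  moreover have "a \<in> open_segment (v i) (v (i + 1)) \<inter> ball a r" using a r by simp
  ultimately show "\<exists>T. openin (top_of_set (open_segment (v i) (v (i + 1)))) T \<and> a \<in> T \<and> (\<forall>x\<in>T. \<forall>y\<in>T. on_side s i x \<longrightarrow> on_side s i y)"
    by blast
qed (use assms in auto)

definition turn :: "int \<Rightarrow> real" where "turn i = crs (e (i - 1)) (e i)"

text \<open>The two sectors at a vertex: the smaller one, and its complement.\<close>

definition cone :: "int \<Rightarrow> complex set" where
  "cone i = {y. 0 < - turn i * crs (y - v i) (v (i + 1) - v i) \<and> 0 < - turn i * crs (v (i - 1) - v i) (y - v i)}"

definition cocone :: "int \<Rightarrow> complex set" where
  "cocone i = {y. - turn i * crs (y - v i) (v (i + 1) - v i) < 0 \<or> - turn i * crs (v (i - 1) - v i) (y - v i) < 0}"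

definition vertex_in :: "int \<Rightarrow> bool" where
  "vertex_in i \<longleftrightarrow> (\<exists>r>0. \<forall>y\<in>ball (v i) r. (y \<in> cone i \<longrightarrow> y \<in> inside curve) \<and> (y \<in> cocone i \<longrightarrow> y \<in> outside curve))"

definition vertex_out :: "int \<Rightarrow> bool" where
  "vertex_out i \<longleftrightarrow> (\<exists>r>0. \<forall>y\<in>ball (v i) r. (y \<in> cone i \<longrightarrow> y \<in> outside curve) \<and> (y \<in> cocone i \<longrightarrow> y \<in> inside curve))"

lemma turn_ab: "crs (v (i - 1) - v i) (v (i + 1) - v i) = - turn i"
  unfolding turn_def by (simp add: crs_def algebra_simps)

lemma turn_nz: "turn i \<noteq> 0" using bend[of i] by (simp add: turn_def)

text \<open>The scaling by the turn makes the description of the cone independent of the sense of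
  the turn: in the sector smaller than pi both cross products are positive, whether the polygon
  turns left or right.\<close>

definition dirA :: "int \<Rightarrow> complex" where "dirA i = of_real (turn i) * (v (i + 1) - v i)"
definition dirB :: "int \<Rightarrow> complex" where "dirB i = of_real (- turn i) * (v (i - 1) - v i)"

lemma cone_iff: "y \<in> cone i \<longleftrightarrow> 0 < crs (dirA i) (y - v i) \<and> 0 < crs (dirB i) (y - v i)"
  and cocone_iff: "y \<in> cocone i \<longleftrightarrow> crs (dirA i) (y - v i) < 0 \<or> crs (dirB i) (y - v i) < 0"
proof -
  have "- turn i * crs (y - v i) (v (i + 1) - v i) = crs (dirA i) (y - v i)"
    unfolding dirA_def crs_scale1 using crs_comm[of "y - v i" "v (i + 1) - v i"] by simp
  moreover have "- turn i * crs (v (i - 1) - v i) (y - v i) = crs (dirB i) (y - v i)"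
    unfolding dirB_def crs_scale1 by simp
  ultimately show "y \<in> cone i \<longleftrightarrow> 0 < crs (dirA i) (y - v i) \<and> 0 < crs (dirB i) (y - v i)"
    "y \<in> cocone i \<longleftrightarrow> crs (dirA i) (y - v i) < 0 \<or> crs (dirB i) (y - v i) < 0"
    unfolding cone_def cocone_def by (simp_all only: mem_Collect_eq)
qed

lemma dir_crs:
  "crs (dirA i) (v (i + 1) - v i) = 0" "crs (dirA i) (v (i - 1) - v i) = (turn i)\<^sup>2"
  "crs (dirB i) (v (i + 1) - v i) = (turn i)\<^sup>2" "crs (dirB i) (v (i - 1) - v i) = 0"
  using turn_ab[of i] crs_comm[of "v (i + 1) - v i" "v (i - 1) - v i"]
  unfolding dirA_def dirB_def crs_scale1 by (simp_all add: power2_eq_square)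

lemma turn_sq: "0 < (turn i)\<^sup>2" using turn_nz[of i] by simp

lemma dir_nz: "dirA i \<noteq> 0" "dirB i \<noteq> 0"
proof -
  have "crs (dirA i) (v (i - 1) - v i) \<noteq> 0" "crs (dirB i) (v (i + 1) - v i) \<noteq> 0"
    unfolding dir_crs using turn_sq[of i] by simp_all
  then show "dirA i \<noteq> 0" "dirB i \<noteq> 0" by (metis crs_zero1)+
qed

lemma curve_cone:
  assumes "y \<in> curve \<longleftrightarrow> (\<exists>x\<ge>0. y - v i = of_real x * (v (i - 1) - v i)) \<or> (\<exists>x\<ge>0. y - v i = of_real x * (v (i + 1) - v i))"
  shows "y \<in> curve \<longleftrightarrow> y \<notin> cone i \<and> y \<notin> cocone i"
proof
  assume "y \<in> curve"
  then have "(\<exists>x\<ge>0. y - v i = of_real x * (v (i - 1) - v i)) \<or> (\<exists>x\<ge>0. y - v i = of_real x * (v (i + 1) - v i))"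
    using assms by blast
  then show "y \<notin> cone i \<and> y \<notin> cocone i"
  proof
    assume "\<exists>x\<ge>0. y - v i = of_real x * (v (i - 1) - v i)"
    then obtain x where x: "0 \<le> x" "y - v i = of_real x * (v (i - 1) - v i)" by blast
    then have "crs (dirA i) (y - v i) = x * (turn i)\<^sup>2" "crs (dirB i) (y - v i) = 0" using dir_crs[of i] by (simp_all only: crs_scale2)
    then show ?thesis using x(1) by (simp add: cone_iff cocone_iff not_less)
  next
    assume "\<exists>x\<ge>0. y - v i = of_real x * (v (i + 1) - v i)"
    then obtain x where x: "0 \<le> x" "y - v i = of_real x * (v (i + 1) - v i)" by blast
    then have "crs (dirB i) (y - v i) = x * (turn i)\<^sup>2" "crs (dirA i) (y - v i) = 0" using dir_crs[of i] by (simp_all only: crs_scale2)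
    then show ?thesis using x(1) by (simp add: cone_iff cocone_iff not_less)
  qed
next
  assume nc: "y \<notin> cone i \<and> y \<notin> cocone i"
  then have ge: "0 \<le> crs (dirA i) (y - v i)" "0 \<le> crs (dirB i) (y - v i)"
    and "crs (dirA i) (y - v i) = 0 \<or> crs (dirB i) (y - v i) = 0" by (auto simp: cone_iff cocone_iff)
  from this(3) show "y \<in> curve"
  proof
    assume "crs (dirA i) (y - v i) = 0"
    then obtain x where "y - v i = of_real x * dirA i" using crs_zero_dir[OF dir_nz(1)] by blast
    then have x: "y - v i = of_real (x * turn i) * (v (i + 1) - v i)" by (simp add: dirA_def mult.assoc)
    then have "0 \<le> (x * turn i) * (turn i)\<^sup>2" using ge(2) dir_crs(3)[of i] by (simp only: crs_scale2)
    then have "0 \<le> x * turn i" using turn_sq[of i] by (simp only: zero_le_mult_iff) linarith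
    then show ?thesis using assms x by blast
  next
    assume "crs (dirB i) (y - v i) = 0"
    then obtain x where "y - v i = of_real x * dirB i" using crs_zero_dir[OF dir_nz(2)] by blast
    then have x: "y - v i = of_real (x * - turn i) * (v (i - 1) - v i)" by (simp add: dirB_def mult.assoc)
    then have "0 \<le> (x * - turn i) * (turn i)\<^sup>2" using ge(1) dir_crs(2)[of i] by (simp only: crs_scale2)
    then have "0 \<le> x * - turn i" using turn_sq[of i] by (simp only: zero_le_mult_iff) linarith
    then show ?thesis using assms x by blast
  qed
qed

lemma vertex_near: "\<exists>r>0. \<forall>y\<in>ball (v i) r. y \<in> curve \<longleftrightarrow> y \<notin> cone i \<and> y \<notin> cocone i"
proof -
  obtain r where r: "r > 0" "\<forall>y\<in>ball (v i) r. y \<in> curve \<longleftrightarrow>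
     (\<exists>x\<ge>0. y - v i = of_real x * (v (i - 1) - v i)) \<or> (\<exists>x\<ge>0. y - v i = of_real x * (v (i + 1) - v i))"
    using near_vertex[of i] by (elim exE conjE)
  have "y \<in> curve \<longleftrightarrow> y \<notin> cone i \<and> y \<notin> cocone i" if "y \<in> ball (v i) r" for y
    by (rule curve_cone[OF r(2)[THEN bspec, OF that]])
  with r(1) show ?thesis by (intro exI[of _ r] conjI ballI)
qed

text \<open>Within a small disc both sectors are connected and miss the curve, so each lies in one
  component; since both components accumulate at the vertex, the sectors are divided between
  them.\<close>

lemma vertex_sides:
  "\<exists>r>0. ((\<forall>y\<in>ball (v i) r. (y \<in> cone i \<longrightarrow> y \<in> inside curve) \<and> (y \<in> cocone i \<longrightarrow> y \<in> outside curve)) \<or>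
     (\<forall>y\<in>ball (v i) r. (y \<in> cone i \<longrightarrow> y \<in> outside curve) \<and> (y \<in> cocone i \<longrightarrow> y \<in> inside curve))) \<and>
     (\<forall>y\<in>ball (v i) r. y \<in> curve \<longleftrightarrow> y \<notin> cone i \<and> y \<notin> cocone i)"
proof -
  obtain r where r: "r > 0" "\<And>y. y \<in> ball (v i) r \<Longrightarrow> y \<in> curve \<longleftrightarrow> y \<notin> cone i \<and> y \<notin> cocone i"
    using vertex_near[of i] by blast
  let ?B = "ball (v i) r"
  define H where "H w = ?B \<inter> {y. 0 < crs w (y - v i)}" for w
  have conH: "convex (H w)" for w unfolding H_def by (intro convex_Int convex_crs_pos convex_ball)
  define K1 where "K1 = ?B \<inter> cone i"
  define K2 where "K2 = ?B \<inter> cocone i"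
  have "K1 = H (dirA i) \<inter> H (dirB i)" by (auto simp: K1_def H_def cone_iff)
  then have con1: "connected K1" using conH by (simp add: convex_Int convex_connected)
  have K2: "K2 = H (- dirA i) \<union> H (- dirB i)" unfolding K2_def H_def crs_minus1 by (auto simp: cocone_iff)
  \<comment> \<open>The sum of the two edge vectors points into the small sector. Its opposite lies
    in both of the half-discs whose union is the large sector, which makes that union
    connected.\<close>
  define w where "w = (v (i - 1) - v i) + (v (i + 1) - v i)"
  have wd: "crs (dirA i) w = (turn i)\<^sup>2" "crs (dirB i) w = (turn i)\<^sup>2" unfolding w_def crs_add2 dir_crs by simp_all
  obtain \<eta> where \<eta>: "\<eta> > 0" "\<eta> * cmod w < r" using small_ex[of r 1 "cmod w" 1] r by auto
  have "v i - of_real \<eta> * w \<in> ?B" using \<eta> by (simp add: dist_norm norm_mult)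
  moreover have "crs (- dirA i) (v i - of_real \<eta> * w - v i) = \<eta> * (turn i)\<^sup>2"
    "crs (- dirB i) (v i - of_real \<eta> * w - v i) = \<eta> * (turn i)\<^sup>2"
    using wd by (simp_all add: crs_minus1 crs_minus2 crs_scale2)
  ultimately have "v i - of_real \<eta> * w \<in> H (- dirA i) \<inter> H (- dirB i)" using \<eta> turn_sq[of i] unfolding H_def by simp
  then have con2: "connected K2" unfolding K2 using conH by (intro connected_Un convex_connected) auto
  have dis: "K1 \<inter> curve = {}" "K2 \<inter> curve = {}" unfolding K1_def K2_def using r(2) by blast+
  have vC: "v i \<in> curve" using r(2)[of "v i"] r(1) by (simp add: cone_iff cocone_iff)
  obtain y1 where y1: "y1 \<in> ?B" "y1 \<in> inside curve" using curve_limit(1)[OF vC r(1)] by blast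
  obtain y2 where y2: "y2 \<in> ?B" "y2 \<in> outside curve" using curve_limit(2)[OF vC r(1)] by blast
  have nc: "y1 \<notin> curve" "y2 \<notin> curve" using y1(2) y2(2) io_un by blast+
  have y12: "y1 \<in> K1 \<or> y1 \<in> K2" "y2 \<in> K1 \<or> y2 \<in> K2"
    using nc r(2)[OF y1(1)] r(2)[OF y2(1)] y1(1) y2(1) unfolding K1_def K2_def by blast+
  note in1 = connected_sub(1)[OF con1 dis(1)] and in2 = connected_sub(1)[OF con2 dis(2)]
  note out1 = connected_sub(2)[OF con1 dis(1)] and out2 = connected_sub(2)[OF con2 dis(2)]
  have "K1 \<subseteq> inside curve \<and> K2 \<subseteq> outside curve \<or> K1 \<subseteq> outside curve \<and> K2 \<subseteq> inside curve"
    using y12 in1[of y1] in2[of y1] out1[of y2] out2[of y2] y1(2) y2(2) io_disj by blast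
  then show ?thesis using r unfolding K1_def K2_def by (intro exI[of _ r]) blast
qed

text \<open>From a point of the edge close to the vertex (parameter \<open>\<delta>\<close>), a much
  smaller step to the inner side (parameter \<open>\<eta>\<close>) ends in the small or in the large
  sector, depending on the sense of the turn.\<close>

lemma side_vertex:
  assumes s: "s = 1 \<or> s = - 1" and z: "z \<in> open_segment (v i) (v (i + 1))" "on_side s i z"
  shows "(s * turn i < 0 \<longrightarrow> vertex_in i) \<and> (0 < s * turn i \<longrightarrow> vertex_out i)"
proof -
  obtain r where r: "r > 0" "((\<forall>y\<in>ball (v i) r. (y \<in> cone i \<longrightarrow> y \<in> inside curve) \<and> (y \<in> cocone i \<longrightarrow> y \<in> outside curve)) \<or>
     (\<forall>y\<in>ball (v i) r. (y \<in> cone i \<longrightarrow> y \<in> outside curve) \<and> (y \<in> cocone i \<longrightarrow> y \<in> inside curve)))" using vertex_sides[of i] by blast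
  define a where "a = v (i - 1) - v i"
  define b where "b = v (i + 1) - v i"
  have bne: "b \<noteq> 0" using step_neq[of i] by (simp add: b_def)
  obtain \<delta> where \<delta>: "\<delta> > 0" "\<delta> < 1" "\<delta> * cmod b < r" using small_ex[of r 1 "cmod b" 1] r by auto
  define z0 where "z0 = v i + of_real \<delta> * b"
  have z0: "z0 \<in> open_segment (v i) (v (i + 1))" unfolding z0_def b_def by (rule open_segmentI) (use \<delta> step_neq[of i] in auto)
  have os: "on_side s i z0" by (rule on_side_move[OF z(1) z0 z(2) s])
  have d0: "dist (v i) z0 = \<delta> * cmod b" using \<delta> by (simp add: z0_def dist_norm norm_mult)
  obtain \<eta> where \<eta>: "\<eta> > 0" "\<eta> * (- turn i * s * crs a (\<i> * b)) < \<delta> * (turn i)\<^sup>2"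
     "z0 - of_real (s * \<eta>) * (\<i> * b) \<in> ball z0 (r - \<delta> * cmod b) \<inter> inside curve"
    using side_point[OF s os, of "r - \<delta> * cmod b" "\<delta> * (turn i)\<^sup>2" "- turn i * s * crs a (\<i> * b)"] \<delta> turn_sq[of i] unfolding b_def[symmetric] by auto
  define y where "y = z0 - of_real (s * \<eta>) * (\<i> * b)"
  have yb: "y \<in> ball (v i) r" using \<eta>(3) d0 dist_triangle[of "v i" y z0] unfolding y_def by auto
  have yi: "y \<in> inside curve" "y \<notin> outside curve" using \<eta>(3) io_disj unfolding y_def by blast+
  have yv: "y - v i = of_real \<delta> * b - of_real (s * \<eta>) * (\<i> * b)" unfolding y_def z0_def by (simp add: algebra_simps)
  have A: "crs (dirA i) (y - v i) = - (s * turn i) * (\<eta> * (cmod b)\<^sup>2)"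
    unfolding yv crs_diff2 crs_scale2 dirA_def crs_scale1 b_def[symmetric] crs_self crs_ii by simp
  have B: "0 < crs (dirB i) (y - v i)"
  proof -
    have "crs (dirB i) (y - v i) = \<delta> * crs (dirB i) (v (i + 1) - v i) - s * \<eta> * crs (dirB i) (\<i> * b)"
      unfolding yv crs_diff2[of "dirB i" "of_real \<delta> * b"] crs_scale2 unfolding b_def ..
    also have "\<dots> = \<delta> * (turn i)\<^sup>2 - \<eta> * (- turn i * s * crs a (\<i> * b))"
      unfolding dir_crs unfolding dirB_def crs_scale1 a_def by simp
    finally show ?thesis using \<eta>(2) by simp
  qed
  have pos: "0 < \<eta> * (cmod b)\<^sup>2" using \<eta>(1) bne by simp
  show ?thesis
  proof (intro conjI impI)
    assume "s * turn i < 0"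
    then have "0 < crs (dirA i) (y - v i)" unfolding A using pos by (intro mult_pos_pos[OF _ pos]) simp
    then have "y \<in> cone i" using B by (simp add: cone_iff)
    then show "vertex_in i" using r yb yi unfolding vertex_in_def by blast
  next
    assume "0 < s * turn i"
    then have "crs (dirA i) (y - v i) < 0" unfolding A using pos by (intro mult_neg_pos[OF _ pos]) simp
    then have "y \<in> cocone i" by (simp add: cocone_iff)
    then show "vertex_out i" using r yb yi unfolding vertex_out_def by blast
  qed
qed

lemma side_vertex':
  assumes s: "s = 1 \<or> s = - 1" and z: "z \<in> open_segment (v (i - 1)) (v i)" "on_side s (i - 1) z"
  shows "(s * turn i < 0 \<longrightarrow> vertex_in i) \<and> (0 < s * turn i \<longrightarrow> vertex_out i)"
proof -
  obtain r where r: "r > 0" "((\<forall>y\<in>ball (v i) r. (y \<in> cone i \<longrightarrow> y \<in> inside curve) \<and> (y \<in> cocone i \<longrightarrow> y \<in> outside curve)) \<or>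
     (\<forall>y\<in>ball (v i) r. (y \<in> cone i \<longrightarrow> y \<in> outside curve) \<and> (y \<in> cocone i \<longrightarrow> y \<in> inside curve)))" using vertex_sides[of i] by blast
  define a where "a = v (i - 1) - v i"
  define b where "b = v (i + 1) - v i"
  have ea: "e (i - 1) = - a" by (simp add: a_def)
  have ane: "a \<noteq> 0" using step_neq[of "i - 1"] by (simp add: a_def)
  obtain \<delta> where \<delta>: "\<delta> > 0" "\<delta> < 1" "\<delta> * cmod a < r" using small_ex[of r 1 "cmod a" 1] r by auto
  define z0 where "z0 = v i + of_real \<delta> * a"
  have "v i + of_real \<delta> * (v (i - 1) - v i) \<in> open_segment (v i) (v (i - 1))"
    by (rule open_segmentI) (use \<delta> step_neq[of "i - 1"] in auto)
  then have z0: "z0 \<in> open_segment (v (i - 1)) (v (i - 1 + 1))" by (simp add: z0_def a_def open_segment_commute)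
  have os: "on_side s (i - 1) z0" by (rule on_side_move[OF _ z0 z(2) s]) (use z in simp)
  have d0: "dist (v i) z0 = \<delta> * cmod a" using \<delta> by (simp add: z0_def dist_norm norm_mult)
  obtain \<eta> where \<eta>: "\<eta> > 0" "\<eta> * (- (turn i * s * crs b (\<i> * a))) < \<delta> * (turn i)\<^sup>2"
     "z0 - of_real (s * \<eta>) * (\<i> * e (i - 1)) \<in> ball z0 (r - \<delta> * cmod a) \<inter> inside curve"
    using side_point[OF s os, of "r - \<delta> * cmod a" "\<delta> * (turn i)\<^sup>2" "- (turn i * s * crs b (\<i> * a))"] \<delta> turn_sq[of i] by auto
  define y where "y = z0 - of_real (s * \<eta>) * (\<i> * e (i - 1))"
  have yb: "y \<in> ball (v i) r" using \<eta>(3) d0 dist_triangle[of "v i" y z0] unfolding y_def by auto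
  have yi: "y \<in> inside curve" "y \<notin> outside curve" using \<eta>(3) io_disj unfolding y_def by blast+
  have yv: "y - v i = of_real \<delta> * a + of_real (s * \<eta>) * (\<i> * a)" unfolding y_def z0_def ea by (simp add: algebra_simps)
  have B: "crs (dirB i) (y - v i) = - (s * turn i) * (\<eta> * (cmod a)\<^sup>2)"
    unfolding yv crs_add2 crs_scale2 dirB_def crs_scale1 a_def[symmetric] crs_self crs_ii by simp
  have A: "0 < crs (dirA i) (y - v i)"
  proof -
    have "crs (dirA i) (y - v i) = \<delta> * crs (dirA i) (v (i - 1) - v i) + s * \<eta> * crs (dirA i) (\<i> * a)"
      unfolding yv crs_add2 crs_scale2 a_def ..
    also have "\<dots> = \<delta> * (turn i)\<^sup>2 - \<eta> * (- (turn i * s * crs b (\<i> * a)))"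
      unfolding dir_crs unfolding dirA_def crs_scale1 b_def by simp
    finally show ?thesis using \<eta>(2) by simp
  qed
  have pos: "0 < \<eta> * (cmod a)\<^sup>2" using \<eta>(1) ane by simp
  show ?thesis
  proof (intro conjI impI)
    assume "s * turn i < 0"
    then have "0 < crs (dirB i) (y - v i)" unfolding B using pos by (intro mult_pos_pos[OF _ pos]) simp
    then have "y \<in> cone i" using A by (simp add: cone_iff)
    then show "vertex_in i" using r yb yi unfolding vertex_in_def by blast
  next
    assume "0 < s * turn i"
    then have "crs (dirB i) (y - v i) < 0" unfolding B using pos by (intro mult_neg_pos[OF _ pos]) simp
    then have "y \<in> cocone i" by (simp add: cocone_iff)
    then show "vertex_out i" using r yb yi unfolding vertex_out_def by blast
  qed
qed

lemma cone_approach: assumes "0 < r" shows "\<exists>y\<in>ball (v i) r. y \<in> cone i"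
proof -
  define w where "w = (v (i - 1) - v i) + (v (i + 1) - v i)"
  have wd: "crs (dirA i) w = (turn i)\<^sup>2" "crs (dirB i) w = (turn i)\<^sup>2" unfolding w_def crs_add2 dir_crs by simp_all
  obtain \<eta> where \<eta>: "\<eta> > 0" "\<eta> * cmod w < r" using small_ex[of r 1 "cmod w" 1] assms by auto
  have "v i + of_real \<eta> * w \<in> ball (v i) r" using \<eta> by (simp add: dist_norm norm_mult)
  moreover have "v i + of_real \<eta> * w \<in> cone i" using \<eta> turn_sq[of i] wd
    by (simp add: cone_iff crs_scale2)
  ultimately show ?thesis by blast
qed

lemma vertex_excl: "\<not> (vertex_in i \<and> vertex_out i)"
proof
  assume "vertex_in i \<and> vertex_out i"
  then obtain r r' where r: "r > 0" "\<forall>y\<in>ball (v i) r. (y \<in> cone i \<longrightarrow> y \<in> inside curve)"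
    "r' > 0" "\<forall>y\<in>ball (v i) r'. (y \<in> cone i \<longrightarrow> y \<in> outside curve)" unfolding vertex_in_def vertex_out_def by blast
  obtain y where y: "y \<in> ball (v i) (min r r')" "y \<in> cone i" using cone_approach[of "min r r'" i] r by auto
  then have "y \<in> inside curve" "y \<in> outside curve" using r by auto
  then show False using io_disj by blast
qed

lemma midpoint_in: "v i + of_real (1/2) * e i \<in> open_segment (v i) (v (i + 1))"
  by (rule open_segmentI) (use step_neq[of i] in auto)

text \<open>Each of the two edges at a vertex determines, together with the turn, which sector is
  inside. Different sides would give contradictory answers.\<close>

lemma sides_agree:
  assumes s: "s = 1 \<or> s = - 1" and o1: "\<forall>z\<in>open_segment (v (i - 1)) (v i). on_side s (i - 1) z"
  shows "\<forall>z\<in>open_segment (v i) (v (i + 1)). on_side s i z"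
proof -
  define z0 where "z0 = v i + of_real (1/2) * e i"
  have z0: "z0 \<in> open_segment (v i) (v (i + 1))" unfolding z0_def by (rule midpoint_in)
  obtain s' where s': "s' = 1 \<or> s' = - 1" "on_side s' i z0" using edge_sides[OF z0] by blast
  note V = side_vertex[OF s'(1) z0 s'(2)]
  have z1: "v (i - 1) + of_real (1/2) * e (i - 1) \<in> open_segment (v (i - 1)) (v i)" using midpoint_in[of "i - 1"] by simp
  note V' = side_vertex'[OF s z1 o1[rule_format, OF z1]]
  have "s' = s"
  proof (rule ccontr)
    assume "s' \<noteq> s"
    then have ss: "s' = - s" using s s' by auto
    consider "s * turn i < 0" | "0 < s * turn i" using turn_nz[of i] s by fastforce
    then show False using V V' vertex_excl[of i] unfolding ss by cases auto
  qed
  then show ?thesis using on_side_move[OF z0 _ s'(2) s'(1)] by blast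
qed

lemma orientation:
  "\<exists>s. (s = 1 \<or> s = - 1) \<and> (\<forall>i. \<forall>z\<in>open_segment (v i) (v (i + 1)). on_side s i z)"
proof -
  obtain s where s: "s = 1 \<or> s = - 1" "on_side s 0 (v 0 + of_real (1/2) * e 0)"
    using edge_sides[OF midpoint_in[of 0]] by blast
  have base: "\<forall>z\<in>open_segment (v 0) (v (0 + 1)). on_side s 0 z"
    using on_side_move[OF midpoint_in[of 0] _ s(2) s(1)] by blast
  have pos: "\<forall>z\<in>open_segment (v i) (v (i + 1)). on_side s i z" if "0 \<le> i" for i
    using that
  proof (induction i rule: int_ge_induct)
    case (step i)
    show ?case using sides_agree[OF s(1), of "i + 1"] step by simp
  qed (rule base)
  have "\<forall>z\<in>open_segment (v i) (v (i + 1)). on_side s i z" for i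
  proof -
    have "0 \<le> i mod m" using m3 by simp
    have vp: "v (i mod m + k) = v (i + k)" for k
    proof -
      have "v ((i mod m + k) mod m) = v ((i + k) mod m)" by (simp add: mod_simps)
      then show ?thesis using periodic_mod[of v m] per by metis
    qed
    have "v (i mod m) = v i" "v (i mod m + 1) = v (i + 1)" using vp[of 0] vp[of 1] by auto
    then show ?thesis using pos[OF \<open>0 \<le> i mod m\<close>] unfolding on_side_def by simp
  qed
  then show ?thesis using s by blast
qed

text \<open>The value 1 means that the interior lies to the right of all edges, so that the right
  turns are the convex vertices. This is the orientation of the polygons of rolling lines.\<close>

definition orient :: real where
  "orient = (SOME s. (s = 1 \<or> s = - 1) \<and> (\<forall>i. \<forall>z\<in>open_segment (v i) (v (i + 1)). on_side s i z))"

lemma orient: "orient = 1 \<or> orient = - 1"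
  and on_side_orient: "z \<in> open_segment (v i) (v (i + 1)) \<Longrightarrow> on_side orient i z"
proof -
  have "(orient = 1 \<or> orient = - 1) \<and> (\<forall>i. \<forall>z\<in>open_segment (v i) (v (i + 1)). on_side orient i z)"
    unfolding orient_def by (rule someI_ex[OF orientation])
  then show "orient = 1 \<or> orient = - 1" "z \<in> open_segment (v i) (v (i + 1)) \<Longrightarrow> on_side orient i z" by simp_all
qed

lemma vertex_in_iff: "vertex_in i \<longleftrightarrow> orient * turn i < 0"
  and vertex_out_iff: "vertex_out i \<longleftrightarrow> 0 < orient * turn i"
proof -
  have "orient * turn i \<noteq> 0" using turn_nz[of i] orient by auto
  then have "orient * turn i < 0 \<or> 0 < orient * turn i" by linarith
  then show "vertex_in i \<longleftrightarrow> orient * turn i < 0" "vertex_out i \<longleftrightarrow> 0 < orient * turn i"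
    using side_vertex[OF orient midpoint_in on_side_orient[OF midpoint_in], of i] vertex_excl[of i] by auto
qed

end

subsection \<open>The turning number\<close>

text \<open>The signed turning angle from \<open>a\<close> to \<open>b\<close>. It is additive only
  up to multiples of 2 pi, and the lemmas below single out configurations without such a
  correction.\<close>

definition ang :: "complex \<Rightarrow> complex \<Rightarrow> real" where "ang a b = Arg (b / a)"

lemma ang_minus: "ang (- a) (- b) = ang a b" by (simp add: ang_def)

lemma Re_divide_inner: "0 < inner w a \<Longrightarrow> 0 < Re (a / w)"
proof -
  assume a: "0 < inner w a"
  then have "w \<noteq> 0" by auto
  then have "0 < (Re w)\<^sup>2 + (Im w)\<^sup>2" by (simp add: complex_neq_0)
  then show ?thesis using a by (simp add: Re_divide inner_complex_def mult.commute)
qed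

lemma Arg_halfplane: "0 < inner w a \<Longrightarrow> \<bar>Arg (a / w)\<bar> < pi / 2"
proof -
  assume "0 < inner w a"
  then have "0 < Re (a / w)" by (rule Re_divide_inner)
  moreover from this have "a / w \<noteq> 0" by force
  ultimately show ?thesis using Re_Ln_pos_lt[of "a / w"] by (simp add: Arg_def)
qed

text \<open>In an open half-plane, arguments taken relative to its normal \<open>w\<close> stay
  below pi/2 in absolute value, so that their differences never wrap around.\<close>

lemma ang_halfplane:
  assumes "0 < inner w a" "0 < inner w b" shows "ang a b = Arg (b / w) - Arg (a / w)"
proof -
  have nz: "w \<noteq> 0" "a \<noteq> 0" "b \<noteq> 0" using assms by auto
  have "\<bar>Arg (a / w)\<bar> < pi / 2" "\<bar>Arg (b / w)\<bar> < pi / 2" using Arg_halfplane assms by auto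
  moreover have "b / a = (b / w) / (a / w)" using nz by simp
  ultimately show ?thesis using Arg_divide'[of "b / w" "a / w"] nz unfolding ang_def by auto
qed

lemma ang_add:
  assumes "0 < inner w a" "0 < inner w b" "0 < inner w c" shows "ang a b + ang b c = ang a c"
  using ang_halfplane[of w] assms by simp

lemma ang_telescope:
  assumes "\<And>k. k \<in> {a..b} \<Longrightarrow> 0 < inner w (d k)" "a \<le> b"
  shows "(\<Sum>k\<in>{a..<b}. ang (d k) (d (Suc k))) = ang (d a) (d b)"
proof -
  have "(\<Sum>k\<in>{a..<b}. ang (d k) (d (Suc k))) = (\<Sum>k\<in>{a..<b}. Arg (d (Suc k) / w) - Arg (d k / w))"
    by (rule sum.cong) (use assms in \<open>auto intro!: ang_halfplane\<close>)
  also have "\<dots> = Arg (d b / w) - Arg (d a / w)" by (rule sum_Suc_diff'[OF assms(2)])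
  also have "\<dots> = ang (d a) (d b)" using assms by (intro ang_halfplane[symmetric]) auto
  finally show ?thesis .
qed

text \<open>A hyperplane separates a compact convex set from the origin, hence confines it to an
  open half-plane. This takes the place of a continuous lifting of the angle over a cell of Hopf's
  triangle.\<close>

lemma ang_quad:
  assumes "convex K" "compact K" "0 \<notin> K" "a \<in> K" "b \<in> K" "c \<in> K" "d \<in> K"
  shows "ang a b + ang b c = ang a d + ang d c"
proof -
  obtain w e where "\<And>x. x \<in> K \<Longrightarrow> inner w x > e" "0 < e"
    using separating_hyperplane_closed_0[OF assms(1) compact_imp_closed[OF assms(2)] assms(3)] by blast
  then have "\<And>x. x \<in> K \<Longrightarrow> 0 < inner w x" by force
  then show ?thesis using ang_add[of w a b c] ang_add[of w a d c] assms(4-7) by simp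
qed

lemma ang_triangle:
  assumes "crs a b \<noteq> 0" shows "ang a (a + b) + ang (a + b) b = ang a b"
proof -
  define w where "w = of_real (crs a b) * (\<i> * (a - b))"
  have w: "inner w x = crs a b * crs (a - b) x" for x
    unfolding w_def crs_inner by (metis inner_scaleR_left scaleR_conv_of_real)
  have "crs (a - b) a = crs a b" "crs (a - b) b = crs a b" "crs (a - b) (a + b) = 2 * crs a b"
    by (simp_all add: crs_def algebra_simps)
  then have "inner w a = (crs a b)\<^sup>2" "inner w b = (crs a b)\<^sup>2" "inner w (a + b) = 2 * (crs a b)\<^sup>2"
    unfolding w by (simp_all add: power2_eq_square)
  then show ?thesis using assms by (intro ang_add[of w]) auto
qed

text \<open>The turn from \<open>x\<close> to \<open>- y\<close> followed by the one from
  \<open>y\<close> to \<open>x\<close> is a half-turn up to full turns; the orientation of the two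
  vectors decides its sign.\<close>

lemma ang_reflect:
  assumes "crs y x \<noteq> 0" shows "ang x (- y) + ang y x = (if 0 < crs y x then pi else - pi)"
proof -
  have nz: "x \<noteq> 0" "y \<noteq> 0" using assms by auto
  define u where "u = x / y"
  have u: "u \<noteq> 0" using nz by (simp add: u_def)
  have "0 < (Re y)\<^sup>2 + (Im y)\<^sup>2" using nz by (simp add: complex_neq_0)
  moreover have im: "Im u = crs y x / ((Re y)\<^sup>2 + (Im y)\<^sup>2)" by (simp add: u_def Im_divide crs_def mult.commute)
  ultimately have s: "0 < Im u \<longleftrightarrow> 0 < crs y x" "Im u < 0 \<longleftrightarrow> crs y x < 0"
    by (simp_all add: zero_less_divide_iff divide_less_0_iff)
  have nr: "u \<notin> \<real>" using s assms unfolding complex_is_Real_iff by linarith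
  have "inverse u \<noteq> 0" using u by simp
  then have "Arg (- inverse u) = (if Arg (inverse u) \<le> 0 then Arg (inverse u) + pi else Arg (inverse u) - pi)"
    by (rule Arg_minus)
  moreover have "Arg (inverse u) = - Arg u" using nr by (simp add: Arg_inverse)
  moreover have "- y / x = - inverse u" using nz by (simp add: u_def)
  ultimately have e: "ang x (- y) + ang y x = (if 0 \<le> Arg u then pi else - pi)"
    unfolding ang_def u_def[symmetric] by auto
  have "Arg u < 0 \<longleftrightarrow> crs y x < 0" using Arg_neg_iff s by simp
  then show ?thesis using e assms by auto
qed

section \<open>Convex vertices and the turning number theorem\<close>

context spoly
begin

text \<open>If the small sector is inside, the region is near the vertex an intersection of a disc
  and two half-planes. If it is outside, the midpoint of two nearby points on the two edges lies in
  it, so no neighbourhood is convex.\<close>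

lemma convex_iff: "(\<exists>\<epsilon>>0. convex ((curve \<union> inside curve) \<inter> ball (v i) \<epsilon>)) \<longleftrightarrow> vertex_in i"
proof -
  from vertex_sides[of i] obtain r where r0: "0 < r \<and>
    ((\<forall>y\<in>ball (v i) r. (y \<in> cone i \<longrightarrow> y \<in> inside curve) \<and> (y \<in> cocone i \<longrightarrow> y \<in> outside curve)) \<or>
     (\<forall>y\<in>ball (v i) r. (y \<in> cone i \<longrightarrow> y \<in> outside curve) \<and> (y \<in> cocone i \<longrightarrow> y \<in> inside curve))) \<and>
     (\<forall>y\<in>ball (v i) r. y \<in> curve \<longleftrightarrow> y \<notin> cone i \<and> y \<notin> cocone i)" ..
  note r = r0[THEN conjunct1] r0[THEN conjunct2, THEN conjunct1] r0[THEN conjunct2, THEN conjunct2, THEN bspec]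
  show ?thesis
  proof
    assume vi: "vertex_in i"
    from r(2) have R0: "\<forall>y\<in>ball (v i) r. (y \<in> cone i \<longrightarrow> y \<in> inside curve) \<and> (y \<in> cocone i \<longrightarrow> y \<in> outside curve)"
    proof
      assume "\<forall>y\<in>ball (v i) r. (y \<in> cone i \<longrightarrow> y \<in> outside curve) \<and> (y \<in> cocone i \<longrightarrow> y \<in> inside curve)"
      with r(1) have "vertex_out i" unfolding vertex_out_def by (intro exI[of _ r] conjI)
      with vi vertex_excl[of i] show ?thesis by simp
    qed
    note R = R0[THEN bspec]
    have "(curve \<union> inside curve) \<inter> ball (v i) r = ball (v i) r \<inter> ({y. 0 \<le> crs (dirA i) (y - v i)} \<inter> {y. 0 \<le> crs (dirB i) (y - v i)})"
    proof (intro equalityI subsetI)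
      fix y assume y: "y \<in> (curve \<union> inside curve) \<inter> ball (v i) r"
      then have "y \<notin> outside curve" using io_disj io_un by blast
      then have "y \<notin> cocone i" using R y by blast
      then show "y \<in> ball (v i) r \<inter> ({y. 0 \<le> crs (dirA i) (y - v i)} \<inter> {y. 0 \<le> crs (dirB i) (y - v i)})"
        using y by (auto simp: cocone_iff)
    next
      fix y assume y: "y \<in> ball (v i) r \<inter> ({y. 0 \<le> crs (dirA i) (y - v i)} \<inter> {y. 0 \<le> crs (dirB i) (y - v i)})"
      then have "y \<notin> cocone i" by (auto simp: cocone_iff)
      then show "y \<in> (curve \<union> inside curve) \<inter> ball (v i) r" using R[of y] r(3)[of y] y by blast
    qed
    then have "convex ((curve \<union> inside curve) \<inter> ball (v i) r)"
      by (simp only:) (intro convex_Int convex_ball convex_crs_nonneg)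
    then show "\<exists>\<epsilon>>0. convex ((curve \<union> inside curve) \<inter> ball (v i) \<epsilon>)" using r(1) by blast
  next
    assume "\<exists>\<epsilon>>0. convex ((curve \<union> inside curve) \<inter> ball (v i) \<epsilon>)"
    then obtain \<epsilon> where \<epsilon>: "\<epsilon> > 0" "convex ((curve \<union> inside curve) \<inter> ball (v i) \<epsilon>)" by blast
    show "vertex_in i"
    proof (rule ccontr)
      assume "\<not> vertex_in i"
      with r(1) have "\<not> (\<forall>y\<in>ball (v i) r. (y \<in> cone i \<longrightarrow> y \<in> inside curve) \<and> (y \<in> cocone i \<longrightarrow> y \<in> outside curve))"
        unfolding vertex_in_def by (intro notI, elim notE, intro exI[of _ r] conjI)
      with r(2) have R: "\<And>y. y \<in> ball (v i) r \<Longrightarrow> y \<in> cone i \<Longrightarrow> y \<in> outside curve" by simp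
      define a b where "a = v (i - 1) - v i" and "b = v (i + 1) - v i"
      obtain \<delta> where \<delta>: "\<delta> > 0" "\<delta> * (cmod a + cmod b) < min r \<epsilon>"
        using small_ex[of "min r \<epsilon>" 1 "cmod a + cmod b" 1] r(1) \<epsilon>(1) by auto
      have nn: "0 \<le> \<delta> * cmod a" "0 \<le> \<delta> * cmod b" using \<delta> by auto
      then have small: "\<delta> * cmod a < min r \<epsilon>" "\<delta> * cmod b < min r \<epsilon>" using \<delta>(2) unfolding distrib_left by linarith+
      define p q where "p = v i + of_real \<delta> * a" and "q = v i + of_real \<delta> * b"
      have pb: "p \<in> ball (v i) r" "p \<in> ball (v i) \<epsilon>" "q \<in> ball (v i) r" "q \<in> ball (v i) \<epsilon>"
        using small \<delta> by (auto simp: p_def q_def dist_norm norm_mult)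
      have "crs (dirA i) (p - v i) = \<delta> * (turn i)\<^sup>2" "crs (dirB i) (p - v i) = 0"
         "crs (dirB i) (q - v i) = \<delta> * (turn i)\<^sup>2" "crs (dirA i) (q - v i) = 0"
        unfolding p_def q_def a_def b_def using dir_crs[of i] by (simp_all add: crs_scale2)
      note cr = this
      have pos: "0 < \<delta> * (turn i)\<^sup>2" using \<delta>(1) turn_sq[of i] by simp
      have "p \<in> curve" "q \<in> curve" using r(3)[OF pb(1)] r(3)[OF pb(3)] pos unfolding cone_iff cocone_iff cr by auto
      then have pq: "p \<in> (curve \<union> inside curve) \<inter> ball (v i) \<epsilon>" "q \<in> (curve \<union> inside curve) \<inter> ball (v i) \<epsilon>" using pb by auto
      define c where "c = (1/2) *\<^sub>R p + (1/2) *\<^sub>R q"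
      have cin: "c \<in> (curve \<union> inside curve) \<inter> ball (v i) \<epsilon>" unfolding c_def
        by (rule convexD[OF \<epsilon>(2) pq]) auto
      have cb: "c \<in> ball (v i) r" unfolding c_def by (rule convexD[OF convex_ball pb(1,3)]) auto
      have "c - v i = (1/2) *\<^sub>R (p - v i) + (1/2) *\<^sub>R (q - v i)" unfolding c_def by (simp add: scaleR_conv_of_real field_simps)
      then have "c \<in> cone i" using pos unfolding cone_iff by (simp add: crs_add2 crs_scaleR2 cr)
      then have "c \<in> outside curve" by (rule R[OF cb])
      then show False using cin io_disj io_un by blast
    qed
  qed
qed

text \<open>If the large sector were inside, a step away from both neighbours would lead to an
  interior point beyond the supporting line, although the curve and with it the interior stay on one
  side.\<close>

lemma extreme_vertex_in:
  assumes w: "\<And>j. 0 \<le> inner w (v i - v j)" and "w \<noteq> 0"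
    and strict: "0 < inner w (v i - v (i - 1)) \<or> 0 < inner w (v i - v (i + 1))"
  shows "vertex_in i"
proof (rule ccontr)
  assume "\<not> vertex_in i"
  moreover have "orient * turn i \<noteq> 0" using turn_nz[of i] orient by auto
  ultimately have "vertex_out i" using vertex_in_iff[of i] vertex_out_iff[of i] by linarith
  then obtain r where r: "r > 0" "\<And>y. y \<in> ball (v i) r \<Longrightarrow> y \<in> cocone i \<Longrightarrow> y \<in> inside curve"
    unfolding vertex_out_def by blast
  define T where "T = {y. inner w y \<le> inner w (v i)}"
  have "convex T" unfolding T_def by (rule convex_halfspace_le)
  moreover have "curve \<subseteq> T"
  proof
    fix y assume "y \<in> curve"
    then obtain j where "y \<in> seg j" by (auto simp: curve_def)
    moreover have "v j \<in> T" for j using w[of j] by (simp add: T_def inner_diff_right)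
    ultimately show "y \<in> T" using \<open>convex T\<close> by (meson closed_segment_subset subsetD)
  qed
  ultimately have "- T \<subseteq> outside curve" by (rule outside_subset_convex)
  then have inT: "inside curve \<subseteq> T" using io_disj by blast
  define u where "u = (v (i - 1) - v i) + (v (i + 1) - v i)"
  have ud: "crs (dirA i) u = (turn i)\<^sup>2" unfolding u_def crs_add2 dir_crs by simp
  obtain \<eta> where \<eta>: "\<eta> > 0" "\<eta> * cmod u < r" using small_ex[of r 1 "cmod u" 1] r by auto
  let ?y = "v i - of_real \<eta> * u"
  have "?y \<in> ball (v i) r" using \<eta> by (simp add: dist_norm norm_mult)
  moreover have "crs (dirA i) (?y - v i) = - (\<eta> * (turn i)\<^sup>2)"
    using ud by (simp add: crs_minus2 crs_scale2)
  then have "?y \<in> cocone i" using \<eta> turn_sq[of i] by (simp add: cocone_iff)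
  ultimately have "?y \<in> T" using r inT by blast
  moreover have "inner w (of_real \<eta> * u) = \<eta> * inner w u" by (metis inner_scaleR_right scaleR_conv_of_real)
  moreover have "inner w u = - (inner w (v i - v (i - 1)) + inner w (v i - v (i + 1)))"
    unfolding u_def inner_add_right inner_diff_right by simp
  then have "inner w u < 0" using w[of "i - 1"] w[of "i + 1"] strict by linarith
  ultimately show False using \<eta> by (simp add: T_def inner_diff_right zero_le_mult_iff)
qed

lemma v_neq_mod: "0 < j \<Longrightarrow> j < m \<Longrightarrow> v (k + j) \<noteq> v k"
  using v_distinct[of k "k + j"] by auto

text \<open>A vertex farthest from \<open>v 1\<close> is strictly extreme in the direction from
  \<open>v 1\<close> to it, since a disc is strictly convex.\<close>

lemma extreme_exists: "\<exists>k w. \<forall>j. v j \<noteq> v k \<longrightarrow> 0 < inner w (v k - v j)"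
proof -
  have vm: "v j \<in> v ` {0..<m}" for j
  proof -
    have "j mod m \<in> {0..<m}" using m3 by simp
    moreover have "v j = v (j mod m)" using periodic_mod[of v m j] per by simp
    ultimately show ?thesis by blast
  qed
  define D where "D j = cmod (v j - v 1)" for j
  obtain k where k: "\<And>j. j \<in> {0..<m} \<Longrightarrow> D j \<le> D k" using finite_max[of "{0..<m}" D] m3 by force
  have k': "D j \<le> D k" for j
  proof -
    obtain l where "l \<in> {0..<m}" "v j = v l" using vm[of j] by blast
    then show ?thesis using k[of l] by (simp add: D_def)
  qed
  define w where "w = v k - v 1"
  have "0 < inner w (v k - v j)" if ne: "v j \<noteq> v k" for j
  proof -
    define z where "z = v j - v k"
    have "z \<noteq> 0" using ne by (simp add: z_def)
    then have "0 < inner z z" by simp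
    moreover have "(cmod (w + z))\<^sup>2 \<le> (cmod w)\<^sup>2" using k'[of j] by (intro power_mono) (auto simp: D_def w_def z_def)
    then have "inner (w + z) (w + z) \<le> inner w w" by (simp add: power2_norm_eq_inner)
    moreover have "inner (w + z) (w + z) = inner w w + 2 * inner w z + inner z z"
      by (simp add: inner_add_left inner_add_right inner_commute[of z w])
    ultimately have "inner w z < 0" by linarith
    then show ?thesis by (simp add: z_def inner_diff_right)
  qed
  then show ?thesis by blast
qed

lemma e_per: "e (i + m) = e i"
  using per[of i] per[of "i + 1"] by (simp add: algebra_simps)

text \<open>A discrete form of Hopf's argument. Secant directions \<open>D i j\<close> are attached
  to a triangle of index pairs, and each elementary square contributes nothing because the two edges
  involved are disjoint. The angle sum along the diagonal, which consists of the turning angles,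
  therefore equals the sum along the two legs, and that can be evaluated because the vertex
  \<open>k\<close> is extreme.\<close>

lemma hopf_at:
  assumes ext: "\<And>j. v j \<noteq> v k \<Longrightarrow> 0 < inner w (v k - v j)"
  shows "(\<Sum>i\<in>{k..<k+m}. ang (e (i - 1)) (e i)) = (if 0 < turn k then 2 * pi else - 2 * pi)"
proof -
  define N where "N = nat m"
  have N: "int N = m" "3 \<le> N" using m3 by (auto simp: N_def)
  define u where "u i = v (k + int i)" for i
  have uN: "u N = u 0" using per[of k] by (simp add: u_def N)
  define g where "g i = u (Suc i) - u i" for i
  have ge: "g i = e (k + int i)" for i by (simp add: g_def u_def add.assoc add.commute[of 1])
  \<comment> \<open>The secant from \<open>u 0\<close> to \<open>u N\<close> would be zero. The
    value of \<open>D 1 (N - 1)\<close> in its place makes the last square degenerate and hence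
    trivial.\<close>
  define D where "D i j = (if i = 0 \<and> j = N then u (N - 1) - u 1 else u j - u i)" for i j
  have quad: "ang (D i j) (D i (Suc j)) + ang (D i (Suc j)) (D (Suc i) (Suc j)) =
      ang (D i j) (D (Suc i) j) + ang (D (Suc i) j) (D (Suc i) (Suc j))" if ij: "Suc i < j" "j < N" for i j
  proof (cases "i = 0 \<and> Suc j = N")
    case True
    then have "D i (Suc j) = D (Suc i) j" using ij N by (auto simp: D_def)
    then show ?thesis by simp
  next
    case False
    let ?K = "(\<Union>x\<in>seg (k + int j). \<Union>y\<in>seg (k + int i). {x - y})"
    have conv: "convex ?K" by (rule convex_differences) simp_all
    have "compact {x - y |x y. x \<in> seg (k + int j) \<and> y \<in> seg (k + int i)}" by (rule compact_differences) simp_all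
    moreover have "{x - y |x y. x \<in> seg (k + int j) \<and> y \<in> seg (k + int i)} = ?K" by blast
    ultimately have comp: "compact ?K" by simp
    have "0 \<notin> ?K"
    proof
      assume "0 \<in> ?K"
      then obtain z where z: "z \<in> seg (k + int j)" "z \<in> seg (k + int i)" by auto
      have "int j < int i + m" using ij N by linarith
      then have "k + int j = k + int i + 1 \<or> k + int j = k + int i + m - 1" using meet[of "k + int i" "k + int j" z] z ij by auto
      then show False using ij N False by linarith
    qed
    note Q = ang_quad[OF conv comp this]
    have S: "u j \<in> seg (k + int j)" "u (Suc j) \<in> seg (k + int j)" for j
      by (simp_all add: u_def add.assoc add.commute[of 1])
    have "D i j = u j - u i" "D i (Suc j) = u (Suc j) - u i" "D (Suc i) j = u j - u (Suc i)" "D (Suc i) (Suc j) = u (Suc j) - u (Suc i)"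
      using False ij by (auto simp: D_def)
    then show ?thesis using S[of i] S[of j] by (simp only:) (intro Q, blast+)
  qed
  have rows: "(\<Sum>l<i. ang (D l (Suc j)) (D (Suc l) (Suc j))) + ang (D 0 j) (D 0 (Suc j))
     = (\<Sum>l<i. ang (D l j) (D (Suc l) j)) + ang (D i j) (D i (Suc j))" if "i < j" "j < N" for i j
    using that
  proof (induction i)
    case (Suc i)
    then show ?case using quad[of i j] by simp
  qed simp
  \<comment> \<open>The angle sum along row 0 from column 1 to column \<open>j\<close>, and then
    along column \<open>j\<close> from row 0 to row \<open>i\<close>. Passing from one diagonal
    position to the next adds one turning angle.\<close>
  define L where "L i j = (\<Sum>l\<in>{1..<j}. ang (D 0 l) (D 0 (Suc l))) + (\<Sum>l<i. ang (D l j) (D (Suc l) j))" for i j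
  have diag: "L j (Suc j) - L (j - 1) j = ang (g (j - 1)) (g j)" if j: "1 \<le> j" "j < N" for j
  proof -
    obtain i where i: "j = Suc i" using j by (cases j) auto
    have "L j (Suc j) - L (j - 1) j = ang (D i j) (D i (Suc j)) + ang (D i (Suc j)) (D j (Suc j))"
      using rows[of i j] j unfolding L_def i by simp
    moreover have "D i j = g i" "D j (Suc j) = g j" "D i (Suc j) = g i + g j" using j N unfolding i by (auto simp: D_def g_def)
    ultimately have "L j (Suc j) - L (j - 1) j = ang (g i) (g i + g j) + ang (g i + g j) (g j)" by (simp only:)
    also have "ang (g i) (g i + g j) + ang (g i + g j) (g j) = ang (g i) (g j)"
    proof (rule ang_triangle)
      have "crs (e (k + int i)) (e (k + int j)) \<noteq> 0" using bend[of "k + int j"] by (simp add: i add.commute add.left_commute)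
      then show "crs (g i) (g j) \<noteq> 0" unfolding ge .
    qed
    finally show ?thesis by (simp add: i)
  qed
  have "(\<Sum>j\<in>{1..<N}. ang (g (j - 1)) (g j)) = (\<Sum>j\<in>{1..<N}. L (Suc j - 1) (Suc j) - L (j - 1) j)"
    by (rule sum.cong) (use diag in auto)
  also have "\<dots> = L (N - 1) N - L 0 1" using sum_Suc_diff'[of 1 N "\<lambda>j. L (j - 1) j"] N by simp
  also have "L 0 1 = 0" by (simp add: L_def)
  finally have tot: "(\<Sum>j\<in>{1..<N}. ang (g (j - 1)) (g j)) = L (N - 1) N" by simp
  have une: "0 < inner w (u 0 - u j)" if "1 \<le> j" "j < N" for j
    using ext v_neq_mod[of "int j" k] that N by (simp add: u_def)
  define g0 gl where "g0 = g 0" and "gl = g (N - 1)"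
  have gl: "gl = u 0 - u (N - 1)" using N uN by (simp add: gl_def g_def)
  have g0: "g0 = u 1 - u 0" by (simp add: g0_def g_def)
  have gle: "gl = e (k - 1)"
  proof -
    have "k + int (N - 1) = k - 1 + m" using N by auto
    then show ?thesis unfolding gl_def ge by (simp only: e_per)
  qed
  have g0e: "g0 = e k" unfolding g0_def ge by simp
  \<comment> \<open>All secants from the extreme vertex lie in the half-plane opposite to
    \<open>w\<close>, so their angles telescope; the secants towards it, in \<open>s2\<close>, lie
    in the half-plane of \<open>w\<close>.\<close>
  have s1: "(\<Sum>l\<in>{1..<N - 1}. ang (D 0 l) (D 0 (Suc l))) = ang g0 (- gl)"
  proof -
    have "(\<Sum>l\<in>{1..<N - 1}. ang (D 0 l) (D 0 (Suc l))) = ang (D 0 1) (D 0 (N - 1))"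
    proof (rule ang_telescope[where w = "- w"])
      fix l assume "l \<in> {1..N - 1}"
      then have l: "l \<in> {1..N - 1}" and lN: "1 \<le> l" "l < N" using N by auto
      from l have "D 0 l = u l - u 0" using N by (auto simp: D_def)
      then show "0 < inner (- w) (D 0 l)" using une[of l] lN by (simp add: inner_diff_right)
    qed (use N in auto)
    moreover have "D 0 1 = g0" "D 0 (N - 1) = - gl" using N by (auto simp: D_def g0 gl)
    ultimately show ?thesis by (simp only:)
  qed
  have s2: "(\<Sum>l\<in>{1..<N - 1}. ang (D l N) (D (Suc l) N)) = ang (- g0) gl"
  proof -
    have "(\<Sum>l\<in>{1..<N - 1}. ang (D l N) (D (Suc l) N)) = ang (D 1 N) (D (N - 1) N)"
    proof (rule ang_telescope[where w = w and d = "\<lambda>l. D l N"])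
      fix l assume "l \<in> {1..N - 1}"
      then have l: "l \<in> {1..N - 1}" and lN: "1 \<le> l" "l < N" using N by auto
      from l have "D l N = u 0 - u l" using N uN by (auto simp: D_def)
      then show "0 < inner w (D l N)" using une[of l] lN by simp
    qed (use N in auto)
    moreover have "D 1 N = - g0" "D (N - 1) N = gl" using N uN by (auto simp: D_def g0 gl)
    ultimately show ?thesis by (simp only:)
  qed
  have mid: "ang (D 0 (N - 1)) (D 0 N) + ang (D 0 N) (D 1 N) = ang gl g0"
  proof -
    have d: "D 0 (N - 1) = - gl" "D 0 N = - gl + - g0" "D 1 N = - g0" using N uN by (auto simp: D_def g0 gl)
    have "crs gl g0 \<noteq> 0" unfolding gle g0e using bend[of k] by simp
    then have "crs (- gl) (- g0) \<noteq> 0" by (simp add: crs_minus1 crs_minus2)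
    from ang_triangle[OF this] show ?thesis unfolding d by (simp add: ang_minus)
  qed
  have t: "turn k = crs gl g0" unfolding gle g0e turn_def ..
  have r1: "{1..<N} = insert (N - 1) {1..<N - 1}" and r2: "{..<N - 1} = insert 0 {1..<N - 1}" using N by auto
  have "L (N - 1) N = ang g0 (- gl) + ang gl g0 + ang (- g0) gl"
    unfolding L_def r1 r2 using s1 s2 mid N by simp
  also have "ang (- g0) gl = ang g0 (- gl)" using ang_minus[of g0 "- gl"] by simp
  finally have L: "L (N - 1) N + ang gl g0 = 2 * (ang g0 (- gl) + ang gl g0)" by simp
  have "(\<Sum>i\<in>{k..<k+m}. ang (e (i - 1)) (e i)) = (\<Sum>j\<in>{..<N}. ang (e (k + int j - 1)) (e (k + int j)))"
    by (rule sum.reindex_bij_witness[of _ "\<lambda>j. k + int j" "\<lambda>i. nat (i - k)"]) (use N in auto)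
  also have "{..<N} = insert 0 {1..<N}" using N by auto
  also have "(\<Sum>j\<in>insert 0 {1..<N}. ang (e (k + int j - 1)) (e (k + int j))) = ang (e (k - 1)) (e k) + (\<Sum>j\<in>{1..<N}. ang (e (k + int j - 1)) (e (k + int j)))"
    by simp
  also have "(\<Sum>j\<in>{1..<N}. ang (e (k + int j - 1)) (e (k + int j))) = (\<Sum>j\<in>{1..<N}. ang (g (j - 1)) (g j))"
  proof (rule sum.cong)
    fix j assume "j \<in> {1..<N}"
    then have j: "k + int j - 1 = k + int (j - 1)" by auto
    show "ang (e (k + int j - 1)) (e (k + int j)) = ang (g (j - 1)) (g j)" unfolding ge j ..
  qed simp
  also have "ang (e (k - 1)) (e k) = ang gl g0" unfolding gle g0e ..
  also have "ang gl g0 + (\<Sum>j\<in>{1..<N}. ang (g (j - 1)) (g j)) = 2 * (ang g0 (- gl) + ang gl g0)" using tot L by simp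
  also have "ang g0 (- gl) + ang gl g0 = (if 0 < crs gl g0 then pi else - pi)"
    by (rule ang_reflect) (use t turn_nz[of k] in simp)
  finally show ?thesis unfolding t by simp
qed

lemma sum_window:
  assumes "\<And>i. g (i + m) = (g i :: real)" shows "(\<Sum>i\<in>{k..<k+m}. g i) = (\<Sum>i\<in>{0..<m}. g i)"
proof -
  have b: "bij_betw (\<lambda>i. i mod m) {k..<k+m} {0..<m}"
  proof -
    have "{x \<in> {k..<k+m}. True} = {k..<k+m}" "{x \<in> {0..<m}. True} = {0..<m}" by auto
    then show ?thesis using window_bij[of m "\<lambda>_. True" k] m3 by simp
  qed
  have "(\<Sum>i\<in>{k..<k+m}. g i) = (\<Sum>i\<in>{k..<k+m}. g (i mod m))"
    by (rule sum.cong) (use periodic_mod[of g m] assms in auto)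
  also have "\<dots> = (\<Sum>i\<in>{0..<m}. g i)" by (rule sum.reindex_bij_betw[OF b])
  finally show ?thesis .
qed

text \<open>The sign of the full turn is that of the turn at an extreme vertex, and since such a
  vertex is convex, this sign is opposite to \<open>orient\<close>.\<close>

theorem hopf: "(\<Sum>i\<in>{0..<m}. ang (e (i - 1)) (e i)) = - 2 * pi * orient"
proof -
  obtain k w where w: "\<And>j. v j \<noteq> v k \<Longrightarrow> 0 < inner w (v k - v j)" using extreme_exists by blast
  have "vertex_in k"
  proof (rule extreme_vertex_in)
    show "0 \<le> inner w (v k - v j)" for j using w[of j] by (cases "v j = v k") auto
    have "0 < inner w (v k - v (k + 1))" using w[of "k+1"] step_neq[of k] by auto
    then show "w \<noteq> 0" "0 < inner w (v k - v (k - 1)) \<or> 0 < inner w (v k - v (k + 1))" by auto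
  qed
  then have o: "orient * turn k < 0" using vertex_in_iff by simp
  have "(\<Sum>i\<in>{0..<m}. ang (e (i - 1)) (e i)) = (\<Sum>i\<in>{k..<k+m}. ang (e (i - 1)) (e i))"
  proof (rule sum_window[symmetric])
    fix i show "ang (e (i + m - 1)) (e (i + m)) = ang (e (i - 1)) (e i)"
    proof -
      have "i + m - 1 = i - 1 + m" by simp
      then show ?thesis by (simp only: e_per)
    qed
  qed
  also have "\<dots> = (if 0 < turn k then 2 * pi else - 2 * pi)" by (rule hopf_at[OF w])
  also have "\<dots> = - 2 * pi * orient" using o orient by auto
  finally show ?thesis .
qed

end

section \<open>The space of lines\<close>

definition par :: "int \<Rightarrow> real" where "par k = (if even k then 1 else - 1)"

lemma par_sq: "par k * par k = 1" by (simp add: par_def)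
lemma par_cases: "par k = 1 \<or> par k = - 1" by (simp add: par_def)

lemma hgt_par: "hgt (x + of_int k * pi) p = par k * hgt x p"
proof -
  have s: "sin (of_int k * pi) = 0" by (rule sin_zero_iff_int2[THEN iffD2]) blast
  have "cos (of_int k * pi) = par k" by (simp add: par_def mult.commute)
  then show ?thesis using s by (simp add: hgt_def sin_add cos_add algebra_simps)
qed

text \<open>Computes the generated equivalence: the relation on the right is closed under flips in
  both directions, and every one of its pairs is reached by iterated flips. All reasoning about
  representatives goes through this.\<close>

lemma mline_eq: "mline x d = mline y e \<longleftrightarrow> (\<exists>k::int. y = x + of_int k * pi \<and> e = par k * d)"
proof -
  define Q where "Q a b \<longleftrightarrow> (\<exists>k::int. fst b = fst a + of_int k * pi \<and> snd b = par k * snd a)" for a b :: "real \<times> real"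
  have Qref: "Q a a" for a unfolding Q_def by (rule exI[of _ 0]) (simp add: par_def)
  have Qstep: "Q a c" if ab: "Q a b" and bc: "flip_step b c \<or> flip_step c b" for a b c
  proof -
    obtain k :: int where k: "fst b = fst a + of_int k * pi" "snd b = par k * snd a" using ab unfolding Q_def by blast
    from bc show ?thesis
    proof
      assume "flip_step b c"
      then have "fst c = fst b + pi" "snd c = - snd b" by (auto simp: flip_step_def split_beta)
      then show ?thesis unfolding Q_def by (intro exI[of _ "k + 1"]) (auto simp: k par_def algebra_simps)
    next
      assume "flip_step c b"
      then have "fst b = fst c + pi" "snd b = - snd c" by (auto simp: flip_step_def split_beta)
      then have "fst c = fst b - pi" "snd c = - snd b" by auto
      then show ?thesis unfolding Q_def by (intro exI[of _ "k - 1"]) (auto simp: k par_def algebra_simps)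
    qed
  qed
  have QI: "Q a b" if "equivclp flip_step a b" for a b
    using that by (induction rule: equivclp_induct) (use Qref Qstep in blast)+
  have step1: "equivclp flip_step (y, e) (y + pi, - e)" for y e
    by (rule r_into_equivclp) (simp add: flip_step_def)
  have IQn: "equivclp flip_step (x, d) (x + of_nat n * pi, par (int n) * d)" for n x d
  proof (induction n)
    case 0 then show ?case by (simp add: par_def)
  next
    case (Suc n)
    have "equivclp flip_step (x + of_nat n * pi, par (int n) * d) (x + of_nat n * pi + pi, - (par (int n) * d))"
      by (rule step1)
    moreover have "x + of_nat n * pi + pi = x + of_nat (Suc n) * pi" "- (par (int n) * d) = par (int (Suc n)) * d"
      by (simp_all add: algebra_simps par_def)
    ultimately show ?case using Suc equivclp_trans by metis
  qed
  have IQ: "equivclp flip_step (x, d) (x + of_int k * pi, par k * d)" for k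
  proof (cases "0 \<le> k")
    case True then show ?thesis using IQn[of x d "nat k"] by simp
  next
    case False
    then have "equivclp flip_step (x + of_int k * pi, par k * d) (x + of_int k * pi + of_nat (nat (-k)) * pi, par (int (nat (-k))) * (par k * d))"
      by (intro IQn)
    moreover have "x + of_int k * pi + of_nat (nat (-k)) * pi = x" "par (int (nat (-k))) * (par k * d) = d" using False by (auto simp: algebra_simps par_def)
    ultimately show ?thesis using equivclp_sym by metis
  qed
  have "mline x d = mline y e \<longleftrightarrow> equivclp flip_step (x, d) (y, e)"
    unfolding mline_def by (rule moebius.abs_eq_iff)
  also have "\<dots> \<longleftrightarrow> (\<exists>k::int. y = x + of_int k * pi \<and> e = par k * d)"
  proof
    assume "equivclp flip_step (x, d) (y, e)"
    then show "\<exists>k::int. y = x + of_int k * pi \<and> e = par k * d" using QI[of "(x, d)" "(y, e)"] by (simp add: Q_def)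
  qed (use IQ in blast)
  finally show ?thesis .
qed

lemma mline_cases: obtains x d where "l = mline x d"
proof -
  obtain z where "l = abs_moebius z" by (metis Quotient3_abs_rep Quotient3_moebius)
  then show ?thesis using that[of "fst z" "snd z"] by (simp add: mline_def)
qed

lemma mline_pi: "mline (x + pi) d = mline x (- d)"
  unfolding mline_eq by (rule exI[of _ "- 1"]) (simp add: par_def)

lemma line_height_hgt: "line_height x d p = hgt x p - d" by (simp add: line_height_def hgt_def)

lemma on_line_mline: "on_line p (mline x d) \<longleftrightarrow> hgt x p = d"
proof
  assume "on_line p (mline x d)"
  then obtain y e where ye: "mline x d = mline y e" "hgt y p = e" unfolding on_line_def line_height_hgt by auto
  then obtain k :: int where k: "y = x + of_int k * pi" "e = par k * d" using mline_eq by blast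
  then have "par k * hgt x p = par k * d" using ye(2) hgt_par by simp
  then show "hgt x p = d" using par_cases[of k] by auto
qed (auto simp: on_line_def line_height_hgt)

lemma prod_par: "(par k * a - par k * d) * (par k * b - par k * d) = (a - d) * (b - d)"
  using par_cases[of k] by (auto simp: algebra_simps)

lemma opposite_sides_mline: "opposite_sides (mline x d) a b \<longleftrightarrow> (hgt x a - d) * (hgt x b - d) \<le> 0"
proof
  assume "opposite_sides (mline x d) a b"
  then obtain y e where ye: "mline x d = mline y e" "(hgt y a - e) * (hgt y b - e) \<le> 0"
    unfolding opposite_sides_def line_height_hgt by auto
  then obtain k :: int where k: "y = x + of_int k * pi" "e = par k * d" using mline_eq by blast
  show "(hgt x a - d) * (hgt x b - d) \<le> 0" using ye(2) unfolding k hgt_par prod_par .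
qed (auto simp: opposite_sides_def line_height_hgt)

lemma same_side_mline: "same_side (mline x d) a b \<longleftrightarrow> (hgt x a - d) * (hgt x b - d) \<ge> 0"
proof
  assume "same_side (mline x d) a b"
  then obtain y e where ye: "mline x d = mline y e" "(hgt y a - e) * (hgt y b - e) \<ge> 0"
    unfolding same_side_def line_height_hgt by auto
  then obtain k :: int where k: "y = x + of_int k * pi" "e = par k * d" using mline_eq by blast
  show "(hgt x a - d) * (hgt x b - d) \<ge> 0" using ye(2) unfolding k hgt_par prod_par .
qed (auto simp: same_side_def line_height_hgt)

lemma dual_point_eq: "mline x d \<in> dual_point p \<longleftrightarrow> hgt x p = d"
  by (simp add: dual_point_def on_line_mline)

lemma real_antiperiodic:
  assumes "\<And>x::real. f (x + pi) = - f x" shows "f (x + of_int k * pi) = par k * f x"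
proof -
  have n: "f (x + of_nat n * pi) = par (int n) * f x" for n x
  proof (induction n)
    case (Suc n)
    have "x + of_nat (Suc n) * pi = (x + of_nat n * pi) + pi" by (simp add: algebra_simps)
    then show ?case using assms[of "x + of_nat n * pi"] Suc by (simp only:) (simp add: par_def)
  qed (simp add: par_def)
  show ?thesis
  proof (cases "0 \<le> k")
    case True then show ?thesis using n[of x "nat k"] by simp
  next
    case False
    have "f x = par (int (nat (-k))) * f (x + of_int k * pi)" using n[of "x + of_int k * pi" "nat (-k)"] False by (simp add: algebra_simps)
    then show ?thesis using False by (auto simp: par_def split: if_splits)
  qed
qed

text \<open>Antiperiodicity makes all representatives of a line agree, so a pseudoline contains
  exactly one line for each angle. It follows that its function is unique.\<close>

lemma represents_mem: assumes "represents f \<gamma>" shows "mline x d \<in> \<gamma> \<longleftrightarrow> d = f x"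
proof
  assume "mline x d \<in> \<gamma>"
  then obtain y where "mline x d = mline y (f y)" using assms by (auto simp: represents_def)
  then obtain k :: int where k: "y = x + of_int k * pi" "f y = par k * d" using mline_eq by blast
  moreover have "f y = par k * f x" unfolding k(1) using real_antiperiodic[of f x k] assms by (simp add: represents_def)
  ultimately show "d = f x" using par_cases[of k] by auto
qed (use assms in \<open>auto simp: represents_def\<close>)

lemma represents_unique: "represents f \<gamma> \<Longrightarrow> represents g \<gamma> \<Longrightarrow> f = g"
  using represents_mem by blast

lemma represents_inj: "represents f \<gamma> \<Longrightarrow> represents f \<mu> \<Longrightarrow> \<gamma> = \<mu>"
  by (simp add: represents_def)

lemma represents_dual: "represents (\<lambda>x. hgt x p) (dual_point p)"
proof -
  have "l \<in> dual_point p \<longleftrightarrow> l \<in> range (\<lambda>x. mline x (hgt x p))" for l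
  proof (cases l rule: mline_cases)
    case (1 x d)
    show ?thesis
    proof
      assume "l \<in> dual_point p"
      then show "l \<in> range (\<lambda>x. mline x (hgt x p))" using 1 dual_point_eq by auto
    next
      assume "l \<in> range (\<lambda>x. mline x (hgt x p))"
      then show "l \<in> dual_point p" using dual_point_eq by auto
    qed
  qed
  then have "dual_point p = range (\<lambda>x. mline x (hgt x p))" by blast
  then show ?thesis unfolding represents_def by (auto intro: continuous_hgt)
qed

lemma crosses_at_represents:
  assumes "represents f \<gamma>" "represents g \<mu>"
  shows "crosses_at \<gamma> \<mu> z \<longleftrightarrow> (\<exists>x. z = mline x (f x) \<and> f x = g x \<and>
    (\<exists>\<epsilon>>0. \<forall>s\<in>{x - \<epsilon><..<x}. \<forall>t\<in>{x<..<x + \<epsilon>}. (f s - g s) * (f t - g t) < 0))"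
  unfolding crosses_at_def using represents_unique assms by metis

lemma touches_at_represents:
  assumes "represents f \<gamma>" "represents g \<mu>"
  shows "touches_at \<gamma> \<mu> z \<longleftrightarrow> (\<exists>x. z = mline x (f x) \<and> f x = g x \<and>
    (\<exists>\<epsilon>>0. \<forall>s\<in>{x - \<epsilon><..<x}. \<forall>t\<in>{x<..<x + \<epsilon>}. (f s - g s) * (f t - g t) > 0))"
  unfolding touches_at_def using represents_unique assms by metis

text \<open>The difference of the heights is a multiple of a sine, which changes its sign at its
  only zero in a period.\<close>

lemma crossing_dual:
  assumes "p \<noteq> q" "hgt x p = hgt x q" shows "crossing (dual_point p) (dual_point q) = mline x (hgt x p)"
  unfolding crossing_def
proof (rule the_equality)
  obtain c where c: "q - p = of_real c * cis x" using assms(2) hgt_eq_dir by blast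
  have c0: "c \<noteq> 0" using c assms(1) by auto
  have h: "hgt y p - hgt y q = - (c * sin (x - y))" for y using hgt_dir[OF c, of y] by simp
  have "(hgt s p - hgt s q) * (hgt t p - hgt t q) < 0" if "s \<in> {x - pi<..<x}" "t \<in> {x<..<x + pi}" for s t
  proof -
    have "0 < sin (x - s)" using sin_gt_zero[of "x - s"] that by simp
    moreover have "sin (x - t) < 0" using sin_gt_zero[of "t - x"] sin_minus[of "t - x"] that by simp
    ultimately have "sin (x - s) * sin (x - t) < 0" by (rule mult_pos_neg)
    moreover have "0 < c * c" using c0 not_real_square_gt_zero[of c] by blast
    ultimately have "(c * c) * (sin (x - s) * sin (x - t)) < 0" using mult_pos_neg by blast
    then show ?thesis unfolding h by (simp add: algebra_simps)
  qed
  then show "crosses_at (dual_point p) (dual_point q) (mline x (hgt x p))"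
    unfolding crosses_at_represents[OF represents_dual represents_dual]
    using assms(2) pi_gt_zero by (intro exI[of _ x] conjI exI[of _ pi]) auto
next
  fix z assume "crosses_at (dual_point p) (dual_point q) z"
  then obtain y where y: "z = mline y (hgt y p)" "hgt y p = hgt y q"
    unfolding crosses_at_represents[OF represents_dual represents_dual] by blast
  then obtain k :: int where k: "y = x + of_int k * pi" using hgt_same_dir[OF assms] by blast
  have "mline x (hgt x p) = mline y (hgt y p)" unfolding mline_eq using k hgt_par by blast
  then show "z = mline x (hgt x p)" using y by simp
qed

subsection \<open>The first level\<close>

lemma open_moebius_iff: "open U \<longleftrightarrow> open {z. mline (fst z) (snd z) \<in> U}"
  unfolding open_moebius_def mline_def by simp

lemma closed_moebius_iff: "closed U \<longleftrightarrow> closed {z. mline (fst z) (snd z) \<in> U}"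
proof -
  have "- {z. mline (fst z) (snd z) \<in> U} = {z. mline (fst z) (snd z) \<in> - U}" by auto
  then show ?thesis unfolding closed_def open_moebius_iff by simp
qed

lemma continuous_mline: "continuous_on A (\<lambda>z. mline (fst z) (snd z))"
proof -
  have "continuous_on UNIV (\<lambda>z. mline (fst z) (snd z))"
    unfolding continuous_on_open_vimage[OF open_UNIV] vimage_def using open_moebius_iff by auto
  then show ?thesis using continuous_on_subset by blast
qed

lemma continuous_hgt2: "continuous_on A (\<lambda>z::real \<times> real. hgt (fst z) p)"
  unfolding hgt_def by (intro continuous_intros)

lemma hgt_bound: "\<bar>hgt x p\<bar> \<le> cmod p"
proof -
  have "hgt x p = inner (\<i> * cis x) p" by (simp add: hgt_crs crs_inner)
  also have "\<bar>\<dots>\<bar> \<le> cmod (\<i> * cis x) * cmod p" by (rule Cauchy_Schwarz_ineq2)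
  finally show ?thesis by (simp add: norm_mult)
qed

text \<open>A predicate respecting a single flip respects all of them, so sets of lines may be
  defined by a representative and tested at any other.\<close>

lemma invariant_mline:
  assumes "\<And>x d. R (x + pi) (- d) \<longleftrightarrow> R x d" shows "mline x d \<in> {l. \<exists>x d. l = mline x d \<and> R x d} \<longleftrightarrow> R x d"
proof -
  have n: "R (x + of_nat n * pi) (par (int n) * d) \<longleftrightarrow> R x d" for n x d
  proof (induction n)
    case (Suc n)
    have "R (x + of_nat (Suc n) * pi) (par (int (Suc n)) * d) = R ((x + of_nat n * pi) + pi) (- (par (int n) * d))"
      by (simp add: algebra_simps par_def)
    then show ?case using assms Suc by simp
  qed (simp add: par_def)
  have z: "R (x + of_int k * pi) (par k * d) \<longleftrightarrow> R x d" for k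
  proof (cases "0 \<le> k")
    case True then show ?thesis using n[of x "nat k" d] by simp
  next
    case False
    then have "par (int (nat (-k))) * (par k * d) = d" "x + of_int k * pi + of_nat (nat (-k)) * pi = x"
      by (auto simp: par_def algebra_simps)
    then show ?thesis using n[of "x + of_int k * pi" "nat (-k)" "par k * d"] by (simp only:)
  qed
  show ?thesis
  proof
    assume "mline x d \<in> {l. \<exists>x d. l = mline x d \<and> R x d}"
    then obtain y e where ye: "mline x d = mline y e" "R y e" by blast
    then obtain k :: int where "y = x + of_int k * pi" "e = par k * d" using mline_eq by blast
    then show "R x d" using z ye(2) by simp
  qed blast
qed

locale pset =
  fixes P :: "complex set" assumes fin: "finite P" and ne: "P \<noteq> {}"
begin

text \<open>The lines with all points strictly on one side. Both inequalities are needed to make the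
  condition independent of the representative; the set turns out to be the external face.\<close>

definition above :: "moebius set" where
  "above = {l. \<exists>x d. l = mline x d \<and> ((\<forall>p\<in>P. hgt x p < d) \<or> (\<forall>p\<in>P. d < hgt x p))}"

definition between :: "moebius set" where
  "between = {l. \<exists>x d. l = mline x d \<and> ((\<forall>p\<in>P. hgt x p \<noteq> d) \<and> (\<exists>p\<in>P. hgt x p < d) \<and> (\<exists>p\<in>P. d < hgt x p))}"

lemma support_iff: "mline x d \<in> support (dual_points P) \<longleftrightarrow> (\<exists>p\<in>P. hgt x p = d)"
  by (auto simp: support_def dual_points_def dual_point_eq)

lemma above_iff: "mline x d \<in> above \<longleftrightarrow> (\<forall>p\<in>P. hgt x p < d) \<or> (\<forall>p\<in>P. d < hgt x p)"
  unfolding above_def by (rule invariant_mline) auto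

lemma between_iff: "mline x d \<in> between \<longleftrightarrow> (\<forall>p\<in>P. hgt x p \<noteq> d) \<and> (\<exists>p\<in>P. hgt x p < d) \<and> (\<exists>p\<in>P. d < hgt x p)"
  unfolding between_def by (rule invariant_mline) auto

lemma partition: "l \<notin> support (dual_points P) \<longleftrightarrow> l \<in> above \<or> l \<in> between"
proof (cases l rule: mline_cases)
  case (1 x d)
  show ?thesis unfolding 1 support_iff above_iff between_iff by (fastforce simp: neq_iff)
qed

lemma above_between: "above \<inter> between = {}"
proof -
  have "\<not> (l \<in> above \<and> l \<in> between)" for l
  proof (cases l rule: mline_cases)
    case (1 x d)
    show ?thesis unfolding 1 above_iff between_iff by (meson less_asym)
  qed
  then show ?thesis by blast
qed

lemma open_strict:
  "open {z::real \<times> real. hgt (fst z) p < snd z}" "open {z::real \<times> real. snd z < hgt (fst z) p}"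
  by (intro open_Collect_less continuous_hgt2 continuous_intros)+

lemma closed_weak:
  "closed {z::real \<times> real. hgt (fst z) p \<le> snd z}" "closed {z::real \<times> real. snd z \<le> hgt (fst z) p}"
  "closed {z::real \<times> real. hgt (fst z) p = snd z}"
  by (intro closed_Collect_le closed_Collect_eq continuous_hgt2 continuous_intros)+

lemma open_above: "open above"
proof -
  have "{z. mline (fst z) (snd z) \<in> above} = (\<Inter>p\<in>P. {z. hgt (fst z) p < snd z}) \<union> (\<Inter>p\<in>P. {z. snd z < hgt (fst z) p})"
    by (auto simp: above_iff)
  also have "open \<dots>" using open_strict fin by (intro open_Un open_INT) auto
  finally show ?thesis using open_moebius_iff by blast
qed

lemma open_between: "open between"
proof -
  have "{z. mline (fst z) (snd z) \<in> between} = (\<Inter>p\<in>P. {z. hgt (fst z) p < snd z} \<union> {z. snd z < hgt (fst z) p}) \<inter>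
     ((\<Union>p\<in>P. {z. hgt (fst z) p < snd z}) \<inter> (\<Union>p\<in>P. {z. snd z < hgt (fst z) p}))"
    by (auto simp: between_iff)
  also have "open \<dots>" using open_strict fin by (intro open_Int open_INT open_UN) auto
  finally show ?thesis using open_moebius_iff by blast
qed

definition bnd :: real where "bnd = (\<Sum>p\<in>P. cmod p)"

lemma bnd: "p \<in> P \<Longrightarrow> \<bar>hgt x p\<bar> \<le> bnd"
  using hgt_bound[of x p] member_le_sum[of p P cmod] fin unfolding bnd_def by fastforce

text \<open>From every pair above all the duals a vertical ray leads up into a connected slab.
  Projecting this set gives all of \<open>above\<close>, since a line below the points becomes one
  above them when reversed.\<close>

lemma connected_above: "connected above"
proof -
  define W where "W = {z::real \<times> real. \<forall>p\<in>P. hgt (fst z) p < snd z}"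
  define slab where "slab = {z::real \<times> real. bnd < snd z}"
  have "slab \<subseteq> W" unfolding slab_def W_def using bnd by (smt (verit) mem_Collect_eq subsetI)
  have "slab = UNIV \<times> {bnd<..}" unfolding slab_def by auto
  then have cs: "connected slab" by (simp add: connected_Times)
  define S where "S = (\<lambda>z. {fst z} \<times> {snd z..} \<union> slab) ` W"
  have "connected (\<Union>S)"
  proof (rule connected_Union)
    fix s assume "s \<in> S"
    then obtain z where z: "s = {fst z} \<times> {snd z..} \<union> slab" by (auto simp: S_def)
    have "(fst z, max (snd z) (bnd + 1)) \<in> ({fst z} \<times> {snd z..}) \<inter> slab" by (auto simp: slab_def)
    then have "({fst z} \<times> {snd z..}) \<inter> slab \<noteq> {}" by blast
    moreover have "connected ({fst z} \<times> {snd z..})" by (intro connected_Times) auto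
    ultimately show "connected s" unfolding z using cs by (intro connected_Un)
  next
    have "(0, bnd + 1) \<in> \<Inter>S" by (auto simp: S_def slab_def)
    then show "\<Inter>S \<noteq> {}" by blast
  qed
  moreover have "\<Union>S = W"
  proof (intro equalityI subsetI)
    fix y assume "y \<in> \<Union>S"
    then obtain z where z: "z \<in> W" "y \<in> {fst z} \<times> {snd z..} \<union> slab" unfolding S_def by blast
    then show "y \<in> W" using \<open>slab \<subseteq> W\<close> by (fastforce simp: W_def)
  next
    fix y assume "y \<in> W"
    then have "{fst y} \<times> {snd y..} \<union> slab \<in> S" unfolding S_def by blast
    moreover have "y \<in> {fst y} \<times> {snd y..} \<union> slab" by (cases y) simp
    ultimately show "y \<in> \<Union>S" by (rule UnionI)
  qed
  ultimately have "connected W" by simp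
  then have "connected ((\<lambda>z. mline (fst z) (snd z)) ` W)" by (intro connected_continuous_image continuous_mline)
  moreover have "(\<lambda>z. mline (fst z) (snd z)) ` W = above"
  proof (intro equalityI subsetI)
    fix l assume "l \<in> (\<lambda>z. mline (fst z) (snd z)) ` W"
    then show "l \<in> above" using above_iff by (auto simp: W_def)
  next
    fix l assume l: "l \<in> above"
    obtain x d where xd: "l = mline x d" by (rule mline_cases)
    then consider "\<forall>p\<in>P. hgt x p < d" | "\<forall>p\<in>P. d < hgt x p" using l above_iff by blast
    then show "l \<in> (\<lambda>z. mline (fst z) (snd z)) ` W"
    proof cases
      case 1
      then have "(x, d) \<in> W" by (simp add: W_def)
      then show ?thesis using xd by force
    next
      case 2
      then have "(x + pi, - d) \<in> W" by (simp add: W_def)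
      moreover have "l = mline (x + pi) (- d)" using xd mline_pi[of x "- d"] by simp
      ultimately show ?thesis by force
    qed
  qed
  ultimately show ?thesis by simp
qed

lemma unbounded_above: "\<not> bounded_lines above"
proof
  assume "bounded_lines above"
  then obtain r where r: "above \<subseteq> {mline \<theta> d |\<theta> d. \<bar>d\<bar> \<le> r}" unfolding bounded_lines_def by blast
  define d where "d = max r bnd + 1"
  have "0 \<le> bnd" unfolding bnd_def by (intro sum_nonneg) auto
  have "mline 0 d \<in> above" unfolding above_iff using bnd[of _ 0] unfolding d_def by (intro disjI1 ballI) (smt (verit))
  then obtain \<theta> d' where d': "mline 0 d = mline \<theta> d'" "\<bar>d'\<bar> \<le> r" using r by blast
  then obtain k where "d' = par k * d" using mline_eq by blast
  then have "\<bar>d'\<bar> = d" using par_cases[of k] \<open>0 \<le> bnd\<close> by (auto simp: d_def)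
  then show False using d' by (auto simp: d_def)
qed

lemma bounded_between: "bounded_lines between"
proof -
  have "l \<in> {mline \<theta> d |\<theta> d. \<bar>d\<bar> \<le> bnd}" if "l \<in> between" for l
  proof -
    obtain x d where xd: "l = mline x d" by (rule mline_cases)
    have "mline x d \<in> between" using that xd by simp
    then obtain p q where "p \<in> P" "q \<in> P" "hgt x p < d" "d < hgt x q" unfolding between_iff by blast
    then have "\<bar>d\<bar> \<le> bnd" using bnd[of p x] bnd[of q x] by linarith
    then show ?thesis using xd by blast
  qed
  then show ?thesis unfolding bounded_lines_def by blast
qed

text \<open>The complement of the support consists of two disjoint open sets. One is connected and
  unbounded, hence a component; the components inside the other are bounded.\<close>

lemma external_face_eq: "external_face (support (dual_points P)) = above"
proof -
  let ?S = "support (dual_points P)"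
  have split: "C \<subseteq> above \<or> C \<subseteq> between" if C: "C \<in> components (- ?S)" for C
  proof -
    have "connected C" "C \<subseteq> - ?S" using in_components_connected in_components_subset C by blast+
    moreover have "above \<inter> C = {} \<or> between \<inter> C = {}"
      by (rule connectedD[OF \<open>connected C\<close> open_above open_between]) (use above_between partition \<open>C \<subseteq> - ?S\<close> in auto)
    ultimately show ?thesis using partition by blast
  qed
  have aS: "above \<subseteq> - ?S" using partition by blast
  have ane: "above \<noteq> {}" using unbounded_above unfolding bounded_lines_def by fastforce
  obtain C where C: "C \<in> components (- ?S)" "above \<subseteq> C"
    using exists_component_superset[OF aS _ connected_above] ane aS by blast
  have "C \<subseteq> above" using split[OF C(1)] C(2) ane above_between by blast
  then have Ca: "C = above" using C by blast
  show ?thesis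
  proof (intro equalityI subsetI)
    fix l assume "l \<in> external_face ?S"
    then obtain K where K: "K \<in> components (- ?S)" "\<not> bounded_lines K" "l \<in> K" unfolding external_face_def by blast
    have "\<not> K \<subseteq> between" using K(2) bounded_between unfolding bounded_lines_def by blast
    then show "l \<in> above" using split[OF K(1)] K(3) by blast
  next
    fix l assume "l \<in> above"
    then show "l \<in> external_face ?S" unfolding external_face_def using C Ca unbounded_above by blast
  qed
qed

lemma closure_meets: "x \<in> closure S \<longleftrightarrow> (\<forall>U. open U \<longrightarrow> x \<in> U \<longrightarrow> U \<inter> S \<noteq> {})"
  unfolding closure_iff_nhds_not_empty by blast

lemma closure_above: "mline x d \<in> closure above \<longleftrightarrow> (\<forall>p\<in>P. hgt x p \<le> d) \<or> (\<forall>p\<in>P. d \<le> hgt x p)"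
proof
  define K where "K = {l. \<exists>x d. l = mline x d \<and> ((\<forall>p\<in>P. hgt x p \<le> d) \<or> (\<forall>p\<in>P. d \<le> hgt x p))}"
  have K: "mline x d \<in> K \<longleftrightarrow> (\<forall>p\<in>P. hgt x p \<le> d) \<or> (\<forall>p\<in>P. d \<le> hgt x p)" for x d
    unfolding K_def by (rule invariant_mline) auto
  have "{z. mline (fst z) (snd z) \<in> K} = (\<Inter>p\<in>P. {z. hgt (fst z) p \<le> snd z}) \<union> (\<Inter>p\<in>P. {z. snd z \<le> hgt (fst z) p})"
    by (auto simp: K)
  also have "closed \<dots>" using closed_weak by (intro closed_Un closed_INT) auto
  finally have "closed K" using closed_moebius_iff by blast
  moreover have "above \<subseteq> K" unfolding above_def K_def by (auto intro: less_imp_le)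
  ultimately have "closure above \<subseteq> K" by (rule closure_minimal[rotated])
  then show "mline x d \<in> closure above \<Longrightarrow> (\<forall>p\<in>P. hgt x p \<le> d) \<or> (\<forall>p\<in>P. d \<le> hgt x p)" using K by blast
next
  assume a: "(\<forall>p\<in>P. hgt x p \<le> d) \<or> (\<forall>p\<in>P. d \<le> hgt x p)"
  show "mline x d \<in> closure above" unfolding closure_meets
  proof (intro allI impI)
    fix U assume U: "open U" "mline x d \<in> U"
    then have "open {z. mline (fst z) (snd z) \<in> U}" "(x, d) \<in> {z. mline (fst z) (snd z) \<in> U}" using open_moebius_iff by auto
    then obtain e where e: "e > 0" "ball (x, d) e \<subseteq> {z. mline (fst z) (snd z) \<in> U}" using open_contains_ball by blast
    from a show "U \<inter> above \<noteq> {}"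
    proof
      assume a: "\<forall>p\<in>P. hgt x p \<le> d"
      have "(x, d + e/2) \<in> ball (x, d) e" using e(1) by (simp add: dist_Pair_Pair dist_real_def)
      then have "mline x (d + e/2) \<in> U" using e(2) by auto
      moreover have "mline x (d + e/2) \<in> above" unfolding above_iff using a e(1) by fastforce
      ultimately show ?thesis by blast
    next
      assume a: "\<forall>p\<in>P. d \<le> hgt x p"
      have "(x, d - e/2) \<in> ball (x, d) e" using e(1) by (simp add: dist_Pair_Pair dist_real_def)
      then have "mline x (d - e/2) \<in> U" using e(2) by auto
      moreover have "mline x (d - e/2) \<in> above" unfolding above_iff using a e(1) by fastforce
      ultimately show ?thesis by blast
    qed
  qed
qed

lemma first_level_iff:
  assumes p: "p \<in> P"
  shows "mline x (hgt x p) \<in> first_level (dual_points P) \<longleftrightarrow> (\<forall>q\<in>P. hgt x q \<le> hgt x p) \<or> (\<forall>q\<in>P. hgt x p \<le> hgt x q)"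
proof -
  have "first_level (dual_points P) = closure above - above"
    unfolding first_level_def external_face_eq frontier_def using open_above by (simp add: interior_open)
  moreover have "mline x (hgt x p) \<notin> above" unfolding above_iff using p by auto
  ultimately show ?thesis using closure_above by blast
qed

lemma rest_iff: "mline x d \<in> support (dual_points P) - first_level (dual_points P) \<longleftrightarrow>
   (\<exists>p\<in>P. hgt x p = d) \<and> (\<exists>q\<in>P. d < hgt x q) \<and> (\<exists>r\<in>P. hgt x r < d)"
proof (cases "\<exists>p\<in>P. hgt x p = d")
  case True
  then obtain p where p: "p \<in> P" "hgt x p = d" by blast
  show ?thesis unfolding Diff_iff support_iff using first_level_iff[OF p(1), of x] p by (auto simp: not_le)
next
  case False
  then show ?thesis by (simp add: support_iff)
qed

end

lemma sep_pi: "sep P (x + pi) (- d) \<longleftrightarrow> sep P x d"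
  unfolding sep_def by auto

text \<open>The condition \<open>sep\<close> is closed and holds off the first level. Conversely, a
  line with this property on the first level contains a second point \<open>p'\<close>. A third
  point \<open>s\<close> lies off the line, and a slight rotation about \<open>p\<close> in the
  right sense separates \<open>p'\<close> from \<open>s\<close>, so that the line is a limit of
  lines outside the first level.\<close>

lemma (in pts) removed_iff: "mline x d \<in> support_minus_first_level (dual_points P) \<longleftrightarrow> sep P x d"
proof -
  have "pset P" using finP n3 by (intro pset.intro) auto
  then interpret ps: pset P .
  let ?A = "support (dual_points P) - first_level (dual_points P)"
  define K where "K = {l. \<exists>x d. l = mline x d \<and> sep P x d}"
  have K: "mline x d \<in> K \<longleftrightarrow> sep P x d" for x d
    unfolding K_def by (rule invariant_mline) (rule sep_pi)
  have "{z. mline (fst z) (snd z) \<in> K} = (\<Union>p\<in>P. {z. hgt (fst z) p = snd z} \<inter>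
      ((\<Union>q\<in>P-{p}. {z. snd z \<le> hgt (fst z) q}) \<inter> (\<Union>r\<in>P-{p}. {z. hgt (fst z) r \<le> snd z})))"
    unfolding K sep_def by blast
  also have "closed \<dots>" using finP by (intro closed_UN closed_Int ps.closed_weak finite_Diff ballI)
  finally have "closed K" using closed_moebius_iff by blast
  moreover have "?A \<subseteq> K"
  proof
    fix l assume l: "l \<in> ?A"
    obtain x d where xd: "l = mline x d" by (rule mline_cases)
    then obtain p q r where "p \<in> P" "hgt x p = d" "q \<in> P" "d < hgt x q" "r \<in> P" "hgt x r < d" using l ps.rest_iff by blast
    then have "sep P x d" unfolding sep_def by (intro bexI[of _ p] conjI bexI[of _ q] bexI[of _ r]) auto
    then show "l \<in> K" using xd K by simp
  qed
  ultimately have "closure ?A \<subseteq> K" by (rule closure_minimal[rotated])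
  then have imp1: "sep P x d" if "mline x d \<in> closure ?A" using K that by blast
  have imp2: "mline x d \<in> closure ?A" if "sep P x d" for x d
  proof (cases "mline x d \<in> ?A")
    case False
    obtain p q r where p: "p \<in> P" "hgt x p = d" "q \<in> P" "q \<noteq> p" "d \<le> hgt x q" "r \<in> P" "r \<noteq> p" "hgt x r \<le> d" using \<open>sep P x d\<close> unfolding sep_def by blast
    have "\<exists>p'\<in>P. p' \<noteq> p \<and> hgt x p' = hgt x p"
    proof (rule ccontr)
      assume "\<not> ?thesis"
      then have "hgt x q \<noteq> d" "hgt x r \<noteq> d" using p by auto
      then have "d < hgt x q" "hgt x r < d" using p by auto
      then show False using False ps.rest_iff p by blast
    qed
    then obtain p' where p': "p' \<in> P" "p' \<noteq> p" "hgt x p' = hgt x p" by blast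
    obtain s where s: "s \<in> P" "s \<noteq> p" "s \<noteq> p'" using third by blast
    have sne: "hgt x s \<noteq> hgt x p" using off_line[OF p(1) p'(1) p'(2)[symmetric] p'(3)[symmetric] s(1)] s by blast
    obtain c where c: "p' - p = of_real c * cis x" using hgt_eq_dir[of x p p'] p'(3) by metis
    have c0: "c \<noteq> 0" using c p' by auto
    have tend: "((\<lambda>y. hgt y p) \<longlongrightarrow> d) F" if "F \<le> at x" for F
      using isCont_hgt[of x p] p(2) tendsto_mono[OF that] unfolding isCont_def by blast
    show ?thesis unfolding ps.closure_meets
    proof (intro allI impI)
      fix U assume U: "open U" "mline x d \<in> U"
      then have oU: "open {z. mline (fst z) (snd z) \<in> U}" "(x, d) \<in> {z. mline (fst z) (snd z) \<in> U}" using open_moebius_iff by auto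
      have ev: "\<forall>\<^sub>F y in at x. mline y (hgt y p) \<in> U"
      proof -
        have "((\<lambda>y. (y, hgt y p)) \<longlongrightarrow> (x, d)) (at x)" by (intro tendsto_Pair tend) auto
        from topological_tendstoD[OF this oU] show ?thesis by simp
      qed
      have ord: "\<forall>\<^sub>F y in at_left x. 0 < c * (hgt y p' - hgt y p)" "\<forall>\<^sub>F y in at_right x. c * (hgt y p' - hgt y p) < 0"
      proof -
        have h: "hgt y p' - hgt y p = c * sin (x - y)" for y using hgt_dir[OF c, of y] by simp
        have cc: "0 < c * c" using c0 not_real_square_gt_zero[of c] by blast
        have l: "0 < sin (x - y)" if "x - pi < y" "y < x" for y using sin_gt_zero[of "x - y"] that by simp
        have r: "sin (x - y) < 0" if "y < x + pi" "x < y" for y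
          using sin_gt_zero[of "y - x"] that sin_minus[of "y - x"] by simp
        show "\<forall>\<^sub>F y in at_left x. 0 < c * (hgt y p' - hgt y p)" unfolding eventually_at_left_field h mult.assoc[symmetric]
          by (rule exI[of _ "x - pi"]) (use l cc in auto)
        show "\<forall>\<^sub>F y in at_right x. c * (hgt y p' - hgt y p) < 0" unfolding eventually_at_right_field h mult.assoc[symmetric]
          by (rule exI[of _ "x + pi"]) (use r cc in \<open>auto intro!: mult_pos_neg\<close>)
      qed
      have fin: "U \<inter> ?A \<noteq> {}" if F: "F \<le> at x" "F \<noteq> bot" and o: "\<forall>\<^sub>F y in F. (hgt y s - hgt y p) * (hgt y p' - hgt y p) < 0" for F
      proof -
        have "\<forall>\<^sub>F y in F. mline y (hgt y p) \<in> U" using ev filter_leD[OF F(1)] by blast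
        with o have "\<forall>\<^sub>F y in F. (hgt y s - hgt y p) * (hgt y p' - hgt y p) < 0 \<and> mline y (hgt y p) \<in> U" by eventually_elim simp
        then obtain y where y: "(hgt y s - hgt y p) * (hgt y p' - hgt y p) < 0" "mline y (hgt y p) \<in> U"
          using eventually_happens'[OF F(2)] by blast
        have "hgt y p < hgt y s \<and> hgt y p' < hgt y p \<or> hgt y p < hgt y p' \<and> hgt y s < hgt y p"
          using y(1) by (auto simp: mult_less_0_iff)
        then have "mline y (hgt y p) \<in> ?A" using ps.rest_iff[of y "hgt y p"] p p' s by blast
        then show ?thesis using y by blast
      qed
      define \<sigma> where "\<sigma> = hgt x s - hgt x p"
      have \<sigma>: "\<sigma> \<noteq> 0" using sne by (simp add: \<sigma>_def)
      have evs: "\<forall>\<^sub>F y in at x. 0 < \<sigma> * (hgt y s - hgt y p)"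
      proof -
        have "((\<lambda>y. \<sigma> * (hgt y s - hgt y p)) \<longlongrightarrow> \<sigma> * \<sigma>) (at x)"
          unfolding \<sigma>_def using isCont_hgt unfolding isCont_def by (intro tendsto_intros)
        moreover have "0 < \<sigma> * \<sigma>" using \<sigma> not_real_square_gt_zero[of \<sigma>] by blast
        ultimately show ?thesis by (rule order_tendstoD(1))
      qed
      have comb: "a * b < 0" if "0 < \<sigma> * a" "0 < c * b" "\<sigma> * c < 0" for a b :: real
        using that by (auto simp: zero_less_mult_iff mult_less_0_iff)
      have comb': "a * b < 0" if "0 < \<sigma> * a" "c * b < 0" "0 < \<sigma> * c" for a b :: real
        using that by (auto simp: zero_less_mult_iff mult_less_0_iff)
      have "\<sigma> * c \<noteq> 0" using \<sigma> c0 by simp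
      then consider "\<sigma> * c < 0" | "0 < \<sigma> * c" by linarith
      then show "U \<inter> ?A \<noteq> {}"
      proof cases
        case 1
        have le: "at_left x \<le> at x" by (simp add: at_le)
        have "\<forall>\<^sub>F y in at_left x. 0 < \<sigma> * (hgt y s - hgt y p)" using evs filter_leD[OF le] by blast
        with ord(1) have "\<forall>\<^sub>F y in at_left x. (hgt y s - hgt y p) * (hgt y p' - hgt y p) < 0"
          by eventually_elim (rule comb[OF _ _ 1])
        then show ?thesis by (rule fin[OF le trivial_limit_at_left_real])
      next
        case 2
        have le: "at_right x \<le> at x" by (simp add: at_le)
        have "\<forall>\<^sub>F y in at_right x. 0 < \<sigma> * (hgt y s - hgt y p)" using evs filter_leD[OF le] by blast
        with ord(2) have "\<forall>\<^sub>F y in at_right x. (hgt y s - hgt y p) * (hgt y p' - hgt y p) < 0"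
          by eventually_elim (rule comb'[OF _ _ 2])
        then show ?thesis by (rule fin[OF le trivial_limit_at_right_real])
      qed
    qed
  next
    case True
    then show ?thesis by (rule subsetD[OF closure_subset])
  qed
  show ?thesis unfolding support_minus_first_level_def
  proof
    assume "mline x d \<in> closure ?A"
    then show "sep P x d" by (rule imp1)
  next
    assume "sep P x d"
    then show "mline x d \<in> closure ?A" by (rule imp2)
  qed
qed

section \<open>Rolling lines and simple polygons\<close>

context roll
begin

lemma rho: "0 < t (i + 1) - t i" "t (i + 1) - t i < pi"
  using t_step[of i] t_gap[of i] by auto

lemma crs_edges: "crs (v i - v (i - 1)) (v (i + 1) - v i) = c (i - 1) * c i * sin (t (i + 1) - t i)"
  using edge[of i] edge[of "i - 1"] by (simp add: crs_scale1 crs_scale2 crs_cis)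

lemma sin_rho: "0 < sin (t (i + 1) - t i)"
  by (rule sin_gt_zero[OF rho])

lemma corner_or: "corner i \<longleftrightarrow> \<not> 0 < c (i - 1) * c i"
proof -
  have "c (i - 1) * c i \<noteq> 0" using c_nz by simp
  then show ?thesis unfolding corner_def by linarith
qed

lemma turn_neg: "crs (v i - v (i - 1)) (v (i + 1) - v i) < 0 \<longleftrightarrow> corner i"
  unfolding crs_edges corner_def using sin_rho[of i] by (simp add: mult_less_0_iff zero_less_mult_iff)

text \<open>At a corner the travel along the rolling line is reversed, which changes the turn of the
  edges from the rotation of the line by pi.\<close>

lemma ang_edges: "ang (v i - v (i - 1)) (v (i + 1) - v i) = t (i + 1) - t i - (if corner i then pi else 0)"
proof -
  define \<rho> where "\<rho> = t (i + 1) - t i"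
  have \<rho>: "0 < \<rho>" "\<rho> < pi" using rho[of i] by (auto simp: \<rho>_def)
  define r where "r = c i / c (i - 1)"
  have r0: "r \<noteq> 0" using c_nz by (simp add: r_def)
  have "(v (i + 1) - v i) / (v i - v (i - 1)) = of_real r * cis \<rho>"
    using edge[of i] edge[of "i - 1"] by (simp add: r_def \<rho>_def cis_divide[symmetric])
  note q = this
  show ?thesis
  proof (cases "corner i")
    case True
    then have "c (i - 1) * c i < 0" by (simp add: corner_def)
    then have "0 < - r" by (auto simp: r_def divide_less_0_iff mult_less_0_iff)
    moreover have "of_real r * cis \<rho> = rcis (- r) (\<rho> - pi)"
      by (simp add: rcis_def cis_divide[symmetric])
    ultimately have "Arg (of_real r * cis \<rho>) = \<rho> - pi" using \<rho> by (intro Arg_unique') auto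
    then show ?thesis using True unfolding ang_def q \<rho>_def by simp
  next
    case False
    then have "0 < c (i - 1) * c i" by (simp add: corner_or)
    then have "0 < r" by (auto simp: r_def zero_less_divide_iff zero_less_mult_iff)
    moreover have "of_real r * cis \<rho> = rcis r \<rho>" by (simp add: rcis_def)
    ultimately have "Arg (of_real r * cis \<rho>) = \<rho>" using \<rho> by (intro Arg_unique') auto
    then show ?thesis using False unfolding ang_def q \<rho>_def by simp
  qed
qed

lemma spoly: assumes n3: "ncorners = 3" shows "spoly m v"
proof
  have "card {k\<in>{0..<m}. corner k} \<le> card {0..<m}" by (rule card_mono) auto
  then show "3 \<le> m" using n3 by (simp add: ncorners_def)
  show "v (i + m) = v i" for i by (rule v_per)
  show "crs (v i - v (i - 1)) (v (i + 1) - v i) \<noteq> 0" for i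
    unfolding crs_edges using c_nz sin_rho[of i] by simp
  show "j = i + 1 \<and> z = v j \<or> j = i + m - 1 \<and> z = v i"
    if ij: "i < j" "j < i + m" and zi: "z \<in> closed_segment (v i) (v (i + 1))" and zj: "z \<in> closed_segment (v j) (v (j + 1))" for i j z
  proof -
    obtain a where a: "0 \<le> a" "a \<le> 1" "z = v i + of_real a * (v (i + 1) - v i)" using zi by (rule segmentE)
    obtain b where b: "0 \<le> b" "b \<le> 1" "z = v j + of_real b * (v (j + 1) - v j)" using zj by (rule segmentE)
    have "j = i + 1 \<and> a = 1 \<and> b = 0 \<or> j = i + m - 1 \<and> a = 0 \<and> b = 1"
      using edges_meet[OF n3 ij a(1,2) b(1,2)] a(3) b(3) by simp
    then show ?thesis using a(3) b(3) by auto
  qed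
qed

lemma sum_rho: "(\<Sum>i\<in>{0..<m}. t (i + 1) - t i) = pi"
proof -
  have "(\<Sum>i\<in>{0..<j}. t (i + 1) - t i) = t j - t 0" if "0 \<le> j" for j using that
  proof (induction j rule: int_ge_induct)
    case (step j)
    have "{0..<j+1} = insert j {0..<j}" using step by auto
    then show ?case using step by simp
  qed simp
  then show ?thesis using m_pos t_per[of 0] by simp
qed

text \<open>The rotations of the line sum up to pi and the three corners subtract 3 pi. The total of
  -2 pi means that the interior is on the right.\<close>

lemma orient_roll: assumes n3: "ncorners = 3" shows "spoly.orient v = 1"
proof -
  interpret sp: spoly m v by (rule spoly[OF n3])
  have "- 2 * pi * sp.orient = (\<Sum>i\<in>{0..<m}. ang (v i - v (i - 1)) (v (i + 1) - v i))"
    using sp.hopf by simp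
  also have "\<dots> = (\<Sum>i\<in>{0..<m}. t (i + 1) - t i) - (\<Sum>i\<in>{0..<m}. if corner i then pi else 0)"
    by (simp add: ang_edges sum_subtractf)
  also have "(\<Sum>i\<in>{0..<m}. if corner i then pi else 0) = of_nat ncorners * pi"
    by (simp add: sum.If_cases ncorners_def Int_def)
  finally have "sp.orient * pi = 1 * pi" unfolding sum_rho n3 by simp
  then show ?thesis by simp
qed

lemma vertex_in_roll: assumes n3: "ncorners = 3" shows "spoly.vertex_in v i \<longleftrightarrow> corner i"
proof -
  interpret sp: spoly m v by (rule spoly[OF n3])
  show ?thesis unfolding sp.vertex_in_iff orient_roll[OF n3] sp.turn_def using turn_neg[of i] by simp
qed

section \<open>The function traced by a rolling line, and tangency\<close>

definition idx :: "real \<Rightarrow> int" where "idx x = (SOME i. t i \<le> x \<and> x < t (i + 1))"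

definition rollf :: "real \<Rightarrow> real" where "rollf x = hgt x (v (idx x))"

lemma idx: "t (idx x) \<le> x" "x < t (idx x + 1)"
  using someI_ex[OF t_cover[of x]] unfolding idx_def by auto

lemma idx_eq: "t i \<le> x \<Longrightarrow> x < t (i + 1) \<Longrightarrow> idx x = i"
  using idx_unique[OF idx] by blast

lemma hgt_join: "hgt (t (i + 1)) (v i) = hgt (t (i + 1)) (v (i + 1))"
  unfolding hgt_eq_dir using edge[of i] by blast

lemma rollf: assumes "t i \<le> x" "x \<le> t (i + 1)" shows "rollf x = hgt x (v i)"
proof (cases "x < t (i + 1)")
  case True then show ?thesis using idx_eq[of i x] assms by (simp add: rollf_def)
next
  case False
  then have x: "x = t (i + 1)" using assms by simp
  then have "idx x = i + 1" using t_step[of "i + 1"] by (intro idx_eq) auto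
  then show ?thesis unfolding rollf_def using hgt_join[of i] x by metis
qed

lemma rollf_pi: "rollf (x + pi) = - rollf x"
proof -
  have "t (idx x + m) = t (idx x) + pi" "t (idx x + m + 1) = t (idx x + 1) + pi"
    using t_per[of "idx x"] t_per[of "idx x + 1"] by (simp_all add: algebra_simps)
  then have "rollf (x + pi) = hgt (x + pi) (v (idx x + m))" using idx[of x] by (intro rollf) auto
  then show ?thesis by (simp add: v_per rollf_def)
qed

lemma rollf_cont: "continuous_on UNIV rollf"
proof -
  have "isCont rollf x" for x
  proof -
    let ?i = "idx x"
    have right: "(rollf \<longlongrightarrow> rollf x) (at_right x)"
    proof (rule Lim_transform_eventually)
      show "((\<lambda>y. hgt y (v ?i)) \<longlongrightarrow> rollf x) (at_right x)"
        using isCont_hgt[of x "v ?i"] tendsto_mono[of "at_right x" "at x"] unfolding isCont_def rollf_def by (simp add: at_le)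
      show "\<forall>\<^sub>F y in at_right x. hgt y (v ?i) = rollf y" unfolding eventually_at_right_field
        by (rule exI[of _ "t (?i + 1)"]) (use idx[of x] rollf[of ?i] in auto)
    qed
    obtain j where j: "t j < x" "x \<le> t (j + 1)"
    proof (cases "t ?i < x")
      case True then show ?thesis using that[of ?i] idx[of x] by auto
    next
      case False
      then have "x = t ?i" using idx(1)[of x] by simp
      then show ?thesis using that[of "?i - 1"] t_step[of "?i - 1"] by auto
    qed
    have left: "(rollf \<longlongrightarrow> rollf x) (at_left x)"
    proof (rule Lim_transform_eventually)
      have "rollf x = hgt x (v j)" using j by (intro rollf) auto
      then show "((\<lambda>y. hgt y (v j)) \<longlongrightarrow> rollf x) (at_left x)"
        using isCont_hgt[of x "v j"] tendsto_mono[of "at_left x" "at x"] unfolding isCont_def by (simp add: at_le)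
      show "\<forall>\<^sub>F y in at_left x. hgt y (v j) = rollf y" unfolding eventually_at_left_field
        by (rule exI[of _ "t j"]) (use j rollf[of j] in auto)
    qed
    show ?thesis unfolding isCont_def filterlim_at_split using left right by simp
  qed
  then show ?thesis by (simp add: continuous_on_eq_continuous_at)
qed

lemma hgt_next: "hgt x (v (i + 1)) - hgt x (v i) = c i * sin (t (i + 1) - x)"
  using hgt_dir[OF edge[of i], of x] by simp

lemma hgt_prev: "hgt x (v (i - 1)) - hgt x (v i) = c (i - 1) * sin (x - t i)"
  using hgt_next[of x "i - 1"] sin_minus[of "t i - x"] by simp

text \<open>Relative to a vertex, the heights of its neighbours are signed edge lengths times sines.
  The product of the lengths is negative exactly at corners, so the case distinction in the notion
  of a tangent amounts to one condition on the sines: the angle lies in the interval during which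
  the line rotates about this vertex.\<close>

lemma tangent_iff:
  "(\<exists>i. hgt x (v i) = d \<and> (if corner i then (hgt x (v (i - 1)) - d) * (hgt x (v (i + 1)) - d) \<le> 0
      else (hgt x (v (i - 1)) - d) * (hgt x (v (i + 1)) - d) \<ge> 0)) \<longleftrightarrow> d = rollf x"
proof
  assume d: "d = rollf x"
  let ?i = "idx x"
  have hd: "hgt x (v ?i) = d" using d by (simp add: rollf_def)
  have s: "0 \<le> sin (x - t ?i) * sin (t (?i + 1) - x)" using idx[of x] rho(2)[of ?i]
    by (intro mult_nonneg_nonneg sin_ge_zero) auto
  have pr: "(hgt x (v (?i - 1)) - d) * (hgt x (v (?i + 1)) - d) = (c (?i - 1) * c ?i) * (sin (x - t ?i) * sin (t (?i + 1) - x))"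
    unfolding hd[symmetric] hgt_next hgt_prev by simp
  show "\<exists>i. hgt x (v i) = d \<and> (if corner i then (hgt x (v (i - 1)) - d) * (hgt x (v (i + 1)) - d) \<le> 0
      else (hgt x (v (i - 1)) - d) * (hgt x (v (i + 1)) - d) \<ge> 0)"
  proof (rule exI[of _ ?i], rule conjI[OF hd], cases "corner ?i")
    case True
    then have "c (?i - 1) * c ?i \<le> 0" by (simp add: corner_def)
    then show "if corner ?i then (hgt x (v (?i - 1)) - d) * (hgt x (v (?i + 1)) - d) \<le> 0
      else (hgt x (v (?i - 1)) - d) * (hgt x (v (?i + 1)) - d) \<ge> 0" unfolding pr using True s by (simp add: mult_nonpos_nonneg)
  next
    case False
    then have "0 \<le> c (?i - 1) * c ?i" by (simp add: corner_or)
    then show "if corner ?i then (hgt x (v (?i - 1)) - d) * (hgt x (v (?i + 1)) - d) \<le> 0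
      else (hgt x (v (?i - 1)) - d) * (hgt x (v (?i + 1)) - d) \<ge> 0" unfolding pr using False s by simp
  qed
next
  assume "\<exists>i. hgt x (v i) = d \<and> (if corner i then (hgt x (v (i - 1)) - d) * (hgt x (v (i + 1)) - d) \<le> 0
      else (hgt x (v (i - 1)) - d) * (hgt x (v (i + 1)) - d) \<ge> 0)"
  then obtain i where i: "hgt x (v i) = d" "if corner i then (hgt x (v (i - 1)) - d) * (hgt x (v (i + 1)) - d) \<le> 0
      else (hgt x (v (i - 1)) - d) * (hgt x (v (i + 1)) - d) \<ge> 0" by blast
  \<comment> \<open>Moves the index by whole periods until the interval of the vertex starts at most
    a half-turn before \<open>x\<close>; then only an angle beyond \<open>t (j + 1)\<close> has to
    be excluded.\<close>
  define z where "z = \<lfloor>(x - t i) / pi\<rfloor>"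
  have "of_int z \<le> (x - t i) / pi" "(x - t i) / pi < of_int z + 1" unfolding z_def by linarith+
  then have z: "of_int z * pi \<le> x - t i" "x - t i < (of_int z + 1) * pi" by (simp_all add: pos_le_divide_eq pos_divide_less_eq)
  define j where "j = i + z * m"
  have tj: "t j \<le> x" "x < t j + pi" using z t_add[of i z] by (auto simp: j_def algebra_simps)
  have ind: "j - 1 = i - 1 + z * m" "j + 1 = i + 1 + z * m" by (auto simp: j_def)
  have vj: "v j = v i" "v (j - 1) = v (i - 1)" "v (j + 1) = v (i + 1)"
    unfolding ind unfolding j_def by (rule v_add)+
  have cj: "corner j = corner i" unfolding j_def using periodic_add[of corner m i z] corner_per by blast
  have hd: "hgt x (v j) = d" using i vj by simp
  have pr: "(hgt x (v (i - 1)) - d) * (hgt x (v (i + 1)) - d) = (c (j - 1) * c j) * (sin (x - t j) * sin (t (j + 1) - x))"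
    unfolding hd[symmetric] vj(2,3)[symmetric] hgt_next hgt_prev by simp
  have "x \<le> t (j + 1)"
  proof (rule ccontr)
    assume "\<not> x \<le> t (j + 1)"
    then have "0 < sin (x - t j)" "0 < sin (x - t (j + 1))" using tj t_step[of j] by (auto intro!: sin_gt_zero)
    then have neg: "sin (x - t j) * sin (t (j + 1) - x) < 0" using sin_minus[of "x - t (j + 1)"] by (intro mult_pos_neg) auto
    show False
    proof (cases "corner i")
      case True
      then have "c (j - 1) * c j < 0" using cj by (simp add: corner_def)
      then have "0 < (c (j - 1) * c j) * (sin (x - t j) * sin (t (j + 1) - x))" using neg by (rule mult_neg_neg)
      then show False using i(2) pr True by simp
    next
      case False
      then have "0 < c (j - 1) * c j" using cj by (simp add: corner_or)
      then have "(c (j - 1) * c j) * (sin (x - t j) * sin (t (j + 1) - x)) < 0" using neg by (rule mult_pos_neg)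
      then show False using i(2) pr False by simp
    qed
  qed
  then show "d = rollf x" using rollf[OF tj(1)] hd by simp
qed

end

section \<open>From a pseudotriangle back to its rolling line\<close>

lemma Im_divide_crs: "Im (b / a) = crs a b / ((Re a)\<^sup>2 + (Im a)\<^sup>2)"
  by (simp add: Im_divide crs_def mult.commute)

lemma ang_sign:
  assumes "crs a b \<noteq> 0"
  shows "crs a b < 0 \<Longrightarrow> - pi < ang a b \<and> ang a b < 0" and "0 < crs a b \<Longrightarrow> 0 < ang a b \<and> ang a b < pi"
proof -
  have "a \<noteq> 0" using assms by auto
  then have p: "0 < (Re a)\<^sup>2 + (Im a)\<^sup>2" by (simp add: complex_neq_0)
  show "- pi < ang a b \<and> ang a b < 0" if "crs a b < 0"
  proof -
    have "Im (b / a) < 0" using that p by (simp add: Im_divide_crs divide_less_0_iff)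
    then show ?thesis unfolding ang_def using Arg_neg_iff[of "b / a"] mpi_less_Arg[of "b / a"] by simp
  qed
  show "0 < ang a b \<and> ang a b < pi" if "0 < crs a b"
  proof -
    have "0 < Im (b / a)" using that p by (simp add: Im_divide_crs zero_less_divide_iff)
    then show ?thesis unfolding ang_def using Arg_lt_pi[of "b / a"] by simp
  qed
qed

text \<open>Adding pi to the negative turns at the convex vertices yields rotations between 0 and
  pi, and with three such vertices the turning number -2 pi becomes pi, the period that a rolling
  line must have.\<close>

lemma (in spoly) roll_exists:
  assumes o: "orient = 1" and n3: "card {i\<in>{0..<m}. vertex_in i} = 3"
  shows "\<exists>t c. roll m v t c \<and> (\<forall>i. roll.corner c i \<longleftrightarrow> vertex_in i)"
proof -
  define \<rho> where "\<rho> i = ang (e (i - 1)) (e i) + (if vertex_in i then pi else 0)" for i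
  have vi: "vertex_in i \<longleftrightarrow> crs (e (i - 1)) (e i) < 0" for i using vertex_in_iff[of i] o by (simp add: turn_def)
  have nz: "crs (e (i - 1)) (e i) \<noteq> 0" for i using turn_nz[of i] by (simp only: turn_def not_False_eq_True)
  have \<rho>: "0 < \<rho> i \<and> \<rho> i < pi" for i
  proof (cases "vertex_in i")
    case True
    then have "- pi < ang (e (i - 1)) (e i) \<and> ang (e (i - 1)) (e i) < 0" using ang_sign(1)[OF nz[of i]] vi[of i] by blast
    moreover have "\<rho> i = ang (e (i - 1)) (e i) + pi" unfolding \<rho>_def using True by (simp only: if_True)
    ultimately show ?thesis by linarith
  next
    case False
    then have "0 < crs (e (i - 1)) (e i)" using nz[of i] vi[of i] by linarith
    then have "0 < ang (e (i - 1)) (e i) \<and> ang (e (i - 1)) (e i) < pi" using ang_sign(2)[OF nz[of i]] by blast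
    moreover have "\<rho> i = ang (e (i - 1)) (e i) + 0" unfolding \<rho>_def using False by (simp only: if_False)
    ultimately show ?thesis by linarith
  qed
  have em: "e (i + m - 1) = e (i - 1)" for i
  proof -
    have "i + m - 1 = i - 1 + m" by simp
    then show ?thesis by (simp only: e_per)
  qed
  have vim: "vertex_in (i + m) = vertex_in i" for i unfolding vi by (simp only: e_per em)
  have \<rho>m: "\<rho> (i + m) = \<rho> i" for i unfolding \<rho>_def vim by (simp only: e_per em)
  \<comment> \<open>The angle \<open>t i\<close> has to be the direction of edge
    \<open>i - 1\<close>, hence the start with the argument of edge -1.\<close>
  define t where "t i = Arg (e (- 1)) + (if 0 \<le> i then \<Sum>k\<in>{0..<i}. \<rho> k else - (\<Sum>k\<in>{i..<0}. \<rho> k))" for i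
  have tstep: "t (i + 1) = t i + \<rho> i" for i
  proof (cases "0 \<le> i")
    case True
    then have "{0..<i+1} = insert i {0..<i}" by auto
    then show ?thesis using True by (simp add: t_def)
  next
    case False
    then have "{i..<0} = insert i {i+1..<0}" by auto
    then show ?thesis using False by (cases "i = - 1") (simp_all add: t_def)
  qed
  have tsum: "t j - t i = (\<Sum>k\<in>{i..<j}. \<rho> k)" if "i \<le> j" for i j using that
  proof (induction j rule: int_ge_induct)
    case (step j)
    have "{i..<j+1} = insert j {i..<j}" using step by auto
    then show ?case using step tstep[of j] by simp
  qed simp
  have "(\<Sum>i\<in>{0..<m}. \<rho> i) = (\<Sum>i\<in>{0..<m}. ang (e (i - 1)) (e i)) + (\<Sum>i\<in>{0..<m}. if vertex_in i then pi else 0)"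
    unfolding \<rho>_def by (rule sum.distrib)
  also have "(\<Sum>i\<in>{0..<m}. if vertex_in i then pi else 0) = of_nat (card {i\<in>{0..<m}. vertex_in i}) * pi"
    by (simp add: sum.If_cases Int_def)
  finally have tot: "(\<Sum>i\<in>{0..<m}. \<rho> i) = pi" unfolding hopf o n3 by simp
  have tper: "t (i + m) = t i + pi" for i
    using tsum[of i "i + m"] sum_window[of \<rho> i, OF \<rho>m] tot m3 by simp
  have quot: "\<exists>r. r \<noteq> 0 \<and> e i = of_real r * cis (\<rho> i) * e (i - 1)" for i
  proof -
    define q where "q = e i / e (i - 1)"
    have e0: "e (i - 1) \<noteq> 0" "e i \<noteq> 0" using step_neq[of i] step_neq[of "i - 1"] by auto
    then have q0: "q \<noteq> 0" by (simp only: q_def divide_eq_0_iff) simp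
    have qe: "e i = q * e (i - 1)" using nonzero_eq_divide_eq[of "e (i - 1)" q "e i"] e0(1) q_def by metis
    have "q = rcis (cmod q) (ang (e (i - 1)) (e i))" unfolding ang_def q_def[symmetric] by (rule rcis_cmod_Arg[symmetric])
    then have q1: "q = of_real (cmod q) * cis (ang (e (i - 1)) (e i))" by (simp only: rcis_def)
    have "\<exists>r. r \<noteq> 0 \<and> q = of_real r * cis (\<rho> i)"
    proof (cases "vertex_in i")
      case True
      then have "cis (ang (e (i - 1)) (e i)) = cis (\<rho> i - pi)" by (simp add: \<rho>_def)
      also have "\<dots> = - cis (\<rho> i)" by (simp add: cis_divide[symmetric])
      finally have "q = of_real (- cmod q) * cis (\<rho> i)" using q1 by simp
      then show ?thesis using q0 by (intro exI[of _ "- cmod q"]) auto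
    next
      case False
      then have "q = of_real (cmod q) * cis (\<rho> i)" using q1 by (simp add: \<rho>_def)
      then show ?thesis using q0 by (intro exI[of _ "cmod q"]) auto
    qed
    then show ?thesis using qe by metis
  qed
  \<comment> \<open>Each rotation carries the direction of one edge to that of the next up to sign,
    so parallelism to the line propagates forwards and backwards from vertex 0.\<close>
  define Q where "Q i \<longleftrightarrow> (\<exists>c. e (i - 1) = of_real c * cis (t i))" for i
  have Qup: "Q (i + 1)" if Qi: "Q i" for i
  proof -
    obtain c where c: "e (i - 1) = of_real c * cis (t i)" using Qi unfolding Q_def by blast
    obtain r where r: "r \<noteq> 0" "e i = of_real r * cis (\<rho> i) * e (i - 1)" using quot[of i] by (elim exE conjE)
    have "e i = of_real (r * c) * (cis (t i) * cis (\<rho> i))" unfolding r(2) c by (simp only: of_real_mult mult_ac)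
    then have "e i = of_real (r * c) * cis (t (i + 1))" unfolding tstep cis_mult .
    then show ?thesis unfolding Q_def by (intro exI[of _ "r * c"]) simp
  qed
  have Qdown: "Q i" if Qi: "Q (i + 1)" for i
  proof -
    obtain c where c: "e i = of_real c * cis (t (i + 1))" using Qi unfolding Q_def by auto
    obtain r where r: "r \<noteq> 0" "e i = of_real r * cis (\<rho> i) * e (i - 1)" using quot[of i] by (elim exE conjE)
    have "of_real r * cis (\<rho> i) * e (i - 1) = of_real c * (cis (t i) * cis (\<rho> i))"
      unfolding r(2)[symmetric] c tstep cis_mult ..
    then have "(of_real r * cis (\<rho> i)) * e (i - 1) = (of_real r * cis (\<rho> i)) * (of_real (c / r) * cis (t i))"
      using r(1) by (simp add: field_simps)
    moreover have "of_real r * cis (\<rho> i) \<noteq> 0" using r(1) by simp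
    ultimately have "e (i - 1) = of_real (c / r) * cis (t i)" by (metis mult_left_cancel)
    then show ?thesis unfolding Q_def by blast
  qed
  have "e (- 1) = of_real (cmod (e (- 1))) * cis (t 0)"
    using rcis_cmod_Arg[of "e (- 1)"] by (simp add: rcis_def t_def)
  then have Q0: "Q 0" unfolding Q_def by (intro exI[of _ "cmod (e (- 1))"]) simp
  have Q: "Q i" for i
  proof (induction i rule: int_induct[of _ 0])
    case base show ?case by (rule Q0)
  next
    case (step1 i) then show ?case using Qup by blast
  next
    case (step2 i) then show ?case using Qdown[of "i - 1"] by simp
  qed
  have "\<exists>c. e i = of_real c * cis (t (i + 1))" for i using Q[of "i + 1"] unfolding Q_def by simp
  then obtain c where c: "\<And>i. e i = of_real (c i) * cis (t (i + 1))" by metis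
  have roll: "roll m v t c"
  proof
    show "0 < m" using m3 by simp
    show "v (i + m) = v i" for i by (rule per)
    show "t (i + m) = t i + pi" for i by (rule tper)
    show "t i < t (i + 1)" for i using tstep \<rho> by simp
    show "v (i + 1) - v i = of_real (c i) * cis (t (i + 1))" for i by (rule c)
    show "c i \<noteq> 0" for i using c[of i] step_neq[of i] by auto
  qed
  then have "roll.corner c i \<longleftrightarrow> vertex_in i" for i
    using roll.turn_neg[OF roll, of i] vi[of i] by simp
  then show ?thesis using roll by blast
qed

section \<open>Polygons as lists of vertices\<close>

definition pv :: "complex list \<Rightarrow> int \<Rightarrow> complex" where
  "pv vs i = vs ! nat (i mod int (length vs))"

lemma pv_per: "pv vs (i + int (length vs)) = pv vs i" by (simp add: pv_def)

lemma pv_nat: "k < length vs \<Longrightarrow> pv vs (int k) = vs ! k"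
  by (simp add: pv_def)

lemma pv_shift_mod: "pv vs (i mod int (length vs) + j) = pv vs (i + j)"
  by (simp add: pv_def mod_simps)

lemma pv_next: "next_vertex vs k = pv vs (int k + 1)"
proof -
  have "nat ((int k + 1) mod int (length vs)) = Suc k mod length vs"
    by (metis Suc_eq_plus1 add.commute nat_int of_nat_Suc zmod_int)
  then show ?thesis by (simp add: next_vertex_def pv_def)
qed

lemma pv_prev: assumes "0 < length vs" shows "prev_vertex vs k = pv vs (int k - 1)"
proof -
  have "(int k - 1) mod int (length vs) = (int k - 1 + int (length vs)) mod int (length vs)" by simp
  also have "int k - 1 + int (length vs) = int (k + length vs - 1)" using assms by (simp add: of_nat_diff Suc_leI)
  also have "int (k + length vs - 1) mod int (length vs) = int ((k + length vs - 1) mod length vs)" by (rule zmod_int[symmetric])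
  finally show ?thesis by (simp add: prev_vertex_def pv_def)
qed

lemma idx_rep:
  assumes "0 < length vs" obtains k where "k < length vs" "pv vs i = vs ! k" "pv vs (i + 1) = next_vertex vs k"
    "pv vs (i - 1) = prev_vertex vs k" "i mod int (length vs) = int k"
proof -
  define k where "k = nat (i mod int (length vs))"
  have k: "int k = i mod int (length vs)" "k < length vs" using assms by (auto simp: k_def nat_less_iff)
  have "pv vs i = vs ! k" by (simp add: pv_def k_def)
  moreover have "pv vs (i + 1) = next_vertex vs k" unfolding pv_next k by (rule pv_shift_mod[symmetric])
  moreover have "pv vs (i - 1) = prev_vertex vs k" unfolding pv_prev[OF assms] k using pv_shift_mod[of vs i "- 1"] by simp
  ultimately show ?thesis using that k by simp
qed

lemma polygon_edges_pv: assumes "0 < length vs"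
  shows "polygon_edges vs = range (\<lambda>i. closed_segment (pv vs i) (pv vs (i + 1)))"
proof (intro equalityI subsetI)
  fix e assume "e \<in> polygon_edges vs"
  then obtain k where k: "k < length vs" "e = closed_segment (vs ! k) (next_vertex vs k)"
    by (auto simp: polygon_edges_def polygon_edge_def)
  then have "e = closed_segment (pv vs (int k)) (pv vs (int k + 1))" by (simp add: pv_nat pv_next)
  then show "e \<in> range (\<lambda>i. closed_segment (pv vs i) (pv vs (i + 1)))" by blast
next
  fix e assume "e \<in> range (\<lambda>i. closed_segment (pv vs i) (pv vs (i + 1)))"
  then obtain i where i: "e = closed_segment (pv vs i) (pv vs (i + 1))" by blast
  obtain k where "k < length vs" "pv vs i = vs ! k" "pv vs (i + 1) = next_vertex vs k" using idx_rep[OF assms] by metis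
  then show "e \<in> polygon_edges vs" unfolding i polygon_edges_def polygon_edge_def by force
qed

lemma range_pv: assumes "0 < length vs" shows "range (pv vs) = set vs"
proof (intro equalityI subsetI)
  fix p assume "p \<in> range (pv vs)"
  then obtain i where i: "p = pv vs i" by blast
  show "p \<in> set vs" using idx_rep[OF assms, of i] i nth_mem by metis
next
  fix p assume "p \<in> set vs"
  then obtain k where "k < length vs" "p = vs ! k" by (metis in_set_conv_nth)
  then show "p \<in> range (pv vs)" using pv_nat by (metis rangeI)
qed

lemma pv_inj:
  assumes "distinct vs" "0 < length vs" "pv vs i = pv vs j" shows "i mod int (length vs) = j mod int (length vs)"
proof -
  obtain k where k: "k < length vs" "pv vs i = vs ! k" "i mod int (length vs) = int k" using idx_rep[OF assms(2)] by metis
  obtain l where l: "l < length vs" "pv vs j = vs ! l" "j mod int (length vs) = int l" using idx_rep[OF assms(2)] by metis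
  have "k = l" using assms k l nth_eq_iff_index_eq by metis
  then show ?thesis using k l by simp
qed

lemma close_cong:
  fixes n :: int assumes "i mod n = j mod n" "\<bar>i - j\<bar> < n" shows "i = j"
proof -
  have "n dvd i - j" using assms(1) by (simp add: mod_eq_dvd_iff)
  then show ?thesis using zdvd_imp_le[of n "\<bar>i - j\<bar>"] assms(2) by fastforce
qed

text \<open>A common point of two edges is an end of both. Distinctness of the vertices makes the
  corresponding indices congruent, and within one period congruent indices are equal; only the
  positions of consecutive edges survive.\<close>

lemma spoly_pv: assumes sp: "simple_polygon vs" shows "spoly (int (length vs)) (pv vs)"
proof
  have n: "3 \<le> length vs" "distinct vs" "0 < length vs" using sp by (auto simp: simple_polygon_def)
  show "3 \<le> int (length vs)" using n by simp
  show "pv vs (i + int (length vs)) = pv vs i" for i by (rule pv_per)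
  show "crs (pv vs i - pv vs (i - 1)) (pv vs (i + 1) - pv vs i) \<noteq> 0" for i
  proof -
    obtain k where k: "k < length vs" "pv vs i = vs ! k" "pv vs (i + 1) = next_vertex vs k" "pv vs (i - 1) = prev_vertex vs k"
      using idx_rep[OF n(3)] by metis
    then have "\<not> collinear {pv vs (i - 1), pv vs i, pv vs (i + 1)}" using sp by (simp add: simple_polygon_def)
    then have "crs (pv vs i - pv vs (i - 1)) (pv vs (i + 1) - pv vs (i - 1)) \<noteq> 0" unfolding collinear_crs .
    moreover have "crs (pv vs i - pv vs (i - 1)) (pv vs (i + 1) - pv vs (i - 1)) = crs (pv vs i - pv vs (i - 1)) (pv vs (i + 1) - pv vs i)"
      by (simp add: crs_def algebra_simps)
    ultimately show ?thesis by simp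
  qed
  fix i j z
  assume ij: "i < j" "j < i + int (length vs)" and z: "z \<in> closed_segment (pv vs i) (pv vs (i + 1))" "z \<in> closed_segment (pv vs j) (pv vs (j + 1))"
  let ?n = "int (length vs)"
  obtain k where k: "k < length vs" "pv vs i = vs ! k" "pv vs (i + 1) = next_vertex vs k" "i mod ?n = int k"
    using idx_rep[OF n(3)] by metis
  obtain l where l: "l < length vs" "pv vs j = vs ! l" "pv vs (j + 1) = next_vertex vs l" "j mod ?n = int l"
    using idx_rep[OF n(3)] by metis
  have "k \<noteq> l" using close_cong[of i ?n j] k(4) l(4) ij by auto
  then have "polygon_edge vs k \<inter> polygon_edge vs l = {vs ! k, next_vertex vs k} \<inter> {vs ! l, next_vertex vs l}"
    using sp k(1) l(1) by (simp add: simple_polygon_def)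
  moreover have "z \<in> polygon_edge vs k \<inter> polygon_edge vs l" using z k l by (simp add: polygon_edge_def)
  ultimately have "z \<in> {pv vs i, pv vs (i + 1)}" "z \<in> {pv vs j, pv vs (j + 1)}" using k l by auto
  then consider "z = pv vs i" "z = pv vs j" | "z = pv vs i" "z = pv vs (j + 1)" | "z = pv vs (i + 1)" "z = pv vs j"
    | "z = pv vs (i + 1)" "z = pv vs (j + 1)" by blast
  then show "j = i + 1 \<and> z = pv vs j \<or> j = i + ?n - 1 \<and> z = pv vs i"
  proof cases
    case 1
    then have "i mod ?n = j mod ?n" using pv_inj[OF n(2,3), of i j] by metis
    then show ?thesis using close_cong[of i ?n j] ij by auto
  next
    case 2
    then have "(i + ?n) mod ?n = (j + 1) mod ?n" using pv_inj[OF n(2,3), of i "j + 1"] by simp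
    then have "i + ?n = j + 1" by (rule close_cong) (use ij in auto)
    then show ?thesis using 2 by auto
  next
    case 3
    then have "(i + 1) mod ?n = j mod ?n" using pv_inj[OF n(2,3), of "i + 1" j] by simp
    then have "i + 1 = j" by (rule close_cong) (use ij n in auto)
    then show ?thesis using 3 by auto
  next
    case 4
    then have "(i + 1) mod ?n = (j + 1) mod ?n" using pv_inj[OF n(2,3), of "i + 1" "j + 1"] by simp
    then have "i + 1 = j + 1" by (rule close_cong) (use ij n in auto)
    then show ?thesis using ij by auto
  qed
qed

lemma (in spoly) list:
  defines "vs \<equiv> map (\<lambda>k. v (int k)) [0..<nat m]"
  shows "length vs = nat m" "pv vs = v" "simple_polygon vs"
proof -
  show len: "length vs = nat m" by (simp add: vs_def)
  have il: "int (length vs) = m" using len m3 by simp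
  have l0: "0 < length vs" using len m3 by simp
  show pv: "pv vs = v"
  proof
    fix i
    have "0 \<le> i mod m" "nat (i mod m) < nat m" using m3 by auto
    then have "pv vs i = v (i mod m)" unfolding pv_def il by (simp add: vs_def)
    then show "pv vs i = v i" using periodic_mod[of v m i] per by simp
  qed
  have nth: "vs ! k = v (int k)" if "k < length vs" for k using that by (simp add: vs_def)
  have nx: "next_vertex vs k = v (int k + 1)" and pr: "prev_vertex vs k = v (int k - 1)" for k
    using pv_next[of vs k] pv_prev[OF l0, of k] pv by auto
  have dist: "distinct vs" unfolding distinct_conv_nth
  proof (intro allI impI)
    fix i j assume "i < length vs" "j < length vs" "i \<noteq> j"
    then show "vs ! i \<noteq> vs ! j" using v_distinct[of "int i" "int j"] v_distinct[of "int j" "int i"] il nth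
      by (cases i j rule: linorder_cases) auto
  qed
  have E: "polygon_edge vs k = seg (int k)" if "k < length vs" for k using that nth nx by (simp add: polygon_edge_def)
  have sub: "seg (int i) \<inter> seg (int j) = {v (int i), v (int i + 1)} \<inter> {v (int j), v (int j + 1)}" if ij: "i < j" "j < length vs" for i j
  proof (intro equalityI subsetI)
    fix z assume z: "z \<in> seg (int i) \<inter> seg (int j)"
    have "int j = int i + 1 \<and> z = v (int j) \<or> int j = int i + m - 1 \<and> z = v (int i)"
      by (rule meet) (use ij il z in auto)
    moreover have "v (int i + m - 1 + 1) = v (int i)" using per[of "int i"] by simp
    ultimately show "z \<in> {v (int i), v (int i + 1)} \<inter> {v (int j), v (int j + 1)}" by auto
  qed auto
  show "simple_polygon vs" unfolding simple_polygon_def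
  proof (intro conjI allI impI)
    show "3 \<le> length vs" using len m3 by simp
    show "distinct vs" by (rule dist)
    fix i assume i: "i < length vs"
    have "crs (v (int i) - v (int i - 1)) (v (int i + 1) - v (int i - 1)) = crs (v (int i) - v (int i - 1)) (v (int i + 1) - v (int i))"
      by (simp add: crs_def algebra_simps)
    then show "\<not> collinear {prev_vertex vs i, vs ! i, next_vertex vs i}"
      unfolding nx pr nth[OF i] collinear_crs using bend[of "int i"] by simp
    fix j assume j: "j < length vs" "i \<noteq> j"
    then show "polygon_edge vs i \<inter> polygon_edge vs j = {vs ! i, next_vertex vs i} \<inter> {vs ! j, next_vertex vs j}"
      unfolding E[OF i] E[OF j(1)] nx nth[OF i] nth[OF j(1)]
      using sub[of i j] sub[of j i] i by (cases i j rule: linorder_cases) auto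
  qed
qed

section \<open>Reversing the orientation of a polygon\<close>

lemma crs_rev: "crs (b - a) (c - b) = - crs (b - c) (a - b)"
  by (simp add: crs_def algebra_simps)

lemma spoly_reverse: assumes "spoly m v" shows "spoly m (\<lambda>i. v (- i))"
proof -
  interpret spoly m v by (rule assms)
  show ?thesis
  proof
    show "3 \<le> m" by (rule m3)
    show "v (- (i + m)) = v (- i)" for i using per[of "- i - m"] by simp
    show "crs (v (- i) - v (- (i - 1))) (v (- (i + 1)) - v (- i)) \<noteq> 0" for i
    proof -
      have "- (i - 1) = - i + 1" "- (i + 1) = - i - 1" by simp_all
      then have "crs (v (- i) - v (- (i - 1))) (v (- (i + 1)) - v (- i)) = - crs (v (- i) - v (- i - 1)) (v (- i + 1) - v (- i))"
        by (simp only:) (rule crs_rev)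
      then show ?thesis using bend[of "- i"] by simp
    qed
    fix i j z
    assume ij: "i < j" "j < i + m" and z: "z \<in> closed_segment (v (- i)) (v (- (i + 1)))" "z \<in> closed_segment (v (- j)) (v (- (j + 1)))"
    have "z \<in> seg (- j - 1)" "z \<in> seg (- i - 1)" using z by (simp_all add: closed_segment_commute)
    then have "- i - 1 = - j - 1 + 1 \<and> z = v (- i - 1) \<or> - i - 1 = - j - 1 + m - 1 \<and> z = v (- j - 1)"
      using ij by (intro meet) auto
    moreover have "v (- j - 1) = v (- i)" if "- i - 1 = - j - 1 + m - 1"
    proof -
      have "- i = - j - 1 + m" using that by simp
      then show ?thesis using per[of "- j - 1"] by simp
    qed
    ultimately show "j = i + 1 \<and> z = v (- j) \<or> j = i + m - 1 \<and> z = v (- i)" by auto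
  qed
qed

lemma curve_reverse: "spoly.curve (\<lambda>i. v (- i)) = spoly.curve v" if "spoly m v"
proof -
  interpret a: spoly m v by (rule that)
  interpret b: spoly m "\<lambda>i. v (- i)" by (rule spoly_reverse[OF that])
  show ?thesis
  proof (intro equalityI subsetI)
    fix z assume "z \<in> b.curve"
    then obtain i where "z \<in> closed_segment (v (- i)) (v (- (i + 1)))" by (auto simp: b.curve_def)
    then have "z \<in> a.seg (- i - 1)" by (simp add: closed_segment_commute)
    then show "z \<in> a.curve" unfolding a.curve_def by blast
  next
    fix z assume "z \<in> a.curve"
    then obtain i where "z \<in> a.seg i" by (auto simp: a.curve_def)
    then have "z \<in> closed_segment (v (- (- i - 1))) (v (- (- i - 1 + 1)))" by (simp add: closed_segment_commute add.commute)
    then show "z \<in> b.curve" unfolding b.curve_def by blast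
  qed
qed

lemma vertex_in_reverse: assumes "spoly m v" shows "spoly.vertex_in (\<lambda>i. v (- i)) i \<longleftrightarrow> spoly.vertex_in v (- i)"
proof -
  interpret a: spoly m v by (rule assms)
  interpret b: spoly m "\<lambda>i. v (- i)" by (rule spoly_reverse[OF assms])
  show ?thesis using a.convex_iff[of "- i"] b.convex_iff[of i] curve_reverse[OF assms] by simp
qed

text \<open>Convexity of a vertex depends only on the region, whereas every turn changes its sign
  under reversal.\<close>

lemma orient_reverse: assumes "spoly m v" shows "spoly.orient (\<lambda>i. v (- i)) = - spoly.orient v"
proof -
  interpret a: spoly m v by (rule assms)
  interpret b: spoly m "\<lambda>i. v (- i)" by (rule spoly_reverse[OF assms])
  have "b.turn 0 = - a.turn 0" by (simp add: a.turn_def b.turn_def crs_def algebra_simps)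
  then have "b.orient * - a.turn 0 < 0 \<longleftrightarrow> a.orient * a.turn 0 < 0"
    using a.vertex_in_iff[of 0] b.vertex_in_iff[of 0] vertex_in_reverse[OF assms, of 0] by simp
  then show ?thesis using a.orient b.orient a.turn_nz[of 0] by (elim disjE) auto
qed

lemma (in spoly) vertex_in_per: "vertex_in (i + m) \<longleftrightarrow> vertex_in i"
proof -
  have "i + m - 1 = i - 1 + m" by simp
  then have "turn (i + m) = crs (e (i - 1 + m)) (e (i + m))" unfolding turn_def by (simp only:)
  also have "\<dots> = turn i" unfolding turn_def e_per ..
  finally have "turn (i + m) = turn i" .
  then show ?thesis by (simp add: vertex_in_iff)
qed

lemma polygon_facts:
  assumes sp: "simple_polygon vs"
  shows "\<Union>(polygon_edges vs) = spoly.curve (pv vs)"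
    and "polygon_interior vs = inside (spoly.curve (pv vs))"
    and "k < length vs \<Longrightarrow> convex_vertex vs k \<longleftrightarrow> spoly.vertex_in (pv vs) (int k)"
    and "card {i. i < length vs \<and> convex_vertex vs i} = card {i\<in>{0..<int (length vs)}. spoly.vertex_in (pv vs) i}"
    and "tangent_to vs l \<longleftrightarrow> (\<exists>i. on_line (pv vs i) l \<and> (if spoly.vertex_in (pv vs) i then opposite_sides l (pv vs (i - 1)) (pv vs (i + 1))
        else same_side l (pv vs (i - 1)) (pv vs (i + 1))))"
proof -
  have n: "0 < length vs" using sp by (auto simp: simple_polygon_def)
  interpret spoly "int (length vs)" "pv vs" by (rule spoly_pv[OF sp])
  show U: "\<Union>(polygon_edges vs) = curve" unfolding polygon_edges_pv[OF n] curve_def by simp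
  show I: "polygon_interior vs = inside curve" by (simp add: polygon_interior_def U)
  show C: "k < length vs \<Longrightarrow> convex_vertex vs k \<longleftrightarrow> vertex_in (int k)" for k
    unfolding convex_vertex_def polygon_region_def U I using convex_iff[of "int k"] pv_nat[of k vs] by simp
  have "bij_betw int {i. i < length vs \<and> convex_vertex vs i} {i\<in>{0..<int (length vs)}. vertex_in i}"
  proof (rule bij_betw_imageI)
    show "inj_on int {i. i < length vs \<and> convex_vertex vs i}" by (rule inj_onI) simp
    show "int ` {i. i < length vs \<and> convex_vertex vs i} = {i\<in>{0..<int (length vs)}. vertex_in i}"
    proof (intro equalityI subsetI)
      fix j assume "j \<in> {i\<in>{0..<int (length vs)}. vertex_in i}"
      then have "j = int (nat j)" "nat j < length vs" "convex_vertex vs (nat j)" using C[of "nat j"] by auto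
      then show "j \<in> int ` {i. i < length vs \<and> convex_vertex vs i}" by blast
    qed (use C in auto)
  qed
  then show "card {i. i < length vs \<and> convex_vertex vs i} = card {i\<in>{0..<int (length vs)}. vertex_in i}" by (rule bij_betw_same_card)
  show "tangent_to vs l \<longleftrightarrow> (\<exists>i. on_line (pv vs i) l \<and> (if vertex_in i then opposite_sides l (pv vs (i - 1)) (pv vs (i + 1))
        else same_side l (pv vs (i - 1)) (pv vs (i + 1))))" (is "_ \<longleftrightarrow> (\<exists>i. ?R i)")
  proof
    assume "tangent_to vs l"
    then obtain k where "k < length vs" "on_line (vs ! k) l" "if convex_vertex vs k
         then opposite_sides l (prev_vertex vs k) (next_vertex vs k)
         else same_side l (prev_vertex vs k) (next_vertex vs k)" unfolding tangent_to_def by blast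
    then have "?R (int k)" using C[of k] unfolding pv_next pv_prev[OF n] by (simp add: pv_nat)
    then show "\<exists>i. ?R i" by blast
  next
    assume "\<exists>i. ?R i"
    then obtain i where i: "?R i" by blast
    obtain k where k: "k < length vs" "pv vs i = vs ! k" "pv vs (i + 1) = next_vertex vs k"
      "pv vs (i - 1) = prev_vertex vs k" "i mod int (length vs) = int k" using idx_rep[OF n] by metis
    have "vertex_in i = vertex_in (int k)" using periodic_mod[of vertex_in "int (length vs)" i] vertex_in_per k(5) by metis
    then have veq: "vertex_in i = convex_vertex vs k" using C[OF k(1)] by simp
    from i[unfolded k(2) k(3) k(4) veq] have "on_line (vs ! k) l \<and> (if convex_vertex vs k then opposite_sides l (prev_vertex vs k) (next_vertex vs k)
        else same_side l (prev_vertex vs k) (next_vertex vs k))" .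
    then show "tangent_to vs l" unfolding tangent_to_def using k(1) by blast
  qed
qed

lemma (in roll) represents_rollf:
  assumes "\<And>l. l \<in> D \<longleftrightarrow> (\<exists>i. on_line (v i) l \<and> (if corner i then opposite_sides l (v (i - 1)) (v (i + 1))
        else same_side l (v (i - 1)) (v (i + 1))))"
  shows "represents rollf D"
proof -
  have mem: "mline x d \<in> D \<longleftrightarrow> d = rollf x" for x d
    unfolding assms on_line_mline opposite_sides_mline same_side_mline by (rule tangent_iff)
  have "l \<in> D \<longleftrightarrow> l \<in> range (\<lambda>x. mline x (rollf x))" for l
  proof (cases l rule: mline_cases)
    case (1 x d)
    show ?thesis
    proof
      assume "l \<in> D"
      then show "l \<in> range (\<lambda>x. mline x (rollf x))" using mem 1 by auto
    next
      assume "l \<in> range (\<lambda>x. mline x (rollf x))"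
      then show "l \<in> D" using mem by auto
    qed
  qed
  then have "D = range (\<lambda>x. mline x (rollf x))" by blast
  then show ?thesis unfolding represents_def using rollf_cont rollf_pi by blast
qed

definition rolled :: "complex list \<Rightarrow> (int \<Rightarrow> complex) \<Rightarrow> (int \<Rightarrow> real) \<Rightarrow> (int \<Rightarrow> real) \<Rightarrow> bool" where
  "rolled vs v t c \<longleftrightarrow> roll (int (length vs)) v t c \<and> roll.ncorners (int (length vs)) c = 3 \<and> range v = set vs \<and>
     (\<forall>i. closed_segment (v i) (v (i + 1)) \<in> polygon_edges vs) \<and> polygon_interior vs = inside (spoly.curve v) \<and>
     \<Union>(polygon_edges vs) = spoly.curve v \<and>
     represents (roll.rollf v t) (dual_pseudotriangle vs)"

lemma pseudotriangle_rolled: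
  assumes "pseudotriangle vs" shows "\<exists>v t c. rolled vs v t c"
proof -
  have sp: "simple_polygon vs" and c3: "card {i. i < length vs \<and> convex_vertex vs i} = 3" using assms by (auto simp: pseudotriangle_def)
  have n: "0 < length vs" using sp by (auto simp: simple_polygon_def)
  let ?m = "int (length vs)"
  have spv: "spoly ?m (pv vs)" by (rule spoly_pv[OF sp])
  note F = polygon_facts[OF sp]
  define good where "good v \<longleftrightarrow> spoly ?m v \<and> spoly.orient v = 1 \<and> card {i\<in>{0..<?m}. spoly.vertex_in v i} = 3 \<and> range v = set vs \<and>
    spoly.curve v = spoly.curve (pv vs) \<and> (\<forall>i. closed_segment (v i) (v (i + 1)) \<in> polygon_edges vs) \<and>
    (\<forall>l. tangent_to vs l \<longleftrightarrow> (\<exists>i. on_line (v i) l \<and> (if spoly.vertex_in v i then opposite_sides l (v (i - 1)) (v (i + 1))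
        else same_side l (v (i - 1)) (v (i + 1)))))" for v
  have "\<exists>v. good v"
  proof (cases "spoly.orient (pv vs) = 1")
    case True
    have "good (pv vs)" unfolding good_def using spv True c3 F(4) F(5) range_pv[OF n] polygon_edges_pv[OF n] by auto
    then show ?thesis by blast
  next
    case False
    \<comment> \<open>If the interior is on the left, the vertices are read backwards: regions,
      convexity and tangents remain, and the interior comes to lie on the right.\<close>
    define u where "u i = pv vs (- i)" for i
    have ue: "u = (\<lambda>i. pv vs (- i))" by (simp add: u_def fun_eq_iff)
    have su: "spoly ?m u" unfolding ue by (rule spoly_reverse[OF spv])
    interpret a: spoly ?m "pv vs" by (rule spv)
    interpret b: spoly ?m u by (rule su)
    have o: "b.orient = 1" using orient_reverse[OF spv] a.orient False unfolding ue by auto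
    have vi: "b.vertex_in i \<longleftrightarrow> a.vertex_in (- i)" for i using vertex_in_reverse[OF spv, of i] unfolding ue .
    have "card {i\<in>{0..<?m}. b.vertex_in i} = card {i\<in>{0..<?m}. a.vertex_in i}"
    proof -
      have "card {i\<in>{0..<?m}. b.vertex_in i} = card {i\<in>{1-?m..<1-?m+?m}. a.vertex_in i}"
        by (rule bij_betw_same_card[of uminus], rule bij_betw_byWitness[where f' = uminus]) (auto simp: vi)
      also have "\<dots> = card {i\<in>{0..<?m}. a.vertex_in i}" by (rule window_card) (use n a.vertex_in_per in auto)
      finally show ?thesis .
    qed
    then have c: "card {i\<in>{0..<?m}. b.vertex_in i} = 3" using c3 F(4) by simp
    have r: "range u = set vs"
    proof -
      have "range u = range (pv vs)"
      proof (intro equalityI subsetI)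
        fix x assume "x \<in> range (pv vs)"
        then obtain i where "x = pv vs i" by blast
        then have "x = u (- i)" by (simp add: u_def)
        then show "x \<in> range u" by blast
      qed (auto simp: u_def)
      then show ?thesis using range_pv[OF n] by simp
    qed
    have cu: "b.curve = a.curve" using curve_reverse[OF spv] unfolding ue .
    have e: "closed_segment (u i) (u (i + 1)) \<in> polygon_edges vs" for i
    proof -
      have "closed_segment (u i) (u (i + 1)) = closed_segment (pv vs (- i - 1)) (pv vs (- i - 1 + 1))"
        by (simp add: u_def closed_segment_commute)
      then show ?thesis unfolding polygon_edges_pv[OF n] by blast
    qed
    have sym: "opposite_sides l p q \<longleftrightarrow> opposite_sides l q p" "same_side l p q \<longleftrightarrow> same_side l q p" for l p q
      unfolding opposite_sides_def same_side_def by (simp_all add: mult.commute)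
    have tg: "tangent_to vs l \<longleftrightarrow> (\<exists>i. on_line (u i) l \<and> (if b.vertex_in i then opposite_sides l (u (i - 1)) (u (i + 1))
        else same_side l (u (i - 1)) (u (i + 1))))" for l
    proof -
      let ?A = "\<lambda>i. on_line (pv vs i) l \<and> (if a.vertex_in i then opposite_sides l (pv vs (i - 1)) (pv vs (i + 1))
        else same_side l (pv vs (i - 1)) (pv vs (i + 1)))"
      let ?B = "\<lambda>i. on_line (u i) l \<and> (if b.vertex_in i then opposite_sides l (u (i - 1)) (u (i + 1))
        else same_side l (u (i - 1)) (u (i + 1)))"
      have AB: "?B i \<longleftrightarrow> ?A (- i)" for i
      proof -
        have "u (i - 1) = pv vs (- i + 1)" "u (i + 1) = pv vs (- i - 1)" by (simp_all add: u_def)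
        then show ?thesis using sym vi[of i] by (simp add: u_def)
      qed
      have "(\<exists>i. ?A i) \<longleftrightarrow> (\<exists>i. ?B i)"
      proof
        assume "\<exists>i. ?A i"
        then obtain i where "?A i" by blast
        then have "?B (- i)" using AB[of "- i"] by simp
        then show "\<exists>i. ?B i" by blast
      qed (use AB in blast)
      then show ?thesis using F(5)[of l] by simp
    qed
    have "good u" unfolding good_def using su o c r cu e tg by blast
    then show ?thesis by blast
  qed
  then obtain v where v: "good v" by blast
  interpret spoly ?m v using v by (simp add: good_def)
  have o: "orient = 1" and c: "card {i\<in>{0..<?m}. vertex_in i} = 3" and r: "range v = set vs"
    and cu: "curve = spoly.curve (pv vs)" and e: "\<And>i. closed_segment (v i) (v (i + 1)) \<in> polygon_edges vs"
    and tg: "\<And>l. tangent_to vs l \<longleftrightarrow> (\<exists>i. on_line (v i) l \<and> (if vertex_in i then opposite_sides l (v (i - 1)) (v (i + 1))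
        else same_side l (v (i - 1)) (v (i + 1))))" using v unfolding good_def by simp_all
  obtain t c' where tc: "roll ?m v t c'" "\<And>i. roll.corner c' i \<longleftrightarrow> vertex_in i" using roll_exists[OF o c] by blast
  have "roll.ncorners ?m c' = 3" unfolding roll.ncorners_def[OF tc(1)] tc(2) by (rule c)
  moreover have "represents (roll.rollf v t) (dual_pseudotriangle vs)"
    by (rule roll.represents_rollf[OF tc(1)]) (simp add: dual_pseudotriangle_def tg tc(2))
  ultimately have "rolled vs v t c'" unfolding rolled_def using tc(1) r e F(1,2) cu by simp
  then show ?thesis by blast
qed

lemma (in roll) pseudotriangle_list:
  assumes n3: "ncorners = 3"
  defines "vs \<equiv> map (\<lambda>k. v (int k)) [0..<nat m]"
  shows "pseudotriangle vs" "polygon_edges vs = range (\<lambda>i. closed_segment (v i) (v (i + 1)))"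
    "polygon_interior vs = inside (spoly.curve v)" "set vs = range v"
proof -
  interpret sp: spoly m v by (rule spoly[OF n3])
  have L: "length vs = nat m" "pv vs = v" "simple_polygon vs" unfolding vs_def by (rule sp.list)+
  have l0: "0 < length vs" and il: "int (length vs) = m" using L(1) sp.m3 by auto
  have "card {i. i < length vs \<and> convex_vertex vs i} = 3"
    unfolding polygon_facts(4)[OF L(3)] L(2) il vertex_in_roll[OF n3] using n3 by (simp add: ncorners_def)
  then show "pseudotriangle vs" using L(3) by (simp add: pseudotriangle_def)
  show "polygon_edges vs = range (\<lambda>i. closed_segment (v i) (v (i + 1)))" using polygon_edges_pv[OF l0] L(2) by simp
  show "polygon_interior vs = inside sp.curve" using polygon_facts(2)[OF L(3)] L(2) by simp
  show "set vs = range v" using range_pv[OF l0] L(2) by simp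
qed

section \<open>Arrangements of sheets\<close>

lemma sides_sign:
  assumes "\<forall>\<^sub>F y in at_left x. 0 < \<sigma> * D (y::real)" "\<forall>\<^sub>F y in at_right x. 0 < \<tau> * (D y :: real)"
  shows "\<sigma> * \<tau> < 0 \<Longrightarrow> \<exists>\<epsilon>>0. \<forall>s\<in>{x - \<epsilon><..<x}. \<forall>t\<in>{x<..<x + \<epsilon>}. D s * D t < 0"
    and "0 < \<sigma> * \<tau> \<Longrightarrow> \<exists>\<epsilon>>0. \<forall>s\<in>{x - \<epsilon><..<x}. \<forall>t\<in>{x<..<x + \<epsilon>}. D s * D t > 0"
proof -
  obtain b where b: "b < x" "\<And>y. b < y \<Longrightarrow> y < x \<Longrightarrow> 0 < \<sigma> * D y" using assms(1) unfolding eventually_at_left_field by auto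
  obtain c where c: "x < c" "\<And>y. x < y \<Longrightarrow> y < c \<Longrightarrow> 0 < \<tau> * D y" using assms(2) unfolding eventually_at_right_field by auto
  define e where "e = min (x - b) (c - x)"
  have e: "0 < e" using b c by (simp add: e_def)
  have s: "0 < \<sigma> * D s" if "s \<in> {x - e<..<x}" for s using that b(2)[of s] by (auto simp: e_def)
  have t: "0 < \<tau> * D t" if "t \<in> {x<..<x + e}" for t using that c(2)[of t] by (auto simp: e_def)
  have 1: "a * b < 0" if "0 < \<sigma> * a" "0 < \<tau> * b" "\<sigma> * \<tau> < 0" for a b :: real
    using that by (auto simp: zero_less_mult_iff mult_less_0_iff)
  have 2: "a * b > 0" if "0 < \<sigma> * a" "0 < \<tau> * b" "\<sigma> * \<tau> > 0" for a b :: real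
    using that by (auto simp: zero_less_mult_iff)
  show "\<exists>\<epsilon>>0. \<forall>s\<in>{x - \<epsilon><..<x}. \<forall>t\<in>{x<..<x + \<epsilon>}. D s * D t < 0" if "\<sigma> * \<tau> < 0"
    using e 1[OF s t that] by blast
  show "\<exists>\<epsilon>>0. \<forall>s\<in>{x - \<epsilon><..<x}. \<forall>t\<in>{x<..<x + \<epsilon>}. D s * D t > 0" if "\<sigma> * \<tau> > 0"
    using e 2[OF s t that] by blast
qed

context sheets
begin

lemma cross_sign:
  assumes fg: "f \<in> L" "g \<in> L" "f \<noteq> g" and cr: "crosses f g x"
  shows "\<exists>\<epsilon>>0. \<forall>s\<in>{x - \<epsilon><..<x}. \<forall>t\<in>{x<..<x + \<epsilon>}. (f s - g s) * (f t - g t) < 0"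
proof -
  define p q where "p = gl f x" and "q = gl g x"
  have c3: "gl f x = gr f x" "gl g x = gr g x" "f x = g x" using cr unfolding crosses_def by blast+
  have m: "p \<noteq> q" "hgt x p = hgt x q" "gr f x = p" "gr g x = q"
    using meet_cases[OF fg c3(3)] c3(1,2) unfolding p_def q_def by metis+
  obtain c where c: "q - p = of_real c * cis x" using m(2) hgt_eq_dir by blast
  have c0: "c < 0 \<or> 0 < c" using c m(1) by (cases "c = 0") auto
  have ev: "\<forall>\<^sub>F y in at_left x. f y = hgt y p" "\<forall>\<^sub>F y in at_left x. g y = hgt y q"
    "\<forall>\<^sub>F y in at_right x. f y = hgt y p" "\<forall>\<^sub>F y in at_right x. g y = hgt y q"
    using germ_ev[OF side_simps(1) fg(1), of x] germ_ev[OF side_simps(1) fg(2), of x]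
      germ_ev[OF side_simps(2) fg(1), of x] germ_ev[OF side_simps(2) fg(2), of x] m
    by (simp_all only: p_def q_def)
  have "(\<forall>\<^sub>F y in at_left x. 0 < (- c) * (f y - g y)) \<and> (\<forall>\<^sub>F y in at_right x. 0 < c * (f y - g y))"
    using c0
  proof
    assume c: "c < 0"
    show ?thesis
    proof
      show "\<forall>\<^sub>F y in at_left x. 0 < (- c) * (f y - g y)" using ev(1,2) order_near(3)[OF \<open>q - p = of_real c * cis x\<close> c]
        by eventually_elim (use c in \<open>auto intro!: mult_neg_pos\<close>)
      show "\<forall>\<^sub>F y in at_right x. 0 < c * (f y - g y)" using ev(3,4) order_near(4)[OF \<open>q - p = of_real c * cis x\<close> c]
        by eventually_elim (use c in \<open>auto intro!: mult_neg_neg\<close>)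
    qed
  next
    assume c: "0 < c"
    show ?thesis
    proof
      show "\<forall>\<^sub>F y in at_left x. 0 < (- c) * (f y - g y)" using ev(1,2) order_near(1)[OF \<open>q - p = of_real c * cis x\<close> c]
        by eventually_elim (use c in \<open>auto intro!: mult_pos_neg\<close>)
      show "\<forall>\<^sub>F y in at_right x. 0 < c * (f y - g y)" using ev(3,4) order_near(2)[OF \<open>q - p = of_real c * cis x\<close> c]
        by eventually_elim (use c in auto)
    qed
  qed
  moreover have "(- c) * c < 0" using c0 by (auto simp: zero_less_mult_iff)
  ultimately show ?thesis using sides_sign(1)[of "- c" "\<lambda>y. f y - g y" x c] by blast
qed

lemma touch_sign:
  assumes fg: "f \<in> L" "g \<in> L" "f \<noteq> g" and ncr: "\<not> crosses f g x"
  shows "\<exists>\<epsilon>>0. \<forall>s\<in>{x - \<epsilon><..<x}. \<forall>t\<in>{x<..<x + \<epsilon>}. (f s - g s) * (f t - g t) > 0"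
proof -
  have sub: "(\<forall>\<^sub>F y in at_left x. Q y) \<and> (\<forall>\<^sub>F y in at_right x. Q y)" if "\<forall>\<^sub>F y in at x. Q y" for Q
    using that by (simp add: eventually_at_split)
  from ordered_near[OF fg ncr] show ?thesis
  proof
    assume "\<forall>\<^sub>F y in at x. f y < g y"
    then have "\<forall>\<^sub>F y in at x. 0 < (- 1) * (f y - g y)" by (rule eventually_mono) simp
    from sub[OF this] show ?thesis using sides_sign(2)[of "- 1" "\<lambda>y. f y - g y" x "- 1"] by simp
  next
    assume "\<forall>\<^sub>F y in at x. g y < f y"
    then have "\<forall>\<^sub>F y in at x. 0 < 1 * (f y - g y)" by (rule eventually_mono) simp
    from sub[OF this] show ?thesis using sides_sign(2)[of 1 "\<lambda>y. f y - g y" x 1] by simp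
  qed
qed

lemma sign_excl:
  fixes D :: "real \<Rightarrow> real"
  assumes "\<exists>\<epsilon>>0. \<forall>s\<in>{x - \<epsilon><..<x}. \<forall>t\<in>{x<..<x + \<epsilon>}. D s * D t < (0::real)"
    "\<exists>\<epsilon>>0. \<forall>s\<in>{x - \<epsilon><..<x}. \<forall>t\<in>{x<..<x + \<epsilon>}. D s * D t > 0"
  shows False
proof -
  obtain e1 where e1: "e1 > 0" "\<And>s t. s \<in> {x - e1<..<x} \<Longrightarrow> t \<in> {x<..<x + e1} \<Longrightarrow> D s * D t < 0" using assms(1) by blast
  obtain e2 where e2: "e2 > 0" "\<And>s t. s \<in> {x - e2<..<x} \<Longrightarrow> t \<in> {x<..<x + e2} \<Longrightarrow> D s * D t > 0" using assms(2) by blast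
  define e where "e = min e1 e2 / 2"
  have "x - e \<in> {x - e1<..<x}" "x + e \<in> {x<..<x + e1}" "x - e \<in> {x - e2<..<x}" "x + e \<in> {x<..<x + e2}"
    using e1(1) e2(1) by (auto simp: e_def)
  then show False using e1(2) e2(2) by (metis less_asym)
qed

text \<open>The line through \<open>p\<close> and \<open>q\<close> supports the hull; the sign of
  \<open>\<sigma>\<close> tells on which side the remaining points are.\<close>

definition one_sided :: "complex \<Rightarrow> complex \<Rightarrow> real \<Rightarrow> real \<Rightarrow> bool" where
  "one_sided p q x \<sigma> \<longleftrightarrow> \<sigma> \<noteq> 0 \<and> (\<forall>r\<in>P. r \<noteq> p \<longrightarrow> r \<noteq> q \<longrightarrow> 0 < \<sigma> * (hgt x r - hgt x p))"

lemma one_sided_near: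
  assumes pq: "p \<in> P" "q \<in> P" "p \<noteq> q" "hgt x p = hgt x q" and os: "one_sided p q x \<sigma>" and F: "side F x"
    and o: "\<forall>\<^sub>F y in F. 0 < \<sigma> * (hgt y q - hgt y p)"
  shows "\<forall>\<^sub>F y in F. \<forall>r\<in>P. r \<noteq> p \<longrightarrow> 0 < \<sigma> * (hgt y r - hgt y p)"
proof -
  have "\<forall>\<^sub>F y in at x. \<forall>r\<in>P-{p,q}. 0 < \<sigma> * (hgt y r - hgt y p)"
  proof (rule eventually_ball_finite, use finP in simp, rule ballI)
    fix r assume r: "r \<in> P - {p, q}"
    have "((\<lambda>y. \<sigma> * (hgt y r - hgt y p)) \<longlongrightarrow> \<sigma> * (hgt x r - hgt x p)) (at x)"
      using isCont_hgt unfolding isCont_def by (intro tendsto_intros)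
    then show "\<forall>\<^sub>F y in at x. 0 < \<sigma> * (hgt y r - hgt y p)"
      by (rule order_tendstoD(1)) (use os r in \<open>auto simp: one_sided_def\<close>)
  qed
  from side_ev[OF F this] o show ?thesis by eventually_elim auto
qed

lemma one_sided_not_sep:
  assumes "p \<in> P" "\<sigma> \<noteq> 0" "\<And>r. r \<in> P \<Longrightarrow> r \<noteq> p \<Longrightarrow> 0 < \<sigma> * (hgt y r - hgt y p)"
  shows "\<not> sep P y (hgt y p)" and "extreme p"
proof -
  have inj: "r = p" if "r \<in> P" "hgt y r = hgt y p" for r using assms(3)[of r] that by (cases "r = p") auto
  show "\<not> sep P y (hgt y p)"
  proof
    assume "sep P y (hgt y p)"
    then obtain p' q r where s: "p' \<in> P" "hgt y p' = hgt y p" "q \<in> P" "q \<noteq> p'" "hgt y p \<le> hgt y q" "r \<in> P" "r \<noteq> p'" "hgt y r \<le> hgt y p"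
      unfolding sep_def by blast
    have "p' = p" using inj s by blast
    then have "0 < \<sigma> * (hgt y q - hgt y p)" "0 < \<sigma> * (hgt y r - hgt y p)" using assms(3) s by auto
    then show False using s(5,8) by (auto simp: zero_less_mult_iff)
  qed
  show "extreme p"
  proof (cases "0 < \<sigma>")
    case True
    have "hgt (y + pi) r < hgt (y + pi) p" if "r \<in> P" "r \<noteq> p" for r using assms(3)[OF that] True by (simp add: zero_less_mult_iff)
    then show ?thesis unfolding extreme_def using assms(1) by blast
  next
    case False
    have "hgt y r < hgt y p" if "r \<in> P" "r \<noteq> p" for r using assms(3)[OF that] False by (simp add: zero_less_mult_iff)
    then show ?thesis unfolding extreme_def using assms(1) by blast
  qed
qed

lemma side_order:
  assumes "p \<noteq> q" "hgt x p = hgt x q" "\<sigma> \<noteq> 0"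
  shows "(\<forall>\<^sub>F y in at_left x. 0 < \<sigma> * (hgt y q - hgt y p)) \<and> (\<forall>\<^sub>F y in at_right x. 0 < \<sigma> * (hgt y p - hgt y q)) \<or>
         (\<forall>\<^sub>F y in at_left x. 0 < \<sigma> * (hgt y p - hgt y q)) \<and> (\<forall>\<^sub>F y in at_right x. 0 < \<sigma> * (hgt y q - hgt y p))"
proof -
  obtain c where c: "q - p = of_real c * cis x" using assms(2) hgt_eq_dir by blast
  have c0: "c \<noteq> 0" using c assms(1) by auto
  have A: "(\<forall>\<^sub>F y in F. 0 < \<sigma> * (hgt y b - hgt y a))" if "\<forall>\<^sub>F y in F. hgt y a < hgt y b" "0 < \<sigma>" for F a b
    using that(1) by (rule eventually_mono) (use that(2) in simp)
  have B: "(\<forall>\<^sub>F y in F. 0 < \<sigma> * (hgt y a - hgt y b))" if "\<forall>\<^sub>F y in F. hgt y a < hgt y b" "\<sigma> < 0" for F a b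
    using that(1) by (rule eventually_mono) (use that(2) in \<open>simp add: mult_neg_neg\<close>)
  consider "0 < c" "0 < \<sigma>" | "0 < c" "\<sigma> < 0" | "c < 0" "0 < \<sigma>" | "c < 0" "\<sigma> < 0" using c0 assms(3) by linarith
  then show ?thesis
  proof cases
    case 1 then show ?thesis using A[OF order_near(1)[OF c 1(1)]] A[OF order_near(2)[OF c 1(1)]] by blast
  next
    case 2 then show ?thesis using B[OF order_near(1)[OF c 2(1)]] B[OF order_near(2)[OF c 2(1)]] by blast
  next
    case 3 then show ?thesis using A[OF order_near(3)[OF c 3(1)]] A[OF order_near(4)[OF c 3(1)]] by blast
  next
    case 4 then show ?thesis using B[OF order_near(3)[OF c 4(1)]] B[OF order_near(4)[OF c 4(1)]] by blast
  qed
qed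

lemma one_sided_swap: "hgt x p = hgt x q \<Longrightarrow> one_sided p q x \<sigma> \<Longrightarrow> one_sided q p x \<sigma>"
  unfolding one_sided_def by metis

lemma one_sided_extreme:
  assumes pq: "p \<in> P" "q \<in> P" "p \<noteq> q" "hgt x p = hgt x q" and os: "one_sided p q x \<sigma>"
  shows "extreme p"
proof -
  have s0: "\<sigma> \<noteq> 0" using os by (simp add: one_sided_def)
  obtain F where F: "side F x" "\<forall>\<^sub>F y in F. 0 < \<sigma> * (hgt y q - hgt y p)" using side_order[OF pq(3,4) s0] side_simps by blast
  obtain y where "\<forall>r\<in>P. r \<noteq> p \<longrightarrow> 0 < \<sigma> * (hgt y r - hgt y p)"
    using eventually_happens'[OF side_bot[OF F(1)] one_sided_near[OF pq os F]] by blast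
  then show ?thesis using one_sided_not_sep(2)[OF pq(1) s0, of y] by blast
qed

text \<open>Before the hull line one of its two points is strictly extreme, after it the other one.
  The dual of the strictly extreme point is outside the support, so the sheet must follow the other
  point each time.\<close>

lemma one_sided_switch:
  assumes pq: "p \<in> P" "q \<in> P" "p \<noteq> q" "hgt x p = hgt x q" and os: "one_sided p q x \<sigma>" and f: "f \<in> L" "f x = hgt x p"
  shows "gl f x = p \<and> gr f x = q \<or> gl f x = q \<and> gr f x = p"
proof -
  have s0: "\<sigma> \<noteq> 0" using os by (simp add: one_sided_def)
  have ne: "germ F f \<noteq> a" if F: "side F x" and ab: "a \<in> P" "b \<in> P" "a \<noteq> b" "hgt x a = hgt x b" "one_sided a b x \<sigma>"
    and o: "\<forall>\<^sub>F y in F. 0 < \<sigma> * (hgt y b - hgt y a)" for F a b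
  proof
    assume g: "germ F f = a"
    have "\<forall>\<^sub>F y in F. (\<forall>r\<in>P. r \<noteq> a \<longrightarrow> 0 < \<sigma> * (hgt y r - hgt y a)) \<and> f y = hgt y a"
      using one_sided_near[OF ab F o] germ_ev[OF F f(1)] by eventually_elim (simp add: g)
    then obtain y where y: "\<forall>r\<in>P. r \<noteq> a \<longrightarrow> 0 < \<sigma> * (hgt y r - hgt y a)" "f y = hgt y a"
      using eventually_happens'[OF side_bot[OF F], of "\<lambda>y. (\<forall>r\<in>P. r \<noteq> a \<longrightarrow> 0 < \<sigma> * (hgt y r - hgt y a)) \<and> f y = hgt y a"] by blast
    then show False using one_sided_not_sep(1)[OF ab(1) s0, of y] suppL[of y "hgt y a"] f(1) by blast
  qed
  have os': "one_sided q p x \<sigma>" by (rule one_sided_swap[OF pq(4) os])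
  note np = ne[OF _ pq os] and nq = ne[OF _ pq(2,1) pq(3)[symmetric] pq(4)[symmetric] os']
  have gs: "gl f x = p \<or> gl f x = q" "gr f x = p \<or> gr f x = q"
    using on_germs[OF side_simps(1) f(1) pq f(2)] on_germs[OF side_simps(2) f(1) pq f(2)] by auto
  from side_order[OF pq(3,4) s0] show ?thesis
  proof
    assume "(\<forall>\<^sub>F y in at_left x. 0 < \<sigma> * (hgt y q - hgt y p)) \<and> (\<forall>\<^sub>F y in at_right x. 0 < \<sigma> * (hgt y p - hgt y q))"
    then show ?thesis using np[OF side_simps(1)] nq[OF side_simps(2)] gs by blast
  next
    assume "(\<forall>\<^sub>F y in at_left x. 0 < \<sigma> * (hgt y p - hgt y q)) \<and> (\<forall>\<^sub>F y in at_right x. 0 < \<sigma> * (hgt y q - hgt y p))"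
    then show ?thesis using nq[OF side_simps(1)] np[OF side_simps(2)] gs by blast
  qed
qed

text \<open>Points strictly on both sides of the line keep the dual of \<open>p\<close> in the
  support at nearby angles.\<close>

lemma two_sided:
  assumes pq: "p \<in> P" "q \<in> P" "p \<noteq> q" "hgt x p = hgt x q" and os: "\<nexists>\<sigma>. one_sided p q x \<sigma>" and F: "side F x"
  shows "\<exists>f\<in>L. germ F f = p"
proof -
  have "\<not> one_sided p q x 1" "\<not> one_sided p q x (- 1)" using os by auto
  then obtain a b where ab: "a \<in> P" "a \<noteq> p" "a \<noteq> q" "\<not> 0 < hgt x a - hgt x p" "b \<in> P" "b \<noteq> p" "b \<noteq> q" "\<not> hgt x b - hgt x p < 0"
    unfolding one_sided_def by auto
  have "hgt x a \<noteq> hgt x p" "hgt x b \<noteq> hgt x p" using off_line[OF pq(1-4)] ab by blast+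
  then have "hgt x p < hgt x b" "hgt x a < hgt x p" using ab by auto
  then have "\<forall>\<^sub>F y in F. sep P y (hgt y p)" using side_ev[OF F ev_sep_strict[OF pq(1) ab(5) ab(1)]] by blast
  then show ?thesis by (rule germ_surj[OF F pq(1)])
qed

lemma no_switch_const:
  assumes f: "f \<in> L" and ns: "\<And>x. \<not> switch f x" shows "gr f x = gr f 0"
proof (rule connected_induction_simple[of UNIV 0 x "\<lambda>x. gr f x = gr f 0"])
  fix a
  obtain b where b: "b > a" "\<And>y. a < y \<Longrightarrow> y < b \<Longrightarrow> gr f y = gr f a" using gr_near[OF f, of a] by blast
  obtain b' where b': "b' < a" "\<And>y. b' < y \<Longrightarrow> y < a \<Longrightarrow> gr f y = gl f a" using gl_near[OF f, of a] by blast
  have "gl f a = gr f a" using ns by (simp add: switch_def)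
  then have "gr f y = gr f a" if "y \<in> {b'<..<b}" for y
    using b(2)[of y] b'(2)[of y] that by (cases y a rule: linorder_cases) auto
  then have "\<forall>x\<in>{b'<..<b}. \<forall>y\<in>{b'<..<b}. gr f x = gr f 0 \<longrightarrow> gr f y = gr f 0" by simp
  moreover have "openin (top_of_set UNIV) {b'<..<b}" by simp
  moreover have "a \<in> {b'<..<b}" using b b' by simp
  ultimately show "\<exists>T. openin (top_of_set UNIV) T \<and> a \<in> T \<and> (\<forall>x\<in>T. \<forall>y\<in>T. gr f x = gr f 0 \<longrightarrow> gr f y = gr f 0)" by blast
qed auto

text \<open>A sheet without switches is the dual of a point \<open>p\<close>. At the line to each
  other point it crosses some sheet, and by uniqueness of the crossings a different one each time;
  but there are \<open>card P - 1\<close> other points and only \<open>card P - 3\<close> other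
  sheets.\<close>

lemma switch_exists:
  assumes uniq: "\<And>f g x y. f \<in> L \<Longrightarrow> g \<in> L \<Longrightarrow> f \<noteq> g \<Longrightarrow> crosses f g x \<Longrightarrow> crosses f g y \<Longrightarrow> \<exists>k::int. y = x + of_int k * pi"
    and f: "f \<in> L"
  shows "\<exists>x. switch f x"
proof (rule ccontr)
  assume ns: "\<nexists>x. switch f x"
  define p where "p = gr f 0"
  have grp: "gr f x = p" "gl f x = p" for x using no_switch_const[OF f] ns unfolding p_def switch_def by metis+
  have pP: "p \<in> P" unfolding p_def by (rule germ_in[OF side_simps(2) f])
  have fx: "f x = hgt x p" for x using germ_at[OF side_simps(2) f, of x] grp(1)[of x] by metis
  have "\<exists>g x. g \<in> L \<and> g \<noteq> f \<and> crosses f g x \<and> gl g x = q" if q: "q \<in> P - {p}" for q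
  proof -
    have qP: "q \<in> P" "p \<noteq> q" using q by auto
    obtain x where x: "hgt x p = hgt x q" using dir_exists[OF qP(2)] by blast
    have "\<nexists>\<sigma>. one_sided p q x \<sigma>"
    proof
      assume "\<exists>\<sigma>. one_sided p q x \<sigma>"
      then obtain \<sigma> where "one_sided p q x \<sigma>" ..
      from one_sided_switch[OF pP qP(1) qP(2) x this f fx] show False using grp qP by metis
    qed
    then have "\<nexists>\<sigma>. one_sided q p x \<sigma>" using one_sided_swap[OF x[symmetric]] by blast
    then obtain g where g: "g \<in> L" "gl g x = q" using two_sided[OF qP(1) pP qP(2)[symmetric] x[symmetric] _ side_simps(1)] by blast
    have gf: "g \<noteq> f" using g grp qP by metis
    have "g x = f x" using germ_at[OF side_simps(1) g(1), of x] g(2) x fx by metis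
    then have "crosses f g x" using meet_cases[OF f g(1) gf[symmetric], of x] grp[of x] unfolding crosses_def by metis
    then show ?thesis using g gf by blast
  qed
  then obtain G X where GX: "\<And>q. q \<in> P - {p} \<Longrightarrow> G q \<in> L \<and> G q \<noteq> f \<and> crosses f (G q) (X q) \<and> gl (G q) (X q) = q" by metis
  have "inj_on G (P - {p})"
  proof (rule inj_onI)
    fix q r assume q: "q \<in> P - {p}" and r: "r \<in> P - {p}" and e: "G q = G r"
    obtain k :: int where "X r = X q + of_int k * pi" using uniq[OF f, of "G q" "X q" "X r"] GX[OF q] GX[OF r] e by metis
    then have "gl (G q) (X r) = gl (G q) (X q)" using gl_per GX[OF q] by simp
    then show "q = r" using GX[OF q] GX[OF r] e by metis
  qed
  moreover have "G ` (P - {p}) \<subseteq> L - {f}" using GX by blast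
  ultimately have "card (P - {p}) \<le> card (L - {f})" using finL by (intro card_inj_on_le) auto
  moreover have "card (P - {p}) = card P - 1" "card (L - {f}) = card L - 1" using pP f finP finL by simp_all
  ultimately show False using cardL n3 by simp
qed

end

context rolling
begin

text \<open>Away from the hull another sheet arrives along the dual of \<open>q\<close>. It meets
  \<open>g\<close>, which switches, so it has to switch as well.\<close>

lemma switch_partner:
  assumes g: "g \<in> L" "gl g x = p" "gr g x = q" "p \<noteq> q" and os: "\<nexists>\<sigma>. one_sided p q x \<sigma>"
  shows "(q, p) \<in> switching"
proof -
  have pq: "p \<in> P" "q \<in> P" "hgt x p = hgt x q"
    using germ_in[OF side_simps(1) g(1), of x] germ_in[OF side_simps(2) g(1), of x] heights_meet[OF g(1), of x] g by auto
  have "\<nexists>\<sigma>. one_sided q p x \<sigma>" using os one_sided_swap[OF pq(3)[symmetric]] by blast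
  then obtain h where h: "h \<in> L" "gl h x = q"
    using two_sided[OF pq(2,1) g(4)[symmetric] pq(3)[symmetric] _ side_simps(1)] by blast
  have gh: "h \<noteq> g" using h g by metis
  have "h x = g x" using germ_at[OF side_simps(1) h(1), of x] germ_at[OF side_simps(1) g(1), of x] h g pq by metis
  then have "gr h x = p" using meet_cases[OF h(1) g(1) gh] h g by metis
  then show ?thesis unfolding switching_def using h g pq by blast
qed

lemma edge_partner:
  assumes "\<not> extreme p" "(q, p) \<in> switching" shows "(p, q) \<in> switching"
proof -
  have "p \<in> P" "q \<in> P" "q \<noteq> p" "\<exists>g\<in>L. \<exists>x. gl g x = q \<and> gr g x = p" using assms(2) by (auto simp: switching_def)
  then obtain g x where g: "p \<in> P" "q \<in> P" "q \<noteq> p" "g \<in> L" "gl g x = q" "gr g x = p" by blast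
  have h: "hgt x q = hgt x p" using heights_meet[OF g(4), of x] g by simp
  have "\<nexists>\<sigma>. one_sided q p x \<sigma>"
    using one_sided_extreme[OF g(1,2) g(3)[symmetric] h[symmetric]] one_sided_swap[OF h] assms(1) by blast
  then show ?thesis by (rule switch_partner[OF g(4-6,3)])
qed

text \<open>At an inner point the only flat arc starts at one angle \<open>x0\<close> per half-turn.
  During the half-turn that follows, \<open>next_up\<close> does not change, so all edges at
  \<open>p\<close> point to the same side of the line at angle \<open>x0\<close>.\<close>

lemma pointed_vertex:
  assumes p: "p \<in> P"
  shows "\<exists>a. a \<noteq> 0 \<and> (\<forall>q. (p, q) \<in> switching \<or> (q, p) \<in> switching \<longrightarrow> inner a p \<le> inner a q)"
proof (cases "extreme p")
  case True
  then obtain x where x: "\<And>q. q \<in> P \<Longrightarrow> q \<noteq> p \<Longrightarrow> hgt x q < hgt x p" unfolding extreme_def by blast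
  have "inner (- (\<i> * cis x)) z = - hgt x z" for z by (simp add: hgt_crs crs_inner)
  moreover have "- (\<i> * cis x) \<noteq> 0" by simp
  moreover have "hgt x q \<le> hgt x p" if "(p, q) \<in> switching \<or> (q, p) \<in> switching" for q
  proof -
    have "q \<in> P" "q \<noteq> p" using that by (auto simp: switching_def)
    then show ?thesis using x[of q] by simp
  qed
  ultimately show ?thesis by (intro exI[of _ "- (\<i> * cis x)"]) simp
next
  case False
  obtain f i where fi: "(f, i) \<in> flat_arcs" "V f i = p" using flat_arc_ex[OF p False] by blast
  have f: "f \<in> L" using fi by (auto simp: flat_arcs_def arcs_def)
  note rf = roll[OF f]
  define x0 where "x0 = T f i"
  \<comment> \<open>The start \<open>x0\<close> is included because a switch there has no earlier
    angle in \<open>J\<close>, so the flat arc itself is no obstacle to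
    \<open>next_up_const\<close>.\<close>
  define J where "J = {x0..<x0 + pi}"
  have cr: "crn h l" if h: "h \<in> L" "V h l = p" "T h l \<in> J" "y \<in> J" "y < T h l" for h l y
  proof (rule ccontr)
    assume n: "\<not> crn h l"
    note rh = roll[OF h(1)]
    have "(h, l mod M h) \<in> flat_arcs" unfolding flat_arcs_def arcs_def
      using roll.corner_mod[OF rh] n h(1) roll.m_pos[OF rh] by simp
    moreover have "V h (l mod M h) = p" using roll.v_mod[OF rh] h(2) by simp
    \<comment> \<open>By uniqueness any flat arc at \<open>p\<close> is the given one, so its angle
      differs from \<open>x0\<close> by a multiple of pi, and none lies strictly inside the
      half-turn.\<close>
    ultimately have "f = h \<and> i = l mod M h" using flat_arc_unique[OF fi(1)] fi(2) False by metis
    then have "l = i + (l div M f) * M f" by (metis add.commute mult.commute mult_div_mod_eq)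
    then have "T f l = x0 + of_int (l div M f) * pi" using roll.t_add[OF rf, of i "l div M f"] by (simp add: x0_def)
    then have "T h l = x0 + of_int (l div M f) * pi" using \<open>f = h \<and> i = l mod M h\<close> by simp
    moreover have "x0 < T h l" "T h l < x0 + pi" using h by (auto simp: J_def)
    ultimately have "0 < of_int (l div M f) * pi" "of_int (l div M f) * pi < 1 * pi" by auto
    then have "0 < real_of_int (l div M f)" "real_of_int (l div M f) < 1" by (simp_all only: zero_less_mult_iff mult_less_cancel_right, simp_all)
    then have "0 < l div M f" "l div M f < 1" by linarith+
    then show False by linarith
  qed
  define \<sigma> where "\<sigma> = (if next_up p x0 then 1 else - 1 :: real)"
  have const: "next_up p y \<longleftrightarrow> next_up p x0" if "y \<in> J" for y
  proof -
    have "connected J" "x0 \<in> J" by (auto simp: J_def)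
    then have "next_up p b" if "a \<in> J" "b \<in> J" "next_up p a" for a b
      by (intro next_up_const[OF p False _ that(1,2) _ that(3)]) (simp, rule cr)
    then show ?thesis using \<open>x0 \<in> J\<close> \<open>y \<in> J\<close> by blast
  qed
  have "0 \<le> \<sigma> * (hgt x0 q - hgt x0 p)" if "(p, q) \<in> switching \<or> (q, p) \<in> switching" for q
  proof -
    have "(p, q) \<in> switching" using that edge_partner[OF False] by blast
    then have "p \<noteq> q" "\<exists>g\<in>L. \<exists>y. gl g y = p \<and> gr g y = q" by (auto simp: switching_def)
    then obtain g y where g: "q \<noteq> p" "g \<in> L" "gl g y = p" "gr g y = q" by metis
    \<comment> \<open>Brings the switch into the half-turn that excludes \<open>x0\<close> and
      includes \<open>x0 + pi\<close>, so that the angles just before the switch belong to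
      \<open>J\<close>.\<close>
    define k where "k = \<lceil>(y - x0) / pi\<rceil> - 1"
    have "of_int k < (y - x0) / pi" "(y - x0) / pi \<le> of_int k + 1" unfolding k_def by linarith+
    then have k: "of_int k * pi < y - x0" "y - x0 \<le> (of_int k + 1) * pi" by (simp_all add: pos_divide_le_eq pos_less_divide_eq)
    define y' where "y' = y + of_int (- k) * pi"
    have y': "x0 < y'" "y' \<le> x0 + pi" using k by (auto simp: y'_def algebra_simps)
    have gy: "gl g y' = p" "gr g y' = q" using gl_per[OF g(2), of y "- k"] gr_per[OF g(2), of y "- k"] g unfolding y'_def by simp_all
    obtain j where j: "y' = T g (j + 1)" using switch_T[OF g(2), of y'] gy g(1) by metis
    have Vj: "V g j = p" "V g (j + 1) = q" using gl_T[OF g(2), of j] gr_T[OF g(2), of "j + 1"] gy j by auto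
    have Cj: "q - p = of_real (C g j) * cis y'" using roll.edge[OF roll[OF g(2)], of j] Vj j by simp
    define w where "w = (max (T g j) x0 + y') / 2"
    have "T g j < y'" using j roll.t_step[OF roll[OF g(2)]] by simp
    then have w: "T g j < w" "x0 < w" "w < y'" using y' by (auto simp: w_def)
    have "next_up p w \<longleftrightarrow> 0 < C g j" by (rule next_up_iff[OF g(2) _ _ Vj(1)]) (use w j in auto)
    moreover have "w \<in> J" using w y' by (simp add: J_def)
    ultimately have sg: "next_up p x0 \<longleftrightarrow> 0 < C g j" using const by blast
    have "C g j \<noteq> 0" by (rule roll.c_nz[OF roll[OF g(2)]])
    then have "0 \<le> \<sigma> * C g j" using sg by (auto simp: \<sigma>_def)
    moreover have "0 \<le> sin (y' - x0)" using y' by (intro sin_ge_zero) auto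
    ultimately have "0 \<le> (\<sigma> * C g j) * sin (y' - x0)" by (rule mult_nonneg_nonneg)
    then show ?thesis using hgt_dir[OF Cj, of x0] by simp
  qed
  moreover have "inner (of_real \<sigma> * (\<i> * cis x0)) z = \<sigma> * hgt x0 z" for z
    unfolding hgt_crs crs_inner by (metis inner_scaleR_left scaleR_conv_of_real)
  moreover have "of_real \<sigma> * (\<i> * cis x0) \<noteq> 0" by (simp add: \<sigma>_def)
  ultimately show ?thesis by (intro exI[of _ "of_real \<sigma> * (\<i> * cis x0)"]) (simp add: right_diff_distrib)
qed

end

section \<open>The faces cut out by an arrangement\<close>

lemma inside_subset_convex_hull: "S \<subseteq> convex hull P \<Longrightarrow> inside S \<subseteq> convex hull (P :: complex set)"
  using outside_subset_convex[OF convex_convex_hull, of S P] inside_Int_outside[of S] by blast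

lemma segment_hgt:
  assumes z: "z \<in> closed_segment p q" "z' \<in> closed_segment p q" and "z \<noteq> z'" "hgt x z = hgt x z'"
  shows "hgt x p = hgt x z" "hgt x q = hgt x z"
proof -
  obtain a b where "z = p + of_real a * (q - p)" "z' = p + of_real b * (q - p)" using segmentE[OF z(1)] segmentE[OF z(2)] by metis
  then have ab: "hgt x z = hgt x p + a * hgt x (q - p)" "hgt x z' = hgt x p + b * hgt x (q - p)" "a \<noteq> b"
    using assms(3) by (auto simp: hgt_add hgt_scale)
  then have "hgt x (q - p) = 0" using assms(4) by simp
  then show "hgt x p = hgt x z" "hgt x q = hgt x z" using ab by (simp_all add: hgt_diff)
qed

lemma dir_through: obtains x where "hgt x p = hgt x q"
  using dir_exists[of p q] by (cases "p = q") auto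

lemma interior_segments:
  assumes "finite A" "\<And>e. e \<in> A \<Longrightarrow> \<exists>p q. e = closed_segment p (q :: complex)" shows "interior (\<Union>A) = {}"
  using assms
proof (induction A)
  case (insert e A)
  obtain p q where e: "e = closed_segment p q" using insert by blast
  have "interior (e \<union> \<Union>A) = interior e" by (rule interior_closed_Un_empty_interior) (use e insert in auto)
  moreover have "interior e = {}" using e interior_closed_segment_ge2[of p q] by simp
  ultimately show ?case by simp
qed simp

lemma side_near: assumes "a \<noteq> 0" "0 < r" shows "\<exists>y\<in>ball z r. crs a (y - z) < 0"
proof -
  define \<eta> where "\<eta> = r / (2 * cmod a)"
  have "0 < \<eta>" "\<eta> * cmod a < r" using assms by (simp_all add: \<eta>_def)
  then have "z - of_real \<eta> * (\<i> * a) \<in> ball z r" "crs a (z - of_real \<eta> * (\<i> * a) - z) < 0"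
    using assms(1) by (simp_all add: dist_norm norm_mult crs_minus2 crs_scale2 crs_ii)
  then show ?thesis by blast
qed

lemma half_hull:
  assumes "\<And>r. r \<in> P \<Longrightarrow> 0 \<le> crs a (r - p)" "w \<in> convex hull P" shows "0 \<le> crs a (w - p)"
  using hull_minimal[of P "{w. 0 \<le> crs a (w - p)}" convex] convex_crs_nonneg assms by blast

lemma not_interior_hull:
  assumes "\<And>r. r \<in> P \<Longrightarrow> 0 \<le> crs a (r - p)" "crs a (z - p) = 0" "a \<noteq> 0" shows "z \<notin> interior (convex hull P)"
proof
  assume "z \<in> interior (convex hull P)"
  then obtain r where r: "0 < r" "ball z r \<subseteq> convex hull P" unfolding mem_interior by blast
  obtain y where y: "y \<in> ball z r" "crs a (y - z) < 0" using side_near[OF assms(3) r(1)] by blast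
  have "0 \<le> crs a (y - p)" by (rule half_hull[OF assms(1)]) (use y r in auto)
  then show False using y(2) assms(2) by (simp add: crs_diff2)
qed

lemma (in pts) on_edge:
  assumes "p \<in> P" "q \<in> P" "p \<noteq> q" "r \<in> P" "r \<in> closed_segment p q" shows "r = p \<or> r = q"
proof -
  obtain x where x: "hgt x p = hgt x q" by (rule dir_through)
  obtain b where "r = p + of_real b * (q - p)" using segmentE[OF assms(5)] by metis
  then have "hgt x r = hgt x p" using x by (simp add: hgt_add hgt_scale hgt_diff)
  then show ?thesis by (rule off_line[OF assms(1-3) x assms(4)])
qed

context rolling
begin

abbreviation "Cu f \<equiv> spoly.curve (V f)"
abbreviation "In f \<equiv> inside (Cu f)"
abbreviation "edge f i \<equiv> closed_segment (V f i) (V f (i + 1))"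

lemma spoly_V: "f \<in> L \<Longrightarrow> spoly (M f) (V f)"
  using roll.spoly[OF roll three_corners_each] .

definition E :: "complex set set" where "E = {closed_segment p q | p q. (p, q) \<in> switching}"

lemma edge_switching: assumes f: "f \<in> L" shows "(V f i, V f (i + 1)) \<in> switching"
  unfolding switching_def using f V_in[OF f] roll.v_neq[OF roll[OF f], of i] gl_T[OF f, of i] gr_T[OF f, of "i + 1"]
  by force

lemma edge_in: "f \<in> L \<Longrightarrow> edge f i \<in> E"
  using edge_switching unfolding E_def by blast

lemma switching_edge:
  assumes "(p, q) \<in> switching" shows "\<exists>f\<in>L. \<exists>i. V f i = p \<and> V f (i + 1) = q"
proof -
  have "p \<noteq> q" "\<exists>f\<in>L. \<exists>x. gl f x = p \<and> gr f x = q" using assms by (auto simp: switching_def)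
  then obtain f x where f: "f \<in> L" "gl f x = p" "gr f x = q" "gl f x \<noteq> gr f x" by blast
  obtain i where "x = T f (i + 1)" using switch_T[OF f(1,4)] ..
  then show ?thesis using f gl_T[OF f(1)] gr_T[OF f(1)] by metis
qed

lemma E_edge: assumes "e \<in> E" shows "\<exists>f\<in>L. \<exists>i. e = edge f i"
  using assms switching_edge unfolding E_def by blast

lemma E_ends: "e \<in> E \<Longrightarrow> \<exists>p\<in>P. \<exists>q\<in>P. p \<noteq> q \<and> e = closed_segment p q"
  unfolding E_def switching_def by blast

lemma finite_E: "finite E"
proof -
  have "E \<subseteq> (\<lambda>(p, q). closed_segment p q) ` (P \<times> P)" unfolding E_def switching_def by auto
  then show ?thesis by (rule finite_subset) (use finP in simp)
qed

lemma closed_UE: "closed (\<Union>E)"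
  by (rule closed_Union[OF finite_E]) (use E_ends in force)

lemma interior_UE: "interior (\<Union>E) = {}"
  by (rule interior_segments[OF finite_E]) (use E_ends in blast)

lemma same_edge:
  assumes "e \<in> E" "e' \<in> E" "z \<in> e \<inter> e'" "z' \<in> e \<inter> e'" "z \<noteq> z'" shows "e = e'"
proof -
  obtain p q where e: "p \<in> P" "q \<in> P" "p \<noteq> q" "e = closed_segment p q" using E_ends[OF assms(1)] by metis
  obtain p' q' where e': "p' \<in> P" "q' \<in> P" "p' \<noteq> q'" "e' = closed_segment p' q'" using E_ends[OF assms(2)] by metis
  obtain x where x: "hgt x z = hgt x z'" by (rule dir_through)
  have 1: "hgt x p = hgt x z" "hgt x q = hgt x z" using segment_hgt[of z p q z' x] assms e x by auto
  have 2: "hgt x p' = hgt x z" "hgt x q' = hgt x z" using segment_hgt[of z p' q' z' x] assms e' x by auto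
  have pq: "hgt x p = hgt x q" using 1 by metis
  have "p' = p \<or> p' = q" by (rule off_line[OF e(1-3) pq e'(1)]) (use 1 2 in metis)
  moreover have "q' = p \<or> q' = q" by (rule off_line[OF e(1-3) pq e'(2)]) (use 1 2 in metis)
  ultimately show ?thesis using e(4) e'(3,4) closed_segment_commute by metis
qed

lemma edge_side:
  assumes f: "f \<in> L" and z: "z \<in> open_segment (V f i) (V f (i + 1))"
  shows "\<exists>r>0. \<forall>y\<in>ball z r. (crs (V f (i + 1) - V f i) (y - z) < 0 \<longrightarrow> y \<in> In f) \<and>
     (0 < crs (V f (i + 1) - V f i) (y - z) \<longrightarrow> y \<in> outside (Cu f))"
  using spoly.on_side_orient[OF spoly_V[OF f] z]
  unfolding spoly.on_side_def[OF spoly_V[OF f]] roll.orient_roll[OF roll[OF f] three_corners_each[OF f]] by simp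

lemma Cu_sub: "f \<in> L \<Longrightarrow> Cu f \<subseteq> \<Union>E"
  unfolding spoly.curve_def[OF spoly_V] using edge_in by blast

lemma In_hull: assumes f: "f \<in> L" shows "In f \<subseteq> interior (convex hull P)"
proof (rule interior_maximal[OF inside_subset_convex_hull spoly.in_open[OF spoly_V[OF f]]])
  have "edge f i \<subseteq> convex hull P" for i using V_in[OF f] by (simp add: closed_segment_subset_convex_hull hull_inc)
  then show "Cu f \<subseteq> convex hull P" unfolding spoly.curve_def[OF spoly_V[OF f]] by blast
qed

text \<open>Regions lie to the right of their edges and inside the hull, which is to the left of a
  hull pair. Hence hull edges are traversed only against the direction of the pair.\<close>

lemma hull_pair_switching:
  assumes H: "(p, q) \<in> hull_pairs" shows "(q, p) \<in> switching" "(p, q) \<notin> switching"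
proof -
  have pq: "p \<in> P" "q \<in> P" "p \<noteq> q" using H by (auto simp: hull_pairs_def)
  have pos: "0 \<le> crs (q - p) (r - p)" if "r \<in> P" for r
    using H that by (cases "r = p \<or> r = q") (auto simp: hull_pairs_def intro: less_imp_le)
  show n: "(p, q) \<notin> switching"
  proof
    assume "(p, q) \<in> switching"
    then obtain f i where f: "f \<in> L" "V f i = p" "V f (i + 1) = q" using switching_edge by blast
    define z where "z = V f i + of_real (1/2) * (V f (i + 1) - V f i)"
    have zo: "z \<in> open_segment (V f i) (V f (i + 1))" unfolding z_def by (rule spoly.midpoint_in[OF spoly_V[OF f(1)]])
    obtain r where r: "0 < r" "\<And>y. y \<in> ball z r \<Longrightarrow> crs (q - p) (y - z) < 0 \<Longrightarrow> y \<in> In f"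
      using edge_side[OF f(1) zo] f by blast
    obtain y where y: "y \<in> ball z r" "crs (q - p) (y - z) < 0" using side_near[of "q - p" r z] r pq by auto
    have "y \<in> convex hull P" using In_hull[OF f(1)] interior_subset r(2)[OF y] by blast
    from half_hull[OF pos this] have "0 \<le> crs (q - p) (y - p)" .
    moreover have "y - p = (y - z) + of_real (1/2) * (q - p)" using f by (simp add: z_def)
    ultimately show False using y(2) by (simp add: crs_add2 crs_scale2 del: of_real_divide)
  qed
  obtain x where x: "hgt x p = hgt x q" by (rule dir_through)
  obtain c where c: "q - p = of_real c * cis x" using x hgt_eq_dir by blast
  have "one_sided p q x c" unfolding one_sided_def using hull_pairs_height[OF H c] c pq by auto
  moreover obtain f where f: "f \<in> L" "f x = hgt x p" using suppL[of x "hgt x p"] pq x unfolding sep_def by force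
  ultimately have "gl f x = p \<and> gr f x = q \<or> gl f x = q \<and> gr f x = p" using one_sided_switch[OF pq x] by blast
  then show "(q, p) \<in> switching" using n f pq unfolding switching_def by blast
qed

lemma P_sub: assumes p: "p \<in> P" shows "p \<in> \<Union>E"
proof -
  have "\<exists>q. (p, q) \<in> switching \<or> (q, p) \<in> switching"
  proof (cases "extreme p")
    case True
    then obtain q where "(p, q) \<in> hull_pairs" using hull_pair_extreme by blast
    then show ?thesis using hull_pair_switching by blast
  next
    case False
    then obtain f i where "(f, i) \<in> flat_arcs" "V f i = p" using flat_arc_ex[OF p] by blast
    then have "f \<in> L" "V f i = p" by (auto simp: flat_arcs_def arcs_def)
    then show ?thesis using edge_switching by metis
  qed
  then show ?thesis unfolding E_def by force
qed

text \<open>That edges do not cross is known only at the end. Until then these finitely many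
  exceptional points are removed, so that a neighbourhood of any other point sees at most one
  edge.\<close>

definition Z :: "complex set" where "Z = P \<union> \<Union>{e \<inter> e' | e e'. e \<in> E \<and> e' \<in> E \<and> e \<noteq> e'}"

lemma finite_Z: "finite Z"
proof -
  have "finite (e \<inter> e')" if "e \<in> E" "e' \<in> E" "e \<noteq> e'" for e e'
  proof -
    have "\<exists>z. e \<inter> e' \<subseteq> {z}" using same_edge[OF that(1,2)] that(3) by (cases "e \<inter> e' = {}") blast+
    then show ?thesis using finite_subset by blast
  qed
  moreover have "{e \<inter> e' | e e'. e \<in> E \<and> e' \<in> E \<and> e \<noteq> e'} \<subseteq> (\<lambda>(e, e'). e \<inter> e') ` (E \<times> E)" by auto
  then have "finite {e \<inter> e' | e e'. e \<in> E \<and> e' \<in> E \<and> e \<noteq> e'}" by (rule finite_subset) (use finite_E in simp)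
  ultimately show ?thesis unfolding Z_def using finP by auto
qed

text \<open>The ordered pair of ends determines the sheet, so a different sheet can use the same
  segment only in the opposite direction.\<close>

lemma edge_only:
  assumes f: "f \<in> L" and k: "k \<in> L" "k \<noteq> f" "edge k j = edge f i" shows "V k j = V f (i + 1) \<and> V k (j + 1) = V f i"
proof -
  note ne = roll.v_neq[OF roll[OF f], of i] roll.v_neq[OF roll[OF k(1)], of j]
  have "V k j \<in> edge f i" "V k (j + 1) \<in> edge f i" using k(3) by (metis ends_in_segment)+
  then have m: "V k j = V f i \<or> V k j = V f (i + 1)" "V k (j + 1) = V f i \<or> V k (j + 1) = V f (i + 1)"
    using on_edge[OF V_in[OF f] V_in[OF f] ne(1)[symmetric] V_in[OF k(1)]] by blast+
  have "V k j \<noteq> V f i"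
  proof
    assume e: "V k j = V f i"
    then have e': "V k (j + 1) = V f (i + 1)" using m ne by metis
    have "hgt (T f (i + 1)) (V f i) = hgt (T f (i + 1)) (V f (i + 1))" by (rule roll.hgt_join[OF roll[OF f]])
    moreover have "hgt (T k (j + 1)) (V f i) = hgt (T k (j + 1)) (V f (i + 1))" using roll.hgt_join[OF roll[OF k(1)], of j] e e' by simp
    ultimately show False using same_line[OF ne(1)[symmetric] _ _ f k(1)] gl_T[OF f, of i] gl_T[OF k(1), of j] e k(2) by metis
  qed
  then show ?thesis using m ne by metis
qed

lemma In_const:
  assumes "k \<in> L" "connected B" "B \<inter> Cu k = {}" "y \<in> B" "z \<in> B" shows "y \<in> In k \<longleftrightarrow> z \<in> In k"
  using spoly.connected_sub(1)[OF spoly_V[OF assms(1)] assms(2,3,4)] spoly.connected_sub(1)[OF spoly_V[OF assms(1)] assms(2,3,5)] assms by blast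

lemma edge_K:
  assumes f: "f \<in> L" and z: "z \<in> open_segment (V f i) (V f (i + 1))" "z \<notin> Z"
  obtains r where "0 < r" "\<forall>y\<in>ball z r. \<forall>k\<in>L. (\<forall>j. edge k j \<noteq> edge f i) \<longrightarrow> y \<in> In k \<longleftrightarrow> z \<in> In k"
    "\<forall>y\<in>ball z r. crs (V f (i + 1) - V f i) (y - z) < 0 \<longrightarrow> y \<in> In f"
    "\<forall>y\<in>ball z r. 0 < crs (V f (i + 1) - V f i) (y - z) \<longrightarrow> y \<notin> In f"
    "\<forall>y\<in>ball z r. y \<in> \<Union>E \<longleftrightarrow> crs (V f (i + 1) - V f i) (y - z) = 0"
proof -
  have ze: "z \<in> edge f i" using z(1) by (simp add: open_segment_def)
  have nz: "z \<notin> \<Union>(E - {edge f i})" using z(2) ze edge_in[OF f, of i] unfolding Z_def by blast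
  have "closed (\<Union>(E - {edge f i}))" by (rule closed_Union) (use finite_E E_ends in force)+
  from ball_avoid[OF this nz] obtain r1 where r1: "0 < r1" "ball z r1 \<inter> \<Union>(E - {edge f i}) = {}" by blast
  obtain r2 where r2: "0 < r2" "\<And>y. y \<in> ball z r2 \<Longrightarrow> crs (V f (i + 1) - V f i) (y - z) < 0 \<Longrightarrow> y \<in> In f"
    "\<And>y. y \<in> ball z r2 \<Longrightarrow> 0 < crs (V f (i + 1) - V f i) (y - z) \<Longrightarrow> y \<in> outside (Cu f)" using edge_side[OF f z(1)] by blast
  obtain r3 where r3: "0 < r3" "\<And>y. y \<in> ball z r3 \<Longrightarrow> y \<in> Cu f \<longleftrightarrow> crs (V f (i + 1) - V f i) (y - z) = 0"
    using spoly.near_edge[OF spoly_V[OF f] z(1)] by blast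
  define r where "r = min r1 (min r2 r3)"
  have r: "0 < r" "ball z r \<subseteq> ball z r1" "ball z r \<subseteq> ball z r2" "ball z r \<subseteq> ball z r3" using r1 r2 r3 by (auto simp: r_def)
  show thesis
  proof (rule that[OF r(1)]; intro ballI impI)
    fix y k assume y: "y \<in> ball z r" and k: "k \<in> L" "\<forall>j. edge k j \<noteq> edge f i"
    show "y \<in> In k \<longleftrightarrow> z \<in> In k"
    proof (rule In_const[OF k(1) connected_ball])
      show "ball z r \<inter> Cu k = {}" unfolding spoly.curve_def[OF spoly_V[OF k(1)]] using edge_in[OF k(1)] k(2) r1 r(2) by blast
    qed (use y r in auto)
  next
    fix y assume y: "y \<in> ball z r"
    show "y \<in> In f" if "crs (V f (i + 1) - V f i) (y - z) < 0" using r2(2) y r(3) that by blast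
    show "y \<notin> In f" if "0 < crs (V f (i + 1) - V f i) (y - z)" using r2(3) y r(3) that inside_Int_outside by blast
    have "y \<in> \<Union>E \<longleftrightarrow> y \<in> edge f i" using r1 y r(2) edge_in[OF f, of i] by blast
    moreover have "y \<in> Cu f \<longleftrightarrow> y \<in> edge f i"
      unfolding spoly.curve_def[OF spoly_V[OF f]] using r1 y r(2) edge_in[OF f] by blast
    ultimately show "y \<in> \<Union>E \<longleftrightarrow> crs (V f (i + 1) - V f i) (y - z) = 0" using r3(2) y r(4) by blast
  qed
qed

section \<open>The number of regions around a point\<close>

definition K :: "complex \<Rightarrow> (real \<Rightarrow> real) set" where "K y = {f \<in> L. y \<in> In f}"

lemma finite_K: "finite (K y)" unfolding K_def using finL by simp

text \<open>An edge that meets the interior of the hull is used by two sheets in opposite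
  directions, with their regions on opposite sides. Crossing the edge leaves one region and enters
  the other, and all further regions stay.\<close>

lemma card_K_local:
  assumes x: "x \<in> interior (convex hull P)" "x \<notin> Z"
  shows "\<exists>r>0. \<exists>n. \<forall>y\<in>ball x r. y \<notin> \<Union>E \<longrightarrow> card (K y) = n"
proof (cases "x \<in> \<Union>E")
  case False
  then obtain r where r: "0 < r" "ball x r \<inter> \<Union>E = {}" using ball_avoid closed_UE by metis
  have "K y = K x" if "y \<in> ball x r" for y
  proof -
    have "y \<in> In k \<longleftrightarrow> x \<in> In k" if k: "k \<in> L" for k
      by (rule In_const[OF k connected_ball, of x r]) (use \<open>y \<in> ball x r\<close> r Cu_sub[OF k] in auto)
    then show ?thesis by (auto simp: K_def)
  qed
  then show ?thesis using r by metis
next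
  case True
  then obtain e where "e \<in> E" "x \<in> e" by blast
  then obtain f i where f: "f \<in> L" "x \<in> edge f i" using E_edge by metis
  define p q where "p = V f i" and "q = V f (i + 1)"
  note PQ = p_def[symmetric] q_def[symmetric]
  have pq: "p \<in> P" "q \<in> P" "p \<noteq> q" "hgt (T f (i + 1)) p = hgt (T f (i + 1)) q"
    using V_in[OF f(1)] roll.v_neq[OF roll[OF f(1)], of i] roll.hgt_join[OF roll[OF f(1)], of i] by (auto simp: p_def q_def)
  have "x \<notin> P" using x(2) by (simp add: Z_def)
  then have xo: "x \<in> open_segment (V f i) (V f (i + 1))" using f(2) pq by (auto simp: open_segment_def p_def q_def)
  have "(q, p) \<in> switching"
  proof (rule switch_partner[OF f(1) _ _ pq(3)])
    show "gl f (T f (i + 1)) = p" "gr f (T f (i + 1)) = q" by (simp_all add: p_def q_def gl_T[OF f(1)] gr_T[OF f(1)])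
    show "\<nexists>\<sigma>. one_sided p q (T f (i + 1)) \<sigma>"
    proof
      assume "\<exists>\<sigma>. one_sided p q (T f (i + 1)) \<sigma>"
      then obtain \<sigma> where s: "one_sided p q (T f (i + 1)) \<sigma>" ..
      define a where "a = of_real \<sigma> * cis (T f (i + 1))"
      have a: "crs a (w - p) = \<sigma> * (hgt (T f (i + 1)) w - hgt (T f (i + 1)) p)" for w
        by (simp add: a_def crs_scale1 hgt_crs crs_diff2 right_diff_distrib)
      have "0 \<le> crs a (r - p)" if "r \<in> P" for r
        using s that pq(4) unfolding a one_sided_def by (cases "r = p \<or> r = q") (auto intro: less_imp_le)
      moreover have "crs a (x - p) = 0"
      proof -
        obtain b where "x = p + of_real b * (q - p)" using segmentE[OF f(2)] unfolding PQ by metis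
        then show ?thesis using pq(4) unfolding a by (simp add: hgt_add hgt_scale hgt_diff)
      qed
      moreover have "a \<noteq> 0" using s by (simp add: a_def one_sided_def)
      ultimately show False using not_interior_hull[of P a p x] x(1) by blast
    qed
  qed
  then obtain g j where g: "g \<in> L" "V g j = q" "V g (j + 1) = p" using switching_edge by blast
  have xg: "x \<in> open_segment (V g j) (V g (j + 1))" using xo g by (simp add: p_def q_def open_segment_commute)
  obtain r1 where r1': "0 < r1" "\<forall>y\<in>ball x r1. \<forall>k\<in>L. (\<forall>j. edge k j \<noteq> closed_segment p q) \<longrightarrow> y \<in> In k \<longleftrightarrow> x \<in> In k"
    "\<forall>y\<in>ball x r1. crs (q - p) (y - x) < 0 \<longrightarrow> y \<in> In f" "\<forall>y\<in>ball x r1. 0 < crs (q - p) (y - x) \<longrightarrow> y \<notin> In f"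
    "\<forall>y\<in>ball x r1. y \<in> \<Union>E \<longleftrightarrow> crs (q - p) (y - x) = 0" by (rule edge_K[OF f(1) xo x(2), unfolded PQ])
  note r1 = r1'[rule_format]
  obtain r2 where r2': "0 < r2" "\<forall>y\<in>ball x r2. \<forall>k\<in>L. (\<forall>j. edge k j \<noteq> closed_segment q p) \<longrightarrow> y \<in> In k \<longleftrightarrow> x \<in> In k"
    "\<forall>y\<in>ball x r2. crs (p - q) (y - x) < 0 \<longrightarrow> y \<in> In g" "\<forall>y\<in>ball x r2. 0 < crs (p - q) (y - x) \<longrightarrow> y \<notin> In g"
    "\<forall>y\<in>ball x r2. y \<in> \<Union>E \<longleftrightarrow> crs (p - q) (y - x) = 0" by (rule edge_K[OF g(1) xg x(2), unfolded g])
  note r2 = r2'(1) r2'(3,4)[rule_format]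
  have neg: "crs (p - q) w = - crs (q - p) w" for w by (simp add: crs_diff1)
  define r where "r = min r1 r2"
  have r: "0 < r" "ball x r \<subseteq> ball x r1" "ball x r \<subseteq> ball x r2" using r1 r2 by (auto simp: r_def)
  have fg: "f \<noteq> g"
  proof
    assume "f = g"
    obtain y where y: "y \<in> ball x r" "crs (q - p) (y - x) < 0" using side_near[of "q - p" r x] r(1) pq by auto
    have "y \<in> In f" "y \<notin> In g" using r1(3)[of y] r2(3)[of y] r(2,3) y neg[of "y - x"] by (simp_all add: subset_iff)
    then show False using \<open>f = g\<close> by simp
  qed
  define K0 where "K0 = {k \<in> L - {f, g}. x \<in> In k}"
  have "card (K y) = Suc (card K0)" if y: "y \<in> ball x r" "y \<notin> \<Union>E" for y
  proof -
    have y12: "y \<in> ball x r1" "y \<in> ball x r2" using y r by auto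
    have o: "y \<in> In k \<longleftrightarrow> x \<in> In k" if k: "k \<in> L" "k \<noteq> f" "k \<noteq> g" for k
    proof (rule r1(2)[OF y12(1) k(1)])
      fix l show "edge k l \<noteq> closed_segment p q"
      proof
        assume "edge k l = closed_segment p q"
        then have e: "edge k l = edge f i" by (simp only: p_def q_def)
        have "edge f i = edge g j" using g by (simp add: p_def q_def closed_segment_commute)
        then show False using edge_only[OF f(1) k(1,2) e] edge_only[OF g(1) k(1,3), of l j] e g roll.v_neq[OF roll[OF g(1)], of j] by (metis p_def q_def)
      qed
    qed
    have "crs (q - p) (y - x) \<noteq> 0" using r1(5)[OF y12(1)] y(2) by blast
    then consider "crs (q - p) (y - x) < 0" | "0 < crs (q - p) (y - x)" by linarith
    then have "K y = insert f K0 \<or> K y = insert g K0"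
    proof cases
      case 1
      then have "y \<in> In f" "y \<notin> In g" using r1(3)[OF y12(1)] r2(3)[OF y12(2)] neg[of "y - x"] by auto
      then have "K y = insert f K0" using o f(1) g(1) fg unfolding K_def K0_def by blast
      then show ?thesis ..
    next
      case 2
      then have "y \<notin> In f" "y \<in> In g" using r1(4)[OF y12(1)] r2(2)[OF y12(2)] neg[of "y - x"] by auto
      then have "K y = insert g K0" using o f(1) g(1) fg unfolding K_def K0_def by blast
      then show ?thesis ..
    qed
    moreover have "finite K0" "f \<notin> K0" "g \<notin> K0" using finL by (auto simp: K0_def)
    ultimately show ?thesis by auto
  qed
  then show ?thesis using r(1) by blast
qed

text \<open>Only one sheet uses a hull edge. The membership in every other region is the same on
  both sides of the edge, and outside the hull there are no regions.\<close>

lemma K_start: "\<exists>y. y \<in> interior (convex hull P) \<and> y \<notin> \<Union>E \<and> card (K y) = 1"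
proof -
  obtain a where "nice a" using eventually_happens'[OF _ ev_nice[of 0]] by auto
  have "P \<noteq> {}" using n3 by auto
  then obtain p where p: "p \<in> P" "\<And>q. q \<in> P \<Longrightarrow> hgt a q \<le> hgt a p" using finite_max[OF finP, of "hgt a"] by blast
  have "hgt a q < hgt a p" if "q \<in> P" "q \<noteq> p" for q
    using p(2)[OF that(1)] \<open>nice a\<close> that p(1) unfolding nice_def by (metis order_le_less)
  then have "extreme p" unfolding extreme_def using p(1) by blast
  then obtain q where H: "(p, q) \<in> hull_pairs" using hull_pair_extreme by blast
  have pq: "p \<noteq> q" using H by (auto simp: hull_pairs_def)
  obtain f i where f: "f \<in> L" "V f i = q" "V f (i + 1) = p" using switching_edge hull_pair_switching(1)[OF H] by blast
  have "infinite (open_segment q p - Z)" using finite_Z pq by (simp add: Diff_infinite_finite)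
  then have "open_segment q p - Z \<noteq> {}" by (metis finite.emptyI)
  then obtain z where z: "z \<in> open_segment q p" "z \<notin> Z" by blast
  obtain r where r': "0 < r" "\<forall>y\<in>ball z r. \<forall>k\<in>L. (\<forall>j. edge k j \<noteq> closed_segment q p) \<longrightarrow> y \<in> In k \<longleftrightarrow> z \<in> In k"
    "\<forall>y\<in>ball z r. crs (p - q) (y - z) < 0 \<longrightarrow> y \<in> In f" "\<forall>y\<in>ball z r. 0 < crs (p - q) (y - z) \<longrightarrow> y \<notin> In f"
    "\<forall>y\<in>ball z r. y \<in> \<Union>E \<longleftrightarrow> crs (p - q) (y - z) = 0" by (rule edge_K[OF f(1) z[folded f(2,3)] , unfolded f(2,3)])
  note r = r'[rule_format]
  have other: "edge k j \<noteq> closed_segment q p" if "k \<in> L" "k \<noteq> f" for k j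
    using edge_only[OF f(1) that, of _ i] edge_switching[OF that(1)] hull_pair_switching(2)[OF H] f by metis
  obtain y where y: "y \<in> ball z r" "crs (p - q) (y - z) < 0" using side_near[of "p - q" r z] r pq by auto
  obtain w where w: "w \<in> ball z r" "crs (q - p) (w - z) < 0" using side_near[of "q - p" r z] r pq by auto
  have "w \<notin> convex hull P"
  proof
    assume "w \<in> convex hull P"
    moreover have "0 \<le> crs (q - p) (r - p)" if "r \<in> P" for r
      using H that by (cases "r = p \<or> r = q") (auto simp: hull_pairs_def intro: less_imp_le)
    ultimately have "0 \<le> crs (q - p) (w - p)" by (rule half_hull[rotated])
    moreover obtain b where "z = p + of_real b * (q - p)" using z(1) segmentE[of z p q] by (metis open_segment_commute segment_open_subset_closed subsetD)
    ultimately show False using w(2) by (simp add: crs_diff2 crs_add2 crs_scale2)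
  qed
  then have nw: "w \<notin> In k" if "k \<in> L" for k using In_hull[OF that] interior_subset by blast
  have "y \<notin> In k" if k: "k \<in> L" "k \<noteq> f" for k
    using r(2)[OF y(1) k(1) other[OF k]] r(2)[OF w(1) k(1) other[OF k]] nw[OF k(1)] by blast
  then have "K y = {f}" using f(1) r(3)[OF y] unfolding K_def by blast
  moreover have "y \<in> interior (convex hull P)" using In_hull[OF f(1)] r(3)[OF y] by blast
  moreover have "y \<notin> \<Union>E" using r(5)[OF y(1)] y(2) by simp
  ultimately show ?thesis by auto
qed

text \<open>The interior of the hull stays connected after removal of the finite set
  \<open>Z\<close>. Points on edges carry no value of their own, but they are limits of points off
  the edges, around which the number is locally constant.\<close>

lemma K_one: assumes y: "y \<in> interior (convex hull P)" "y \<notin> \<Union>E" shows "card (K y) = 1"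
proof -
  define S where "S = interior (convex hull P) - Z"
  have opS: "open S" unfolding S_def using finite_Z by (intro open_Diff) (auto intro: finite_imp_closed)
  have conS: "connected S" unfolding S_def
    by (rule connected_open_delete_finite) (use finite_Z in \<open>auto intro: convex_connected convex_interior\<close>)
  obtain w where w: "w \<in> interior (convex hull P)" "w \<notin> \<Union>E" "card (K w) = 1" using K_start by blast
  have ZU: "Z \<subseteq> \<Union>E" unfolding Z_def using P_sub by blast
  have "card (K w) = card (K y)"
  proof (rule connected_equivalence_relation_gen[OF conS, of w y "\<lambda>x. x \<notin> \<Union>E" "\<lambda>x y. card (K x) = card (K y)"])
    fix T a assume T: "openin (top_of_set S) T" "a \<in> T"
    have "open T" using T(1) opS openin_open_eq by blast
    then have "\<not> T \<subseteq> \<Union>E" using interior_maximal[of T "\<Union>E"] interior_UE T(2) by blast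
    then show "\<exists>z. z \<in> T \<and> z \<notin> \<Union>E" by blast
  next
    fix a assume a: "a \<in> S"
    then obtain r n where r: "0 < r" "\<And>y. y \<in> ball a r \<Longrightarrow> y \<notin> \<Union>E \<Longrightarrow> card (K y) = n"
      using card_K_local[of a] unfolding S_def by blast
    have "openin (top_of_set S) (S \<inter> ball a r)" by (simp add: openin_open_Int)
    moreover have "a \<in> S \<inter> ball a r" using a r by simp
    moreover have "\<forall>x\<in>S \<inter> ball a r. \<forall>y\<in>S \<inter> ball a r. x \<notin> \<Union>E \<and> y \<notin> \<Union>E \<longrightarrow> card (K x) = card (K y)" using r(2) by (metis IntD2)
    ultimately show "\<exists>T. openin (top_of_set S) T \<and> a \<in> T \<and> (\<forall>x\<in>T. \<forall>y\<in>T. x \<notin> \<Union>E \<and> y \<notin> \<Union>E \<longrightarrow> card (K x) = card (K y))" by blast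
  qed (use w y ZU in \<open>auto simp: S_def\<close>)
  then show ?thesis using w by simp
qed

lemma In_disjoint: assumes "f \<in> L" "g \<in> L" "f \<noteq> g" shows "In f \<inter> In g = {}"
proof (rule ccontr)
  assume ne: "In f \<inter> In g \<noteq> {}"
  have "open (In f \<inter> In g)" using spoly.in_open[OF spoly_V[OF assms(1)]] spoly.in_open[OF spoly_V[OF assms(2)]] by blast
  then have "\<not> In f \<inter> In g \<subseteq> \<Union>E" using interior_maximal[of "In f \<inter> In g" "\<Union>E"] interior_UE ne by blast
  then obtain y where y: "y \<in> In f" "y \<in> In g" "y \<notin> \<Union>E" by blast
  have "card (K y) = 1" by (rule K_one) (use y In_hull[OF assms(1)] in auto)
  moreover have "{f, g} \<subseteq> K y" using y assms by (auto simp: K_def)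
  ultimately show False using card_mono[OF finite_K, of "{f, g}" y] assms(3) by simp
qed

text \<open>Beside any edge lies a region of a sheet that uses it. If the edge ran through another
  region, the two regions would overlap.\<close>

lemma In_UE: assumes f: "f \<in> L" shows "In f \<inter> \<Union>E = {}"
proof (rule ccontr)
  assume "In f \<inter> \<Union>E \<noteq> {}"
  then obtain y e where y: "y \<in> In f" "y \<in> e" "e \<in> E" by blast
  then obtain g i where g: "g \<in> L" "e = edge g i" using E_edge by metis
  have op: "open (In f)" by (rule spoly.in_open[OF spoly_V[OF f]])
  have "y \<in> closure (open_segment (V g i) (V g (i + 1)))" using y g roll.v_neq[OF roll[OF g(1)], of i] by simp
  then obtain z where z: "z \<in> In f" "z \<in> open_segment (V g i) (V g (i + 1))"
    using op y(1) open_Int_closure_eq_empty[OF op, of "open_segment (V g i) (V g (i + 1))"] by blast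
  have zC: "z \<in> Cu g" unfolding spoly.curve_def[OF spoly_V[OF g(1)]] using z(2) by (auto simp: open_segment_def)
  have "f \<noteq> g" using z(1) zC inside_no_overlap by blast
  obtain r where r: "0 < r" "ball z r \<subseteq> In f" using z(1) op by (meson open_contains_ball)
  then show False using spoly.curve_limit(1)[OF spoly_V[OF g(1)] zC r(1)] In_disjoint[OF f g(1) \<open>f \<noteq> g\<close>] by blast
qed

text \<open>If two edges met transversally off \<open>P\<close>, one would run into the region to
  the right of the other. If they were parallel there, general position would give them the same
  ends.\<close>

lemma noncrossing: assumes "e \<in> E" "e' \<in> E" "e \<noteq> e'" shows "e \<inter> e' \<subseteq> P"
proof
  fix z assume z: "z \<in> e \<inter> e'"
  show "z \<in> P"
  proof (rule ccontr)
    assume zP: "z \<notin> P"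
    obtain f i where f: "f \<in> L" "e = edge f i" using E_edge[OF assms(1)] by blast
    obtain g j where g: "g \<in> L" "e' = edge g j" using E_edge[OF assms(2)] by blast
    define a b where "a = V f (i + 1) - V f i" and "b = V g (j + 1) - V g j"
    have zf: "z \<in> open_segment (V f i) (V f (i + 1))" and zg: "z \<in> open_segment (V g j) (V g (j + 1))"
      using z f g zP V_in[OF f(1)] V_in[OF g(1)] by (auto simp: open_segment_def)
    obtain s where s: "0 < s" "s < 1" "z = V f i + of_real s * a" using open_segmentE[OF zf] unfolding a_def by metis
    obtain u where u: "0 < u" "u < 1" "z = V g j + of_real u * b" using open_segmentE[OF zg] unfolding b_def by metis
    have b0: "a \<noteq> 0" "b \<noteq> 0" using roll.v_neq[OF roll[OF f(1)], of i] roll.v_neq[OF roll[OF g(1)], of j] by (auto simp: a_def b_def)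
    obtain r where r: "0 < r" "\<And>y. y \<in> ball z r \<Longrightarrow> crs a (y - z) < 0 \<Longrightarrow> y \<in> In f"
      using edge_side[OF f(1) zf] unfolding a_def by blast
    define k0 where "k0 = r / cmod b"
    have k0: "0 < k0" using r(1) b0 by (simp add: k0_def)
    define \<eta> where "\<eta> = min (min u (1 - u)) k0 / 2"
    have \<eta>: "0 < \<eta>" "\<eta> < u" "\<eta> < 1 - u" "\<eta> < k0" using u(1,2) k0 by (auto simp: \<eta>_def)
    have "\<eta> * cmod b < r" using \<eta>(4) b0 by (simp add: k0_def pos_less_divide_eq)
    then have near: "z + of_real k * b \<in> ball z r" if "k = \<eta> \<or> k = - \<eta>" for k
      using that \<eta>(1) by (auto simp: dist_norm norm_mult)
    have on: "z + of_real k * b \<in> e'" if "k = \<eta> \<or> k = - \<eta>" for k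
    proof -
      have "V g j + of_real (u + k) * b \<in> closed_segment (V g j) (V g (j + 1))" unfolding b_def
        by (rule segmentI) (use that \<eta> in auto)
      then show ?thesis using u(3) g(2) by (simp add: algebra_simps)
    qed
    consider "crs a b = 0" | "crs a b < 0" | "0 < crs a b" by linarith
    then show False
    proof cases
      case 1
      then obtain w where w: "b = of_real w * a" using crs_zero_dir[OF b0(1)] by blast
      obtain x where x: "hgt x (V f i) = hgt x (V f (i + 1))" by (rule dir_through)
      then have a0: "hgt x a = 0" by (simp add: a_def hgt_diff)
      have b0: "hgt x b = 0" using w a0 by (simp add: hgt_scale)
      have "hgt x z = hgt x (V f i)" unfolding s(3) by (simp add: a0 hgt_add hgt_scale)
      moreover have "hgt x z = hgt x (V g j)" unfolding u(3) by (simp add: b0 hgt_add hgt_scale)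
      ultimately have hz: "hgt x (V g j) = hgt x (V f i)" "hgt x (V g (j + 1)) = hgt x (V f i)"
        using b0 unfolding b_def hgt_diff by linarith+
      have "V g j = V f i \<or> V g j = V f (i + 1)" "V g (j + 1) = V f i \<or> V g (j + 1) = V f (i + 1)"
        using off_line[OF V_in[OF f(1)] V_in[OF f(1)] roll.v_neq[OF roll[OF f(1)], of i, symmetric] x V_in[OF g(1)]] hz by blast+
      then show False using f(2) g(2) assms(3) roll.v_neq[OF roll[OF g(1)], of j] closed_segment_commute by metis
    next
      case 2
      then have "crs a (z + of_real \<eta> * b - z) < 0" using \<eta>(1) by (simp add: crs_scale2 mult_pos_neg)
      then show False using r(2)[OF near] on In_UE[OF f(1)] assms(2) by blast
    next
      case 3
      then have "crs a (z + of_real (- \<eta>) * b - z) < 0" using \<eta>(1) by (simp add: crs_scale2 crs_minus2)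
      then show False using r(2)[OF near] on In_UE[OF f(1)] assms(2) by blast
    qed
  qed
qed

lemma P_UE: "P \<union> \<Union>E = \<Union>E" using P_sub by blast

lemma In_component: assumes f: "f \<in> L" shows "In f \<in> components (- (P \<union> \<Union>E))"
  unfolding in_components_maximal P_UE
proof (intro conjI allI impI)
  fix D assume D: "D \<noteq> {} \<and> In f \<subseteq> D \<and> D \<subseteq> - \<Union>E \<and> connected D"
  obtain x where x: "x \<in> In f" using spoly.in_ne[OF spoly_V[OF f]] by blast
  have "D \<subseteq> In f" by (rule spoly.connected_sub(1)[OF spoly_V[OF f] _ _ _ x]) (use D x Cu_sub[OF f] in auto)
  then show "D = In f" using D by blast
qed (use spoly.in_ne[OF spoly_V[OF f]] spoly.in_con[OF spoly_V[OF f]] In_UE[OF f] in auto)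

lemma In_pseudotriangle:
  assumes f: "f \<in> L" shows "\<exists>vs\<in>pseudotriangles_of P E. polygon_interior vs = In f"
proof -
  define vs where "vs = map (\<lambda>k. V f (int k)) [0..<nat (M f)]"
  have "pseudotriangle vs" "polygon_edges vs = range (edge f)" "polygon_interior vs = In f" "set vs = range (V f)"
    unfolding vs_def using roll.pseudotriangle_list[OF roll[OF f] three_corners_each[OF f]] by blast+
  then show ?thesis unfolding pseudotriangles_of_def
    using edge_in[OF f] In_component[OF f] V_in[OF f] by (intro bexI[of _ vs]) auto
qed

lemma pseudotriangulation_E: "pseudotriangulation P E"
  unfolding pseudotriangulation_def
proof (intro conjI ballI impI)
  show "E \<subseteq> edges_on P" unfolding edges_on_def using E_ends by blast
  show "e \<inter> f \<subseteq> P" if "e \<in> E" "f \<in> E" "e \<noteq> f" for e f using noncrossing that by blast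
  let ?F = "\<Union>vs\<in>pseudotriangles_of P E. polygon_interior vs"
  have e: "e \<subseteq> convex hull P" if "e \<in> E" for e
  proof -
    obtain p q where "p \<in> P" "q \<in> P" "e = closed_segment p q" using E_ends[OF \<open>e \<in> E\<close>] by metis
    then show ?thesis by (simp add: closed_segment_subset_convex_hull hull_inc)
  qed
  have "polygon_interior vs \<subseteq> convex hull P" if "vs \<in> pseudotriangles_of P E" for vs
    unfolding polygon_interior_def by (rule inside_subset_convex_hull) (use that e in \<open>auto simp: pseudotriangles_of_def\<close>)
  then have "P \<union> \<Union>E \<union> ?F \<subseteq> convex hull P" using e hull_subset[of P convex] by blast
  moreover have "convex hull P \<subseteq> P \<union> \<Union>E \<union> ?F"
  proof -
    \<comment> \<open>A closed set, so it is enough that it covers the interior of the hull, whose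
      closure is the hull. The boundaries of the regions are contained in the edges.\<close>
    define A where "A = \<Union>E \<union> (\<Union>f\<in>L. closure (In f))"
    have "interior (convex hull P) \<subseteq> A"
    proof
      fix y assume y: "y \<in> interior (convex hull P)"
      show "y \<in> A"
      proof (cases "y \<in> \<Union>E")
        case False
        have "K y \<noteq> {}" using K_one[OF y False] by auto
        then show ?thesis using closure_subset unfolding A_def K_def by blast
      qed (simp add: A_def)
    qed
    moreover have "closed A" unfolding A_def using finL closed_UE by auto
    ultimately have "closure (interior (convex hull P)) \<subseteq> A" by (rule closure_minimal)
    moreover have "interior (convex hull P) \<noteq> {}" using K_start by blast
    ultimately have "convex hull P \<subseteq> A" using convex_closure_interior[of "convex hull P"] closure_subset by fastforce
    also have "A \<subseteq> \<Union>E \<union> ?F"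
    proof -
      have "closure (In f) \<subseteq> \<Union>E \<union> ?F" if f: "f \<in> L" for f
        using closure_Un_frontier[of "In f"] spoly.fr_in[OF spoly_V[OF f]] Cu_sub[OF f] In_pseudotriangle[OF f] by blast
      then show ?thesis unfolding A_def by blast
    qed
    finally show ?thesis by blast
  qed
  ultimately show "convex hull P = P \<union> \<Union>E \<union> ?F" by blast
qed

lemma pointed_E: "pointed P E"
  unfolding pointed_def
proof
  fix p assume p: "p \<in> P"
  obtain a where a: "a \<noteq> 0" "\<And>q. (p, q) \<in> switching \<or> (q, p) \<in> switching \<Longrightarrow> inner a p \<le> inner a q" using pointed_vertex[OF p] by blast
  have "e \<subseteq> {z. inner a p \<le> inner a z}" if e: "e \<in> E" "p \<in> e" for e
  proof -
    obtain q r where qr: "(q, r) \<in> switching" "e = closed_segment q r" using e(1) unfolding E_def by blast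
    then have "q \<in> P" "r \<in> P" "q \<noteq> r" by (auto simp: switching_def)
    then have "p = q \<or> p = r" using on_edge p e(2) qr(2) by blast
    then have "inner a p \<le> inner a q" "inner a p \<le> inner a r" using a(2)[of q] a(2)[of r] qr(1) by auto
    then show ?thesis unfolding qr(2) using convex_halfspace_ge[of "inner a p" a] by (intro closed_segment_subset) auto
  qed
  then show "\<exists>a. a \<noteq> 0 \<and> (\<forall>e\<in>E. p \<in> e \<longrightarrow> e \<subseteq> {z. inner a z \<ge> inner a p})" using a(1) by blast
qed

end

section \<open>Pseudoline arrangements and sheets\<close>

text \<open>A shift by half-turns multiplies both values of the difference by the same sign, which
  cancels in their product. Crossings and contacts can therefore be tested at any
  representative.\<close>

lemma sign_shift:
  fixes D :: "real \<Rightarrow> real"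
  assumes anti: "\<And>x. D (x + pi) = - D x" and y: "y = x + of_int k * pi"
    and s: "\<exists>\<epsilon>>0. \<forall>s\<in>{y - \<epsilon><..<y}. \<forall>t\<in>{y<..<y + \<epsilon>}. Q (D s * D t)"
  shows "\<exists>\<epsilon>>0. \<forall>s\<in>{x - \<epsilon><..<x}. \<forall>t\<in>{x<..<x + \<epsilon>}. Q (D s * D t)"
proof -
  obtain \<epsilon> where e: "0 < \<epsilon>" "\<And>s t. s \<in> {y - \<epsilon><..<y} \<Longrightarrow> t \<in> {y<..<y + \<epsilon>} \<Longrightarrow> Q (D s * D t)" using s by blast
  have "Q (D s * D t)" if "s \<in> {x - \<epsilon><..<x}" "t \<in> {x<..<x + \<epsilon>}" for s t
  proof -
    have "Q (D (s + of_int k * pi) * D (t + of_int k * pi))" by (rule e(2)) (use that y in auto)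
    moreover have "D (s + of_int k * pi) * D (t + of_int k * pi) = (par k * par k) * (D s * D t)"
      by (simp add: real_antiperiodic[of D, OF anti])
    ultimately show ?thesis by (simp add: par_sq)
  qed
  then show ?thesis using e(1) by blast
qed

lemma sign_here:
  assumes f: "represents f \<gamma>" and g: "represents g \<mu>"
  shows "(\<exists>y. mline x (f x) = mline y (f y) \<and> f y = g y \<and>
      (\<exists>\<epsilon>>0. \<forall>s\<in>{y - \<epsilon><..<y}. \<forall>t\<in>{y<..<y + \<epsilon>}. Q ((f s - g s) * (f t - g t)))) \<longleftrightarrow>
    f x = g x \<and> (\<exists>\<epsilon>>0. \<forall>s\<in>{x - \<epsilon><..<x}. \<forall>t\<in>{x<..<x + \<epsilon>}. Q ((f s - g s) * (f t - g t)))" (is "?l \<longleftrightarrow> ?r")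
proof
  assume ?l
  then obtain y where y0: "mline x (f x) = mline y (f y) \<and> f y = g y \<and>
    (\<exists>\<epsilon>>0. \<forall>s\<in>{y - \<epsilon><..<y}. \<forall>t\<in>{y<..<y + \<epsilon>}. Q ((f s - g s) * (f t - g t)))" ..
  note y = y0[THEN conjunct1] y0[THEN conjunct2, THEN conjunct1] y0[THEN conjunct2, THEN conjunct2]
  obtain k :: int where k: "y = x + of_int k * pi" using y(1) mline_eq by blast
  have "mline x (f x) \<in> \<mu>" using y(1,2) represents_mem[OF g, of y "f y"] by simp
  then show ?r using represents_mem[OF g] sign_shift[of "\<lambda>s. f s - g s", OF _ k y(3)] f g by (simp add: represents_def)
next
  assume r: ?r
  show ?l by (rule exI[of _ x]) (use r in simp)
qed

lemma crosses_at_here: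
  assumes "represents f \<gamma>" "represents g \<mu>"
  shows "crosses_at \<gamma> \<mu> (mline x (f x)) \<longleftrightarrow> f x = g x \<and>
    (\<exists>\<epsilon>>0. \<forall>s\<in>{x - \<epsilon><..<x}. \<forall>t\<in>{x<..<x + \<epsilon>}. (f s - g s) * (f t - g t) < 0)"
  unfolding crosses_at_represents[OF assms] by (rule sign_here[OF assms, of x "\<lambda>z. z < 0"])

lemma touches_at_here:
  assumes "represents f \<gamma>" "represents g \<mu>"
  shows "touches_at \<gamma> \<mu> (mline x (f x)) \<longleftrightarrow> f x = g x \<and>
    (\<exists>\<epsilon>>0. \<forall>s\<in>{x - \<epsilon><..<x}. \<forall>t\<in>{x<..<x + \<epsilon>}. (f s - g s) * (f t - g t) > 0)"
  unfolding touches_at_represents[OF assms] by (rule sign_here[OF assms, of x "\<lambda>z. z > 0"])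

definition represented :: "moebius set set \<Rightarrow> (real \<Rightarrow> real) set \<Rightarrow> bool" where
  "represented \<Lambda> L \<longleftrightarrow> (\<forall>\<gamma>\<in>\<Lambda>. \<exists>f\<in>L. represents f \<gamma>) \<and> (\<forall>f\<in>L. \<exists>\<gamma>\<in>\<Lambda>. represents f \<gamma>)"

lemma represented_support:
  assumes R: "represented \<Lambda> L" shows "mline x d \<in> support \<Lambda> \<longleftrightarrow> (\<exists>f\<in>L. f x = d)"
proof
  assume "mline x d \<in> support \<Lambda>"
  then obtain \<gamma> where g: "\<gamma> \<in> \<Lambda>" "mline x d \<in> \<gamma>" unfolding support_def ..
  obtain f where f: "f \<in> L" "represents f \<gamma>" using R g(1) unfolding represented_def by blast
  show "\<exists>f\<in>L. f x = d" using represents_mem[OF f(2), of x d] g(2) f(1) by auto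
next
  assume "\<exists>f\<in>L. f x = d"
  then obtain f where f: "f \<in> L" "f x = d" ..
  obtain \<gamma> where g: "\<gamma> \<in> \<Lambda>" "represents f \<gamma>" using R f(1) unfolding represented_def by blast
  show "mline x d \<in> support \<Lambda>" using represents_mem[OF g(2), of x d] g(1) f(2) unfolding support_def by auto
qed

lemma represented_finite: assumes R: "represented \<Lambda> L" shows "finite \<Lambda> \<longleftrightarrow> finite L"
proof -
  have "\<Lambda> = (\<lambda>f. range (\<lambda>x. mline x (f x))) ` L"
  proof (intro equalityI subsetI)
    fix \<gamma> assume "\<gamma> \<in> \<Lambda>"
    then obtain f where "f \<in> L" "represents f \<gamma>" using R unfolding represented_def by blast
    then show "\<gamma> \<in> (\<lambda>f. range (\<lambda>x. mline x (f x))) ` L" by (auto simp: represents_def)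
  next
    fix \<gamma> assume "\<gamma> \<in> (\<lambda>f. range (\<lambda>x. mline x (f x))) ` L"
    then obtain f where f: "f \<in> L" "\<gamma> = range (\<lambda>x. mline x (f x))" by blast
    then obtain \<mu> where "\<mu> \<in> \<Lambda>" "represents f \<mu>" using R unfolding represented_def by blast
    then show "\<gamma> \<in> \<Lambda>" using f(2) by (simp add: represents_def)
  qed
  moreover have "L = (\<lambda>\<gamma>. SOME f. represents f \<gamma>) ` \<Lambda>"
  proof -
    have *: "(SOME f. represents f \<gamma>) = f" if "represents f \<gamma>" for f \<gamma>
      using that represents_unique by (metis someI)
    show ?thesis
    proof (intro equalityI subsetI)
      fix f assume "f \<in> L"
      then obtain \<gamma> where "\<gamma> \<in> \<Lambda>" "represents f \<gamma>" using R unfolding represented_def by blast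
      then show "f \<in> (\<lambda>\<gamma>. SOME f. represents f \<gamma>) ` \<Lambda>" using *[of f \<gamma>] by (intro image_eqI[of _ _ \<gamma>]) auto
    next
      fix f assume "f \<in> (\<lambda>\<gamma>. SOME f. represents f \<gamma>) ` \<Lambda>"
      then obtain \<gamma> where g: "\<gamma> \<in> \<Lambda>" "f = (SOME f. represents f \<gamma>)" by blast
      then obtain g where "g \<in> L" "represents g \<gamma>" using R unfolding represented_def by blast
      then show "f \<in> L" using g(2) * by simp
    qed
  qed
  ultimately show ?thesis by (metis finite_imageI)
qed

context sheets
begin

lemma crosses_iff:
  assumes L: "f \<in> L" "g \<in> L" "f \<noteq> g" and r: "represents f \<gamma>" "represents g \<mu>"
  shows "crosses_at \<gamma> \<mu> (mline x (f x)) \<longleftrightarrow> crosses f g x"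
    and "touches_at \<gamma> \<mu> (mline x (f x)) \<longleftrightarrow> f x = g x \<and> \<not> crosses f g x"
proof -
  have c: "f x = g x" if "crosses f g x" using that unfolding crosses_def by blast
  let ?D = "\<lambda>Q. \<exists>\<epsilon>>0. \<forall>s\<in>{x - \<epsilon><..<x}. \<forall>t\<in>{x<..<x + \<epsilon>}. Q ((f s - g s) * (f t - g t))"
  have 1: "crosses f g x \<Longrightarrow> ?D (\<lambda>z. z < 0)" by (rule cross_sign[OF L])
  have 2: "\<not> crosses f g x \<Longrightarrow> ?D (\<lambda>z. z > 0)" by (rule touch_sign[OF L])
  have 3: "\<not> (?D (\<lambda>z. z < 0) \<and> ?D (\<lambda>z. z > 0))" using sign_excl[of x "\<lambda>s. f s - g s"] by metis
  show "crosses_at \<gamma> \<mu> (mline x (f x)) \<longleftrightarrow> crosses f g x" unfolding crosses_at_here[OF r] using c 1 2 3 by metis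
  show "touches_at \<gamma> \<mu> (mline x (f x)) \<longleftrightarrow> f x = g x \<and> \<not> crosses f g x"
    unfolding touches_at_here[OF r] using c 1 2 3 by metis
qed

end

context rolling
begin

lemma arrangement:
  assumes R: "represented \<Lambda> L" shows "pseudoline_arrangement \<Lambda>" "support \<Lambda> = support_minus_first_level (dual_points P)"
proof -
  show "support \<Lambda> = support_minus_first_level (dual_points P)"
  proof (rule set_eqI)
    fix l obtain x d where l: "l = mline x d" by (rule mline_cases)
    show "l \<in> support \<Lambda> \<longleftrightarrow> l \<in> support_minus_first_level (dual_points P)"
      unfolding l represented_support[OF R] removed_iff suppL ..
  qed
  have "(\<exists>!z. crosses_at \<gamma> \<mu> z) \<and> (\<forall>z\<in>\<gamma> \<inter> \<mu>. crosses_at \<gamma> \<mu> z \<or> touches_at \<gamma> \<mu> z)"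
    if gm: "\<gamma> \<in> \<Lambda>" "\<mu> \<in> \<Lambda>" "\<gamma> \<noteq> \<mu>" for \<gamma> \<mu>
  proof -
    obtain f where f: "f \<in> L" "represents f \<gamma>" using R gm unfolding represented_def by blast
    obtain g where g: "g \<in> L" "represents g \<mu>" using R gm unfolding represented_def by blast
    have fg: "f \<noteq> g" using f g gm(3) represents_inj by blast
    note cr = crosses_iff[OF f(1) g(1) fg f(2) g(2)]
    obtain x where x: "crosses f g x" using cross_ex[OF f(1) g(1) fg] by blast
    have "z = mline x (f x)" if z: "crosses_at \<gamma> \<mu> z" for z
    proof -
      obtain y where y: "z = mline y (f y)" using z crosses_at_represents[OF f(2) g(2)] by blast
      then have "crosses f g y" using z cr(1) by blast
      then obtain k :: int where k: "y = x + of_int k * pi" using cross_unique[OF f(1) g(1) fg x] by blast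
      then show ?thesis unfolding y using mline_eq[of x "f x" y "f y"] real_antiperiodic[of f, OF antiL[OF f(1)]] by auto
    qed
    then have "\<exists>!z. crosses_at \<gamma> \<mu> z" using x cr(1) by blast
    moreover have "crosses_at \<gamma> \<mu> z \<or> touches_at \<gamma> \<mu> z" if z: "z \<in> \<gamma> \<inter> \<mu>" for z
    proof -
      obtain y d where y: "z = mline y d" by (rule mline_cases)
      then have "d = f y" "d = g y" using z represents_mem[OF f(2)] represents_mem[OF g(2)] by auto
      then show ?thesis using cr[of y] unfolding y by auto
    qed
    ultimately show ?thesis by blast
  qed
  moreover have "finite \<Lambda>" using represented_finite[OF R] finL by blast
  moreover have "pseudoline \<gamma>" if "\<gamma> \<in> \<Lambda>" for \<gamma> using R that unfolding represented_def pseudoline_def by blast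
  ultimately show "pseudoline_arrangement \<Lambda>" unfolding pseudoline_arrangement_def by blast
qed

lemma contact_iff:
  assumes R: "represented \<Lambda> L"
  shows "contact_point \<Lambda> (mline x d) \<longleftrightarrow> (\<exists>f\<in>L. \<exists>g\<in>L. f \<noteq> g \<and> f x = d \<and> g x = d \<and> \<not> crosses f g x)"
proof
  assume "contact_point \<Lambda> (mline x d)"
  then obtain \<gamma> \<mu> where gm: "\<gamma> \<in> \<Lambda>" "\<mu> \<in> \<Lambda>" "\<gamma> \<noteq> \<mu>" "touches_at \<gamma> \<mu> (mline x d)" unfolding contact_point_def by blast
  obtain f where f: "f \<in> L" "represents f \<gamma>" using R gm unfolding represented_def by blast
  obtain g where g: "g \<in> L" "represents g \<mu>" using R gm unfolding represented_def by blast
  have fg: "f \<noteq> g" using f g gm(3) represents_inj by blast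
  have "mline x d \<in> \<gamma>" using gm(4) touches_at_represents[OF f(2) g(2)] represents_mem[OF f(2)] by metis
  then have d: "d = f x" using represents_mem[OF f(2)] by blast
  have "f x = g x \<and> \<not> crosses f g x" using crosses_iff(2)[OF f(1) g(1) fg f(2) g(2)] gm(4) unfolding d by blast
  then show "\<exists>f\<in>L. \<exists>g\<in>L. f \<noteq> g \<and> f x = d \<and> g x = d \<and> \<not> crosses f g x" using f(1) g(1) fg d by metis
next
  assume "\<exists>f\<in>L. \<exists>g\<in>L. f \<noteq> g \<and> f x = d \<and> g x = d \<and> \<not> crosses f g x"
  then obtain f g where fg: "f \<in> L" "g \<in> L" "f \<noteq> g" "f x = d" "g x = d" "\<not> crosses f g x" by blast
  obtain \<gamma> where g: "\<gamma> \<in> \<Lambda>" "represents f \<gamma>" using R fg unfolding represented_def by blast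
  obtain \<mu> where m: "\<mu> \<in> \<Lambda>" "represents g \<mu>" using R fg unfolding represented_def by blast
  have "touches_at \<gamma> \<mu> (mline x (f x))" using crosses_iff(2)[OF fg(1-3) g(2) m(2)] fg(4-6) by metis
  moreover have "\<gamma> \<noteq> \<mu>" using fg(3) g(2) m(2) represents_unique by blast
  ultimately show "contact_point \<Lambda> (mline x d)" unfolding contact_point_def using g m fg(4) by blast
qed

text \<open>At an inner line a switch of one sheet forces the partner to switch, which makes a
  contact. At a hull line the single sheet switches alone, and this line is accounted for as a
  vertex of the first level.\<close>

lemma primal_iff:
  assumes R: "represented \<Lambda> L" and pq: "p \<in> P" "q \<in> P" "p \<noteq> q" "hgt x p = hgt x q"
  shows "contact_point \<Lambda> (mline x (hgt x p)) \<or> mline x (hgt x p) \<in> first_level (dual_points P) \<longleftrightarrow>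
    (p, q) \<in> switching \<or> (q, p) \<in> switching"
proof
  assume "contact_point \<Lambda> (mline x (hgt x p)) \<or> mline x (hgt x p) \<in> first_level (dual_points P)"
  then have "\<exists>f\<in>L. gl f x = p \<and> gr f x = q \<or> gl f x = q \<and> gr f x = p"
  proof
    assume "contact_point \<Lambda> (mline x (hgt x p))"
    then obtain f g where fg: "f \<in> L" "g \<in> L" "f \<noteq> g" "f x = hgt x p" "g x = hgt x p" "\<not> crosses f g x"
      unfolding contact_iff[OF R] by blast
    have e: "f x = g x" using fg by metis
    have n: "\<not> (gl f x = gr f x \<and> gl g x = gr g x)" using fg(6) e unfolding crosses_def by blast
    then have ne: "gl f x \<noteq> gr f x" using meet_cases[OF fg(1-3) e] by metis
    have "gl f x = p \<or> gl f x = q" "gr f x = p \<or> gr f x = q"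
      using on_germs[OF side_simps(1) fg(1) pq fg(4)] on_germs[OF side_simps(2) fg(1) pq fg(4)] by auto
    then have "gl f x = p \<and> gr f x = q \<or> gl f x = q \<and> gr f x = p" using ne by metis
    then show ?thesis using fg(1) by (intro bexI[of _ f])
  next
    assume "mline x (hgt x p) \<in> first_level (dual_points P)"
    moreover have "pset P" by unfold_locales (use finP pq in auto)
    ultimately have fl: "(\<forall>r\<in>P. hgt x r \<le> hgt x p) \<or> (\<forall>r\<in>P. hgt x p \<le> hgt x r)" using pset.first_level_iff pq(1) by blast
    have nr: "hgt x r \<noteq> hgt x p" if "r \<in> P" "r \<noteq> p" "r \<noteq> q" for r using off_line[OF pq that(1)] that by blast
    have "\<exists>\<sigma>. one_sided p q x \<sigma>"
      using fl
    proof
      assume a: "\<forall>r\<in>P. hgt x r \<le> hgt x p"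
      have "hgt x r < hgt x p" if "r \<in> P" "r \<noteq> p" "r \<noteq> q" for r using a nr[OF that] that by (meson order_le_less)
      then have "one_sided p q x (- 1)" unfolding one_sided_def by simp
      then show ?thesis ..
    next
      assume a: "\<forall>r\<in>P. hgt x p \<le> hgt x r"
      have "hgt x p < hgt x r" if "r \<in> P" "r \<noteq> p" "r \<noteq> q" for r using a nr[OF that] that by (metis order_le_less)
      then have "one_sided p q x 1" unfolding one_sided_def by simp
      then show ?thesis ..
    qed
    then obtain \<sigma> where s: "one_sided p q x \<sigma>" ..
    have "sep P x (hgt x p)" unfolding sep_def using pq by force
    then obtain f where "f \<in> L" "f x = hgt x p" using suppL by blast
    then show ?thesis using one_sided_switch[OF pq s] by blast
  qed
  then obtain f where f: "f \<in> L" "gl f x = p \<and> gr f x = q \<or> gl f x = q \<and> gr f x = p" ..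
  from f(2) show "(p, q) \<in> switching \<or> (q, p) \<in> switching"
  proof
    assume "gl f x = p \<and> gr f x = q"
    then have "(p, q) \<in> switching" unfolding switching_def using f(1) pq(1-3) by blast
    then show ?thesis ..
  next
    assume "gl f x = q \<and> gr f x = p"
    then have "(q, p) \<in> switching" unfolding switching_def using f(1) pq(1-3) by blast
    then show ?thesis ..
  qed
next
  have "contact_point \<Lambda> (mline x (hgt x p)) \<or> mline x (hgt x p) \<in> first_level (dual_points P)"
    if pq: "p \<in> P" "q \<in> P" "p \<noteq> q" "hgt x p = hgt x q" and sw: "(p, q) \<in> switching" for p q
  proof -
    have "\<exists>f\<in>L. \<exists>y. gl f y = p \<and> gr f y = q" using sw by (simp add: switching_def)
    then obtain f y where f: "f \<in> L" "gl f y = p" "gr f y = q" by blast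
    have "hgt y p = hgt y q" using heights_meet[OF f(1), of y] f by simp
    then obtain k :: int where "x = y + of_int k * pi" using hgt_same_dir[OF pq(3)] pq(4) by blast
    then have fx: "gl f x = p" "gr f x = q" using gl_per[OF f(1)] gr_per[OF f(1)] f by simp_all
    then have fp: "f x = hgt x p" using germ_at[OF side_simps(1) f(1), of x] by simp
    show ?thesis
    proof (cases "\<exists>\<sigma>. one_sided p q x \<sigma>")
      case True
      then obtain \<sigma> where s: "\<sigma> \<noteq> 0" "\<And>r. r \<in> P \<Longrightarrow> r \<noteq> p \<Longrightarrow> r \<noteq> q \<Longrightarrow> 0 < \<sigma> * (hgt x r - hgt x p)" unfolding one_sided_def by blast
      have s': "0 \<le> \<sigma> * (hgt x r - hgt x p)" if "r \<in> P" for r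
        using s(2)[OF that] pq(4) by (cases "r = p \<or> r = q") (auto intro: less_imp_le)
      have "(\<forall>r\<in>P. hgt x r \<le> hgt x p) \<or> (\<forall>r\<in>P. hgt x p \<le> hgt x r)"
      proof (cases "0 < \<sigma>")
        case True then show ?thesis using s' by (simp add: zero_le_mult_iff)
      next
        case False then show ?thesis using s' s(1) by (simp add: zero_le_mult_iff)
      qed
      moreover have "pset P" by unfold_locales (use finP pq in auto)
      ultimately show ?thesis using pset.first_level_iff pq(1) by blast
    next
      case False
      then obtain g where g: "g \<in> L" "gr g x = p" using two_sided[OF pq False side_simps(2)] by blast
      have gp: "g x = hgt x p" using germ_at[OF side_simps(2) g(1), of x] g(2) by metis
      have "f \<noteq> g" "\<not> crosses f g x" using fx g pq(3) unfolding crosses_def by metis+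
      then show ?thesis unfolding contact_iff[OF R] using f(1) g(1) fp gp by blast
    qed
  qed
  note this[OF pq] this[OF pq(2,1) pq(3)[symmetric] pq(4)[symmetric], folded pq(4)]
  moreover assume "(p, q) \<in> switching \<or> (q, p) \<in> switching"
  ultimately show "contact_point \<Lambda> (mline x (hgt x p)) \<or> mline x (hgt x p) \<in> first_level (dual_points P)" by (elim disjE)
qed

lemma primal_edges_eq: assumes R: "represented \<Lambda> L" shows "primal_edges P \<Lambda> = E"
proof -
  have *: "(let z = crossing (dual_point p) (dual_point q) in contact_point \<Lambda> z \<or> z \<in> first_level (dual_points P)) \<longleftrightarrow>
     (p, q) \<in> switching \<or> (q, p) \<in> switching" if pq: "p \<in> P" "q \<in> P" "p \<noteq> q" for p q
  proof -
    obtain x where x: "hgt x p = hgt x q" by (rule dir_through)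
    show ?thesis unfolding Let_def crossing_dual[OF pq(3) x] by (rule primal_iff[OF R pq x])
  qed
  have sw: "p \<in> P \<and> q \<in> P \<and> p \<noteq> q" if "(p, q) \<in> switching" for p q using that by (auto simp: switching_def)
  show ?thesis
  proof (intro equalityI subsetI)
    fix e assume "e \<in> primal_edges P \<Lambda>"
    then obtain p q where "p \<in> P" "q \<in> P" "p \<noteq> q" "e = closed_segment p q" "(p, q) \<in> switching \<or> (q, p) \<in> switching"
      unfolding primal_edges_def using * by blast
    then show "e \<in> E" unfolding E_def using closed_segment_commute by blast
  next
    fix e assume "e \<in> E"
    then obtain p q where "e = closed_segment p q" "(p, q) \<in> switching" unfolding E_def by blast
    then show "e \<in> primal_edges P \<Lambda>" unfolding primal_edges_def using * sw by blast
  qed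
qed

end

text \<open>The sign conditions for crossings and contacts isolate the common points, which gives
  sheets, and the uniqueness of the crossings provides the switches through
  \<open>switch_exists\<close>.\<close>

lemma (in pts) arrangement_pseudotriangulation:
  assumes A: "pseudoline_arrangement \<Lambda>" and S: "support \<Lambda> = support_minus_first_level (dual_points P)"
  shows "pointed_pseudotriangulation P (primal_edges P \<Lambda>)"
proof -
  define L where "L = {f. \<exists>\<gamma>\<in>\<Lambda>. represents f \<gamma>}"
  have "\<exists>f. represents f \<gamma>" if "\<gamma> \<in> \<Lambda>" for \<gamma>
    using A that by (simp add: pseudoline_arrangement_def pseudoline_def)
  then have R: "represented \<Lambda> L" unfolding represented_def L_def by blast
  have two: "(\<exists>!z. crosses_at \<gamma> \<mu> z) \<and> (\<forall>z\<in>\<gamma> \<inter> \<mu>. crosses_at \<gamma> \<mu> z \<or> touches_at \<gamma> \<mu> z)"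
    if "\<gamma> \<in> \<Lambda>" "\<mu> \<in> \<Lambda>" "\<gamma> \<noteq> \<mu>" for \<gamma> \<mu> using A that by (simp add: pseudoline_arrangement_def)
  have pair: "\<exists>\<gamma>\<in>\<Lambda>. \<exists>\<mu>\<in>\<Lambda>. \<gamma> \<noteq> \<mu> \<and> represents f \<gamma> \<and> represents g \<mu>" if fg: "f \<in> L" "g \<in> L" "f \<noteq> g" for f g
  proof -
    obtain \<gamma> where g: "\<gamma> \<in> \<Lambda>" "represents f \<gamma>" using fg(1) unfolding L_def by blast
    obtain \<mu> where m: "\<mu> \<in> \<Lambda>" "represents g \<mu>" using fg(2) unfolding L_def by blast
    have "\<gamma> \<noteq> \<mu>" using represents_unique g(2) m(2) fg(3) by blast
    then show ?thesis using g m by blast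
  qed
  interpret sheets P L
  proof unfold_locales
    show "finite L" using A represented_finite[OF R] by (simp add: pseudoline_arrangement_def)
    show "continuous_on UNIV f" if "f \<in> L" for f using that by (auto simp: L_def represents_def)
    show "f (x + pi) = - f x" if "f \<in> L" for f x using that by (auto simp: L_def represents_def)
    show "(\<exists>f\<in>L. f x = d) \<longleftrightarrow> sep P x d" for x d
      by (simp only: represented_support[OF R, symmetric] S removed_iff)
    show "\<forall>\<^sub>F y in at x. f y \<noteq> g y" if fg: "f \<in> L" "g \<in> L" "f \<noteq> g" for f g x
    proof -
      obtain \<gamma> \<mu> where gm: "\<gamma> \<in> \<Lambda>" "\<mu> \<in> \<Lambda>" "\<gamma> \<noteq> \<mu>" "represents f \<gamma>" "represents g \<mu>" using pair[OF fg] by blast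
      show ?thesis
      proof (cases "f x = g x")
        case False
        have "continuous_on UNIV (\<lambda>y. f y - g y)" using gm(4,5) by (auto simp: represents_def intro: continuous_intros)
        then have "((\<lambda>y. f y - g y) \<longlongrightarrow> f x - g x) (at x)" by (simp add: continuous_on_def)
        from tendsto_imp_eventually_ne[OF this, of 0] show ?thesis using False by (simp add: eventually_mono)
      next
        case True
        have "mline x (f x) \<in> \<gamma> \<inter> \<mu>" using represents_mem[OF gm(4)] represents_mem[OF gm(5)] True by simp
        then have "crosses_at \<gamma> \<mu> (mline x (f x)) \<or> touches_at \<gamma> \<mu> (mline x (f x))" using two[OF gm(1-3)] by blast
        then obtain \<epsilon> where e0: "0 < \<epsilon>" and sgn: "(\<forall>s\<in>{x - \<epsilon><..<x}. \<forall>t\<in>{x<..<x + \<epsilon>}. (f s - g s) * (f t - g t) < 0) \<or>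
            (\<forall>s\<in>{x - \<epsilon><..<x}. \<forall>t\<in>{x<..<x + \<epsilon>}. (f s - g s) * (f t - g t) > 0)"
          unfolding crosses_at_here[OF gm(4,5)] touches_at_here[OF gm(4,5)] by (elim disjE conjE exE) auto
        have e: "(f s - g s) * (f t - g t) \<noteq> 0" if "s \<in> {x - \<epsilon><..<x}" "t \<in> {x<..<x + \<epsilon>}" for s t
        proof -
          have "(f s - g s) * (f t - g t) < 0 \<or> (f s - g s) * (f t - g t) > 0" using sgn that by blast
          then show ?thesis by linarith
        qed
        have "f y \<noteq> g y" if "y \<noteq> x" "dist y x < \<epsilon>" for y
        proof (cases "y < x")
          case True then show ?thesis using e[of y "x + \<epsilon> / 2"] that e0 by (auto simp: dist_real_def)
        next
          case False then show ?thesis using e[of "x - \<epsilon> / 2" y] that e0 by (auto simp: dist_real_def)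
        qed
        then show ?thesis using e0 unfolding eventually_at by (intro exI[of _ \<epsilon>]) simp
      qed
    qed
  qed
  interpret rolling P L
  proof unfold_locales
    fix f assume f: "f \<in> L"
    show "\<exists>x. switch f x"
    proof (rule switch_exists[OF _ f])
      fix f g x y assume fg: "f \<in> L" "g \<in> L" "f \<noteq> g" and c: "crosses f g x" "crosses f g y"
      obtain \<gamma> \<mu> where gm: "\<gamma> \<in> \<Lambda>" "\<mu> \<in> \<Lambda>" "\<gamma> \<noteq> \<mu>" "represents f \<gamma>" "represents g \<mu>" using pair[OF fg] by blast
      obtain z where z: "\<And>w. crosses_at \<gamma> \<mu> w \<Longrightarrow> w = z" using two[OF gm(1-3)] by blast
      have "crosses_at \<gamma> \<mu> (mline x (f x))" "crosses_at \<gamma> \<mu> (mline y (f y))"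
        using c unfolding crosses_iff(1)[OF fg gm(4,5)] .
      then have "mline x (f x) = mline y (f y)" using z by metis
      then show "\<exists>k::int. y = x + of_int k * pi" using mline_eq by blast
    qed
  qed
  show ?thesis unfolding pointed_pseudotriangulation_def primal_edges_eq[OF R] using pseudotriangulation_E pointed_E ..
qed

section \<open>The arrangement dual to a pseudotriangulation\<close>

abbreviation region :: "(int \<Rightarrow> complex) \<Rightarrow> complex set" where "region v \<equiv> inside (spoly.curve v)"

text \<open>Short initial pieces of rays describe the sectors of a region at \<open>p\<close>
  without fixing a radius, and two disjoint regions cannot share such a direction.\<close>

definition dir_in :: "complex set \<Rightarrow> complex \<Rightarrow> complex \<Rightarrow> bool" where
  "dir_in I p w \<longleftrightarrow> (\<exists>b>0. \<forall>s>0. s < b \<longrightarrow> p + of_real s * w \<in> I)"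

lemma dir_in_meet: assumes "dir_in I p w" "dir_in J p w" shows "I \<inter> J \<noteq> {}"
proof -
  obtain a where a: "0 < a" "\<And>s. 0 < s \<Longrightarrow> s < a \<Longrightarrow> p + of_real s * w \<in> I" using assms(1) unfolding dir_in_def by blast
  obtain b where b: "0 < b" "\<And>s. 0 < s \<Longrightarrow> s < b \<Longrightarrow> p + of_real s * w \<in> J" using assms(2) unfolding dir_in_def by blast
  define s where "s = min a b / 2"
  have "0 < s" "s < a" "s < b" using a(1) b(1) by (auto simp: s_def)
  then show ?thesis using a(2) b(2) by blast
qed

lemma dir_in_scale: assumes "dir_in I p (of_real k * w)" "0 < k" shows "dir_in I p w"
proof -
  obtain b where b: "0 < b" "\<And>s. 0 < s \<Longrightarrow> s < b \<Longrightarrow> p + of_real s * (of_real k * w) \<in> I" using assms(1) unfolding dir_in_def by blast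
  have "p + of_real s * w \<in> I" if "0 < s" "s < b * k" for s
    using b(2)[of "s / k"] that assms(2) by (simp add: pos_divide_less_eq)
  moreover have "0 < b * k" using b(1) assms(2) by simp
  ultimately show ?thesis unfolding dir_in_def by blast
qed

lemma dir_in_local:
  assumes "0 < r" "\<And>y. y \<in> ball p r \<Longrightarrow> y \<in> X \<Longrightarrow> y \<in> I" "\<And>s. 0 < s \<Longrightarrow> p + of_real s * w \<in> X" shows "dir_in I p w"
proof -
  define b where "b = r / (cmod w + 1)"
  have n: "0 < cmod w + 1" using norm_ge_zero[of w] by linarith
  have "p + of_real s * w \<in> I" if s: "0 < s" "s < b" for s
  proof (rule assms(2)[OF _ assms(3)[OF s(1)]])
    have "s * cmod w < r" using s n by (simp add: b_def pos_less_divide_eq algebra_simps)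
    then show "p + of_real s * w \<in> ball p r" using s(1) by (simp add: dist_norm norm_mult)
  qed
  moreover have "0 < b" using assms(1) n by (simp add: b_def)
  ultimately show ?thesis unfolding dir_in_def by blast
qed

text \<open>Cramer's rule, written with the scaled vectors \<open>dirB\<close> and
  \<open>dirA\<close>: up to a positive factor, the cross products that define the cone are the
  coordinates with respect to the two edge vectors.\<close>

lemma crs_combination:
  "of_real ((- crs A B)\<^sup>2) * w = of_real (crs (of_real (- crs A B) * B) w) * A + of_real (crs (of_real (- (- crs A B)) * A) w) * B"
  unfolding crs_scale1 by (simp add: complex_eq_iff crs_def power2_eq_square) (simp add: algebra_simps)

context spoly
begin

lemma cone_dir:
  assumes "0 < s" shows "v i + of_real s * w \<in> cone i \<longleftrightarrow> v i + w \<in> cone i" "v i + of_real s * w \<in> cocone i \<longleftrightarrow> v i + w \<in> cocone i"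
  using assms by (simp_all add: cone_iff cocone_iff crs_scale2 zero_less_mult_iff mult_less_0_iff)

lemma dir_inside:
  shows "vertex_in i \<Longrightarrow> v i + w \<in> cone i \<Longrightarrow> dir_in (inside curve) (v i) w"
    and "vertex_in i \<Longrightarrow> v i + w \<in> cocone i \<Longrightarrow> \<not> dir_in (inside curve) (v i) w"
    and "\<not> vertex_in i \<Longrightarrow> v i + w \<in> cocone i \<Longrightarrow> dir_in (inside curve) (v i) w"
    and "\<not> vertex_in i \<Longrightarrow> v i + w \<in> cone i \<Longrightarrow> \<not> dir_in (inside curve) (v i) w"
proof -
  have out: "\<not> dir_in (inside curve) (v i) w" if "dir_in (outside curve) (v i) w"
    using dir_in_meet that io_disj by blast
  have c: "dir_in I (v i) w" if "0 < r" "\<And>y. y \<in> ball (v i) r \<Longrightarrow> y \<in> cone i \<Longrightarrow> y \<in> I" "v i + w \<in> cone i" for r I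
    by (rule dir_in_local[OF that(1,2)]) (use that(3) cone_dir in auto)
  have cc: "dir_in I (v i) w" if "0 < r" "\<And>y. y \<in> ball (v i) r \<Longrightarrow> y \<in> cocone i \<Longrightarrow> y \<in> I" "v i + w \<in> cocone i" for r I
    by (rule dir_in_local[OF that(1,2)]) (use that(3) cone_dir in auto)
  {
    assume "vertex_in i"
    then obtain r where r: "0 < r" "\<And>y. y \<in> ball (v i) r \<Longrightarrow> y \<in> cone i \<Longrightarrow> y \<in> inside curve"
      "\<And>y. y \<in> ball (v i) r \<Longrightarrow> y \<in> cocone i \<Longrightarrow> y \<in> outside curve" unfolding vertex_in_def by blast
    show "v i + w \<in> cone i \<Longrightarrow> dir_in (inside curve) (v i) w" by (rule c[OF r(1,2)])
    show "v i + w \<in> cocone i \<Longrightarrow> \<not> dir_in (inside curve) (v i) w" using out cc[OF r(1,3)] by blast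
  }
  {
    assume "\<not> vertex_in i"
    then have "vertex_out i" unfolding vertex_in_iff vertex_out_iff using orient turn_nz[of i] by (metis linorder_neqE_linordered_idom mult_eq_0_iff one_neq_zero neg_equal_0_iff_equal)
    then obtain r where r: "0 < r" "\<And>y. y \<in> ball (v i) r \<Longrightarrow> y \<in> cone i \<Longrightarrow> y \<in> outside curve"
      "\<And>y. y \<in> ball (v i) r \<Longrightarrow> y \<in> cocone i \<Longrightarrow> y \<in> inside curve" unfolding vertex_out_def by blast
    show "v i + w \<in> cocone i \<Longrightarrow> dir_in (inside curve) (v i) w" by (rule cc[OF r(1,3)])
    show "v i + w \<in> cone i \<Longrightarrow> \<not> dir_in (inside curve) (v i) w" using out c[OF r(1,2)] by blast
  }
qed

lemma dir_cases:
  assumes "crs (v (i - 1) - v i) w \<noteq> 0" "crs (v (i + 1) - v i) w \<noteq> 0"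
  shows "v i + w \<in> cone i \<longleftrightarrow> v i + w \<notin> cocone i"
  using assms turn_nz[of i] by (auto simp: cone_iff cocone_iff dirA_def dirB_def crs_scale1 crs_minus1 less_le not_less)

lemma dir_iff:
  assumes "crs (v (i - 1) - v i) w \<noteq> 0" "crs (v (i + 1) - v i) w \<noteq> 0"
  shows "dir_in (inside curve) (v i) w \<longleftrightarrow> (if vertex_in i then v i + w \<in> cone i else v i + w \<in> cocone i)"
  using dir_inside[of i w] dir_cases[OF assms] by metis

lemma vertex_combination:
  "of_real ((turn i)\<^sup>2) * w = of_real (crs (dirA i) w) * (v (i - 1) - v i) + of_real (crs (dirB i) w) * (v (i + 1) - v i)"
proof -
  have "turn i = - crs (v (i - 1) - v i) (v (i + 1) - v i)" by (simp add: turn_ab)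
  then show ?thesis unfolding dirA_def dirB_def by (simp only: crs_combination)
qed

end

context roll
begin

definition tangent_at :: "real \<Rightarrow> int \<Rightarrow> bool" where
  "tangent_at x i \<longleftrightarrow> (if corner i then (hgt x (v (i - 1)) - hgt x (v i)) * (hgt x (v (i + 1)) - hgt x (v i)) \<le> 0
     else (hgt x (v (i - 1)) - hgt x (v i)) * (hgt x (v (i + 1)) - hgt x (v i)) \<ge> 0)"

lemma tangent_at_iff: "d = rollf x \<longleftrightarrow> (\<exists>i. hgt x (v i) = d \<and> tangent_at x i)"
  unfolding tangent_iff[symmetric] tangent_at_def by metis

text \<open>At a line containing neither edge at the vertex, tangency depends only on the region and
  the kind of vertex: a tangent enters the region in one direction at a corner and in both
  directions at a concave vertex.\<close>

lemma tangent_dirs: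
  assumes n3: "ncorners = 3" and ne: "hgt x (v (i - 1)) \<noteq> hgt x (v i)" "hgt x (v (i + 1)) \<noteq> hgt x (v i)"
  defines "I \<equiv> region v"
  shows "tangent_at x i \<longleftrightarrow> (if corner i then dir_in I (v i) (cis x) \<or> dir_in I (v i) (- cis x)
     else dir_in I (v i) (cis x) \<and> dir_in I (v i) (- cis x))"
proof -
  interpret S: spoly m v by (rule spoly[OF n3])
  define a b where "a = hgt x (v (i - 1)) - hgt x (v i)" and "b = hgt x (v (i + 1)) - hgt x (v i)"
  have ab: "a \<noteq> 0" "b \<noteq> 0" using ne by (auto simp: a_def b_def)
  have c: "crs (v (i - 1) - v i) (cis x) = - a" "crs (v (i + 1) - v i) (cis x) = - b"
    by (simp_all add: a_def b_def crs_comm[of _ "cis x"] hgt_crs[symmetric] hgt_diff)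
  define T where "T = S.turn i"
  have T0: "T \<noteq> 0" using S.turn_nz by (simp add: T_def)
  have cn: "v i + cis x \<in> S.cone i \<longleftrightarrow> 0 < - (T * b) \<and> 0 < T * a" "v i + - cis x \<in> S.cone i \<longleftrightarrow> 0 < T * b \<and> 0 < - (T * a)"
    "v i + cis x \<in> S.cocone i \<longleftrightarrow> - (T * b) < 0 \<or> T * a < 0" "v i + - cis x \<in> S.cocone i \<longleftrightarrow> T * b < 0 \<or> - (T * a) < 0"
    unfolding S.cone_iff S.cocone_iff S.dirA_def S.dirB_def T_def[symmetric]
    by (simp_all add: crs_scale1 crs_minus1 crs_minus2 c)
  have vi: "S.vertex_in i \<longleftrightarrow> corner i" by (rule vertex_in_roll[OF n3])
  have d: "dir_in I (v i) (cis x) \<longleftrightarrow> (if corner i then v i + cis x \<in> S.cone i else v i + cis x \<in> S.cocone i)"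
    "dir_in I (v i) (- cis x) \<longleftrightarrow> (if corner i then v i + - cis x \<in> S.cone i else v i + - cis x \<in> S.cocone i)"
    unfolding I_def vi[symmetric] by (rule S.dir_iff; use ab in \<open>simp add: crs_minus2 c\<close>)+
  have "tangent_at x i \<longleftrightarrow> (if corner i then a * b \<le> 0 else a * b \<ge> 0)" by (simp add: tangent_at_def a_def b_def)
  also have "\<dots> \<longleftrightarrow> (if corner i then v i + cis x \<in> S.cone i \<or> v i + - cis x \<in> S.cone i
     else v i + cis x \<in> S.cocone i \<and> v i + - cis x \<in> S.cocone i)"
    unfolding cn using ab T0 by (auto simp: mult_le_0_iff zero_le_mult_iff zero_less_mult_iff mult_less_0_iff)
  finally show ?thesis unfolding d by simp
qed

end

lemma (in pts) crs_nz:
  assumes "p \<in> P" "q \<in> P" "r \<in> P" "p \<noteq> q" "q \<noteq> r" "p \<noteq> r" shows "crs (q - p) (r - p) \<noteq> 0"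
  using gp assms unfolding general_position_def collinear_crs by blast

lemma hull_dir:
  assumes "p \<in> P" "q \<in> P" "r \<in> P" "0 \<le> a" "0 \<le> b"
  shows "dir_in (convex hull P) p (of_real a * (q - p) + of_real b * (r - p))"
proof -
  have "p + of_real s * (of_real a * (q - p) + of_real b * (r - p)) \<in> convex hull P" if s: "0 < s" "s < 1 / (2 * (a + b + 1))" for s
  proof -
    have "s * (2 * (a + b + 1)) < 1" using s assms(4,5) by (simp add: pos_less_divide_eq)
    then have "2 * s * a + 2 * s * b + 2 * s < 1" by (simp add: algebra_simps)
    moreover have ge: "0 \<le> 2 * s * a" "0 \<le> 2 * s * b" using s(1) assms(4,5) by simp_all
    ultimately have le: "2 * s * a \<le> 1" "2 * s * b \<le> 1" using s(1) by linarith+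
    have x: "p + of_real (2 * s * a) * (q - p) \<in> convex hull P" "p + of_real (2 * s * b) * (r - p) \<in> convex hull P"
      using segmentI[OF ge(1) le(1), of p q] segmentI[OF ge(2) le(2), of p r] closed_segment_subset_convex_hull[of p P q]
        closed_segment_subset_convex_hull[of p P r] hull_inc[of _ P convex] assms(1-3) by blast+
    have "(1/2) *\<^sub>R (p + of_real (2 * s * a) * (q - p)) + (1/2) *\<^sub>R (p + of_real (2 * s * b) * (r - p)) \<in> convex hull P"
      by (rule convexD[OF convex_convex_hull x]) auto
    then show ?thesis by (simp add: scaleR_conv_of_real algebra_simps)
  qed
  moreover have "0 < 1 / (2 * (a + b + 1))" using assms(4,5) by simp
  ultimately show ?thesis unfolding dir_in_def by blast
qed

section \<open>The faces of a pointed pseudotriangulation and their tangents\<close>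

locale pointed_pt = pts +
  fixes T :: "complex set set"
  assumes ppt: "pointed_pseudotriangulation P T"
begin

definition L :: "(real \<Rightarrow> real) set" where
  "L = {f. \<exists>vs\<in>pseudotriangles_of P T. represents f (dual_pseudotriangle vs)}"

definition face :: "int \<Rightarrow> (int \<Rightarrow> complex) \<Rightarrow> (int \<Rightarrow> real) \<Rightarrow> (int \<Rightarrow> real) \<Rightarrow> bool" where
  "face m v t c \<longleftrightarrow> roll m v t c \<and> roll.ncorners m c = 3 \<and> range v \<subseteq> P \<and> (\<forall>i. closed_segment (v i) (v (i + 1)) \<in> T) \<and>
     region v \<in> components (- (P \<union> \<Union>T))"

lemma T_ends: "e \<in> T \<Longrightarrow> \<exists>p\<in>P. \<exists>q\<in>P. p \<noteq> q \<and> e = closed_segment p q"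
proof -
  assume "e \<in> T"
  moreover have "T \<subseteq> edges_on P" using ppt unfolding pointed_pseudotriangulation_def pseudotriangulation_def by (elim conjE)
  ultimately show ?thesis unfolding edges_on_def by blast
qed

lemma finite_T: "finite T"
proof -
  have "T \<subseteq> (\<lambda>(p, q). closed_segment p q) ` (P \<times> P)" using T_ends by force
  then show ?thesis by (rule finite_subset) (use finP in simp)
qed

lemma vs_face:
  assumes vs: "vs \<in> pseudotriangles_of P T"
  shows "\<exists>m v t c. face m v t c \<and> polygon_interior vs = region v \<and> represents (roll.rollf v t) (dual_pseudotriangle vs)"
proof -
  have v: "pseudotriangle vs" "set vs \<subseteq> P" "polygon_edges vs \<subseteq> T" "polygon_interior vs \<in> components (- (P \<union> \<Union>T))"
    using vs by (auto simp: pseudotriangles_of_def)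
  obtain v t c where "rolled vs v t c" using pseudotriangle_rolled[OF v(1)] by blast
  then show ?thesis using v unfolding rolled_def face_def by (intro exI[of _ "int (length vs)"] exI[of _ v] exI[of _ t] exI[of _ c]) auto
qed

lemma L_face: assumes "f \<in> L" shows "\<exists>m v t c. face m v t c \<and> f = roll.rollf v t"
proof -
  obtain vs where vs: "vs \<in> pseudotriangles_of P T" "represents f (dual_pseudotriangle vs)" using assms unfolding L_def by blast
  obtain m v t c where "face m v t c" "represents (roll.rollf v t) (dual_pseudotriangle vs)" using vs_face[OF vs(1)] by blast
  then show ?thesis using represents_unique[OF vs(2)] by blast
qed

lemma face_facts:
  assumes "face m v t c"
  shows "roll m v t c" "roll.ncorners m c = 3" "spoly m v" "v i \<in> P" "v (i + 1) \<noteq> v i" "v (i - 1) \<noteq> v i"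
    "closed_segment (v i) (v (i + 1)) \<in> T" "closed_segment (v i) (v (i - 1)) \<in> T"
    "region v \<inter> \<Union>T = {}" "region v \<inter> P = {}"
proof -
  show r: "roll m v t c" and n: "roll.ncorners m c = 3" and "v i \<in> P" and e: "closed_segment (v i) (v (i + 1)) \<in> T"
    using assms by (auto simp: face_def)
  show "spoly m v" by (rule roll.spoly[OF r n])
  show "v (i + 1) \<noteq> v i" "v (i - 1) \<noteq> v i" using roll.v_neq[OF r, of i] roll.v_neq[OF r, of "i - 1"] by simp_all
  have "closed_segment (v (i - 1)) (v (i - 1 + 1)) \<in> T" using assms unfolding face_def by blast
  then show "closed_segment (v i) (v (i - 1)) \<in> T" by (simp add: closed_segment_commute)
  have "region v \<subseteq> - (P \<union> \<Union>T)" using assms in_components_subset unfolding face_def by blast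
  then show "region v \<inter> \<Union>T = {}" "region v \<inter> P = {}" by blast+
qed

lemma edge_not_dir: assumes F: "face m v t c" and e: "closed_segment p q \<in> T" shows "\<not> dir_in (region v) p (q - p)"
proof
  assume "dir_in (region v) p (q - p)"
  then obtain b where b: "0 < b" "\<And>s. 0 < s \<Longrightarrow> s < b \<Longrightarrow> p + of_real s * (q - p) \<in> region v" unfolding dir_in_def by blast
  define s where "s = min b 1 / 2"
  have s: "0 < s" "s < b" "0 \<le> s" "s \<le> 1" using b(1) by (auto simp: s_def)
  show False using b(2)[OF s(1,2)] segmentI[OF s(3,4), of p q] e face_facts(9)[OF F] by blast
qed

lemma face_vertex:
  assumes F: "face m v t c" and p: "p \<in> P" "p \<in> spoly.curve v" shows "\<exists>i. v i = p"
proof -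
  obtain i where i: "p \<in> closed_segment (v i) (v (i + 1))" using p(2) unfolding spoly.curve_def[OF face_facts(3)[OF F]] by blast
  have "p = v i \<or> p = v (i + 1)" by (rule on_edge[OF face_facts(4)[OF F] face_facts(4)[OF F] face_facts(5)[OF F, symmetric] p(1) i])
  then show ?thesis by metis
qed

lemma dir_vertex:
  assumes F: "face m v t c" and p: "p \<in> P" and d: "dir_in (region v) p w" shows "\<exists>i. v i = p"
proof (rule face_vertex[OF F p])
  note S = face_facts(3)[OF F]
  obtain b where b: "0 < b" "\<And>s. 0 < s \<Longrightarrow> s < b \<Longrightarrow> p + of_real s * w \<in> region v" using d unfolding dir_in_def by blast
  have ev: "\<forall>\<^sub>F s in at_right 0. p + of_real s * w \<in> region v"
    unfolding eventually_at_right_field using b by auto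
  have "((\<lambda>s. p + of_real s * w) \<longlongrightarrow> p + of_real 0 * w) (at_right 0)" by (intro tendsto_intros)
  then have lim: "((\<lambda>s. p + of_real s * w) \<longlongrightarrow> p) (at_right 0)" by simp
  have "\<forall>\<^sub>F s in at_right 0. p + of_real s * w \<in> closure (region v)"
    using ev by (rule eventually_mono) (use closure_subset in blast)
  then have "p \<in> closure (region v)"
    by (rule Lim_in_closed_set[OF closed_closure _ _ lim]) simp
  moreover have "p \<notin> region v" using face_facts(10)[OF F] p by blast
  ultimately have "p \<in> frontier (region v)" using closure_Un_frontier by blast
  then show "p \<in> spoly.curve v" using spoly.fr_in[OF S] by simp
qed

lemma same_face:
  assumes "face m v t c" "face m' w t' c'" "dir_in (region v) p u" "dir_in (region w) p u"
  shows "region v = region w"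
  using dir_in_meet[OF assms(3,4)] components_nonoverlap assms(1,2) unfolding face_def by blast

text \<open>A short piece of the ray avoids all edges and lies in the hull, so it is contained in
  one face. The point \<open>p\<close> is then on the boundary of this face and, being in
  \<open>P\<close>, one of its vertices.\<close>

lemma face_at:
  assumes p: "p \<in> P" and u: "u \<noteq> 0" and hu: "dir_in (convex hull P) p u"
    and N: "\<And>q. q \<in> P \<Longrightarrow> q \<noteq> p \<Longrightarrow> closed_segment p q \<in> T \<Longrightarrow> crs (q - p) u \<noteq> 0"
  shows "\<exists>m v t c i. face m v t c \<and> roll.rollf v t \<in> L \<and> v i = p \<and> dir_in (region v) p u"
proof -
  define D where "D = (P - {p}) \<union> \<Union>{e \<in> T. p \<notin> e}"
  have "closed (\<Union>{e \<in> T. p \<notin> e})" by (rule closed_Union) (use finite_T T_ends in force)+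
  then have "closed D" unfolding D_def using finP by (intro closed_Un) (auto intro: finite_imp_closed)
  moreover have "p \<notin> D" by (auto simp: D_def)
  ultimately obtain r where r: "0 < r" "ball p r \<inter> D = {}" using ball_avoid by blast
  have "dir_in (- D) p u" by (rule dir_in_local[OF r(1), of p UNIV]) (use r in auto)
  then obtain b1 where b1: "0 < b1" "\<And>s. 0 < s \<Longrightarrow> s < b1 \<Longrightarrow> p + of_real s * u \<notin> D" unfolding dir_in_def by blast
  obtain b2 where b2: "0 < b2" "\<And>s. 0 < s \<Longrightarrow> s < b2 \<Longrightarrow> p + of_real s * u \<in> convex hull P" using hu unfolding dir_in_def by blast
  define b where "b = min b1 b2"
  define S where "S = (\<lambda>s. p + of_real s * u) ` {0<..<b}"
  have b: "0 < b" using b1 b2 by (simp add: b_def)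
  have off: "p + of_real s * u \<notin> P \<union> \<Union>T" if s: "0 < s" "s < b" for s
  proof
    assume a: "p + of_real s * u \<in> P \<union> \<Union>T"
    have nD: "p + of_real s * u \<notin> D" using b1(2) s by (simp add: b_def)
    have "p + of_real s * u \<noteq> p" using u s by simp
    then obtain e where e: "e \<in> T" "p \<in> e" "p + of_real s * u \<in> e" using a nD unfolding D_def by blast
    obtain q r where qr: "q \<in> P" "r \<in> P" "q \<noteq> r" "e = closed_segment q r" using T_ends[OF e(1)] by blast
    have "p = q \<or> p = r" by (rule on_edge[OF qr(1-3) p]) (use e qr in simp)
    then obtain q where q: "q \<in> P" "q \<noteq> p" "e = closed_segment p q" using qr closed_segment_commute by metis
    obtain x where x: "p + of_real s * u = p + of_real x * (q - p)" using segmentE e(3) q(3) by metis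
    then have "s * crs (q - p) u = 0" by (metis add_left_cancel crs_scale2 crs_self mult_zero_right)
    then show False using N[OF q(1,2)] e(1) q(3) s by simp
  qed
  have conS: "connected S" unfolding S_def by (intro connected_continuous_image continuous_intros) simp
  have SU: "S \<subseteq> - (P \<union> \<Union>T)" unfolding S_def using off by auto
  define y where "y = p + of_real (b / 2) * u"
  have yS: "y \<in> S" unfolding S_def y_def by (rule imageI) (use b in simp)
  have "y \<in> convex hull P" unfolding y_def by (rule b2(2)) (use b b1 in \<open>auto simp: b_def\<close>)
  moreover have "convex hull P = P \<union> \<Union>T \<union> (\<Union>vs\<in>pseudotriangles_of P T. polygon_interior vs)"
    using ppt unfolding pointed_pseudotriangulation_def pseudotriangulation_def by (elim conjE)
  ultimately obtain vs where vs: "vs \<in> pseudotriangles_of P T" "y \<in> polygon_interior vs" using SU yS by blast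
  obtain m v t c where F: "face m v t c" "polygon_interior vs = region v" "represents (roll.rollf v t) (dual_pseudotriangle vs)"
    using vs_face[OF vs(1)] by blast
  have "S \<subseteq> region v"
    by (rule components_maximal[of _ "- (P \<union> \<Union>T)"]) (use F(1,2) vs(2) yS conS SU in \<open>auto simp: face_def\<close>)
  then have "dir_in (region v) p u" unfolding dir_in_def S_def using b by (intro exI[of _ b]) (auto simp: image_subset_iff)
  moreover have "roll.rollf v t \<in> L" using vs(1) F(3) unfolding L_def by blast
  ultimately show ?thesis using F(1) dir_vertex[OF F(1) p] by blast
qed

lemma face_hgt:
  assumes F: "face m v t c" and y: "nice y" shows "hgt y (v (i - 1)) \<noteq> hgt y (v i)" "hgt y (v (i + 1)) \<noteq> hgt y (v i)"
  using y face_facts(4-6)[OF F] unfolding nice_def by metis+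

text \<open>If edges leave \<open>p\<close> on both sides of the line, the face containing a
  suitable direction of the line is tangent at a corner. If all edges leave on one side, the face
  towards a point on the other side is tangent at a concave vertex.\<close>

lemma tangent_exists:
  assumes p: "p \<in> P" and y: "nice y" and q: "q \<in> P" "hgt y p < hgt y q" and r: "r \<in> P" "hgt y r < hgt y p"
  shows "\<exists>f\<in>L. f y = hgt y p"
proof -
  define N where "N = {q \<in> P. q \<noteq> p \<and> closed_segment p q \<in> T}"
  have ne: "hgt y q \<noteq> hgt y p" if "q \<in> P" "q \<noteq> p" for q using y that p unfolding nice_def by blast
  have tan: ?thesis if F: "face m v t c" "roll.rollf v t \<in> L" and i: "v i = p" and ta: "roll.tangent_at v c y i" for m v t c i
  proof -
    have "hgt y p = roll.rollf v t y" unfolding roll.tangent_at_iff[OF face_facts(1)[OF F(1)]] using i ta by blast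
    then show ?thesis using F(2) by metis
  qed
  show ?thesis
  proof (cases "(\<exists>a\<in>N. hgt y p < hgt y a) \<and> (\<exists>b\<in>N. hgt y b < hgt y p)")
    case True
    then obtain a b where a: "a \<in> N" "hgt y p < hgt y a" and b: "b \<in> N" "hgt y b < hgt y p" by blast
    \<comment> \<open>The positive combination of an edge above and an edge below that has height
      zero, hence a direction along the line, either forward or backward.\<close>
    define u where "u = of_real (hgt y p - hgt y b) * (a - p) + of_real (hgt y a - hgt y p) * (b - p)"
    have ab: "a \<in> P" "b \<in> P" "a \<noteq> p" "b \<noteq> p" "a \<noteq> b" using a b by (auto simp: N_def)
    have "hgt y u = 0" unfolding u_def hgt_add hgt_scale hgt_diff by (simp add: algebra_simps)
    then obtain k where k: "u = of_real k * cis y" using hgt_zero_iff by blast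
    have "crs (a - p) u = (hgt y a - hgt y p) * crs (a - p) (b - p)" unfolding u_def crs_add2 crs_scale2 by simp
    then have u0: "u \<noteq> 0" using crs_nz[OF p ab(1,2)] ab a(2) by auto
    then have k0: "k \<noteq> 0" using k by auto
    have cu: "crs (q - p) u \<noteq> 0" if "q \<in> P" "q \<noteq> p" for q
      using ne[OF that] k0 unfolding k crs_scale2 crs_comm[of "q - p"] hgt_crs[symmetric] hgt_diff by simp
    have "dir_in (convex hull P) p u" unfolding u_def by (rule hull_dir) (use p ab a b in auto)
    from face_at[OF p u0 this cu] obtain m v t c i where F: "face m v t c" "roll.rollf v t \<in> L" "v i = p" "dir_in (region v) p u" by blast
    note ff = face_facts[OF F(1)]
    interpret S: spoly m v by (rule ff(3))
    have d: "if S.vertex_in i then v i + u \<in> S.cone i else v i + u \<in> S.cocone i"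
      using S.dir_iff[of i u] F(4) cu[OF ff(4)] ff(5,6)[of i] F(3) by simp
    have vi: "S.vertex_in i \<longleftrightarrow> roll.corner c i" by (rule roll.vertex_in_roll[OF ff(1,2)])
    \<comment> \<open>At a concave vertex the large sector is free of edges, so all edges at
      \<open>p\<close> lie in the closed small sector. That sector is a convex cone and would
      contain \<open>u\<close> too.\<close>
    have "roll.corner c i"
    proof (rule ccontr)
      assume nc: "\<not> roll.corner c i"
      have "v i + (w - p) \<notin> S.cocone i" if "w \<in> N" for w
        using edge_not_dir[OF F(1), of p w] S.dir_inside(3)[of i "w - p"] that nc vi F(3) by (auto simp: N_def)
      then have "0 \<le> crs (S.dirA i) (w - p) \<and> 0 \<le> crs (S.dirB i) (w - p)" if "w \<in> N" for w
        using that by (auto simp: S.cocone_iff not_less)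
      from this[OF a(1)] this[OF b(1)] have "0 \<le> crs (S.dirA i) u" "0 \<le> crs (S.dirB i) u"
        using a(2) b(2) unfolding u_def crs_add2 crs_scale2 by simp_all
      then have "v i + u \<notin> S.cocone i" by (simp add: S.cocone_iff not_less)
      then show False using d nc vi by simp
    qed
    moreover have "dir_in (region v) p (cis y) \<or> dir_in (region v) p (- cis y)"
    proof (cases "0 < k")
      case True then show ?thesis using F(4) dir_in_scale unfolding k by blast
    next
      case False
      then have "0 < - k" using k0 by simp
      moreover have "u = of_real (- k) * (- cis y)" using k by simp
      ultimately show ?thesis using F(4) dir_in_scale by metis
    qed
    ultimately have "roll.tangent_at v c y i"
      using roll.tangent_dirs[OF ff(1,2) face_hgt[OF F(1) y]] F(3) by simp
    then show ?thesis using tan F by blast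
  next
    case False
    then obtain \<sigma> r where s: "\<sigma> = 1 \<or> \<sigma> = - 1" "\<And>w. w \<in> N \<Longrightarrow> 0 < \<sigma> * (hgt y w - hgt y p)" "r \<in> P" "\<sigma> * (hgt y r - hgt y p) < 0"
    proof (cases "\<exists>b\<in>N. hgt y b < hgt y p")
      case True
      have "0 < - 1 * (hgt y w - hgt y p)" if w: "w \<in> N" for w
        using False True w ne[of w] unfolding N_def by force
      moreover have "- 1 * (hgt y q - hgt y p) < 0" using q by simp
      ultimately show ?thesis using that[of "- 1" q] q(1) by blast
    next
      case None: False
      have "0 < 1 * (hgt y w - hgt y p)" if w: "w \<in> N" for w
        using None w ne[of w] unfolding N_def by force
      moreover have "1 * (hgt y r - hgt y p) < 0" using r by simp
      ultimately show ?thesis using that[of 1 r] r(1) by blast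
    qed
    have rp: "r \<noteq> p" using s(4) by auto
    have cu: "crs (w - p) (r - p) \<noteq> 0" if "w \<in> P" "w \<noteq> p" "closed_segment p w \<in> T" for w
    proof (rule crs_nz[OF p that(1) s(3) that(2)[symmetric] _ rp[symmetric]])
      show "w \<noteq> r" using s(2)[of w] s(4) that by (auto simp: N_def)
    qed
    \<comment> \<open>Here every edge at \<open>p\<close> is on the side of \<open>\<sigma>\<close>,
      and \<open>r\<close> is on the other one.\<close>
    have "dir_in (convex hull P) p (of_real 1 * (r - p) + of_real 0 * (p - p))" by (rule hull_dir) (use p s(3) in auto)
    then have "dir_in (convex hull P) p (r - p)" by simp
    from face_at[OF p _ this cu] rp obtain m v t c i where F: "face m v t c" "roll.rollf v t \<in> L" "v i = p" "dir_in (region v) p (r - p)" by auto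
    note ff = face_facts[OF F(1)]
    interpret S: spoly m v by (rule ff(3))
    have vi: "S.vertex_in i \<longleftrightarrow> roll.corner c i" by (rule roll.vertex_in_roll[OF ff(1,2)])
    have N: "v (i - 1) \<in> N" "v (i + 1) \<in> N" using ff(4-8) F(3) unfolding N_def by auto
    define a b where "a = hgt y (v (i - 1)) - hgt y (v i)" and "b = hgt y (v (i + 1)) - hgt y (v i)"
    have ab: "0 < \<sigma> * a" "0 < \<sigma> * b" using s(2)[OF N(1)] s(2)[OF N(2)] F(3) by (simp_all add: a_def b_def)
    \<comment> \<open>The sector at a corner is spanned positively by two edges on the side of
      \<open>\<sigma>\<close> and cannot contain the direction to \<open>r\<close>.\<close>
    have "\<not> roll.corner c i"
    proof
      assume "roll.corner c i"
      then have "v i + (r - p) \<in> S.cone i"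
        using S.dir_iff[of i "r - p"] F(3,4) cu[OF ff(4)] ff(5-8)[of i] vi by simp
      then have pos: "0 < crs (S.dirA i) (r - p)" "0 < crs (S.dirB i) (r - p)" by (simp_all add: S.cone_iff)
      have "hgt y (of_real ((S.turn i)\<^sup>2) * (r - p)) = crs (S.dirA i) (r - p) * a + crs (S.dirB i) (r - p) * b"
        unfolding S.vertex_combination by (simp only: hgt_add hgt_scale hgt_diff a_def b_def)
      then have "(S.turn i)\<^sup>2 * (\<sigma> * hgt y (r - p)) = crs (S.dirA i) (r - p) * (\<sigma> * a) + crs (S.dirB i) (r - p) * (\<sigma> * b)"
        unfolding hgt_scale by (metis distrib_left mult.left_commute)
      moreover have "0 < crs (S.dirA i) (r - p) * (\<sigma> * a)" "0 < crs (S.dirB i) (r - p) * (\<sigma> * b)" using pos ab by simp_all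
      ultimately have "0 < (S.turn i)\<^sup>2 * (\<sigma> * hgt y (r - p))" by linarith
      then have "0 < \<sigma> * hgt y (r - p)" using S.turn_sq[of i] zero_less_mult_pos by blast
      then show False using s(4) unfolding hgt_diff by linarith
    qed
    moreover have "0 \<le> a * b" using s(1) ab by (auto simp: zero_le_mult_iff)
    ultimately have "roll.tangent_at v c y i" unfolding roll.tangent_at_def[OF ff(1)] a_def b_def by simp
    then show ?thesis using tan F by blast
  qed
qed

text \<open>The same face may be listed from another vertex or in the other sense. By
  \<open>tangent_dirs\<close> its tangents at generic angles depend only on the region and on
  convexity, which the region determines.\<close>

lemma same_interior:
  assumes F: "face m v t c" and G: "face m' w t' c'" and I: "region v = region w" and y: "nice y"
  shows "roll.rollf v t y = roll.rollf w t' y"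
proof -
  note ff = face_facts[OF F] and fg = face_facts[OF G]
  have C: "spoly.curve v = spoly.curve w" using spoly.fr_in[OF ff(3)] spoly.fr_in[OF fg(3)] I by metis
  obtain i where i: "hgt y (v i) = roll.rollf v t y" "roll.tangent_at v c y i" using roll.tangent_at_iff[OF ff(1)] by metis
  have "v i \<in> spoly.curve v" unfolding spoly.curve_def[OF ff(3)] by auto
  then have "v i \<in> spoly.curve w" by (simp only: C)
  then obtain j where j: "w j = v i" using face_vertex[OF G ff(4)] by blast
  have "spoly.vertex_in v i \<longleftrightarrow> spoly.vertex_in w j"
    unfolding spoly.convex_iff[OF ff(3), symmetric] spoly.convex_iff[OF fg(3), symmetric] C j ..
  then have "roll.corner c i \<longleftrightarrow> roll.corner c' j" unfolding roll.vertex_in_roll[OF ff(1,2)] roll.vertex_in_roll[OF fg(1,2)] .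
  then have "roll.tangent_at w c' y j"
    using i(2) unfolding roll.tangent_dirs[OF ff(1,2) face_hgt[OF F y]] roll.tangent_dirs[OF fg(1,2) face_hgt[OF G y]] I j by simp
  then have "hgt y (v i) = roll.rollf w t' y" unfolding roll.tangent_at_iff[OF fg(1)] by (intro exI[of _ j]) (simp add: j)
  then show ?thesis using i(1) by simp
qed

text \<open>The direction is a positive combination of the two edge vectors. Both lie in the closed
  half-plane of \<open>a\<close>, and as they are not parallel they cannot both lie on its
  boundary.\<close>

lemma corner_dirs:
  assumes F: "face m v t c" and co: "roll.corner c i" and a: "a \<noteq> 0" "inner a (v i) \<le> inner a (v (i - 1))" "inner a (v i) \<le> inner a (v (i + 1))"
    and ne: "crs (v (i - 1) - v i) w \<noteq> 0" "crs (v (i + 1) - v i) w \<noteq> 0" and d: "dir_in (region v) (v i) w"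
  shows "0 < inner a w"
proof -
  note ff = face_facts[OF F]
  interpret S: spoly m v by (rule ff(3))
  have "v i + w \<in> S.cone i" using S.dir_iff[OF ne] d co roll.vertex_in_roll[OF ff(1,2)] by simp
  then have pos: "0 < crs (S.dirA i) w" "0 < crs (S.dirB i) w" by (simp_all add: S.cone_iff)
  define A B where "A = v (i - 1) - v i" and "B = v (i + 1) - v i"
  have ge: "0 \<le> inner a A" "0 \<le> inner a B" using a by (simp_all add: A_def B_def inner_diff_right)
  have "\<not> (inner a A = 0 \<and> inner a B = 0)"
  proof
    assume z: "inner a A = 0 \<and> inner a B = 0"
    then have "Re a * Re A + Im a * Im A = 0" "Re a * Re B + Im a * Im B = 0" by (simp_all add: inner_complex_def)
    then have "Re a * crs A B = 0" "Im a * crs A B = 0" unfolding crs_def by algebra+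
    then have "crs A B = 0" using a(1) by (auto simp: complex_eq_iff)
    then show False using S.turn_ab[of i] S.turn_nz[of i] by (simp add: A_def B_def)
  qed
  then have "0 < inner a A \<or> 0 < inner a B" using ge by linarith
  then have "0 < crs (S.dirA i) w * inner a A + crs (S.dirB i) w * inner a B"
    using pos ge by (auto intro: add_pos_nonneg add_nonneg_pos)
  also have "\<dots> = inner a (of_real ((S.turn i)\<^sup>2) * w)"
    unfolding S.vertex_combination A_def B_def by (simp add: inner_add_right scaleR_conv_of_real[symmetric] del: of_real_diff)
  also have "\<dots> = (S.turn i)\<^sup>2 * inner a w" by (metis inner_scaleR_right scaleR_conv_of_real)
  finally show ?thesis using S.turn_sq[of i] by (simp add: zero_less_mult_iff)
qed

text \<open>A tangent at a concave vertex has all edges at this point on one side, because they lie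
  in the small sector between its two edges. A generic tangent at a corner has edges on both
  sides.\<close>

lemma flat_corner_excl:
  assumes F: "face m v t c" and G: "face m' w t' c'" and y: "nice y" and ij: "v i = w j"
    and ta: "roll.tangent_at v c y i" "roll.tangent_at w c' y j" and co: "\<not> roll.corner c i" shows "\<not> roll.corner c' j"
proof
  assume cj: "roll.corner c' j"
  note ff = face_facts[OF F] and fg = face_facts[OF G]
  interpret S: spoly m v by (rule ff(3))
  define a b where "a = hgt y (v (i - 1)) - hgt y (v i)" and "b = hgt y (v (i + 1)) - hgt y (v i)"
  have ab: "0 \<le> a * b" "a \<noteq> 0" "b \<noteq> 0" using ta(1) co face_hgt[OF F y, of i] unfolding roll.tangent_at_def[OF ff(1)] a_def b_def by auto
  have same: "0 \<le> a * (hgt y q - hgt y (v i))" if q: "closed_segment (v i) q \<in> T" for q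
  proof -
    have "v i + (q - v i) \<notin> S.cocone i"
      using edge_not_dir[OF F q] S.dir_inside(3)[of i "q - v i"] co roll.vertex_in_roll[OF ff(1,2)] by auto
    then have pos: "0 \<le> crs (S.dirA i) (q - v i)" "0 \<le> crs (S.dirB i) (q - v i)" by (auto simp: S.cocone_iff not_less)
    have "hgt y (of_real ((S.turn i)\<^sup>2) * (q - v i)) = crs (S.dirA i) (q - v i) * a + crs (S.dirB i) (q - v i) * b"
      unfolding S.vertex_combination by (simp only: hgt_add hgt_scale hgt_diff a_def b_def)
    then have "(S.turn i)\<^sup>2 * (a * hgt y (q - v i)) = crs (S.dirA i) (q - v i) * (a * a) + crs (S.dirB i) (q - v i) * (a * b)"
      unfolding hgt_scale by (metis distrib_left mult.left_commute)
    moreover have "0 \<le> crs (S.dirA i) (q - v i) * (a * a)" "0 \<le> crs (S.dirB i) (q - v i) * (a * b)" using pos ab(1) by simp_all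
    ultimately have "0 \<le> (S.turn i)\<^sup>2 * (a * hgt y (q - v i))" by linarith
    then show ?thesis using S.turn_sq[of i] unfolding hgt_diff by (simp add: zero_le_mult_iff)
  qed
  define a' b' where "a' = hgt y (w (j - 1)) - hgt y (w j)" and "b' = hgt y (w (j + 1)) - hgt y (w j)"
  have ab': "a' * b' \<le> 0" "a' \<noteq> 0" "b' \<noteq> 0" using ta(2) cj face_hgt[OF G y, of j] unfolding roll.tangent_at_def[OF fg(1)] a'_def b'_def by auto
  have "0 \<le> a * a'" "0 \<le> a * b'" using same fg(7,8)[of j] ij by (simp_all add: a'_def b'_def)
  then show False using ab ab' by (auto simp: zero_le_mult_iff mult_le_0_iff)
qed

text \<open>Two faces tangent to the same line at the same point share a direction, and hence
  coincide. At concave vertices both directions of the line are shared. At corners pointedness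
  decides: only one of the two directions can lie in the open half-plane given by
  \<open>a\<close>.\<close>

lemma unique_nice:
  assumes fg: "f \<in> L" "g \<in> L" and y: "nice y" and eq: "f y = g y" and z: "nice z" shows "f z = g z"
proof -
  obtain m v t c where F: "face m v t c" "f = roll.rollf v t" using L_face[OF fg(1)] by blast
  obtain m' w t' c' where G: "face m' w t' c'" "g = roll.rollf w t'" using L_face[OF fg(2)] by blast
  note ff = face_facts[OF F(1)] and gg = face_facts[OF G(1)]
  obtain i where i: "hgt y (v i) = f y" "roll.tangent_at v c y i" using roll.tangent_at_iff[OF ff(1)] F(2) by metis
  obtain j where j: "hgt y (w j) = f y" "roll.tangent_at w c' y j" using roll.tangent_at_iff[OF gg(1)] G(2) eq by metis
  have ij: "v i = w j" using y i(1) j(1) ff(4) gg(4) unfolding nice_def by metis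
  define I J where "I = region v" and "J = region w"
  have dI: "if roll.corner c i then dir_in I (v i) (cis y) \<or> dir_in I (v i) (- cis y) else dir_in I (v i) (cis y) \<and> dir_in I (v i) (- cis y)"
    using i(2) unfolding roll.tangent_dirs[OF ff(1,2) face_hgt[OF F(1) y]] I_def .
  have dJ: "if roll.corner c' j then dir_in J (v i) (cis y) \<or> dir_in J (v i) (- cis y) else dir_in J (v i) (cis y) \<and> dir_in J (v i) (- cis y)"
    using j(2) unfolding roll.tangent_dirs[OF gg(1,2) face_hgt[OF G(1) y]] J_def ij .
  have "\<exists>u. dir_in I (v i) u \<and> dir_in J (v i) u"
  proof (cases "roll.corner c i")
    case False
    then have "\<not> roll.corner c' j" using flat_corner_excl[OF F(1) G(1) y ij i(2) j(2)] by blast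
    then show ?thesis using dI dJ False by auto
  next
    case True
    have cj: "roll.corner c' j" using flat_corner_excl[OF G(1) F(1) y ij[symmetric] j(2) i(2)] True by blast
    obtain a where a: "a \<noteq> 0" "\<And>e. e \<in> T \<Longrightarrow> v i \<in> e \<Longrightarrow> e \<subseteq> {z. inner a z \<ge> inner a (v i)}"
    proof -
      have "pointed P T" using ppt by (simp add: pointed_pseudotriangulation_def)
      then have "\<exists>a. a \<noteq> 0 \<and> (\<forall>e\<in>T. v i \<in> e \<longrightarrow> e \<subseteq> {z. inner a z \<ge> inner a (v i)})" using ff(4)[of i] unfolding pointed_def by (rule bspec)
      then show ?thesis using that by blast
    qed
    have up: "inner a (v i) \<le> inner a q" if "closed_segment (v i) q \<in> T" for q using a(2)[OF that] by auto
    have c0: "crs (v (i - 1) - v i) (cis y) \<noteq> 0" "crs (v (i + 1) - v i) (cis y) \<noteq> 0"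
      "crs (w (j - 1) - w j) (cis y) \<noteq> 0" "crs (w (j + 1) - w j) (cis y) \<noteq> 0"
      using face_hgt[OF F(1) y, of i] face_hgt[OF G(1) y, of j] by (simp_all add: crs_comm[of _ "cis y"] hgt_crs[symmetric] hgt_diff)
    have c1: "crs (v (i - 1) - v i) (- cis y) \<noteq> 0" "crs (v (i + 1) - v i) (- cis y) \<noteq> 0"
      "crs (w (j - 1) - w j) (- cis y) \<noteq> 0" "crs (w (j + 1) - w j) (- cis y) \<noteq> 0" using c0 by (simp_all add: crs_minus2)
    have p1: "0 < inner a u" if "dir_in I (v i) u" "u = cis y \<or> u = - cis y" for u
      by (rule corner_dirs[OF F(1) True a(1) up up]) (use ff(7,8) that c0 c1 in \<open>auto simp: I_def\<close>)
    have p2: "0 < inner a u" if "dir_in J (v i) u" "u = cis y \<or> u = - cis y" for u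
      by (rule corner_dirs[OF G(1) cj a(1) up[unfolded ij] up[unfolded ij]]) (use gg(7,8) that c0 c1 ij in \<open>auto simp: J_def\<close>)
    show ?thesis using dI dJ True cj p1[of "cis y"] p1[of "- cis y"] p2[of "cis y"] p2[of "- cis y"] by auto
  qed
  then obtain u where "dir_in I (v i) u" "dir_in J (v i) u" by blast
  then have "I = J" using same_face[OF F(1) G(1)] unfolding I_def J_def by blast
  then show ?thesis using same_interior[OF F(1) G(1) _ z] F(2) G(2) unfolding I_def J_def by simp
qed

lemma L_cont: "f \<in> L \<Longrightarrow> continuous_on UNIV f" and L_anti: "f \<in> L \<Longrightarrow> f (x + pi) = - f x"
  by (auto simp: L_def represents_def)

lemma L_tendsto: "f \<in> L \<Longrightarrow> (f \<longlongrightarrow> f x) (at x)"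
  using L_cont by (auto simp: continuous_on_def)

text \<open>Agreement at one generic angle spreads to all of them by \<open>unique_nice\<close> and
  then to every angle by continuity. Distinct sheets therefore differ at all generic angles.\<close>

lemma L_iso: assumes fg: "f \<in> L" "g \<in> L" "f \<noteq> g" shows "\<forall>\<^sub>F y in at x. f y \<noteq> g y"
proof -
  have "f y \<noteq> g y" if y: "nice y" for y
  proof
    assume eq: "f y = g y"
    have "f z = g z" for z
    proof -
      have "\<forall>\<^sub>F y in at z. f y = g y" using ev_nice by (rule eventually_mono) (rule unique_nice[OF fg(1,2) y eq])
      then have "(g \<longlongrightarrow> f z) (at z)" by (rule Lim_transform_eventually[OF L_tendsto[OF fg(1)]])
      then show ?thesis using L_tendsto[OF fg(2), of z] tendsto_unique trivial_limit_at by blast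
    qed
    then show False using fg(3) by blast
  qed
  then show ?thesis using ev_nice by (rule eventually_mono[rotated])
qed

text \<open>If all other points were strictly on one side of a tangent, its vertex would be extreme
  and hence a corner, but at a corner a tangent cannot have both neighbours strictly on one
  side.\<close>

lemma L_sep: assumes f: "f \<in> L" shows "sep P x (f x)"
proof -
  obtain m v t c where F: "face m v t c" "f = roll.rollf v t" using L_face[OF f] by blast
  note ff = face_facts[OF F(1)]
  obtain i where i: "hgt x (v i) = f x" "roll.tangent_at v c x i" using roll.tangent_at_iff[OF ff(1)] F(2) by metis
  have ex: "\<exists>q\<in>P. q \<noteq> v i \<and> 0 \<le> \<sigma> * (hgt x q - f x)" if s: "\<sigma> = 1 \<or> \<sigma> = - 1" for \<sigma>
  proof (rule ccontr)
    assume "\<not> ?thesis"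
    then have lt: "\<sigma> * (hgt x q - f x) < 0" if "q \<in> P" "q \<noteq> v i" for q using that by (meson not_less)
    have "spoly.vertex_in v i"
    proof (rule spoly.extreme_vertex_in[OF ff(3)])
      define w where "w = of_real \<sigma> * (\<i> * cis x)"
      have w: "inner w z = \<sigma> * hgt x z" for z
        unfolding w_def hgt_crs crs_inner by (metis inner_scaleR_left scaleR_conv_of_real)
      have neg: "\<sigma> * (hgt x (v j) - f x) \<le> 0" for j using lt[OF ff(4), of j] i(1) by (cases "v j = v i") auto
      show "0 \<le> inner w (v i - v j)" for j using neg[of j] unfolding w hgt_diff i(1) by (simp add: right_diff_distrib)
      show "w \<noteq> 0" using s by (auto simp: w_def)
      have "0 < inner w (v i - v (i - 1))" using lt[OF ff(4,6)] unfolding w hgt_diff i(1) by (simp add: right_diff_distrib)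
      then show "0 < inner w (v i - v (i - 1)) \<or> 0 < inner w (v i - v (i + 1))" ..
    qed
    then have "roll.corner c i" using roll.vertex_in_roll[OF ff(1,2)] by blast
    then have "(hgt x (v (i - 1)) - f x) * (hgt x (v (i + 1)) - f x) \<le> 0"
      using i unfolding roll.tangent_at_def[OF ff(1)] by simp
    moreover have "\<sigma> * (hgt x (v (i - 1)) - f x) < 0" "\<sigma> * (hgt x (v (i + 1)) - f x) < 0" using lt ff(4-6) by blast+
    ultimately show False using s by (auto simp: mult_le_0_iff)
  qed
  show ?thesis unfolding sep_def using ex[of 1] ex[of "- 1"] ff(4)[of i] i(1) by (intro bexI[of _ "v i"]) auto
qed

lemma finite_L: "finite L"
proof -
  have "represented (dual_arrangement P T) L"
    using vs_face unfolding represented_def dual_arrangement_def L_def by blast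
  moreover have "pseudotriangles_of P T \<subseteq> {vs. set vs \<subseteq> P \<and> distinct vs}"
    by (auto simp: pseudotriangles_of_def pseudotriangle_def simple_polygon_def)
  then have "finite (pseudotriangles_of P T)" by (rule finite_subset) (simp add: finite_subset_distinct finP)
  ultimately show ?thesis using represented_finite unfolding dual_arrangement_def by blast
qed

text \<open>At nearby generic angles some tangent passes through a point of the line; if the line
  contains two points, one of them separates the other from a third point. If no sheet passed
  through the line itself, the finitely many continuous sheets would avoid these points at all
  nearby angles.\<close>

lemma sep_L: assumes "sep P x d" shows "\<exists>f\<in>L. f x = d"
proof -
  obtain p q r where p: "p \<in> P" "hgt x p = d" and q: "q \<in> P" "q \<noteq> p" "d \<le> hgt x q" and r: "r \<in> P" "r \<noteq> p" "hgt x r \<le> d"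
    using assms unfolding sep_def by blast
  define Q where "Q = {p \<in> P. hgt x p = d}"
  have ev: "\<forall>\<^sub>F y in at x. \<exists>f\<in>L. \<exists>a\<in>Q. f y = hgt y a"
  proof (cases "\<exists>b\<in>P. b \<noteq> p \<and> hgt x b = d")
    case False
    then have "hgt x p < hgt x q" "hgt x r < hgt x p" using p q r by (auto simp: less_le)
    then have "\<forall>\<^sub>F y in at x. hgt y p < hgt y q" "\<forall>\<^sub>F y in at x. hgt y r < hgt y p" using ev_less by blast+
    then show ?thesis using ev_nice
    proof eventually_elim
      case (elim y)
      then have "\<exists>f\<in>L. f y = hgt y p" using tangent_exists[OF p(1) _ q(1) _ r(1)] by blast
      moreover have "p \<in> Q" using p by (simp add: Q_def)
      ultimately show ?case by blast
    qed
  next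
    case True
    then obtain b where b: "b \<in> P" "b \<noteq> p" "hgt x b = d" by blast
    obtain s where s: "s \<in> P" "s \<noteq> p" "s \<noteq> b" using third by blast
    have pb: "hgt x p = hgt x b" using p b by simp
    have sd: "hgt x s \<noteq> hgt x p" using off_line[OF p(1) b(1) b(2)[symmetric] pb s(1)] s by blast
    have PQ: "p \<in> Q" "b \<in> Q" using p b by (auto simp: Q_def)
    have T: "\<exists>f\<in>L. \<exists>a\<in>Q. f y = hgt y a" if y: "nice y"
      and o: "hgt y s < hgt y p \<and> hgt y s < hgt y b \<or> hgt y p < hgt y s \<and> hgt y b < hgt y s" for y
    proof -
      have "hgt y p \<noteq> hgt y b" using y p(1) b(1,2) unfolding nice_def by metis
      then consider "hgt y p < hgt y b" | "hgt y b < hgt y p" by linarith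
      then have "(\<exists>f\<in>L. f y = hgt y p) \<or> (\<exists>f\<in>L. f y = hgt y b)"
        using o tangent_exists[OF p(1) y b(1) _ s(1)] tangent_exists[OF p(1) y s(1) _ b(1)]
          tangent_exists[OF b(1) y p(1) _ s(1)] tangent_exists[OF b(1) y s(1) _ p(1)] by cases blast+
      then show ?thesis using PQ by blast
    qed
    consider "hgt x s < hgt x p" | "hgt x p < hgt x s" using sd by linarith
    then show ?thesis
    proof cases
      case 1
      then have "\<forall>\<^sub>F y in at x. hgt y s < hgt y p" "\<forall>\<^sub>F y in at x. hgt y s < hgt y b" using ev_less pb by simp_all
      then show ?thesis using ev_nice by eventually_elim (rule T, auto)
    next
      case 2
      then have "\<forall>\<^sub>F y in at x. hgt y p < hgt y s" "\<forall>\<^sub>F y in at x. hgt y b < hgt y s" using ev_less pb by simp_all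
      then show ?thesis using ev_nice by eventually_elim (rule T, auto)
    qed
  qed
  show ?thesis
  proof (rule ccontr)
    assume n: "\<not> ?thesis"
    have "\<forall>\<^sub>F y in at x. \<forall>f\<in>L. \<forall>a\<in>Q. f y \<noteq> hgt y a"
    proof (intro eventually_ball_finite ballI)
      show "finite L" by (rule finite_L)
      show "finite Q" using finP by (simp add: Q_def)
      fix f a assume fa: "f \<in> L" "a \<in> Q"
      have "((\<lambda>y. f y - hgt y a) \<longlongrightarrow> f x - hgt x a) (at x)"
        by (intro tendsto_diff L_tendsto[OF fa(1)]) (use isCont_hgt in \<open>simp add: isCont_def\<close>)
      moreover have "f x - hgt x a \<noteq> 0" using n fa by (auto simp: Q_def)
      ultimately have "\<forall>\<^sub>F y in at x. f y - hgt y a \<noteq> 0" by (rule tendsto_imp_eventually_ne)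
      then show "\<forall>\<^sub>F y in at x. f y \<noteq> hgt y a" by (rule eventually_mono) simp
    qed
    with ev have "\<forall>\<^sub>F y in at x. False" by eventually_elim blast
    then show False by simp
  qed
qed

lemma dual_arrangement:
  shows "pseudoline_arrangement (dual_arrangement P T)" "support (dual_arrangement P T) = support_minus_first_level (dual_points P)"
proof -
  interpret sheets P L
  proof unfold_locales
    show "(\<exists>f\<in>L. f x = d) \<longleftrightarrow> sep P x d" for x d
    proof
      assume "\<exists>f\<in>L. f x = d"
      then show "sep P x d" using L_sep[of _ x] by auto
    qed (rule sep_L)
  qed (use finite_L L_cont L_anti L_iso in simp_all)
  interpret rolling P L
  proof unfold_locales
    fix f assume f: "f \<in> L"
    obtain m v t c where F: "face m v t c" "f = roll.rollf v t" using L_face[OF f] by blast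
    note ff = face_facts[OF F(1)]
    have st: "t i < t (i + 1)" for i by (rule roll.t_step[OF ff(1)])
    \<comment> \<open>The tangent changes its vertex at the line of an edge, so the angle of any
      edge exhibits a switch; the edge from \<open>v 0\<close> to \<open>v 1\<close> is
      taken.\<close>
    have "\<forall>\<^sub>F y in at_left (t 1). f y = hgt y (v 0)"
      unfolding eventually_at_left_field F(2) using roll.rollf[OF ff(1), of 0] st[of 0] by (intro exI[of _ "t 0"]) simp
    then have l: "gl f (t 1) = v 0" by (rule germ_eqI[OF side_simps(1) f ff(4)])
    have "\<forall>\<^sub>F y in at_right (t 1). f y = hgt y (v 1)"
      unfolding eventually_at_right_field F(2) using roll.rollf[OF ff(1), of 1] st[of 1] by (intro exI[of _ "t 2"]) simp
    then have r: "gr f (t 1) = v 1" by (rule germ_eqI[OF side_simps(2) f ff(4)])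
    show "\<exists>x. switch f x" unfolding switch_def using l r ff(5)[of 0] by (metis add_0)
  qed
  have "represented (dual_arrangement P T) L"
    using vs_face unfolding represented_def dual_arrangement_def L_def by blast
  from arrangement[OF this] show "pseudoline_arrangement (dual_arrangement P T)"
    "support (dual_arrangement P T) = support_minus_first_level (dual_points P)" .
qed

end

section \<open>Duality\<close>

lemma no_pseudotriangles:
  assumes "finite P" "card P < 3" shows "pseudotriangles_of P T = {}"
proof -
  have False if vs: "vs \<in> pseudotriangles_of P T" for vs
  proof -
    have "set vs \<subseteq> P" "distinct vs" "3 \<le> length vs"
      using vs by (auto simp: pseudotriangles_of_def pseudotriangle_def simple_polygon_def)
    then show False using card_mono[OF assms(1), of "set vs"] distinct_card[of vs] assms(2) by linarith
  qed
  then show ?thesis by blast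
qed

lemma nothing_left:
  assumes "finite P" "card P < 3" shows "support_minus_first_level (dual_points P) = {}"
proof -
  have "support (dual_points P) - first_level (dual_points P) = {}"
  proof (cases "P = {}")
    case False
    interpret pset P by unfold_locales (use assms False in auto)
    show ?thesis
    proof (rule ccontr)
      assume "\<not> ?thesis"
      then obtain l where l: "l \<in> support (dual_points P) - first_level (dual_points P)" by blast
      obtain x d where "l = mline x d" by (rule mline_cases)
      then obtain p q r where pqr: "p \<in> P" "hgt x p = d" "q \<in> P" "d < hgt x q" "r \<in> P" "hgt x r < d" using l rest_iff by blast
      then have "card {p, q, r} = 3" by (auto simp: card_insert_if)
      then show False using card_mono[OF assms(1), of "{p, q, r}"] pqr assms(2) by simp
    qed
  qed (simp add: support_def dual_points_def)
  then show ?thesis by (simp add: support_minus_first_level_def)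
qed

text \<open>With two points, the line through them has all of \<open>P\<close> on it and is a vertex
  of the first level, which supplies the single edge.\<close>

lemma primal_edges_small:
  assumes P: "finite P" "card P < 3" shows "primal_edges P {} = edges_on P"
proof -
  have "(let z = crossing (dual_point p) (dual_point q) in contact_point {} z \<or> z \<in> first_level (dual_points P))"
    if pq: "p \<in> P" "q \<in> P" "p \<noteq> q" for p q
  proof -
    interpret pset P by unfold_locales (use P pq in auto)
    obtain x where x: "hgt x p = hgt x q" by (rule dir_through)
    have "{p, q} = P" by (rule card_seteq[OF P(1)]) (use pq P in auto)
    then have "\<forall>r\<in>P. hgt x r \<le> hgt x p" using x by auto
    then show ?thesis unfolding Let_def crossing_dual[OF pq(3) x] using first_level_iff[OF pq(1)] by blast
  qed
  then show ?thesis unfolding primal_edges_def edges_on_def by blast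
qed

lemma small_pseudotriangulation:
  assumes P: "finite P" "card P < 3" shows "pointed_pseudotriangulation P (edges_on P)"
proof -
  have "P = {} \<or> (\<exists>a. P = {a}) \<or> (\<exists>a b. a \<noteq> b \<and> P = {a, b})"
  proof -
    have "card P = 0 \<or> card P = 1 \<or> card P = 2" using P(2) by auto
    then show ?thesis using P(1) by (auto simp: card_1_singleton_iff card_2_iff)
  qed
  then consider "P = {}" | a where "P = {a}" | a b where "a \<noteq> b" "P = {a, b}" by blast
  then show ?thesis
  proof cases
    case (3 a b)
    then have e: "edges_on P = {closed_segment a b}" by (auto simp: edges_on_def closed_segment_commute)
    have half: "closed_segment p q \<subseteq> {z. inner (q - p) z \<ge> inner (q - p) p}" for p q :: complex
    proof (rule closed_segment_subset)
      have "0 \<le> inner (q - p) (q - p)" by (rule inner_ge_zero)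
      then show "q \<in> {z. inner (q - p) z \<ge> inner (q - p) p}" by (simp only: mem_Collect_eq inner_diff_right)
    qed (simp_all add: convex_halfspace_ge)
    have "pointed P (edges_on P)" unfolding pointed_def
    proof
      fix p assume "p \<in> P"
      then obtain q where q: "q \<noteq> p" "edges_on P = {closed_segment p q}"
        using 3 e closed_segment_commute[of a b] by (metis empty_iff insert_iff)
      then show "\<exists>d. d \<noteq> 0 \<and> (\<forall>e\<in>edges_on P. p \<in> e \<longrightarrow> e \<subseteq> {z. inner d z \<ge> inner d p})"
        using half[of p q] by (intro exI[of _ "q - p"]) simp
    qed
    moreover have "convex hull P = closed_segment a b" by (simp add: 3(2) segment_convex_hull)
    then have "convex hull P = P \<union> \<Union>(edges_on P)" unfolding e using 3(2) ends_in_segment[of a b] by auto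
    ultimately show ?thesis
      unfolding pointed_pseudotriangulation_def pseudotriangulation_def no_pseudotriangles[OF P] e by simp
  qed (unfold pointed_pseudotriangulation_def pseudotriangulation_def no_pseudotriangles[OF P],
      auto simp: edges_on_def pointed_def intro: exI[of _ 1])
qed

theorem theorem16:
  fixes P :: "complex set"
  assumes "finite P" and "general_position P"
  shows "(\<forall>T. pointed_pseudotriangulation P T \<longrightarrow>
            pseudoline_arrangement (dual_arrangement P T) \<and>
            support (dual_arrangement P T) = support_minus_first_level (dual_points P)) \<and>
         (\<forall>\<Lambda>. pseudoline_arrangement \<Lambda> \<and>
            support \<Lambda> = support_minus_first_level (dual_points P) \<longrightarrow>
            pointed_pseudotriangulation P (primal_edges P \<Lambda>))"
proof (cases "card P < 3")
  case True
  note small = assms(1) True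
  \<comment> \<open>Pseudolines are nonempty, so an empty support leaves only the empty
    arrangement.\<close>
  have "\<Lambda> = {}" if A: "pseudoline_arrangement \<Lambda>" and S: "support \<Lambda> = {}" for \<Lambda>
  proof -
    have "\<gamma> \<noteq> {}" if "\<gamma> \<in> \<Lambda>" for \<gamma>
      using A that by (auto simp: pseudoline_arrangement_def pseudoline_def represents_def)
    then show ?thesis using S by (auto simp: support_def)
  qed
  moreover have "pointed_pseudotriangulation P (primal_edges P {})"
    unfolding primal_edges_small[OF small] by (rule small_pseudotriangulation[OF small])
  moreover have "dual_arrangement P T = {}" for T
    unfolding dual_arrangement_def no_pseudotriangles[OF small] by simp
  moreover have "pseudoline_arrangement {}" "support {} = {}" by (simp_all add: pseudoline_arrangement_def support_def)
  ultimately show ?thesis unfolding nothing_left[OF small] by metis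
next
  case False
  interpret pts P by unfold_locales (use assms False in auto)
  have "pseudoline_arrangement (dual_arrangement P T) \<and>
      support (dual_arrangement P T) = support_minus_first_level (dual_points P)" if "pointed_pseudotriangulation P T" for T
  proof -
    interpret pointed_pt P T by unfold_locales (rule that)
    show ?thesis using dual_arrangement by blast
  qed
  then show ?thesis using arrangement_pseudotriangulation by blast
qed

end
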